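(* Let $n$ be the dimension, and let $G\subset\mathbb{R}^n$ and $\mathcal{O}\subset\mathbb{R}^n$ be bounded connected closed regions with interior points. For sufficiently small $\varepsilon>0$ consider the parameterized family of Hamiltonian systems $$H(y,x,\xi,\varepsilon)=\langle\omega(\xi),y\rangle+\varepsilon P(y,x,\xi,\varepsilon),\qquad (y,x,\xi)\in G\times\mathbb{T}^n\times\mathcal{O},$$ where $\omega(\cdot)$ is continuous about $\xi$ on $\mathcal{O}$, $P(\cdot,\cdot,\xi,\varepsilon)$ is real analytic about $y$ and $x$ on $G\times\mathbb{T}^n$, and $P(y,x,\cdot,\varepsilon)$ is continuous about the parameter $\xi$. Let $\varpi_1$ be a modulus of continuity such that $P$ is $\varpi_1$ continuous about $\xi$. Assume: (A1) Given $\mathtt{p}\in\mathbb{R}^n$, there exists $\xi_0$ in the interior $\mathcal{O}^o$ of $\mathcal{O}$ such that $\omega(\xi_0)=\mathtt{p}$, and for given $\tau>0$, $\omega(\xi_0)$ satisfies the Diophantine condition $$|\langle k,\omega(\xi_0)\rangle|\ge\gamma|k|^{-\tau},\quad 0\ne k\in\mathbb{Z}^n,\quad \gamma>0.$$ (A2) There exist a neighborhood $B(\xi_0,\delta)\subset\mathcal{O}^o$ of $\xi_0$ with some $\delta>0$ and a modulus of continuity $\varpi_2$ satisfying $\varpi_1\lesssim\varpi_2$, such that $$|\omega(\xi)-\omega(\zeta)|\ge\varpi_2(|\xi-\zeta|)\quad\text{for all }\xi,\zeta\in B(\xi_0,\delta)\text{ with }0<|\xi-\zeta|\le 1.$$ Then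 there exists a sufficiently small $\varepsilon_0>0$ such that for any $0<\varepsilon<\varepsilon_0$ there exists $\xi^*\in B(\xi_0,\delta)$ such that the perturbed Hamiltonian system $H(y,x,\xi^*,\varepsilon)$ admits an invariant torus with frequency $\mathtt{p}=\omega(\xi_0)$.
   Context: A modulus of continuity is a strictly monotonic increasing continuous function $\varpi$ on $\mathbb{R}^+$ such that $\lim_{x\to0^+}\varpi(x)=0$ and $\limsup_{x\to0^+}x/\varpi(x)<+\infty$. A function $f$ is called $\varpi$ continuous about $x$ if for any fixed $x$ there is a modulus of continuity $\varpi$ such that $|f(x)-f(y)|\le\varpi(|x-y|)$ for all $0<|x-y|\le1$; a continuous function on a bounded connected closed region has a modulus of continuity. For moduli of continuity $\varpi_1,\varpi_2$, one writes $\varpi_1\lesssim\varpi_2$ ("$\varpi_1$ is not weaker than $\varpi_2$") if $\limsup_{x\to0^+}\varpi_1(x)/\varpi_2(x)<+\infty$. Here $\mathbb{T}^n$ is the standard $n$-torus, $x$ is the angle variable, $y$ the action variable, $\xi$ a parameter; the equations of motion are $\dot y=-\partial_xH$, $\dot x=\partial_yH$. $B(\xi_0,\delta)$ is the ball of radius $\delta$ centered at $\xi_0$. An invariant torus with frequency $\mathtt{p}$ is an invariant $n$-torus carrying quasi-periodic motion with frequency vector $\mathtt{p}$.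
   Formalization: Analyticity of P in (y,x) is taken with a complex neighbourhood width and sup bound uniform in ξ and ε (the usual KAM convention); without uniformity in ε the claim fails, e.g. for P=⟨a,y⟩/ε with p−a not in ω(O). *)

theory Defs
  imports "HOL-Analysis.Analysis"
begin

definition modulus_of_continuity :: "(real \<Rightarrow> real) \<Rightarrow> bool" where
  "modulus_of_continuity \<phi> \<longleftrightarrow>
     strict_mono_on {0<..} \<phi> \<and> continuous_on {0<..} \<phi> \<and>
     (\<phi> \<longlongrightarrow> 0) (at_right 0) \<and>
     Limsup (at_right 0) (\<lambda>x. ereal (x / \<phi> x)) < \<infinity>"

definition modulus_continuous_on ::
  "(real \<Rightarrow> real) \<Rightarrow> 'a::metric_space set \<Rightarrow> ('a \<Rightarrow> 'b::metric_space) \<Rightarrow> bool" where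
  "modulus_continuous_on \<phi> S f \<longleftrightarrow>
     (\<forall>\<xi>\<in>S. \<forall>\<zeta>\<in>S. 0 < dist \<xi> \<zeta> \<and> dist \<xi> \<zeta> \<le> 1 \<longrightarrow> dist (f \<xi>) (f \<zeta>) \<le> \<phi> (dist \<xi> \<zeta>))"

definition not_weaker :: "(real \<Rightarrow> real) \<Rightarrow> (real \<Rightarrow> real) \<Rightarrow> bool" (infix "\<lesssim>" 50) where
  "\<phi>\<^sub>1 \<lesssim> \<phi>\<^sub>2 \<longleftrightarrow> Limsup (at_right 0) (\<lambda>x. ereal (\<phi>\<^sub>1 x / \<phi>\<^sub>2 x)) < \<infinity>"

definition diophantine :: "real \<Rightarrow> real \<Rightarrow> real ^ 'n \<Rightarrow> bool" where
  "diophantine \<gamma> \<tau> p \<longleftrightarrow>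
     (\<forall>k. k \<noteq> 0 \<and> (\<forall>i. k $ i \<in> \<int>) \<longrightarrow> \<bar>k \<bullet> p\<bar> \<ge> \<gamma> * norm k powr (- \<tau>))"

text \<open>
  The torus is the quotient of \<open>\<real>\<^sup>n\<close> by the lattice \<open>(2\<pi>\<int>)\<^sup>n\<close>. Functions on the torus are
  represented by periodic functions on \<open>\<real>\<^sup>n\<close>, points and curves by their lifts.
\<close>

definition torus_lattice :: "(real ^ 'n) set" where
  "torus_lattice = {v. \<forall>i. \<exists>m::int. v $ i = 2 * pi * of_int m}"

definition torus_periodic :: "(real ^ 'n \<Rightarrow> 'b) \<Rightarrow> bool" where
  "torus_periodic f \<longleftrightarrow> (\<forall>x. \<forall>v\<in>torus_lattice. f (x + v) = f x)"

definition complexify :: "real ^ 'n \<Rightarrow> complex ^ 'n" where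
  "complexify x = (\<chi> i. complex_of_real (x $ i))"

text \<open>The \<open>r\<close>-neighbourhood of (the lift of) \<open>G \<times> \<T>\<^sup>n\<close> in complex space; the condition on \<open>v\<close>
  says that its imaginary part has norm less than \<open>r\<close>.\<close>

definition complex_neighbourhood ::
  "(real ^ 'n) set \<Rightarrow> real \<Rightarrow> ((complex ^ 'n) \<times> (complex ^ 'n)) set" where
  "complex_neighbourhood G r =
     {(u, v). (\<exists>y\<in>G. dist u (complexify y) < r) \<and> (\<exists>x. dist v (complexify x) < r)}"

definition holomorphic_several_on ::
  "((complex ^ 'n) \<times> (complex ^ 'n) \<Rightarrow> complex) \<Rightarrow> ((complex ^ 'n) \<times> (complex ^ 'n)) set \<Rightarrow> bool" where
  "holomorphic_several_on F U \<longleftrightarrow>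
     (\<forall>z\<in>U. \<exists>D. (F has_derivative D) (at z) \<and>
        (\<forall>c h. D (c *s fst h, c *s snd h) = c * D h))"

text \<open>
  For compact \<open>G\<close>, a function is real analytic on \<open>G \<times> \<T>\<^sup>n\<close> (that is, on some open set
  containing it) iff the following holds for some \<open>r > 0\<close> and some \<open>M\<close>. The width \<open>r\<close> and the
  bound \<open>M\<close> are kept as arguments so that they can be asked to be uniform in parameters.
\<close>

definition real_analytic_with ::
  "real \<Rightarrow> real \<Rightarrow> (real ^ 'n) set \<Rightarrow> (real ^ 'n \<Rightarrow> real ^ 'n \<Rightarrow> real) \<Rightarrow> bool" where
  "real_analytic_with r M G f \<longleftrightarrow>
     (\<exists>F. holomorphic_several_on F (complex_neighbourhood G r) \<and>
          (\<forall>z \<in> complex_neighbourhood G r. norm (F z) \<le> M) \<and>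
          (\<forall>y\<in>G. \<forall>x. F (complexify y, complexify x) = complex_of_real (f y x)))"

definition hamiltonian ::
  "(real ^ 'n \<Rightarrow> real ^ 'n) \<Rightarrow> (real ^ 'n \<Rightarrow> real ^ 'n \<Rightarrow> real ^ 'n \<Rightarrow> real \<Rightarrow> real) \<Rightarrow>
   real ^ 'n \<Rightarrow> real ^ 'n \<Rightarrow> real ^ 'n \<Rightarrow> real \<Rightarrow> real" where
  "hamiltonian \<omega> P y x \<xi> \<epsilon> = \<omega> \<xi> \<bullet> y + \<epsilon> * P y x \<xi> \<epsilon>"

text \<open>The action stays in the interior of \<open>G\<close>, where the partial gradients of a function given
  only on \<open>G\<close> are determined.\<close>

definition hamilton_solution ::
  "(real ^ 'n) set \<Rightarrow> (real ^ 'n \<Rightarrow> real ^ 'n \<Rightarrow> real) \<Rightarrow>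
   (real \<Rightarrow> real ^ 'n) \<Rightarrow> (real \<Rightarrow> real ^ 'n) \<Rightarrow> bool" where
  "hamilton_solution G H y x \<longleftrightarrow>
     (\<forall>t. y t \<in> interior G \<and>
        (\<exists>Hy Hx. GDERIV (\<lambda>v. H v (x t)) (y t) :> Hy \<and> GDERIV (\<lambda>v. H (y t) v) (x t) :> Hx \<and>
           (y has_vector_derivative - Hx) (at t) \<and> (x has_vector_derivative Hy) (at t)))"

text \<open>
  An embedding \<open>\<theta> \<mapsto> (Y \<theta>, X \<theta>)\<close> of the torus into \<open>G \<times> \<T>\<^sup>n\<close> that is homotopic to the unperturbed
  tori \<open>\<theta> \<mapsto> (y\<^sub>0, \<theta>)\<close>, i.e. the lift of \<open>X\<close> is the identity plus a periodic map. Without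
  this normalisation the frequency vector would only be determined up to a change of basis of
  the lattice. Being continuous and injective on a compact space, the map is an embedding.
\<close>

definition torus_embedding :: "(real ^ 'n \<Rightarrow> real ^ 'n) \<Rightarrow> (real ^ 'n \<Rightarrow> real ^ 'n) \<Rightarrow> bool" where
  "torus_embedding Y X \<longleftrightarrow>
     continuous_on UNIV Y \<and> continuous_on UNIV X \<and>
     torus_periodic Y \<and> torus_periodic (\<lambda>\<theta>. X \<theta> - \<theta>) \<and>
     (\<forall>\<theta> \<theta>'. Y \<theta> = Y \<theta>' \<and> X \<theta> - X \<theta>' \<in> torus_lattice \<longrightarrow> \<theta> - \<theta>' \<in> torus_lattice)"

definition admits_invariant_torus ::
  "(real ^ 'n) set \<Rightarrow> (real ^ 'n \<Rightarrow> real ^ 'n \<Rightarrow> real) \<Rightarrow> real ^ 'n \<Rightarrow> bool" where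
  "admits_invariant_torus G H p \<longleftrightarrow>
     (\<exists>Y X. torus_embedding Y X \<and>
        (\<forall>\<theta>. hamilton_solution G H (\<lambda>t. Y (\<theta> + t *\<^sub>R p)) (\<lambda>t. X (\<theta> + t *\<^sub>R p))))"

end

theory Submission
  imports Defs "HOL-Complex_Analysis.Complex_Analysis"
begin

text \<open>
  An invariant torus is sought as an embedding \<open>\<theta> \<mapsto> (Y \<theta>, \<theta> + u \<theta>)\<close> that is isotropic, lies in an energy
  level and satisfies \<open>\<partial>\<^sub>yH (Y, \<theta> + u) = p + \<partial>\<^sub>p u\<close>; isotropy then forces the remaining equation
  \<open>\<partial>\<^sub>p Y = - \<partial>\<^sub>xH\<close>. Since no derivative of the frequency map is available, the iteration runs at each
  parameter \<open>\<xi>\<close> separately, with \<open>p\<close> replaced by \<open>p + b \<xi>\<close> for a continuous drift \<open>b\<close> that starts as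
  \<open>\<omega> - p\<close>. One Newton step solves two homological equations for the Diophantine vector \<open>p\<close>, one from
  linearising the energy equation, one from the conjugacy equation (whose mean is absorbed in \<open>b\<close>), and
  turns errors \<open>(e, b)\<close> into an error of size \<open>e (e + \<bar>b\<bar>)\<close> on a smaller strip. As long as \<open>b\<close> stays below a
  geometric threshold the step can be repeated; the closed sets of parameters where it can be are nested,
  and the drifts extend continuously to all parameters (Dugundji) and converge to a continuous limit
  close to \<open>\<omega> - p\<close>; a zero of the limit drift is a parameter with an invariant torus of frequency \<open>p\<close>.

  The lower bound on \<open>\<omega>\<close> enters only through injectivity: by invariance of domain \<open>\<omega>\<close> is a homeomorphism
  onto a neighbourhood of \<open>p\<close>, and Brouwer's theorem yields a parameter at which the limit drift vanishes.
\<close>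

unbundle no Formal_Power_Series.fps_syntax

section \<open>Holomorphic functions of several variables\<close>

text \<open>Apart from the perturbation the Hamiltonian is linear in \<open>y\<close>, so there is
  no twist: shifting the actions cannot correct the frequency, and the mean of the conjugacy
  equation can only go into the drift. Small divisors are controlled for \<open>p\<close> alone;
  solving both homological equations along \<open>p\<close> instead of \<open>p + b\<close> is what
  produces the mixed term in the new error. It prevents quadratic convergence: at the parameters of
  interest the drift at stage \<open>j\<close> is only as small as the sum of the corrections still
  to come, so errors, drifts and corrections all decrease geometrically, with ratios small enough to
  beat the growth of the Cauchy and small divisor constants on shrinking strips. Isotropy stays
  exact because the action correction is chosen so that its pullback to the torus is an exact
  differential \<open>- ds\<close>, and because the other correction merely reparametrises the
  torus. All objects are families jointly continuous in the parameter and the complex point; the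
  given complex extensions exist for each parameter separately, so this continuity has to be
  recovered from real points.\<close>

definition hol :: "(complex ^ 'm \<Rightarrow> complex) \<Rightarrow> (complex ^ 'm) set \<Rightarrow> bool" where
  "hol f U \<longleftrightarrow> (\<forall>z\<in>U. \<exists>D. (f has_derivative D) (at z) \<and> (\<forall>c h. D (c *s h) = c * D h))"

text \<open>The derivative along a complex line. As a one-variable \<open>deriv\<close> it is a
  total function and gives access to one-variable Cauchy theory; on holomorphic functions it is
  complex linear in \<open>h\<close>, since \<open>hol\<close> combines real linearity with complex
  homogeneity.\<close>

definition dd :: "(complex ^ 'm \<Rightarrow> complex) \<Rightarrow> complex ^ 'm \<Rightarrow> complex ^ 'm \<Rightarrow> complex" where
  "dd f h z = deriv (\<lambda>t. f (z + t *s h)) 0"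

lemma norm_vector_smult: "norm (c *s h) = norm c * norm (h :: complex ^ 'm)"
proof -
  have "norm (c *s h) = sqrt (\<Sum>i\<in>UNIV. (norm c)\<^sup>2 * (norm (h $ i))\<^sup>2)"
    by (simp add: norm_vec_def L2_set_def norm_mult power_mult_distrib)
  also have "\<dots> = norm c * norm h"
    by (simp add: norm_vec_def L2_set_def real_sqrt_mult flip: sum_distrib_left)
  finally show ?thesis .
qed

lemma scaleR_vector_smult: "r *\<^sub>R (h :: complex ^ 'm) = of_real r *s h"
proof -
  have "(r *\<^sub>R h) $ i = (of_real r *s h) $ i" for i
    unfolding vector_scaleR_component vector_smult_component by (rule scaleR_conv_of_real)
  then show ?thesis by (simp add: vec_eq_iff)
qed

lemma bounded_linear_smult_left: "bounded_linear (\<lambda>t. t *s (h :: complex ^ 'm))"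
  by (rule bounded_linear_intro[where K="norm h"])
    (auto simp: vec_eq_iff algebra_simps norm_vector_smult)

lemma hol_subset: "hol f U \<Longrightarrow> V \<subseteq> U \<Longrightarrow> hol f V"
  by (auto simp: hol_def)

lemma dd_eq_derivative:
  fixes f :: "complex ^ 'm \<Rightarrow> complex"
  assumes "(f has_derivative D) (at (z + t *s h))" "\<And>c. D (c *s h) = c * D h"
  shows "((\<lambda>s. f (z + s *s h)) has_field_derivative D h) (at t)"
proof -
  have "((\<lambda>s. z + s *s h) has_derivative (\<lambda>s. s *s h)) (at t)"
    by (rule has_derivative_eq_rhs[OF has_derivative_add[OF has_derivative_const[of z]
          bounded_linear_imp_has_derivative[OF bounded_linear_smult_left[of h], of "at t"]]]) auto
  from has_derivative_compose[OF this assms(1)]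
  have "((\<lambda>s. f (z + s *s h)) has_derivative (\<lambda>s. D (s *s h))) (at t)" .
  moreover have "(\<lambda>s. D (s *s h)) = (*) (D h)"
    using assms(2) by (auto simp: mult.commute)
  ultimately show ?thesis unfolding has_field_derivative_def by simp
qed

lemma dd_unique:
  assumes "(f has_derivative D) (at z)" "\<And>c h. D (c *s h) = c * D h"
  shows "dd f h z = D h"
  unfolding dd_def
  by (rule DERIV_imp_deriv, rule dd_eq_derivative) (use assms in auto)

lemma hol_has_derivative:
  assumes "hol f U" "z \<in> U"
  shows "(f has_derivative (\<lambda>h. dd f h z)) (at z)"
proof -
  obtain D where D: "(f has_derivative D) (at z)" "\<And>c h. D (c *s h) = c * D h"
    using assms unfolding hol_def by blast
  have "dd f h z = D h" for h using dd_unique[OF D] .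
  then show ?thesis using D(1) by simp
qed

lemma hol_dd_smult:
  assumes "hol f U" "z \<in> U"
  shows "dd f (c *s h) z = c * dd f h z"
proof -
  obtain D where D: "(f has_derivative D) (at z)" "\<And>c h. D (c *s h) = c * D h"
    using assms unfolding hol_def by blast
  show ?thesis using dd_unique[OF D] D(2) by simp
qed

lemma hol_dd_add:
  assumes "hol f U" "z \<in> U"
  shows "dd f (a + b) z = dd f a z + dd f b z"
  using hol_has_derivative[OF assms] has_derivative_linear linear_add by blast

lemma hol_dd_sum:
  assumes "hol f U" "z \<in> U"
  shows "dd f (sum g A) z = (\<Sum>i\<in>A. dd f (g i) z)"
  using linear_sum[OF has_derivative_linear[OF hol_has_derivative[OF assms]], of g A] .

lemma vector_eq_sum_axis: "h = (\<Sum>i\<in>UNIV. (h $ i) *s axis i (1::complex))"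
  by (simp add: vec_eq_iff axis_def if_distrib cong: if_cong)

lemma hol_dd_axis:
  assumes "hol f U" "z \<in> U"
  shows "dd f h z = (\<Sum>i\<in>UNIV. h $ i * dd f (axis i 1) z)"
  by (subst vector_eq_sum_axis) (simp add: hol_dd_sum[OF assms] hol_dd_smult[OF assms])

lemma hol_line_deriv:
  assumes "hol f U" "z + t *s h \<in> U"
  shows "((\<lambda>s. f (z + s *s h)) has_field_derivative dd f h (z + t *s h)) (at t)"
  by (rule dd_eq_derivative[where D="\<lambda>k. dd f k (z + t *s h)"])
    (use assms hol_has_derivative hol_dd_smult in blast)+

lemma hol_continuous_on: "hol f U \<Longrightarrow> continuous_on U f"
  by (meson continuous_at_imp_continuous_on has_derivative_continuous hol_has_derivative)

lemma hol_line_holomorphic: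
  assumes "hol f U" "\<And>t. t \<in> T \<Longrightarrow> z + t *s h \<in> U"
  shows "(\<lambda>t. f (z + t *s h)) holomorphic_on T"
  unfolding holomorphic_on_def field_differentiable_def
  using hol_line_deriv[OF assms(1) assms(2)] has_field_derivative_at_within by blast

section \<open>Quadratic Taylor remainders and derivatives of derivatives\<close>

lemma Taylor_remainder_unit:
  assumes G: "G holomorphic_on ball 0 R" and B: "\<And>t. t \<in> ball 0 R \<Longrightarrow> norm (G t) \<le> B" and R: "R > 2"
  shows "norm (G 1 - G 0 - deriv G 0) \<le> 8 * B / R\<^sup>2"
proof -
  have der: "((deriv ^^ i) G has_field_derivative (deriv ^^ Suc i) G x) (at x within cball 0 1)"
    if "x \<in> cball 0 1" for i x
  proof -
    have "(deriv ^^ i) G holomorphic_on ball 0 R" by (intro holomorphic_higher_deriv G) auto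
    then have "((deriv ^^ i) G has_field_derivative deriv ((deriv ^^ i) G) x) (at x)"
      using that R by (intro holomorphic_derivI[of _ "ball 0 R"]) auto
    then show ?thesis by (simp add: has_field_derivative_at_within)
  qed
  have bd: "norm ((deriv ^^ Suc 1) G x) \<le> 8 * B / R\<^sup>2" if x: "x \<in> cball 0 1" for x
  proof -
    have sub: "cball x (R/2) \<subseteq> ball 0 R"
    proof
      fix w assume "w \<in> cball x (R/2)"
      then have "norm (w - x) \<le> R/2" by (simp add: dist_norm norm_minus_commute)
      moreover have "norm w \<le> norm (w - x) + norm x" by norm
      ultimately show "w \<in> ball 0 R" using x R by simp
    qed
    \<comment> \<open>Since \<open>R > 2\<close>, the disc of radius \<open>R/2\<close> about any
      point of the closed unit disc stays in \<open>ball 0 R\<close>; Cauchy's inequality on it is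
      the origin of the factor \<open>8\<close>.\<close>
    have "norm ((deriv ^^ 2) G x) \<le> fact 2 * B / (R/2)^2"
    proof (rule Cauchy_inequality)
      show "G holomorphic_on ball x (R/2)"
        using G sub by (meson ball_subset_cball holomorphic_on_subset order_trans)
      show "continuous_on (cball x (R/2)) G"
        using G sub by (meson holomorphic_on_imp_continuous_on continuous_on_subset)
      show "norm (G w) \<le> B" if "norm (x - w) = R/2" for w
        using that sub by (intro B) (auto simp: dist_norm subset_iff)
    qed (use R in auto)
    then show ?thesis by (simp add: power2_eq_square eval_nat_numeral)
  qed
  have "cmod ((deriv ^^ 0) G 1 - (\<Sum>i\<le>1. (deriv ^^ i) G 0 * (1-0) ^ i / (fact i)))
      \<le> (8 * B / R\<^sup>2) * cmod(1 - 0)^(Suc 1) / fact 1"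
    by (rule complex_Taylor[OF convex_cball[of 0 1] der bd]) auto
  then show ?thesis by (simp add: algebra_simps)
qed

lemma line_in_ball:
  assumes "norm t * norm w < \<rho>" shows "z + t *s (w :: complex ^ 'm) \<in> ball z \<rho>"
  using assms by (simp add: dist_norm norm_vector_smult)

text \<open>Holomorphy is demanded only on the line through \<open>z\<close> in direction
  \<open>w\<close>, so that the estimate also serves for a limit function that is not yet known to
  be \<open>hol\<close>.\<close>

lemma line_Taylor:
  assumes hol: "\<And>T. (\<And>t. t \<in> T \<Longrightarrow> z + t *s w \<in> ball z \<rho>) \<Longrightarrow> (\<lambda>t. f (z + t *s w)) holomorphic_on T"
    and B: "\<And>v. v \<in> ball z \<rho> \<Longrightarrow> norm (f v) \<le> B" and w: "norm (w :: complex ^ 'm) < \<rho> / 2"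
  shows "norm (f (z + w) - f z - dd f w z) \<le> 8 * B * (norm w)\<^sup>2 / \<rho>\<^sup>2"
proof (cases "w = 0")
  case True
  have "0 \<le> B" using B[of z] w by (metis centre_in_ball dual_order.trans half_gt_zero_iff norm_ge_zero order_le_less_trans)
  then show ?thesis using True w by (simp add: dd_def)
next
  case False
  have \<rho>: "\<rho> > 0" using w by (smt (verit) norm_ge_zero field_sum_of_halves)
  define R where "R = \<rho> / norm w"
  have in_ball: "z + t *s w \<in> ball z \<rho>" if "t \<in> ball 0 R" for t
    using that False by (intro line_in_ball) (simp add: R_def field_simps)
  have R: "R > 2" using w False by (simp add: R_def field_simps)
  have "norm (f (z + 1 *s w) - f (z + 0 *s w) - deriv (\<lambda>t. f (z + t *s w)) 0) \<le> 8 * B / R\<^sup>2"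
    by (rule Taylor_remainder_unit[OF hol _ R]) (use in_ball B in auto)
  then show ?thesis using False \<rho> by (simp add: dd_def R_def power_divide)
qed

lemma hol_Taylor:
  assumes "hol f (ball z \<rho>)"
    and "\<And>v. v \<in> ball z \<rho> \<Longrightarrow> norm (f v) \<le> B" and "norm (w :: complex ^ 'm) < \<rho> / 2"
  shows "norm (f (z + w) - f z - dd f w z) \<le> 8 * B * (norm w)\<^sup>2 / \<rho>\<^sup>2"
  by (rule line_Taylor[OF hol_line_holomorphic[OF assms(1)] assms(2,3)])

text \<open>The common route to differentiability of directional derivatives, of uniform limits and
  of Fourier coefficients: in each case Cauchy estimates bound the remainder of an obvious linear
  candidate.\<close>

lemma derivative_from_quadratic_remainder:
  fixes f :: "complex ^ 'm \<Rightarrow> complex"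
  assumes add: "\<And>a b. L (a + b) = L a + L b" and smult: "\<And>c h. L (c *s h) = c * L h"
    and \<rho>: "\<rho> > 0" and rem: "\<And>w. norm w < \<rho> \<Longrightarrow> norm (f (z + w) - f z - L w) \<le> C * (norm w)\<^sup>2"
  shows "(f has_derivative L) (at z)"
proof -
  have lin: "linear L"
    by (rule linearI) (use add smult in \<open>auto simp: scaleR_vector_smult scaleR_conv_of_real\<close>)
  have "((\<lambda>h. norm (f (z + h) - f z - L h) / norm h) \<longlongrightarrow> 0) (at 0)"
  proof (rule Lim_null_comparison)
    have "\<forall>\<^sub>F h in at 0. norm (h :: complex ^ 'm) < \<rho>"
      using \<rho> by (auto simp: eventually_at intro!: exI[of _ \<rho>])
    then show "\<forall>\<^sub>F h in at 0. norm (norm (f (z + h) - f z - L h) / norm h) \<le> C * norm h"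
    proof eventually_elim
      case (elim h)
      show ?case
      proof (cases "h = 0")
        case False
        then show ?thesis using rem[OF elim] by (simp add: field_simps power2_eq_square)
      qed auto
    qed
    show "((\<lambda>h. C * norm h) \<longlongrightarrow> 0) (at 0)"
      by (rule tendsto_mult_right_zero, rule tendsto_norm_zero, rule tendsto_ident_at)
  qed
  then show ?thesis
    using lin linear_conv_bounded_linear by (auto simp: has_derivative_at)
qed

lemma bounded_near:
  fixes f :: "complex ^ 'm \<Rightarrow> complex"
  assumes "open U" "z \<in> U" "continuous_on U f"
  obtains \<rho> B where "\<rho> > 0" "ball z \<rho> \<subseteq> U" "\<And>v. v \<in> ball z \<rho> \<Longrightarrow> norm (f v) \<le> B"
proof -
  obtain \<rho> where \<rho>: "\<rho> > 0" "cball z \<rho> \<subseteq> U" using assms open_contains_cball by blast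
  then have "bounded (f ` cball z \<rho>)"
    using assms(3) by (meson compact_cball compact_continuous_image compact_imp_bounded continuous_on_subset)
  then obtain B where "\<And>v. v \<in> cball z \<rho> \<Longrightarrow> norm (f v) \<le> B" unfolding bounded_iff by blast
  then show ?thesis using that[of \<rho> B] \<rho> by (meson ball_subset_cball order_trans subsetD)
qed

text \<open>The rate depends on the base point only through \<open>\<rho>\<close> and
  \<open>B\<close>. Directional derivatives thereby become uniform limits of difference quotients,
  which transfers holomorphy on lines and continuity in parameters to them.\<close>

lemma hol_difference_quotient:
  fixes f :: "complex ^ 'm \<Rightarrow> complex"
  assumes f: "hol f (ball z \<rho>)" and B: "\<And>x. x \<in> ball z \<rho> \<Longrightarrow> norm (f x) \<le> B" and v: "norm v < \<rho> / 2"
  shows "norm ((f (z + of_real (1 / real (Suc n)) *s v) - f z) * of_nat (Suc n) - dd f v z)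
    \<le> 8 * B * (norm v)\<^sup>2 / \<rho>\<^sup>2 / real (Suc n)"
proof -
  let ?c = "of_real (1 / real (Suc n)) :: complex"
  have "0 < \<rho>" using v norm_ge_zero[of v] by linarith
  then have z: "z \<in> ball z \<rho>" by simp
  have nc: "norm (?c *s v) = norm v / real (Suc n)" by (simp only: norm_vector_smult norm_of_real) simp
  have "norm (f (z + ?c *s v) - f z - dd f (?c *s v) z) \<le> 8 * B * (norm (?c *s v))\<^sup>2 / \<rho>\<^sup>2"
  proof (rule hol_Taylor[OF f B])
    have "norm v / real (Suc n) \<le> norm v" by (simp add: divide_le_eq mult_le_cancel_left1)
    then show "norm (?c *s v) < \<rho> / 2" using v unfolding nc by linarith
  qed
  then have "norm (f (z + ?c *s v) - f z - ?c * dd f v z) * real (Suc n)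
      \<le> 8 * B * (norm (?c *s v))\<^sup>2 / \<rho>\<^sup>2 * real (Suc n)"
    unfolding hol_dd_smult[OF f z] by (rule mult_right_mono) simp
  moreover have "(f (z + ?c *s v) - f z) * of_nat (Suc n) - dd f v z = (f (z + ?c *s v) - f z - ?c * dd f v z) * of_nat (Suc n)"
  proof -
    have c1: "?c * of_nat (Suc n) = 1" by (simp del: of_nat_Suc)
    have dist: "(a - b - c * d) * N = (a - b) * N - (c * N) * d" for a b c d N :: complex
      by (simp add: algebra_simps)
    show ?thesis unfolding dist c1 by simp
  qed
  moreover have "8 * B * (norm (?c *s v))\<^sup>2 / \<rho>\<^sup>2 * real (Suc n) = 8 * B * (norm v)\<^sup>2 / \<rho>\<^sup>2 / real (Suc n)"
  proof -
    have "K * (a / N)\<^sup>2 / c * N = K * a\<^sup>2 / c / N" if "N > 0" for K a N c :: real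
      using that by (simp add: power2_eq_square)
    then show ?thesis unfolding nc by (simp del: of_nat_Suc)
  qed
  ultimately show ?thesis by (simp add: norm_mult del: of_nat_Suc)
qed

lemma hol_dd_line_holomorphic:
  fixes f :: "complex ^ 'm \<Rightarrow> complex"
  assumes f: "hol f U" and U: "open U" and T: "\<And>t. t \<in> T \<Longrightarrow> z + t *s h \<in> U"
  shows "(\<lambda>t. dd f w (z + t *s h)) holomorphic_on T"
proof -
  have "(\<lambda>t. dd f w (z + t *s h)) field_differentiable (at t0)" if t0: "t0 \<in> T" for t0
  proof -
    define z1 where "z1 = z + t0 *s h"
    obtain \<rho> B where \<rho>: "\<rho> > 0" "ball z1 \<rho> \<subseteq> U" and B: "\<And>v. v \<in> ball z1 \<rho> \<Longrightarrow> norm (f v) \<le> B"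
      using bounded_near[OF U, of z1 f] T[OF t0] hol_continuous_on[OF f] unfolding z1_def by blast
    \<comment> \<open>Difference quotients in a long direction would leave the ball on which
      \<open>f\<close> is bounded, so \<open>w\<close> is shrunk to \<open>v\<close>; homogeneity of
      \<open>dd\<close> in the direction undoes the factor at the end.\<close>
    define \<kappa> where "\<kappa> = \<rho> / (8 * (norm w + 1))"
    have w1: "norm w + 1 > 0" by (simp add: add_pos_pos add_nonneg_pos)
    have \<kappa>: "\<kappa> > 0" using \<rho> w1 by (simp add: \<kappa>_def)
    define v where "v = of_real \<kappa> *s w"
    have "norm v = \<rho> / 8 * (norm w / (norm w + 1))"
      using \<kappa> by (simp add: v_def norm_vector_smult) (simp add: \<kappa>_def)
    also have "\<dots> < \<rho> / 8 * 1" by (rule mult_strict_left_mono) (use \<rho> w1 in auto)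
    finally have v: "norm v < \<rho> / 8" by simp
    define s where "s = \<rho> / (2 * (norm h + 1))"
    have h1: "norm h + 1 > 0" by (simp add: add_pos_pos add_nonneg_pos)
    have s: "s > 0" using \<rho> h1 by (simp add: s_def)
    have near: "z + t *s h \<in> ball z1 (\<rho>/2)" if "t \<in> ball t0 s" for t
    proof -
      have "norm (t - t0) * norm h \<le> s * norm h"
        using that by (intro mult_right_mono) (auto simp: dist_norm norm_minus_commute)
      also have "\<dots> < s * (norm h + 1)" using s by simp
      also have "\<dots> = \<rho>/2" using h1 by (simp add: s_def field_simps)
      finally have "z1 + (t - t0) *s h \<in> ball z1 (\<rho>/2)" by (rule line_in_ball)
      moreover have "z1 + (t - t0) *s h = z + t *s h" by (simp add: z1_def vec_eq_iff algebra_simps)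
      ultimately show ?thesis by (simp only:)
    qed
    have sub: "ball y (\<rho>/2) \<subseteq> ball z1 \<rho>" if "y \<in> ball z1 (\<rho>/2)" for y
    proof
      fix x assume x: "x \<in> ball y (\<rho>/2)"
      show "x \<in> ball z1 \<rho>" using dist_triangle[of z1 x y] x that by simp
    qed
    define q where "q = (\<lambda>n t. (f (z + t *s h + of_real (1 / real (Suc n)) *s v) - f (z + t *s h)) * of_nat (Suc n))"
    have est: "norm (q n t - dd f v (z + t *s h)) \<le> 8 * B * (norm v)\<^sup>2 / (\<rho>/2)\<^sup>2 / real (Suc n)" if t: "t \<in> ball t0 s" for n t
      unfolding q_def
      by (rule hol_difference_quotient) (use hol_subset[OF f] sub[OF near[OF t]] \<rho> B v in auto)
    have "(\<lambda>t. dd f v (z + t *s h)) holomorphic_on ball t0 s"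
    proof (rule holomorphic_uniform_sequence[where f=q])
      fix n
      have p1: "z + t *s h \<in> U" if "t \<in> ball t0 s" for t using near[OF that] sub \<rho> by (meson centre_in_ball half_gt_zero subsetD)
      have p2: "(z + of_real (1 / real (Suc n)) *s v) + t *s h \<in> U" if "t \<in> ball t0 s" for t
      proof -
        have "norm (of_real (1 / real (Suc n)) *s v) = norm v / real (Suc n)" by (simp only: norm_vector_smult norm_of_real) simp
        also have "\<dots> \<le> norm v" by (simp add: divide_le_eq mult_le_cancel_left1)
        also have "\<dots> < \<rho>/2" using v \<rho> by simp
        finally have "(z + t *s h) + of_real (1 / real (Suc n)) *s v \<in> ball (z + t *s h) (\<rho>/2)" by (simp add: dist_norm)
        then have "(z + t *s h) + of_real (1 / real (Suc n)) *s v \<in> U"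
          using sub[OF near[OF that]] \<rho>(2) by blast
        then show ?thesis by (simp only: add_ac)
      qed
      let ?x = "of_real (1 / real (Suc n)) *s v"
      have eq: "z + t *s h + ?x = (z + ?x) + t *s h" for t by (simp only: add_ac)
      show "q n holomorphic_on ball t0 s" unfolding q_def eq
        by (intro holomorphic_on_mult holomorphic_on_diff holomorphic_on_const hol_line_holomorphic[OF f] p1 p2)
    next
      fix x assume x: "x \<in> ball t0 s"
      obtain d where d: "0 < d" "cball x d \<subseteq> ball t0 s" using x open_contains_cball open_ball by blast
      have "uniform_limit (cball x d) q (\<lambda>t. dd f v (z + t *s h)) sequentially"
      proof (rule uniform_limitI)
        fix e :: real assume "e > 0"
        let ?K = "8 * B * (norm v)\<^sup>2 / (\<rho>/2)\<^sup>2"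
        have "(\<lambda>n. ?K / real (Suc n)) \<longlonglongrightarrow> 0"
          unfolding divide_inverse[of _ "real (Suc _)"]
          by (rule tendsto_mult_right_zero[OF LIMSEQ_inverse_real_of_nat])
        then have "\<forall>\<^sub>F n in sequentially. ?K / real (Suc n) < e"
          using \<open>e > 0\<close> by (rule order_tendstoD)
        then show "\<forall>\<^sub>F n in sequentially. \<forall>t\<in>cball x d. dist (q n t) (dd f v (z + t *s h)) < e"
        proof eventually_elim
          case (elim n)
          show ?case
          proof
            fix t assume "t \<in> cball x d"
            then have "t \<in> ball t0 s" using d(2) by blast
            from est[OF this, of n] elim show "dist (q n t) (dd f v (z + t *s h)) < e"
              unfolding dist_norm by linarith
          qed
        qed
      qed
      then show "\<exists>d>0. cball x d \<subseteq> ball t0 s \<and> uniform_limit (cball x d) q (\<lambda>t. dd f v (z + t *s h)) sequentially"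
        using d by blast
    qed auto
    then have "(\<lambda>t. (1/of_real \<kappa>) * dd f v (z + t *s h)) holomorphic_on ball t0 s"
      by (intro holomorphic_intros)
    moreover have "(1/of_real \<kappa>) * dd f v (z + t *s h) = dd f w (z + t *s h)" if "t \<in> ball t0 s" for t
    proof -
      have "z + t *s h \<in> U" using near[OF that] sub \<rho> by (meson centre_in_ball half_gt_zero subsetD)
      then show ?thesis unfolding v_def by (subst hol_dd_smult[OF f]) (use \<kappa> in auto)
    qed
    ultimately have "(\<lambda>t. dd f w (z + t *s h)) holomorphic_on ball t0 s"
      by (rule holomorphic_transform)
    then show ?thesis
      by (rule holomorphic_on_imp_differentiable_at) (use s in auto)
  qed
  then show ?thesis unfolding holomorphic_on_def using field_differentiable_at_within by blast
qed

lemma line_Cauchy: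
  assumes "(\<lambda>t. f (z + t *s h)) holomorphic_on ball 0 R" "0 < r" "r < R"
    and "\<And>t. norm t = r \<Longrightarrow> norm (f (z + t *s h)) \<le> B"
  shows "norm (dd f h z) \<le> B / r"
proof -
  have "norm ((deriv ^^ 1) (\<lambda>t. f (z + t *s h)) 0) \<le> fact 1 * B / r ^ 1"
  proof (rule Cauchy_inequality)
    show "(\<lambda>t. f (z + t *s h)) holomorphic_on ball 0 r"
      using assms(1) by (rule holomorphic_on_subset) (use assms in auto)
    show "continuous_on (cball 0 r) (\<lambda>t. f (z + t *s h))"
      by (rule holomorphic_on_imp_continuous_on, rule holomorphic_on_subset[OF assms(1)]) (use assms in auto)
  qed (use assms in auto)
  then show ?thesis by (simp add: dd_def)
qed

text \<open>The first-order remainder \<open>f (y + w) - f y - dd f w y\<close> is quadratic in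
  \<open>w\<close>, uniformly for \<open>y\<close> near \<open>z\<close>. A Cauchy estimate for it
  in direction \<open>h\<close> gives the remainder of \<open>dd f h\<close> with linear part
  \<open>dd (dd f w) h\<close>. The derivative thus appears with the two directions interchanged, so
  the symmetry of second derivatives comes for free.\<close>

lemma hol_dd_has_derivative:
  fixes f :: "complex ^ 'm \<Rightarrow> complex"
  assumes f: "hol f U" and U: "open U" and z: "z \<in> U"
  shows "(dd f h has_derivative (\<lambda>w. dd (dd f w) h z)) (at z)"
    and "dd (dd f (c *s w)) h z = c * dd (dd f w) h z"
proof -
  obtain \<rho> B where \<rho>: "\<rho> > 0" "ball z \<rho> \<subseteq> U" and B: "\<And>v. v \<in> ball z \<rho> \<Longrightarrow> norm (f v) \<le> B"
    using bounded_near[OF U z hol_continuous_on[OF f]] by metis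
  define R where "R = \<rho> / (2 * (norm h + 1))"
  have h1: "norm h + 1 > 0" by (simp add: add_pos_pos add_nonneg_pos)
  have R: "R > 0" using \<rho> h1 by (simp add: R_def)
  have near: "z + t *s h \<in> ball z (\<rho>/2)" if "t \<in> ball 0 R" for t
  proof -
    have "norm t * norm h \<le> R * norm h" using that by (intro mult_right_mono) auto
    also have "\<dots> < R * (norm h + 1)" using R by simp
    also have "\<dots> = \<rho>/2" using h1 by (simp add: R_def field_simps)
    finally show ?thesis by (rule line_in_ball)
  qed
  have halfsub: "y + w \<in> U" if "y \<in> ball z (\<rho>/2)" "norm w < \<rho>/2" for y w
  proof -
    have "dist z (y + w) \<le> dist z y + norm w" by (metis add_diff_cancel_left' dist_norm dist_triangle norm_minus_commute)
    then show ?thesis using that \<rho> by auto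
  qed
  have nearU: "z + t *s h \<in> U" if "t \<in> ball 0 R" for t using halfsub[OF near[OF that], of 0] \<rho> by simp
  have dif: "(\<lambda>t. dd f w (z + t *s h)) field_differentiable (at 0)" for w
    by (rule holomorphic_on_imp_differentiable_at[OF hol_dd_line_holomorphic[OF f U nearU], of "ball 0 R"]) (use R in auto)
  have ev: "\<forall>\<^sub>F t in nhds 0. t \<in> ball 0 R" using R by (intro eventually_nhds_in_open) auto
  show smult: "dd (dd f (c *s w)) h z = c * dd (dd f w) h z" for c w
  proof -
    have "dd (dd f (c *s w)) h z = deriv (\<lambda>t. c * dd f w (z + t *s h)) 0" unfolding dd_def[of "dd f (c *s w)"]
      by (rule deriv_cong_ev[OF eventually_mono[OF ev]]) (auto simp: hol_dd_smult[OF f nearU])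
    also have "\<dots> = c * deriv (\<lambda>t. dd f w (z + t *s h)) 0" by (rule deriv_cmult[OF dif])
    finally show ?thesis by (simp add: dd_def[of "dd f w"])
  qed
  have add: "dd (dd f (a + b)) h z = dd (dd f a) h z + dd (dd f b) h z" for a b
  proof -
    have "dd (dd f (a + b)) h z = deriv (\<lambda>t. dd f a (z + t *s h) + dd f b (z + t *s h)) 0" unfolding dd_def[of "dd f (a + b)"]
      by (rule deriv_cong_ev[OF eventually_mono[OF ev]]) (auto simp: hol_dd_add[OF f nearU])
    also have "\<dots> = deriv (\<lambda>t. dd f a (z + t *s h)) 0 + deriv (\<lambda>t. dd f b (z + t *s h)) 0" by (rule deriv_add[OF dif dif])
    finally show ?thesis by (simp add: dd_def[of "dd f a"] dd_def[of "dd f b"])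
  qed
  show "(dd f h has_derivative (\<lambda>w. dd (dd f w) h z)) (at z)"
  proof (rule derivative_from_quadratic_remainder[where \<rho>="\<rho>/4" and C="8 * B / (\<rho>/2)\<^sup>2 / (R/2)", OF add smult])
    fix w :: "complex ^ 'm" assume w: "norm w < \<rho>/4"
    define N where "N = (\<lambda>y. f (y + w) - f y - dd f w y)"
    have p2: "(z + w) + t *s h \<in> U" if "t \<in> ball 0 R" for t
      using halfsub[OF near[OF that], of w] w \<rho> by (simp add: algebra_simps)
    have eq: "z + t *s h + w = (z + w) + t *s h" for t by simp
    have hN: "(\<lambda>t. N (z + t *s h)) holomorphic_on ball 0 R"
      unfolding N_def eq
      by (intro holomorphic_intros hol_line_holomorphic[OF f] hol_dd_line_holomorphic[OF f U] nearU p2)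
    have bN: "norm (N y) \<le> 8 * B * (norm w)\<^sup>2 / (\<rho>/2)\<^sup>2" if "y \<in> ball z (\<rho>/2)" for y
    proof -
      have s: "ball y (\<rho>/2) \<subseteq> ball z \<rho>"
        proof
          fix x assume x: "x \<in> ball y (\<rho>/2)"
          show "x \<in> ball z \<rho>" using dist_triangle[of z x y] x that by simp
        qed
      show ?thesis unfolding N_def
        by (rule hol_Taylor) (use s \<rho> B w hol_subset[OF f] in auto)
    qed
    have "norm (dd N h z) \<le> 8 * B * (norm w)\<^sup>2 / (\<rho>/2)\<^sup>2 / (R/2)"
      by (rule line_Cauchy[OF hN]) (use R in \<open>auto intro!: bN near\<close>)
    moreover have "dd N h z = dd f h (z + w) - dd f h z - dd (dd f w) h z"
    proof -
      have d1: "(\<lambda>t. f (z + w + t *s h)) field_differentiable (at 0)"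
        by (rule holomorphic_on_imp_differentiable_at[OF hol_line_holomorphic[OF f p2], of "ball 0 R"]) (use R in auto)
      have d2: "(\<lambda>t. f (z + t *s h)) field_differentiable (at 0)"
        by (rule holomorphic_on_imp_differentiable_at[OF hol_line_holomorphic[OF f nearU], of "ball 0 R"]) (use R in auto)
      show ?thesis unfolding dd_def[of N] unfolding N_def eq
        by (simp add: deriv_diff d1 d2 dif field_differentiable_diff)
          (simp add: dd_def)
    qed
    ultimately show "norm (dd f h (z + w) - dd f h z - dd (dd f w) h z) \<le> 8 * B / (\<rho>/2)\<^sup>2 / (R/2) * (norm w)\<^sup>2"
      by (simp add: field_simps)
  qed (use \<rho> in auto)
qed

lemma hol_dd: "hol f U \<Longrightarrow> open U \<Longrightarrow> hol (dd f h) U"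
  unfolding hol_def[of "dd f h"] using hol_dd_has_derivative by blast

lemma dd_commute:
  assumes "hol f U" "open U" "z \<in> U"
  shows "dd (dd f h) w z = dd (dd f w) h z"
  using dd_unique[OF hol_dd_has_derivative[OF assms]] .

text \<open>Weierstrass' theorem, for an arbitrary filter because Fourier series are summed along
  finite sets of frequencies. The one-variable theorem applies on each complex line, linearity in
  the direction passes to the limit, and a local bound on \<open>g\<close> makes the remainder
  quadratic.\<close>

lemma hol_uniform_limit:
  fixes f :: "'i \<Rightarrow> complex ^ 'm \<Rightarrow> complex"
  assumes f: "\<forall>\<^sub>F n in F. hol (f n) U" and U: "open U" and lim: "uniform_limit U f g F" and F: "F \<noteq> bot"
  shows "hol g U" and "z \<in> U \<Longrightarrow> ((\<lambda>n. dd (f n) h z) \<longlongrightarrow> dd g h z) F"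
proof -
  have contg: "continuous_on U g"
    by (rule uniform_limit_theorem[OF _ lim F]) (rule eventually_mono[OF f hol_continuous_on])
  have line: "(\<exists>r>0. (\<forall>t\<in>ball t0 r. z + t *s h \<in> U)) \<and> ((\<lambda>t. g (z + t *s h)) has_field_derivative dd g h (z + t0 *s h)) (at t0)
      \<and> ((\<lambda>n. dd (f n) h (z + t0 *s h)) \<longlongrightarrow> dd g h (z + t0 *s h)) F" if z: "z + t0 *s h \<in> U" for z h t0
  proof -
    have "continuous_on UNIV (\<lambda>t. z + t *s h)"
      by (intro continuous_intros linear_continuous_on bounded_linear_smult_left)
    then have "open ((\<lambda>t. z + t *s h) -` U)" using U by (simp add: open_vimage)
    then obtain r where r: "r > 0" "cball t0 r \<subseteq> (\<lambda>t. z + t *s h) -` U"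
      using z open_contains_cball by (metis vimageI)
    obtain g' where g': "\<And>w. w \<in> ball t0 r \<Longrightarrow> ((\<lambda>t. g (z + t *s h)) has_field_derivative g' w) (at w)
          \<and> ((\<lambda>n. dd (f n) h (z + w *s h)) \<longlongrightarrow> g' w) F"
    proof (rule has_complex_derivative_uniform_limit[where f="\<lambda>n t. f n (z + t *s h)" and f'="\<lambda>n w. dd (f n) h (z + w *s h)" and g="\<lambda>t. g (z + t *s h)"])
      show "\<forall>\<^sub>F n in F. continuous_on (cball t0 r) (\<lambda>t. f n (z + t *s h)) \<and>
             (\<forall>w\<in>ball t0 r. ((\<lambda>t. f n (z + t *s h)) has_field_derivative dd (f n) h (z + w *s h)) (at w))"
        using f
      proof eventually_elim
        case (elim n)
        have "continuous_on (cball t0 r) (\<lambda>t. f n (z + t *s h))"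
          by (rule holomorphic_on_imp_continuous_on, rule hol_line_holomorphic[OF elim]) (use r in auto)
        moreover have "\<forall>w\<in>ball t0 r. ((\<lambda>t. f n (z + t *s h)) has_field_derivative dd (f n) h (z + w *s h)) (at w)"
          using r by (intro ballI hol_line_deriv[OF elim]) (auto simp: subset_iff)
        ultimately show ?case by blast
      qed
      show "uniform_limit (cball t0 r) (\<lambda>n t. f n (z + t *s h)) (\<lambda>t. g (z + t *s h)) F"
      proof (rule uniform_limitI)
        fix e :: real assume "e > 0"
        from uniform_limitD[OF lim this] show "\<forall>\<^sub>F n in F. \<forall>x\<in>cball t0 r. dist (f n (z + x *s h)) (g (z + x *s h)) < e"
          by eventually_elim (use r in auto)
      qed
    qed (use F r in auto)
    have t0: "t0 \<in> ball t0 r" using r by simp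
    have "((\<lambda>t. g (z + (t0 + t) *s h)) has_field_derivative g' t0) (at 0)"
      using g'[OF t0] by (subst DERIV_at_within_shift[of _ _ t0 _ UNIV, simplified, symmetric]) (auto simp: add.commute)
    then have "((\<lambda>t. g ((z + t0 *s h) + t *s h)) has_field_derivative g' t0) (at 0)"
      by (simp add: vector_sadd_rdistrib algebra_simps)
    then have "dd g h (z + t0 *s h) = g' t0" unfolding dd_def by (rule DERIV_imp_deriv)
    then show ?thesis using g'[OF t0] r by (auto simp: subset_iff intro!: exI[of _ r])
  qed
  show limdd: "((\<lambda>n. dd (f n) h z) \<longlongrightarrow> dd g h z) F" if "z \<in> U" for z h
    using line[of z 0 h] that by simp
  show "hol g U" unfolding hol_def
  proof
    fix z assume z: "z \<in> U"
    have add: "dd g (a + b) z = dd g a z + dd g b z" for a b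
    proof -
      have "((\<lambda>n. dd (f n) (a+b) z) \<longlongrightarrow> dd g a z + dd g b z) F"
        by (rule Lim_transform_eventually[OF tendsto_add[OF limdd[OF z] limdd[OF z]] eventually_mono[OF f]])
          (simp add: hol_dd_add[OF _ z])
      then show ?thesis using tendsto_unique[OF F limdd[OF z]] by blast
    qed
    have smult: "dd g (c *s b) z = c * dd g b z" for c b
    proof -
      have "((\<lambda>n. dd (f n) (c *s b) z) \<longlongrightarrow> c * dd g b z) F"
        by (rule Lim_transform_eventually[OF tendsto_mult[OF tendsto_const limdd[OF z]] eventually_mono[OF f]])
          (simp add: hol_dd_smult[OF _ z])
      then show ?thesis using tendsto_unique[OF F limdd[OF z]] by blast
    qed
    obtain \<rho> B where \<rho>: "\<rho> > 0" "ball z \<rho> \<subseteq> U" and B: "\<And>v. v \<in> ball z \<rho> \<Longrightarrow> norm (g v) \<le> B"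
      using bounded_near[OF U z contg] by metis
    have "(g has_derivative (\<lambda>h. dd g h z)) (at z)"
    proof (rule derivative_from_quadratic_remainder[where \<rho>="\<rho>/2" and C="8 * B / \<rho>\<^sup>2", OF add smult])
      fix w :: "complex ^ 'm" assume w: "norm w < \<rho>/2"
      have "norm (g (z + w) - g z - dd g w z) \<le> 8 * B * (norm w)\<^sup>2 / \<rho>\<^sup>2"
      proof (rule line_Taylor[OF _ B w])
        fix T assume T: "\<And>t. t \<in> T \<Longrightarrow> z + t *s w \<in> ball z \<rho>"
        show "(\<lambda>t. g (z + t *s w)) holomorphic_on T"
          unfolding holomorphic_on_def field_differentiable_def
          using line T \<rho> by (meson has_field_derivative_at_within subsetD)
      qed
      then show "norm (g (z + w) - g z - dd g w z) \<le> 8 * B / \<rho>\<^sup>2 * (norm w)\<^sup>2" by (simp add: mult.commute mult.left_commute)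
    qed (use \<rho> in auto)
    then show "\<exists>D. (g has_derivative D) (at z) \<and> (\<forall>c h. D (c *s h) = c * D h)" using smult by blast
  qed
qed

section \<open>Algebraic operations and the chain rule\<close>

lemma hol_const [simp]: "hol (\<lambda>z. c) U"
  unfolding hol_def by (intro ballI exI[of _ "\<lambda>_. 0"]) auto

lemma hol_component [simp]: "hol (\<lambda>z. z $ i) U"
  unfolding hol_def
  by (intro ballI exI[of _ "\<lambda>h. h $ i"]) (auto intro: bounded_linear_imp_has_derivative bounded_linear_vec_nth)

lemma dd_const [simp]: "dd (\<lambda>z. c) h z = 0"
  by (simp add: dd_def)

lemma dd_component [simp]: "dd (\<lambda>z. z $ i) h z = h $ i"
  by (rule dd_unique[where D="\<lambda>h. h $ i"]) (auto intro: bounded_linear_imp_has_derivative bounded_linear_vec_nth)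

lemma hol_add:
  assumes f: "hol f U" and g: "hol g U"
  shows "hol (\<lambda>z. f z + g z) U" "z \<in> U \<Longrightarrow> dd (\<lambda>z. f z + g z) h z = dd f h z + dd g h z"
proof -
  have D: "((\<lambda>z. f z + g z) has_derivative (\<lambda>h. dd f h z + dd g h z)) (at z)"
    "dd f (c *s h) z + dd g (c *s h) z = c * (dd f h z + dd g h z)" if "z \<in> U" for z c h
    using that assms
    by (auto intro!: has_derivative_add hol_has_derivative simp: hol_dd_smult algebra_simps)
  then show "hol (\<lambda>z. f z + g z) U" unfolding hol_def by blast
  show "z \<in> U \<Longrightarrow> dd (\<lambda>z. f z + g z) h z = dd f h z + dd g h z" using dd_unique D by blast
qed

lemma hol_mult:
  assumes f: "hol f U" and g: "hol g U"
  shows "hol (\<lambda>z. f z * g z) U" "z \<in> U \<Longrightarrow> dd (\<lambda>z. f z * g z) h z = f z * dd g h z + dd f h z * g z"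
proof -
  have D: "((\<lambda>z. f z * g z) has_derivative (\<lambda>h. f z * dd g h z + dd f h z * g z)) (at z)"
    "f z * dd g (c *s h) z + dd f (c *s h) z * g z = c * (f z * dd g h z + dd f h z * g z)" if "z \<in> U" for z c h
    using that assms
    by (auto intro!: has_derivative_mult[of f _ _ _ g] hol_has_derivative simp: hol_dd_smult distrib_left)
  then show "hol (\<lambda>z. f z * g z) U" unfolding hol_def by blast
  show "z \<in> U \<Longrightarrow> dd (\<lambda>z. f z * g z) h z = f z * dd g h z + dd f h z * g z" using dd_unique D by blast
qed

lemma hol_cmult:
  assumes f: "hol f U"
  shows "hol (\<lambda>z. c * f z) U" "z \<in> U \<Longrightarrow> dd (\<lambda>z. c * f z) h z = c * dd f h z"
  using hol_mult[OF hol_const[of c] f] by auto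

lemma hol_diff:
  assumes f: "hol f U" and g: "hol g U"
  shows "hol (\<lambda>z. f z - g z) U" "z \<in> U \<Longrightarrow> dd (\<lambda>z. f z - g z) h z = dd f h z - dd g h z"
  using hol_add[OF f hol_cmult(1)[OF g, of "-1"]] hol_cmult(2)[OF g, of _ "-1"] by auto

lemma hol_sum:
  assumes "\<And>i. i \<in> I \<Longrightarrow> hol (f i) U"
  shows "hol (\<lambda>z. \<Sum>i\<in>I. f i z) U" "z \<in> U \<Longrightarrow> dd (\<lambda>z. \<Sum>i\<in>I. f i z) h z = (\<Sum>i\<in>I. dd (f i) h z)"
  using assms
proof (induction I rule: infinite_finite_induct)
  case (insert i I)
  { case 1 with insert show ?case by (auto intro!: hol_add) }
  { case 2 with insert show ?case by (simp add: hol_add(2)[of _ U]) }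
qed auto

lemma hol_inverse:
  assumes f: "hol f U" and nz: "\<And>z. z \<in> U \<Longrightarrow> f z \<noteq> 0"
  shows "hol (\<lambda>z. inverse (f z)) U"
  unfolding hol_def
proof
  fix z assume z: "z \<in> U"
  have "((\<lambda>z. inverse (f z)) has_derivative (\<lambda>h. - (inverse (f z) * dd f h z * inverse (f z)))) (at z)"
    by (rule Deriv.has_derivative_inverse[OF nz[OF z] hol_has_derivative[OF f z]])
  moreover have "\<forall>c h. - (inverse (f z) * dd f (c *s h) z * inverse (f z)) = c * - (inverse (f z) * dd f h z * inverse (f z))"
    by (simp add: hol_dd_smult[OF f z])
  ultimately show "\<exists>D. ((\<lambda>z. inverse (f z)) has_derivative D) (at z) \<and> (\<forall>c h. D (c *s h) = c * D h)"
    by blast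
qed

definition vdd :: "(complex ^ 'm \<Rightarrow> complex ^ 'k) \<Rightarrow> complex ^ 'm \<Rightarrow> complex ^ 'm \<Rightarrow> complex ^ 'k" where
  "vdd \<psi> h z = (\<chi> i. dd (\<lambda>z. \<psi> z $ i) h z)"

lemma vdd_has_derivative:
  assumes "\<And>i. hol (\<lambda>z. \<psi> z $ i) U" "z \<in> U"
  shows "(\<psi> has_derivative (\<lambda>h. vdd \<psi> h z)) (at z)"
proof -
  have "((\<lambda>z. \<Sum>i\<in>UNIV. (\<psi> z $ i) *s axis i 1) has_derivative (\<lambda>h. \<Sum>i\<in>UNIV. (vdd \<psi> h z $ i) *s axis i 1)) (at z)"
    by (intro has_derivative_sum bounded_linear.has_derivative[OF bounded_linear_smult_left])
      (simp add: vdd_def hol_has_derivative[OF assms])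
  then show ?thesis by (simp flip: vector_eq_sum_axis)
qed

lemma vdd_linear:
  assumes "\<And>i. hol (\<lambda>z. \<psi> z $ i) U" "z \<in> U"
  shows "vdd \<psi> (c *s h) z = c *s vdd \<psi> h z" "vdd \<psi> (a + b) z = vdd \<psi> a z + vdd \<psi> b z"
  using hol_dd_smult[OF assms] hol_dd_add[OF assms] by (auto simp: vdd_def vec_eq_iff)

lemma hol_compose:
  fixes \<psi> :: "complex ^ 'm \<Rightarrow> complex ^ 'k"
  assumes f: "hol f V" and \<psi>: "\<And>i. hol (\<lambda>z. \<psi> z $ i) U" and maps: "\<And>z. z \<in> U \<Longrightarrow> \<psi> z \<in> V"
  shows "hol (\<lambda>z. f (\<psi> z)) U" "z \<in> U \<Longrightarrow> dd (\<lambda>z. f (\<psi> z)) h z = dd f (vdd \<psi> h z) (\<psi> z)"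
proof -
  have D: "((\<lambda>z. f (\<psi> z)) has_derivative (\<lambda>h. dd f (vdd \<psi> h z) (\<psi> z))) (at z)"
    "dd f (vdd \<psi> (c *s h) z) (\<psi> z) = c * dd f (vdd \<psi> h z) (\<psi> z)" if "z \<in> U" for z c h
    using has_derivative_compose[OF vdd_has_derivative[OF \<psi> that] hol_has_derivative[OF f maps[OF that]]]
      hol_dd_smult[OF f maps[OF that]] vdd_linear[OF \<psi> that] by auto
  then show "hol (\<lambda>z. f (\<psi> z)) U" unfolding hol_def by blast
  show "z \<in> U \<Longrightarrow> dd (\<lambda>z. f (\<psi> z)) h z = dd f (vdd \<psi> h z) (\<psi> z)" using dd_unique D by blast
qed

lemma dd_cong:
  assumes "open U" "z \<in> U" "\<And>x. x \<in> U \<Longrightarrow> f x = g x"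
  shows "dd f h z = dd g h z"
proof -
  have "continuous_on UNIV (\<lambda>t. z + t *s h)"
    by (intro continuous_intros linear_continuous_on bounded_linear_smult_left)
  then have "open ((\<lambda>t. z + t *s h) -` U)" using assms(1) by (simp add: open_vimage)
  then have "\<forall>\<^sub>F t in nhds 0. t \<in> (\<lambda>t. z + t *s h) -` U"
    by (rule eventually_nhds_in_open) (use assms in auto)
  then show ?thesis unfolding dd_def
    by (intro deriv_cong_ev refl) (auto elim!: eventually_mono simp: assms(3))
qed

lemma hol_cong:
  assumes "open U" "\<And>x. x \<in> U \<Longrightarrow> f x = g x" "hol f U"
  shows "hol g U"
  unfolding hol_def
proof
  fix z assume z: "z \<in> U"
  have "(g has_derivative (\<lambda>h. dd f h z)) (at z)"
    using hol_has_derivative[OF assms(3) z] assms(1) z assms(2) by (rule has_derivative_transform_within_open)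
  then show "\<exists>D. (g has_derivative D) (at z) \<and> (\<forall>c h. D (c *s h) = c * D h)"
    using hol_dd_smult[OF assms(3) z] by blast
qed

lemma norm_vec_le_sum: "norm (x :: complex ^ 'm) \<le> (\<Sum>i\<in>UNIV. norm (x $ i))"
  unfolding norm_vec_def by (rule L2_set_le_sum) simp

lemma norm_vec_le_card:
  assumes "\<And>i. norm (x $ i) \<le> c"
  shows "norm (x :: complex ^ 'm) \<le> real CARD('m) * c"
  by (rule order_trans[OF norm_vec_le_sum]) (use sum_bounded_above[of UNIV "\<lambda>i. norm (x $ i)" c] assms in auto)

lemma complexify_component [simp]: "complexify x $ i = of_real (x $ i)"
  by (simp add: complexify_def)

lemma complexify_axis [simp]: "complexify (axis i 1) = axis i 1"
  by (simp add: vec_eq_iff axis_def)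

lemma norm_complexify [simp]: "norm (complexify x) = norm x"
  by (simp add: norm_vec_def)

lemma complexify_add: "complexify (x + y) = complexify x + complexify y"
  by (simp add: vec_eq_iff)

lemma complexify_scaleR: "complexify (c *\<^sub>R x) = of_real c *s complexify x"
  by (simp add: vec_eq_iff)

section \<open>Real analytic functions depending continuously on a parameter\<close>

text \<open>\<open>\<Lambda>\<close> lists generators of the period lattice only. Reality at real
  points allows real objects to be read off by \<open>Re\<close> at the end. Continuity is asked
  jointly in parameter and point, the form that composition and uniform limits preserve.\<close>

definition analytic_family ::
  "'p::topological_space set \<Rightarrow> (complex ^ 'm) set \<Rightarrow> (complex ^ 'm) set \<Rightarrow> ('p \<Rightarrow> complex ^ 'm \<Rightarrow> complex) \<Rightarrow> bool" where
  "analytic_family \<Xi> U \<Lambda> f \<longleftrightarrow>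
     (\<forall>\<xi>\<in>\<Xi>. hol (f \<xi>) U \<and> (\<forall>z\<in>U. \<forall>v\<in>\<Lambda>. f \<xi> (z + v) = f \<xi> z) \<and>
        (\<forall>x. complexify x \<in> U \<longrightarrow> f \<xi> (complexify x) \<in> \<real>)) \<and>
     continuous_on (\<Xi> \<times> U) (\<lambda>(\<xi>, z). f \<xi> z)"

lemma analytic_familyD:
  assumes "analytic_family \<Xi> U \<Lambda> f"
  shows "\<xi> \<in> \<Xi> \<Longrightarrow> hol (f \<xi>) U" "\<xi> \<in> \<Xi> \<Longrightarrow> z \<in> U \<Longrightarrow> v \<in> \<Lambda> \<Longrightarrow> f \<xi> (z + v) = f \<xi> z"
    "\<xi> \<in> \<Xi> \<Longrightarrow> complexify x \<in> U \<Longrightarrow> f \<xi> (complexify x) \<in> \<real>"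
    "continuous_on (\<Xi> \<times> U) (\<lambda>(\<xi>, z). f \<xi> z)"
  using assms unfolding analytic_family_def by auto

lemma analytic_family_subset:
  assumes "analytic_family \<Xi> U \<Lambda> f" "\<Xi>' \<subseteq> \<Xi>" "U' \<subseteq> U"
  shows "analytic_family \<Xi>' U' \<Lambda> f"
proof -
  have "continuous_on (\<Xi>' \<times> U') (\<lambda>(\<xi>, z). f \<xi> z)"
    by (rule continuous_on_subset[of "\<Xi> \<times> U"]) (use assms in \<open>auto simp: analytic_family_def\<close>)
  then show ?thesis using assms unfolding analytic_family_def by (meson hol_subset subsetD)
qed

lemma analytic_family_cong:
  assumes "analytic_family \<Xi> U \<Lambda> f" "open U" "\<And>z v. z \<in> U \<Longrightarrow> v \<in> \<Lambda> \<Longrightarrow> z + v \<in> U"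
    "\<And>\<xi> z. \<xi> \<in> \<Xi> \<Longrightarrow> z \<in> U \<Longrightarrow> f \<xi> z = g \<xi> z"
  shows "analytic_family \<Xi> U \<Lambda> g"
proof -
  have "continuous_on (\<Xi> \<times> U) (\<lambda>(\<xi>, z). g \<xi> z) = continuous_on (\<Xi> \<times> U) (\<lambda>(\<xi>, z). f \<xi> z)"
    by (rule continuous_on_cong) (use assms(4) in auto)
  moreover have "hol (g \<xi>) U" if "\<xi> \<in> \<Xi>" for \<xi>
    using hol_cong[OF assms(2), of "f \<xi>" "g \<xi>"] assms that analytic_familyD(1) by blast
  ultimately show ?thesis
    using assms unfolding analytic_family_def by auto
qed

lemma analytic_family_const:
  assumes "continuous_on \<Xi> c" "\<And>\<xi>. \<xi> \<in> \<Xi> \<Longrightarrow> c \<xi> \<in> \<real>"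
  shows "analytic_family \<Xi> U \<Lambda> (\<lambda>\<xi> z. c \<xi>)"
  using assms unfolding analytic_family_def
  by (auto simp: case_prod_beta intro!: continuous_on_compose2[OF assms(1)] continuous_intros)

lemma analytic_family_add:
  assumes "analytic_family \<Xi> U \<Lambda> f" "analytic_family \<Xi> U \<Lambda> g"
  shows "analytic_family \<Xi> U \<Lambda> (\<lambda>\<xi> z. f \<xi> z + g \<xi> z)"
  using assms unfolding analytic_family_def
  by (auto simp: case_prod_beta intro!: hol_add continuous_intros)

lemma analytic_family_mult:
  assumes "analytic_family \<Xi> U \<Lambda> f" "analytic_family \<Xi> U \<Lambda> g"
  shows "analytic_family \<Xi> U \<Lambda> (\<lambda>\<xi> z. f \<xi> z * g \<xi> z)"
  using assms unfolding analytic_family_def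
  by (auto simp: case_prod_beta intro!: hol_mult continuous_intros)

lemma analytic_family_diff:
  assumes "analytic_family \<Xi> U \<Lambda> f" "analytic_family \<Xi> U \<Lambda> g"
  shows "analytic_family \<Xi> U \<Lambda> (\<lambda>\<xi> z. f \<xi> z - g \<xi> z)"
  using assms unfolding analytic_family_def
  by (auto simp: case_prod_beta intro!: hol_diff continuous_intros)

lemma analytic_family_sum:
  assumes "\<And>i. i \<in> I \<Longrightarrow> analytic_family \<Xi> U \<Lambda> (f i)"
  shows "analytic_family \<Xi> U \<Lambda> (\<lambda>\<xi> z. \<Sum>i\<in>I. f i \<xi> z)"
  using assms by (induction I rule: infinite_finite_induct)
    (auto intro: analytic_family_add analytic_family_const)

lemma analytic_family_prod:
  assumes "\<And>i. i \<in> I \<Longrightarrow> analytic_family \<Xi> U \<Lambda> (f i)"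
  shows "analytic_family \<Xi> U \<Lambda> (\<lambda>\<xi> z. \<Prod>i\<in>I. f i \<xi> z)"
  using assms by (induction I rule: infinite_finite_induct)
    (auto intro: analytic_family_mult analytic_family_const)

lemma analytic_family_divide:
  assumes "analytic_family \<Xi> U \<Lambda> f" "analytic_family \<Xi> U \<Lambda> g" "\<And>\<xi> z. \<xi> \<in> \<Xi> \<Longrightarrow> z \<in> U \<Longrightarrow> g \<xi> z \<noteq> 0"
  shows "analytic_family \<Xi> U \<Lambda> (\<lambda>\<xi> z. f \<xi> z / g \<xi> z)"
  using assms unfolding analytic_family_def divide_inverse
  by (auto simp: case_prod_beta intro!: hol_mult hol_inverse continuous_intros Reals_inverse)

lemma analytic_family_det:
  assumes "\<And>i j. analytic_family \<Xi> U \<Lambda> (\<lambda>\<xi> z. A \<xi> z $ i $ j)"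
  shows "analytic_family \<Xi> U \<Lambda> (\<lambda>\<xi> z. det (A \<xi> z))"
  unfolding det_def
  by (intro analytic_family_sum analytic_family_mult analytic_family_prod assms analytic_family_const) auto

lemma continuous_on_family_vec:
  fixes \<psi> :: "'p::topological_space \<Rightarrow> complex ^ 'm \<Rightarrow> complex ^ 'k"
  assumes "\<And>i. continuous_on (\<Xi> \<times> U) (\<lambda>(\<xi>, z). \<psi> \<xi> z $ i)"
  shows "continuous_on (\<Xi> \<times> U) (\<lambda>(\<xi>, z). \<psi> \<xi> z)"
proof -
  have "continuous_on (\<Xi> \<times> U) (\<lambda>x. \<chi> i. (\<lambda>(\<xi>, z). \<psi> \<xi> z $ i) x)"
    by (intro continuous_on_vec_lambda assms)
  then show ?thesis by (simp add: case_prod_beta)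
qed

lemma analytic_family_compose:
  fixes \<psi> :: "'p::topological_space \<Rightarrow> complex ^ 'm \<Rightarrow> complex ^ 'k"
  assumes f: "analytic_family \<Xi> V \<Lambda>' f"
    and \<psi>: "\<And>i. analytic_family \<Xi> U {} (\<lambda>\<xi> z. \<psi> \<xi> z $ i)"
    and maps: "\<And>\<xi> z. \<xi> \<in> \<Xi> \<Longrightarrow> z \<in> U \<Longrightarrow> \<psi> \<xi> z \<in> V"
    and per: "\<And>\<xi> z v. \<xi> \<in> \<Xi> \<Longrightarrow> z \<in> U \<Longrightarrow> v \<in> \<Lambda> \<Longrightarrow> \<exists>v'\<in>insert 0 \<Lambda>'. \<psi> \<xi> (z + v) = \<psi> \<xi> z + v'"
  shows "analytic_family \<Xi> U \<Lambda> (\<lambda>\<xi> z. f \<xi> (\<psi> \<xi> z))"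
proof -
  have "continuous_on (\<Xi> \<times> U) (\<lambda>x. (\<lambda>(\<xi>, z). f \<xi> z) (fst x, (\<lambda>(\<xi>, z). \<psi> \<xi> z) x))"
    by (rule continuous_on_compose2[OF analytic_familyD(4)[OF f]])
      (auto intro!: continuous_intros continuous_on_family_vec analytic_familyD(4)[OF \<psi>] maps)
  moreover have "f \<xi> (\<psi> \<xi> (complexify x)) \<in> \<real>" if "\<xi> \<in> \<Xi>" "complexify x \<in> U" for \<xi> x
  proof -
    have "\<psi> \<xi> (complexify x) = complexify (\<chi> i. Re (\<psi> \<xi> (complexify x) $ i))"
      using analytic_familyD(3)[OF \<psi> that] by (auto simp: vec_eq_iff)
    then show ?thesis using analytic_familyD(3)[OF f that(1)] maps[OF that] by metis
  qed
  moreover have "f \<xi> (\<psi> \<xi> (z + v)) = f \<xi> (\<psi> \<xi> z)" if "\<xi> \<in> \<Xi>" "z \<in> U" "v \<in> \<Lambda>" for \<xi> z v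
    using per[OF that] analytic_familyD(2)[OF f that(1) maps[OF that(1,2)]] by auto
  moreover have "hol (\<lambda>z. f \<xi> (\<psi> \<xi> z)) U" if "\<xi> \<in> \<Xi>" for \<xi>
    using analytic_familyD(1)[OF f that] analytic_familyD(1)[OF \<psi> that] maps[OF that] by (rule hol_compose)
  ultimately show ?thesis unfolding analytic_family_def by (auto simp: case_prod_beta)
qed

lemma analytic_family_uniform_limit:
  fixes f :: "'i \<Rightarrow> 'p::topological_space \<Rightarrow> complex ^ 'm \<Rightarrow> complex"
  assumes f: "\<forall>\<^sub>F n in F. analytic_family \<Xi> U \<Lambda> (f n)" and U: "open U" and F: "F \<noteq> bot"
    and per: "\<And>z v. z \<in> U \<Longrightarrow> v \<in> \<Lambda> \<Longrightarrow> z + v \<in> U"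
    and lim: "uniform_limit (\<Xi> \<times> U) (\<lambda>n (\<xi>, z). f n \<xi> z) (\<lambda>(\<xi>, z). g \<xi> z) F"
  shows "analytic_family \<Xi> U \<Lambda> g"
proof -
  have pt: "((\<lambda>n. f n \<xi> z) \<longlongrightarrow> g \<xi> z) F" if "\<xi> \<in> \<Xi>" "z \<in> U" for \<xi> z
    using tendsto_uniform_limitI[OF lim, of "(\<xi>, z)"] that by simp
  have "continuous_on (\<Xi> \<times> U) (\<lambda>(\<xi>, z). g \<xi> z)"
    by (rule uniform_limit_theorem[OF eventually_mono[OF f analytic_familyD(4)] lim F])
  moreover have "hol (g \<xi>) U" if \<xi>: "\<xi> \<in> \<Xi>" for \<xi>
  proof (rule hol_uniform_limit(1)[OF eventually_mono[OF f] U _ F])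
    show "analytic_family \<Xi> U \<Lambda> (f n) \<Longrightarrow> hol (f n \<xi>) U" for n using analytic_familyD(1) \<xi> by blast
    show "uniform_limit U (\<lambda>n. f n \<xi>) (g \<xi>) F"
    proof (rule uniform_limitI)
      fix e :: real assume "e > 0"
      from uniform_limitD[OF lim this] show "\<forall>\<^sub>F n in F. \<forall>x\<in>U. dist (f n \<xi> x) (g \<xi> x) < e"
        by eventually_elim (use \<xi> in auto)
    qed
  qed
  moreover have "g \<xi> (z + v) = g \<xi> z" if "\<xi> \<in> \<Xi>" "z \<in> U" "v \<in> \<Lambda>" for \<xi> z v
  proof -
    have "((\<lambda>n. f n \<xi> (z + v)) \<longlongrightarrow> g \<xi> z) F"
      by (rule Lim_transform_eventually[OF pt[OF that(1,2)] eventually_mono[OF f]])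
        (use that analytic_familyD(2) in metis)
    then show ?thesis using tendsto_unique[OF F pt[OF that(1) per[OF that(2,3)]]] by blast
  qed
  moreover have "g \<xi> (complexify x) \<in> \<real>" if "\<xi> \<in> \<Xi>" "complexify x \<in> U" for \<xi> x
    by (rule Lim_in_closed_set[OF closed_complex_Reals eventually_mono[OF f] F pt[OF that]])
      (use that analytic_familyD(3) in metis)
  ultimately show ?thesis unfolding analytic_family_def by auto
qed

lemma uniform_limitI_bound:
  assumes "\<And>n x. x \<in> X \<Longrightarrow> norm (f n x - g x) \<le> K / real (Suc n)"
  shows "uniform_limit X f g sequentially"
proof (rule uniform_limitI)
  fix e :: real assume "e > 0"
  have "(\<lambda>n. K / real (Suc n)) \<longlonglongrightarrow> 0"
    unfolding divide_inverse[of _ "real (Suc _)"]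
    by (rule tendsto_mult_right_zero[OF LIMSEQ_inverse_real_of_nat])
  then have "\<forall>\<^sub>F n in sequentially. K / real (Suc n) < e"
    using \<open>e > 0\<close> by (rule order_tendstoD)
  then show "\<forall>\<^sub>F n in sequentially. \<forall>x\<in>X. dist (f n x) (g x) < e"
  proof eventually_elim
    case (elim n)
    then show ?case using order_le_less_trans[OF assms] unfolding dist_norm by blast
  qed
qed

text \<open>Joint continuity of the derivative comes from uniform convergence of difference
  quotients, which is where the bound \<open>B\<close> common to all parameters enters. The
  direction is real so that the quotients are real at real points.\<close>

lemma analytic_family_dd:
  fixes f :: "'p::topological_space \<Rightarrow> complex ^ 'm \<Rightarrow> complex"
  assumes f: "analytic_family \<Xi> U \<Lambda> f" and B: "\<And>\<xi> z. \<xi> \<in> \<Xi> \<Longrightarrow> z \<in> U \<Longrightarrow> norm (f \<xi> z) \<le> B"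
    and U': "open U'" and \<rho>: "\<rho> > 0" "\<And>z. z \<in> U' \<Longrightarrow> ball z \<rho> \<subseteq> U"
    and per: "\<And>z v. z \<in> U' \<Longrightarrow> v \<in> \<Lambda> \<Longrightarrow> z + v \<in> U'"
  shows "analytic_family \<Xi> U' \<Lambda> (\<lambda>\<xi>. dd (f \<xi>) (complexify h))"
proof -
  define \<kappa> where "\<kappa> = \<rho> / (4 * (norm h + 1))"
  have h1: "norm h + 1 > 0" by (simp add: add_pos_pos add_nonneg_pos)
  have \<kappa>: "\<kappa> > 0" using \<rho> h1 by (simp add: \<kappa>_def)
  define v where "v = complexify (\<kappa> *\<^sub>R h)"
  have "norm v = \<rho> / 4 * (norm h / (norm h + 1))"
    using \<kappa> by (simp add: v_def) (simp add: \<kappa>_def)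
  also have "\<dots> < \<rho> / 4 * 1" by (rule mult_strict_left_mono) (use \<rho> h1 in auto)
  finally have v: "norm v < \<rho> / 2" using \<rho> by simp
  define q where "q = (\<lambda>n \<xi> z. (f \<xi> (z + complexify ((1 / real (Suc n)) *\<^sub>R \<kappa> *\<^sub>R h)) - f \<xi> z) * of_nat (Suc n))"
  have shift: "z + complexify ((1 / real (Suc n)) *\<^sub>R \<kappa> *\<^sub>R h) \<in> U" if "z \<in> U'" for z n
  proof -
    have "norm ((1 / real (Suc n)) *\<^sub>R \<kappa> *\<^sub>R h) = norm v / real (Suc n)" by (simp add: v_def)
    also have "\<dots> \<le> norm v" by (simp add: divide_le_eq mult_le_cancel_left1)
    finally have "norm (complexify ((1 / real (Suc n)) *\<^sub>R \<kappa> *\<^sub>R h)) < \<rho>" using v \<rho> unfolding norm_complexify by linarith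
    then have "z + complexify ((1 / real (Suc n)) *\<^sub>R \<kappa> *\<^sub>R h) \<in> ball z \<rho>" by (simp add: dist_norm)
    then show ?thesis using \<rho>(2)[OF that] by blast
  qed
  have sub: "U' \<subseteq> U" using \<rho> by (meson centre_in_ball subsetD subsetI)
  have "analytic_family \<Xi> U' \<Lambda> (\<lambda>\<xi>. dd (f \<xi>) v)"
  proof (rule analytic_family_uniform_limit[OF always_eventually U' sequentially_bot per])
    have "analytic_family \<Xi> U' \<Lambda> (\<lambda>\<xi> z. f \<xi> (z + complexify ((1 / real (Suc n)) *\<^sub>R \<kappa> *\<^sub>R h)))" for n
    proof (rule analytic_family_compose[OF f])
      show "analytic_family \<Xi> U' {} (\<lambda>\<xi> z. (z + complexify ((1 / real (Suc n)) *\<^sub>R \<kappa> *\<^sub>R h)) $ i)" for i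
        unfolding analytic_family_def by (auto simp: case_prod_beta intro!: hol_add continuous_intros)
    qed (use shift in auto)
    then show "\<forall>n. analytic_family \<Xi> U' \<Lambda> (q n)"
      unfolding q_def
      by (intro allI analytic_family_mult analytic_family_diff analytic_family_subset[OF f] sub analytic_family_const) auto
    show "uniform_limit (\<Xi> \<times> U') (\<lambda>n (\<xi>, z). q n \<xi> z) (\<lambda>(\<xi>, z). dd (f \<xi>) v z) sequentially"
    proof (rule uniform_limitI_bound[where K="8 * B * (norm v)\<^sup>2 / \<rho>\<^sup>2"], clarsimp simp del: of_nat_Suc)
      fix n \<xi> z assume a: "\<xi> \<in> \<Xi>" "z \<in> U'"
      have "norm ((f \<xi> (z + of_real (1 / real (Suc n)) *s v) - f \<xi> z) * of_nat (Suc n) - dd (f \<xi>) v z)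
          \<le> 8 * B * (norm v)\<^sup>2 / \<rho>\<^sup>2 / real (Suc n)"
        by (rule hol_difference_quotient[OF hol_subset[OF analytic_familyD(1)[OF f a(1)] \<rho>(2)[OF a(2)]] B[OF a(1)] v])
          (use \<rho>(2)[OF a(2)] in auto)
      then show "norm (q n \<xi> z - dd (f \<xi>) v z) \<le> 8 * B * (norm v)\<^sup>2 / (\<rho>\<^sup>2 * real (Suc n))"
        unfolding q_def v_def complexify_scaleR[of "1 / real (Suc n)"] by (simp del: of_nat_Suc)
    qed
  qed
  then have "analytic_family \<Xi> U' \<Lambda> (\<lambda>\<xi> z. of_real (1/\<kappa>) * dd (f \<xi>) v z)"
    by (intro analytic_family_mult analytic_family_const) auto
  then show ?thesis
  proof (rule analytic_family_cong[OF _ U' per])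
    fix \<xi> z assume a: "\<xi> \<in> \<Xi>" "z \<in> U'"
    then have "z \<in> U" using sub by blast
    from hol_dd_smult[OF analytic_familyD(1)[OF f a(1)] this, of "of_real \<kappa>" "complexify h"]
    show "of_real (1/\<kappa>) * dd (f \<xi>) v z = dd (f \<xi>) (complexify h) z"
      using \<kappa> unfolding v_def complexify_scaleR by simp
  qed auto
qed

section \<open>Strips around the real space, Cauchy estimates and linear systems on them\<close>

definition strip :: "real \<Rightarrow> (complex ^ 'm) set" where
  "strip r = {z. \<forall>i. \<bar>Im (z $ i)\<bar> < r}"

lemma open_strip: "open (strip r :: (complex ^ 'm) set)"
proof -
  have "(strip r :: (complex ^ 'm) set) = (\<Inter>i. {z. \<bar>Im (z $ i)\<bar> < r})" by (auto simp: strip_def)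
  moreover have "open {z :: complex ^ 'm. \<bar>Im (z $ i)\<bar> < r}" for i
    by (intro open_Collect_less continuous_intros)
  ultimately show ?thesis by (simp add: open_INT)
qed

lemma convex_strip: "convex (strip r :: (complex ^ 'm) set)"
proof (rule convexI)
  fix x y :: "complex ^ 'm" and u v :: real
  assume a: "x \<in> strip r" "y \<in> strip r" "0 \<le> u" "0 \<le> v" "u + v = 1"
  have "\<bar>u * Im (x $ i) + v * Im (y $ i)\<bar> < r" for i
  proof -
    have "\<bar>u * Im (x $ i) + v * Im (y $ i)\<bar> \<le> u * \<bar>Im (x $ i)\<bar> + v * \<bar>Im (y $ i)\<bar>"
      using a by (simp add: abs_mult order_trans[OF abs_triangle_ineq])
    also have "\<dots> < r" using a by (intro convex_bound_lt) (auto simp: strip_def)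
    finally show ?thesis .
  qed
  then show "u *\<^sub>R x + v *\<^sub>R y \<in> strip r" by (simp add: strip_def)
qed

lemma strip_mono: "r \<le> s \<Longrightarrow> strip r \<subseteq> strip s"
  unfolding strip_def by (auto intro: less_le_trans)

lemma strip_add:
  assumes "z \<in> strip (r - d)" "\<And>i. norm (w $ i) \<le> d"
  shows "z + w \<in> strip r"
  unfolding strip_def
proof (clarsimp)
  fix i show "\<bar>Im (z $ i) + Im (w $ i)\<bar> < r"
    using assms(1)[unfolded strip_def mem_Collect_eq, rule_format, of i] assms(2)[of i] abs_Im_le_cmod[of "w $ i"]
    by linarith
qed

lemma strip_ball: "z \<in> strip (r - d) \<Longrightarrow> ball z d \<subseteq> strip r"
proof
  fix x assume z: "z \<in> strip (r - d)" and "x \<in> ball z d"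
  then have "norm (x - z) < d" by (simp add: dist_norm norm_minus_commute)
  then have "norm ((x - z) $ i) \<le> d" for i
    using Finite_Cartesian_Product.norm_nth_le[of "x - z" i] by linarith
  from strip_add[OF z this] have "z + (x - z) \<in> strip r" .
  then show "x \<in> strip r" by simp
qed

lemma complexify_in_strip [simp]: "complexify x \<in> strip r \<longleftrightarrow> r > 0"
  by (simp add: strip_def)

definition periods :: "(complex ^ 'm) set" where
  "periods = range (\<lambda>i. axis i (2 * of_real pi))"

lemma strip_periods: "z \<in> strip r \<Longrightarrow> v \<in> periods \<Longrightarrow> z + v \<in> strip r"
  by (auto simp: strip_def periods_def axis_def)

lemma ball_Cauchy:
  fixes f :: "complex ^ 'm \<Rightarrow> complex"
  assumes f: "hol f U" and B: "\<And>z. z \<in> U \<Longrightarrow> norm (f z) \<le> B"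
    and z: "ball z d \<subseteq> U" and d: "d > 0"
  shows "norm (dd f h z) \<le> 2 * B / d * norm h"
proof (cases "h = 0")
  case True
  then show ?thesis by (simp add: dd_def)
next
  case False
  have *: "z + t *s h \<in> U" if "norm t * norm h < d" for t
    using z line_in_ball[OF that] by blast
  have "norm (dd f h z) \<le> B / (d / norm h / 2)"
    by (rule line_Cauchy[where R="d / norm h"])
      (use False d in \<open>auto intro!: hol_line_holomorphic[OF f] * B simp: field_simps norm_mult\<close>)
  then show ?thesis using False by (simp add: field_simps)
qed

lemma strip_Cauchy:
  assumes f: "hol f (strip r)" and B: "\<And>z. z \<in> strip r \<Longrightarrow> norm (f z) \<le> B"
    and z: "z \<in> strip (r - d)" and d: "d > 0"
  shows "norm (dd f h z) \<le> 2 * B / d * norm h"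
  by (rule ball_Cauchy[OF f B strip_ball[OF z] d])

lemma strip_Lipschitz:
  fixes f :: "complex ^ 'm \<Rightarrow> complex"
  assumes f: "hol f (strip r)" and B: "\<And>z. z \<in> strip r \<Longrightarrow> norm (f z) \<le> B"
    and z: "z \<in> strip (r - d)" "w \<in> strip (r - d)" and d: "d > 0"
  shows "norm (f w - f z) \<le> 2 * B / d * norm (w - z)"
proof (rule differentiable_bound[OF convex_strip _ _ z(2,1)])
  fix x :: "complex ^ 'm" assume x: "x \<in> strip (r - d)"
  then have "x \<in> strip r" using strip_mono[of "r - d" r] d by auto
  then show "(f has_derivative (\<lambda>h. dd f h x)) (at x within strip (r - d))"
    using hol_has_derivative[OF f] has_derivative_at_withinI by blast
  show "onorm (\<lambda>h. dd f h x) \<le> 2 * B / d"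
    by (rule onorm_le) (use strip_Cauchy[OF f B x d] in auto)
qed

text \<open>The matrix \<open>E\<close> has operator norm at most \<open>n^2 * q\<close>, hence at
  most one half, and \<open>x\<close> is the difference of the image of \<open>x\<close> and
  \<open>E x\<close>. The bound gives injectivity and the size of the inverse at once.\<close>

lemma near_identity_bound:
  fixes E :: "'n::finite \<Rightarrow> 'n \<Rightarrow> complex"
  assumes E: "\<And>i j. norm (E i j) \<le> q" and q: "(real CARD('n))\<^sup>2 * q \<le> 1/2"
  shows "norm x \<le> 2 * norm (\<chi> i. x $ i + (\<Sum>j\<in>UNIV. E i j * x $ j))"
proof -
  define v1 :: "complex ^ 'n" where "v1 = (\<chi> i. x $ i + (\<Sum>j\<in>UNIV. E i j * x $ j))"
  define v2 :: "complex ^ 'n" where "v2 = (\<chi> i. \<Sum>j\<in>UNIV. E i j * x $ j)"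
  have q0: "0 \<le> q" by (rule order_trans[OF norm_ge_zero E])
  have "norm v2 \<le> real CARD('n) * (real CARD('n) * (q * norm x))"
  proof (rule norm_vec_le_card)
    fix i
    have "norm (E i j * x $ j) \<le> q * norm x" for j
      unfolding norm_mult by (rule mult_mono[OF E Finite_Cartesian_Product.norm_nth_le q0]) simp
    then have "norm (\<Sum>j\<in>UNIV. E i j * x $ j) \<le> (\<Sum>j\<in>(UNIV::'n set). q * norm x)"
      by (intro sum_norm_le)
    then show "norm (v2 $ i) \<le> real CARD('n) * (q * norm x)" by (simp add: v2_def)
  qed
  also have "\<dots> = ((real CARD('n))\<^sup>2 * q) * norm x" by (simp add: power2_eq_square)
  also have "\<dots> \<le> 1/2 * norm x" using q by (rule mult_right_mono) simp
  finally have "norm v2 \<le> 1/2 * norm x" .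
  moreover have "x = v1 - v2"
    by (simp add: vec_eq_iff v1_def v2_def)
  then have "norm x \<le> norm v1 + norm v2"
    using norm_triangle_ineq4[of v1 v2] by simp
  ultimately show ?thesis unfolding v1_def[symmetric] by linarith
qed

text \<open>Cramer's rule expresses the solution by determinants and one division, so it is again an
  analytic family; its size comes separately from \<open>near_identity_bound\<close>.\<close>

lemma analytic_family_solve:
  fixes E :: "'n::finite \<Rightarrow> 'n \<Rightarrow> 'p::topological_space \<Rightarrow> complex ^ 'm \<Rightarrow> complex"
  assumes U: "open U" "\<And>z v. z \<in> U \<Longrightarrow> v \<in> \<Lambda> \<Longrightarrow> z + v \<in> U"
    and E: "\<And>i j. analytic_family \<Xi> U \<Lambda> (E i j)"
    and b: "\<And>i. analytic_family \<Xi> U \<Lambda> (b i)"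
    and q: "\<And>i j \<xi> z. \<xi> \<in> \<Xi> \<Longrightarrow> z \<in> U \<Longrightarrow> norm (E i j \<xi> z) \<le> q" "(real CARD('n))\<^sup>2 * q \<le> 1/2"
  obtains x :: "'p \<Rightarrow> complex ^ 'm \<Rightarrow> complex ^ 'n" where
    "\<And>i. analytic_family \<Xi> U \<Lambda> (\<lambda>\<xi> z. x \<xi> z $ i)"
    "\<And>\<xi> z i. \<xi> \<in> \<Xi> \<Longrightarrow> z \<in> U \<Longrightarrow> x \<xi> z $ i + (\<Sum>j\<in>UNIV. E i j \<xi> z * x \<xi> z $ j) = b i \<xi> z"
    "\<And>\<xi> z. \<xi> \<in> \<Xi> \<Longrightarrow> z \<in> U \<Longrightarrow> norm (x \<xi> z) \<le> 2 * norm (\<chi> i. b i \<xi> z)"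
proof -
  define A :: "'p \<Rightarrow> complex ^ 'm \<Rightarrow> complex ^ 'n ^ 'n" where "A = (\<lambda>\<xi> z. \<chi> i j. (if i = j then 1 else 0) + E i j \<xi> z)"
  define x :: "'p \<Rightarrow> complex ^ 'm \<Rightarrow> complex ^ 'n" where
    "x = (\<lambda>\<xi> z. \<chi> k. det (\<chi> i j. if j = k then b i \<xi> z else A \<xi> z $ i $ j) / det (A \<xi> z))"
  have Av: "(A \<xi> z *v y) $ i = y $ i + (\<Sum>j\<in>UNIV. E i j \<xi> z * y $ j)" for \<xi> z y i
  proof -
    have "(A \<xi> z *v y) $ i = (\<Sum>j\<in>UNIV. (if i = j then y $ j else 0) + E i j \<xi> z * y $ j)"
      unfolding matrix_vector_mult_def A_def by (auto simp: algebra_simps intro!: sum.cong)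
    then show ?thesis by (simp add: sum.distrib)
  qed
  have bd: "norm y \<le> 2 * norm (A \<xi> z *v y)" if "\<xi> \<in> \<Xi>" "z \<in> U" for \<xi> z y
  proof -
    have "A \<xi> z *v y = (\<chi> i. y $ i + (\<Sum>j\<in>UNIV. E i j \<xi> z * y $ j))" using Av by (simp add: vec_eq_iff)
    then show ?thesis using near_identity_bound[of "\<lambda>i j. E i j \<xi> z" q y] q that by simp
  qed
  have det: "det (A \<xi> z) \<noteq> 0" if "\<xi> \<in> \<Xi>" "z \<in> U" for \<xi> z
  proof -
    have "\<forall>y. A \<xi> z *v y = 0 \<longrightarrow> y = 0" using bd[OF that] by (metis mult_zero_right norm_le_zero_iff norm_zero)
    then have "invertible (A \<xi> z)"
      unfolding invertible_left_inverse using matrix_left_invertible_ker by blast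
    then show ?thesis using invertible_det_nz by blast
  qed
  have sol: "A \<xi> z *v x \<xi> z = (\<chi> i. b i \<xi> z)" if "\<xi> \<in> \<Xi>" "z \<in> U" for \<xi> z
  proof -
    have "x \<xi> z = (\<chi> k. det (\<chi> i j. if j = k then (\<chi> i. b i \<xi> z) $ i else A \<xi> z $ i $ j) / det (A \<xi> z))"
      by (simp only: x_def vec_lambda_beta)
    then show ?thesis using cramer[OF det[OF that], of "x \<xi> z" "\<chi> i. b i \<xi> z"] by blast
  qed
  have famA: "analytic_family \<Xi> U \<Lambda> (\<lambda>\<xi> z. A \<xi> z $ i $ j)" for i j
    unfolding A_def vec_lambda_beta by (intro analytic_family_add E analytic_family_const) auto
  show ?thesis
  proof (rule that[of x])
    fix i
    have "analytic_family \<Xi> U \<Lambda> (\<lambda>\<xi> z. det (\<chi> k j. if j = i then b k \<xi> z else A \<xi> z $ k $ j))"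
    proof (rule analytic_family_det)
      fix k j
      show "analytic_family \<Xi> U \<Lambda> (\<lambda>\<xi> z. (\<chi> k j. if j = i then b k \<xi> z else A \<xi> z $ k $ j) $ k $ j)"
        by (cases "j = i") (auto simp: b famA)
    qed
    then show "analytic_family \<Xi> U \<Lambda> (\<lambda>\<xi> z. x \<xi> z $ i)"
      unfolding x_def using analytic_family_divide[OF _ analytic_family_det[OF famA] det] by simp
  next
    fix \<xi> z i assume a: "\<xi> \<in> \<Xi>" "z \<in> U"
    show "x \<xi> z $ i + (\<Sum>j\<in>UNIV. E i j \<xi> z * x \<xi> z $ j) = b i \<xi> z"
      using sol[OF a] Av[of \<xi> z "x \<xi> z" i] by simp
  next
    fix \<xi> z assume a: "\<xi> \<in> \<Xi>" "z \<in> U"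
    show "norm (x \<xi> z) \<le> 2 * norm (\<chi> i. b i \<xi> z)" using bd[OF a, of "x \<xi> z"] sol[OF a] by simp
  qed
qed

section \<open>Fourier series on a strip\<close>

definition fcoef :: "int \<Rightarrow> (complex \<Rightarrow> complex) \<Rightarrow> complex" where
  "fcoef m \<phi> = integral {0..2 * pi} (\<lambda>t. \<phi> (of_real t) * exp (- (\<i> * of_int m * of_real t))) / of_real (2 * pi)"

definition hstrip :: "real \<Rightarrow> real \<Rightarrow> complex set" where
  "hstrip \<alpha> \<beta> = {t. \<alpha> < Im t \<and> Im t < \<beta>}"

lemma open_hstrip: "open (hstrip \<alpha> \<beta>)"
  unfolding hstrip_def by (intro open_Collect_conj open_Collect_less continuous_intros)

lemma convex_hstrip: "convex (hstrip \<alpha> \<beta>)"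
proof -
  have "hstrip \<alpha> \<beta> = {t. Im t > \<alpha>} \<inter> {t. Im t < \<beta>}" by (auto simp: hstrip_def)
  then show ?thesis by (simp add: convex_Int convex_halfspace_Im_gt convex_halfspace_Im_lt)
qed

lemma hstrip_add_real [simp]: "of_real t + a \<in> hstrip \<alpha> \<beta> \<longleftrightarrow> a \<in> hstrip \<alpha> \<beta>"
  "a + of_real t \<in> hstrip \<alpha> \<beta> \<longleftrightarrow> a \<in> hstrip \<alpha> \<beta>"
  by (auto simp: hstrip_def)

lemma hstrip_real [simp]: "of_real t \<in> hstrip \<alpha> \<beta> \<longleftrightarrow> \<alpha> < 0 \<and> 0 < \<beta>"
  by (auto simp: hstrip_def)

lemma continuous_on_real_line:
  assumes "continuous_on (hstrip \<alpha> \<beta>) \<phi>" "a \<in> hstrip \<alpha> \<beta>"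
  shows "continuous_on S (\<lambda>t. \<phi> (of_real t + a))"
  by (rule continuous_on_compose2[OF assms(1)]) (use assms(2) in \<open>auto intro!: continuous_intros\<close>)

text \<open>The derivative of the integral with respect to \<open>a\<close> is the integral of
  \<open>deriv G\<close> over one period, which vanishes by periodicity; this replaces a contour
  argument.\<close>

lemma integral_periodic_shift:
  assumes G: "G holomorphic_on hstrip \<alpha> \<beta>" and per: "\<And>t. t \<in> hstrip \<alpha> \<beta> \<Longrightarrow> G (t + of_real (2 * pi)) = G t"
    and ab: "a \<in> hstrip \<alpha> \<beta>" "b \<in> hstrip \<alpha> \<beta>"
  shows "integral {0..2 * pi} (\<lambda>t. G (of_real t + a)) = integral {0..2 * pi} (\<lambda>t. G (of_real t + b))"
proof -
  let ?U = "hstrip \<alpha> \<beta>"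
  have contG: "continuous_on ?U G" using G by (rule holomorphic_on_imp_continuous_on)
  have contG': "continuous_on ?U (deriv G)"
    using holomorphic_deriv[OF G open_hstrip] by (rule holomorphic_on_imp_continuous_on)
  have der: "(G has_field_derivative deriv G x) (at x)" if "x \<in> ?U" for x
    using holomorphic_derivI[OF G open_hstrip that] .
  have "((\<lambda>a. integral (cbox 0 (2 * pi)) (\<lambda>t. G (of_real t + a))) has_field_derivative 0) (at x within ?U)"
    if x: "x \<in> ?U" for x
  proof -
    have "((\<lambda>a. integral (cbox 0 (2 * pi)) (\<lambda>t. G (of_real t + a))) has_field_derivative
        integral (cbox 0 (2 * pi)) (\<lambda>t. deriv G (of_real t + x))) (at x within ?U)"
    proof (rule leibniz_rule_field_derivative)
      fix y t assume "y \<in> ?U"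
      then have "(G has_field_derivative deriv G (of_real t + y)) (at (of_real t + y))" by (intro der) simp
      then show "((\<lambda>y. G (of_real t + y)) has_field_derivative deriv G (of_real t + y)) (at y within ?U)"
        using DERIV_shift[of G "deriv G (of_real t + y)" y "of_real t"]
        by (auto simp: add.commute intro: has_field_derivative_at_within)
    next
      fix y assume "y \<in> ?U"
      then show "(\<lambda>t. G (of_real t + y)) integrable_on cbox 0 (2 * pi)"
        by (intro integrable_continuous continuous_on_real_line[OF contG])
    next
      show "continuous_on (?U \<times> cbox 0 (2 * pi)) (\<lambda>(x, t). deriv G (of_real t + x))"
        unfolding case_prod_beta
        by (rule continuous_on_compose2[OF contG']) (auto intro!: continuous_intros)
    qed (use x convex_hstrip in auto)
    moreover have "((\<lambda>t. deriv G (of_real t + x)) has_integral (G (of_real (2 * pi) + x) - G (of_real 0 + x))) {0..2*pi}"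
    proof (rule fundamental_theorem_of_calculus)
      fix t :: real
      have "((\<lambda>s. G (s + x)) has_field_derivative deriv G (of_real t + x)) (at (of_real t))"
        using der[of "of_real t + x"] x DERIV_shift[of G "deriv G (of_real t + x)" "of_real t" x] by simp
      then show "((\<lambda>t. G (of_real t + x)) has_vector_derivative deriv G (of_real t + x)) (at t within {0..2*pi})"
        by (rule has_vector_derivative_real_field)
    qed simp
    moreover have "G (of_real (2 * pi) + x) - G (of_real 0 + x) = 0" using per[OF x] by (simp add: add.commute)
    ultimately show ?thesis by (simp add: integral_unique)
  qed
  from has_field_derivative_zero_constant[OF convex_hstrip this]
  show ?thesis using ab by auto
qed

lemma exp_two_pi_int: "exp (\<i> * of_int m * of_real (2 * pi)) = 1"
  unfolding exp_eq_1 by (auto intro!: exI[of _ m])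

lemma fcoef_shift:
  assumes \<phi>: "\<phi> holomorphic_on hstrip \<alpha> \<beta>" and per: "\<And>t. t \<in> hstrip \<alpha> \<beta> \<Longrightarrow> \<phi> (t + of_real (2 * pi)) = \<phi> t"
    and a: "a \<in> hstrip \<alpha> \<beta>" "0 \<in> hstrip \<alpha> \<beta>"
  shows "fcoef m (\<lambda>t. \<phi> (t + a)) = exp (\<i> * of_int m * a) * fcoef m \<phi>"
proof -
  define G where "G = (\<lambda>s. \<phi> s * exp (- (\<i> * of_int m * s)))"
  have "integral {0..2 * pi} (\<lambda>t. G (of_real t + a)) = integral {0..2 * pi} (\<lambda>t. G (of_real t + 0))"
  proof (rule integral_periodic_shift[OF _ _ a])
    show "G holomorphic_on hstrip \<alpha> \<beta>" unfolding G_def by (intro holomorphic_intros \<phi>)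
    show "G (t + of_real (2 * pi)) = G t" if "t \<in> hstrip \<alpha> \<beta>" for t
    proof -
      have "- (\<i> * of_int m * (t + of_real (2 * pi))) = - (\<i> * of_int m * t) - \<i> * of_int m * of_real (2 * pi)"
        by (simp add: algebra_simps)
      then show ?thesis unfolding G_def per[OF that] by (simp only: exp_diff exp_two_pi_int) simp
    qed
  qed
  moreover have eq: "\<phi> (of_real t + a) * exp (- (\<i> * of_int m * of_real t)) = exp (\<i> * of_int m * a) * G (of_real t + a)" for t
    unfolding G_def by (simp add: algebra_simps exp_add[symmetric] flip: exp_add)
  have "fcoef m (\<lambda>t. \<phi> (t + a)) = exp (\<i> * of_int m * a) * integral {0..2 * pi} (\<lambda>t. G (of_real t + a)) / of_real (2 * pi)"
    unfolding fcoef_def eq by simp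
  moreover have "fcoef m \<phi> = integral {0..2 * pi} (\<lambda>t. G (of_real t + 0)) / of_real (2 * pi)"
    by (simp add: fcoef_def G_def)
  ultimately show ?thesis by simp
qed

lemma fcoef_bound:
  assumes "continuous_on UNIV (\<lambda>t::real. \<phi> (of_real t))" "\<And>t::real. norm (\<phi> (of_real t)) \<le> B"
  shows "norm (fcoef m \<phi>) \<le> B"
proof -
  have "norm (integral {0..2 * pi} (\<lambda>t. \<phi> (of_real t) * exp (- (\<i> * of_int m * of_real t)))) \<le> B * (2 * pi - 0)"
    by (rule integral_bound)
      (auto simp: norm_mult assms(2) intro!: continuous_intros continuous_on_subset[OF assms(1)])
  then show ?thesis by (simp add: fcoef_def norm_divide divide_le_eq)
qed

lemma fcoef_decay:
  assumes \<phi>: "\<phi> holomorphic_on hstrip (-\<rho>) \<rho>" and per: "\<And>t. t \<in> hstrip (-\<rho>) \<rho> \<Longrightarrow> \<phi> (t + of_real (2 * pi)) = \<phi> t"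
    and s: "0 < s" "s < \<rho>" and B: "\<And>t. \<bar>Im t\<bar> = s \<Longrightarrow> norm (\<phi> t) \<le> B"
  shows "norm (fcoef m \<phi>) \<le> B * exp (- s * real_of_int \<bar>m\<bar>)"
proof -
  \<comment> \<open>An imaginary shift directed against the sign of \<open>m\<close>, so that
    \<open>\<i> * m * a\<close> is the positive number \<open>s * \<bar>m\<bar>\<close> in either
    case.\<close>
  define a where "a = \<i> * of_real (if m \<ge> 0 then - s else s)"
  have a: "a \<in> hstrip (-\<rho>) \<rho>" "0 \<in> hstrip (-\<rho>) \<rho>" using s by (auto simp: a_def hstrip_def)
  have ex: "exp (\<i> * of_int m * a) = exp (of_real (s * real_of_int \<bar>m\<bar>))"
    by (rule arg_cong[where f=exp]) (auto simp: a_def algebra_simps)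
  have "norm (fcoef m (\<lambda>t. \<phi> (t + a))) \<le> B"
    by (rule fcoef_bound[OF continuous_on_real_line[OF holomorphic_on_imp_continuous_on[OF \<phi>] a(1)]])
      (auto intro!: B simp: a_def s order_less_imp_le)
  also have "norm (fcoef m (\<lambda>t. \<phi> (t + a))) = exp (s * real_of_int \<bar>m\<bar>) * norm (fcoef m \<phi>)"
  proof -
    have sh: "fcoef m (\<lambda>t. \<phi> (t + a)) = exp (\<i> * of_int m * a) * fcoef m \<phi>"
      by (rule fcoef_shift[OF \<phi> per a])
    show ?thesis unfolding sh ex norm_mult norm_exp_eq_Re by simp
  qed
  finally show ?thesis by (simp add: exp_minus field_simps)
qed

text \<open>With \<open>q = exp (- s)\<close> the sum is \<open>(1 + q) / (1 - q)\<close>. The bound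
  is of first order in \<open>1 / s\<close>, so that summing over all frequencies costs one power of
  the lost width per coordinate.\<close>

lemma has_sum_exp_int:
  fixes s :: real
  assumes s: "0 < s" "s \<le> 1"
  obtains W where "((\<lambda>m::int. exp (- s * real_of_int \<bar>m\<bar>)) has_sum W) UNIV" "1 \<le> W" "W \<le> 4 / s"
proof -
  define q where "q = exp (- s)"
  have q: "0 < q" "q < 1" using s by (auto simp: q_def)
  have eq: "exp (- s * real n) = q ^ n" for n by (simp add: q_def exp_of_nat_mult[symmetric] mult.commute)
  have nat: "((\<lambda>n::nat. q ^ n) has_sum 1 / (1 - q)) UNIV"
    using q by (intro norm_summable_imp_has_sum) (auto intro: geometric_sums simp: summable_geometric)
  have pos: "((\<lambda>m::int. exp (- s * real_of_int \<bar>m\<bar>)) has_sum 1 / (1 - q)) (range int)"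
    by (subst has_sum_reindex) (use nat eq in \<open>auto simp: o_def\<close>)
  have nat': "((\<lambda>n::nat. q * q ^ n) has_sum q * (1 / (1 - q))) UNIV" using nat by (rule has_sum_cmult_right)
  have neg: "((\<lambda>m::int. exp (- s * real_of_int \<bar>m\<bar>)) has_sum q * (1 / (1 - q))) (range (\<lambda>n. - int (Suc n)))"
  proof (subst has_sum_reindex)
    have "exp (- s * real_of_int \<bar>- int (Suc n)\<bar>) = q * q ^ n" for n using eq[of "Suc n"] by (simp add: add.commute)
    then show "((\<lambda>m::int. exp (- s * real_of_int \<bar>m\<bar>)) \<circ> (\<lambda>n. - int (Suc n)) has_sum q * (1 / (1 - q))) UNIV"
      using nat' by (simp add: o_def)
  qed (auto simp: inj_on_def)
  have un: "range int \<union> range (\<lambda>n. - int (Suc n)) = UNIV"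
  proof -
    have "m \<in> range int \<union> range (\<lambda>n. - int (Suc n))" for m
      by (cases m rule: int_cases) auto
    then show ?thesis by blast
  qed
  have "((\<lambda>m::int. exp (- s * real_of_int \<bar>m\<bar>)) has_sum (1 / (1 - q) + q * (1 / (1 - q)))) UNIV"
  proof -
    have "range int \<inter> range (\<lambda>n. - int (Suc n)) = {}" by auto
    from has_sum_Un_disjoint[OF pos neg this] show ?thesis by (simp only: un)
  qed
  moreover have "1 \<le> 1 / (1 - q) + q * (1 / (1 - q))" using q by (simp add: field_simps)
  moreover have "1 / (1 - q) + q * (1 / (1 - q)) \<le> 4 / s"
  proof -
    have "1 + s \<le> exp s" by (rule exp_ge_add_one_self)
    then have "q \<le> 1 / (1 + s)" using s unfolding q_def exp_minus by (simp add: field_simps)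
    moreover have "1 / (1 + s) \<le> 1 - s / 2"
    proof -
      have "s * s \<le> s" using s mult_left_le[of s s] by simp
      then have "1 \<le> (1 - s / 2) * (1 + s)" by (simp add: algebra_simps)
      then show ?thesis using s by (simp only: divide_le_eq) simp
    qed
    ultimately have "1 - q \<ge> s / 2" by simp
    then have "(1 + q) / (1 - q) \<le> 2 / (s / 2)" using q s by (intro frac_le) auto
    then show ?thesis by (simp add: add_divide_distrib)
  qed
  ultimately show ?thesis using that by blast
qed

text \<open>The zeros of \<open>exp (\<i> * t) - 1\<close> are the multiples of
  \<open>2 * pi\<close>. They are simple, with derivative \<open>\<i>\<close>, and by periodicity
  \<open>\<phi> t - \<phi> 0\<close> vanishes there too, so every singularity is removable.\<close>

lemma divided_difference_holomorphic:
  assumes \<phi>: "\<phi> holomorphic_on hstrip \<alpha> \<beta>" and per: "\<And>t. t \<in> hstrip \<alpha> \<beta> \<Longrightarrow> \<phi> (t + of_real (2 * pi)) = \<phi> t"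
    and 0: "0 \<in> hstrip \<alpha> \<beta>"
  shows "(\<lambda>t. if exp (\<i> * t) = 1 then deriv \<phi> t / \<i> else (\<phi> t - \<phi> 0) / (exp (\<i> * t) - 1)) holomorphic_on hstrip \<alpha> \<beta>"
    (is "?q holomorphic_on ?U")
proof -
  have per_int: "\<phi> (t + of_real (2 * pi * of_int k)) = \<phi> t" if t: "t \<in> ?U" for t k
  proof -
    have nat: "\<phi> (t + of_real (2 * pi * of_nat n)) = \<phi> t" if "t \<in> ?U" for t n
    proof (induction n)
      case (Suc n)
      have "\<phi> (t + of_real (2 * pi * of_nat (Suc n))) = \<phi> ((t + of_real (2 * pi * of_nat n)) + of_real (2 * pi))"
        by (simp add: algebra_simps)
      also have "\<dots> = \<phi> t"
        using per[of "t + of_real (2 * pi * of_nat n)"] Suc that by (simp only: hstrip_add_real)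
      finally show ?case .
    qed simp
    show ?thesis
    proof (cases k rule: int_cases2)
      case (nonneg n) then show ?thesis using nat[OF t, of n] by simp
    next
      case (nonpos n)
      have "t + of_real (2 * pi * of_int k) \<in> ?U" using t by (simp only: hstrip_add_real)
      from nat[OF this, of n] nonpos show ?thesis by simp
    qed
  qed
  have "?q field_differentiable (at t0)" if t0: "t0 \<in> ?U" for t0
  proof (cases "exp (\<i> * t0) = 1")
    case False
    define V where "V = ?U \<inter> {t. exp (\<i> * t) \<noteq> 1}"
    have "open V" unfolding V_def
      by (intro open_Int open_hstrip open_Collect_neq continuous_intros)
    moreover have "(\<lambda>t. (\<phi> t - \<phi> 0) / (exp (\<i> * t) - 1)) holomorphic_on V"
      unfolding V_def by (intro holomorphic_intros holomorphic_on_subset[OF \<phi>]) auto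
    then have "?q holomorphic_on V" by (rule holomorphic_transform) (auto simp: V_def)
    moreover have "t0 \<in> V" using t0 False by (simp add: V_def)
    ultimately show ?thesis using holomorphic_on_imp_differentiable_at by blast
  next
    case True
    then obtain k where "\<i> * t0 = of_int (2 * k) * pi * \<i>"
      unfolding exp_eq_1 by (auto simp: complex_eq_iff)
    then have k: "t0 = of_real (2 * pi * of_int k)" by (simp add: complex_eq_iff)
    have \<phi>t0: "\<phi> t0 = \<phi> 0" using per_int[OF 0, of k] k by simp
    define A where "A = (\<lambda>z. if z = t0 then deriv \<phi> t0 else (\<phi> z - \<phi> t0) / (z - t0))"
    define E where "E = (\<lambda>z. if z = t0 then deriv (\<lambda>t. exp (\<i> * t)) t0 else (exp (\<i> * z) - exp (\<i> * t0)) / (z - t0))"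
    have A: "A holomorphic_on ?U" unfolding A_def by (rule pole_lemma_open[OF \<phi> open_hstrip])
    have E: "E holomorphic_on UNIV" unfolding E_def by (rule pole_lemma_open) (auto intro!: holomorphic_intros)
    have "deriv (\<lambda>t. exp (\<i> * t)) t0 = \<i> * exp (\<i> * t0)"
      by (rule DERIV_imp_deriv) (auto intro!: derivative_eq_intros)
    then have Et0: "E t0 = \<i>" using True by (simp add: E_def)
    define V where "V = ?U \<inter> {t. E t \<noteq> 0}"
    have "open V" unfolding V_def
      by (intro open_Int open_hstrip open_Collect_neq continuous_intros holomorphic_on_imp_continuous_on[OF E])
    moreover have "t0 \<in> V" using t0 Et0 by (simp add: V_def)
    moreover have "(\<lambda>z. A z / E z) holomorphic_on V"
      unfolding V_def by (intro holomorphic_intros holomorphic_on_subset[OF A] holomorphic_on_subset[OF E]) auto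
    then have "?q holomorphic_on V"
    proof (rule holomorphic_transform)
      fix x assume x: "x \<in> V"
      show "A x / E x = ?q x"
      proof (cases "x = t0")
        case True
        then show ?thesis using \<open>exp (\<i> * t0) = 1\<close> Et0 by (simp add: A_def)
      next
        case False
        then have "exp (\<i> * x) \<noteq> 1" using x True by (auto simp: V_def E_def)
        then show ?thesis using False True \<phi>t0 by (simp add: A_def E_def)
      qed
    qed
    ultimately show ?thesis using holomorphic_on_imp_differentiable_at by blast
  qed
  then show ?thesis unfolding holomorphic_on_def using field_differentiable_at_within by blast
qed

lemma fcoef_const: "fcoef m (\<lambda>_. c) = (if m = 0 then c else 0)"
proof (cases "m = 0")
  case True
  then show ?thesis by (simp add: fcoef_def scaleR_conv_of_real)
next
  case False
  \<comment> \<open>A constant is unchanged by the shift \<open>pi / m\<close>, while its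
    coefficient is multiplied by \<open>exp (\<i> * pi) = -1\<close>.\<close>
  have "fcoef m (\<lambda>_. c) = exp (\<i> * of_int m * of_real (pi / of_int m)) * fcoef m (\<lambda>_. c)"
    by (rule fcoef_shift[of "\<lambda>_. c" "-1" 1 "of_real (pi / of_int m)" m]) (auto simp: hstrip_def)
  moreover have "\<i> * of_int m * of_real (pi / of_int m) = \<i> * of_real pi" using False by simp
  ultimately have "fcoef m (\<lambda>_. c) = - fcoef m (\<lambda>_. c)" by (simp only: exp_pi_i') simp
  then show ?thesis using False by simp
qed

text \<open>Writing \<open>\<phi> t = \<phi> 0 + q t * (exp (\<i> * t) - 1)\<close> makes the
  coefficients telescope: up to the constant, \<open>fcoef m \<phi>\<close> is
  \<open>fcoef (m - 1) q - fcoef m q\<close>. The boundary terms of a symmetric partial sum tend to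
  zero by exponential decay.\<close>

lemma fourier_series_at_0:
  assumes \<phi>: "\<phi> holomorphic_on hstrip (-\<rho>) \<rho>" and per: "\<And>t. t \<in> hstrip (-\<rho>) \<rho> \<Longrightarrow> \<phi> (t + of_real (2 * pi)) = \<phi> t"
    and \<rho>: "0 < \<rho>" and M: "\<And>t. t \<in> hstrip (-\<rho>) \<rho> \<Longrightarrow> norm (\<phi> t) \<le> M"
  shows "((\<lambda>m. fcoef m \<phi>) has_sum \<phi> 0) UNIV"
proof -
  define s where "s = min (\<rho>/2) 1"
  have s: "0 < s" "s < \<rho>" "s \<le> 1" using \<rho> by (auto simp: s_def)
  have 0: "0 \<in> hstrip (-\<rho>) \<rho>" using \<rho> by (simp add: hstrip_def)
  have decay: "norm (fcoef m \<phi>) \<le> M * exp (- s * real_of_int \<bar>m\<bar>)" for m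
    by (rule fcoef_decay[OF \<phi> per s(1,2)]) (use s in \<open>auto intro!: M simp: hstrip_def\<close>)
  obtain W where W: "((\<lambda>m::int. exp (- s * real_of_int \<bar>m\<bar>)) has_sum W) UNIV" using has_sum_exp_int[OF s(1,3)] by blast
  have "(\<lambda>m. norm (fcoef m \<phi>)) summable_on UNIV"
    by (rule Infinite_Sum.abs_summable_on_comparison_test'[where g="\<lambda>m. M * exp (- s * real_of_int \<bar>m\<bar>)"])
      (use has_sum_cmult_right[OF W, of M] decay in \<open>auto simp: summable_on_def\<close>)
  then have "(\<lambda>m. fcoef m \<phi>) summable_on UNIV" by (rule abs_summable_summable)
  then obtain S where S: "((\<lambda>m. fcoef m \<phi>) has_sum S) UNIV" by (auto simp: summable_on_def)
  define q where "q = (\<lambda>t. if exp (\<i> * t) = 1 then deriv \<phi> t / \<i> else (\<phi> t - \<phi> 0) / (exp (\<i> * t) - 1))"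
  have q: "q holomorphic_on hstrip (-\<rho>) \<rho>" unfolding q_def by (rule divided_difference_holomorphic[OF \<phi> per 0])
  have exp_per: "exp (\<i> * (t + of_real (2 * pi))) = exp (\<i> * t)" for t
    using exp_two_pi_int[of 1] by (simp add: ring_distribs exp_add)
  have q_per: "q (t + of_real (2 * pi)) = q t" if t: "t \<in> hstrip (-\<rho>) \<rho>" for t
  proof -
    have "deriv \<phi> (t + of_real (2 * pi)) = deriv \<phi> t"
    proof -
      have "(\<phi> has_field_derivative deriv \<phi> (t + of_real (2 * pi))) (at (t + of_real (2 * pi)))"
        by (rule holomorphic_derivI[OF \<phi> open_hstrip]) (use t in \<open>simp only: hstrip_add_real\<close>)
      then have "((\<lambda>t. \<phi> (t + of_real (2 * pi))) has_field_derivative deriv \<phi> (t + of_real (2 * pi))) (at t)"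
        by (simp add: DERIV_shift)
      then have "(\<phi> has_field_derivative deriv \<phi> (t + of_real (2 * pi))) (at t)"
        by (rule has_field_derivative_transform_within_open[OF _ open_hstrip t]) (rule per)
      then show ?thesis by (simp add: DERIV_imp_deriv)
    qed
    then show ?thesis unfolding q_def exp_per per[OF t] by simp
  qed
  \<comment> \<open>\<open>fcoef_decay\<close> needs a bound only on the lines at heights
    \<open>s\<close> and \<open>-s\<close>, which avoid the zeros of the denominator; the removable
    singularities need no estimate.\<close>
  have q_bound: "norm (q t) \<le> 2 * M / (1 - exp (-s))" if t: "\<bar>Im t\<bar> = s" for t
  proof -
    have e: "norm (exp (\<i> * t)) = exp (- Im t)" by simp
    have lower: "1 - exp (-s) \<le> norm (exp (\<i> * t) - 1)"
    proof (cases "Im t \<ge> 0")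
      case True
      then show ?thesis using norm_triangle_ineq2[of 1 "exp (\<i> * t)"] t e by (simp add: norm_minus_commute)
    next
      case False
      have "1 - exp (-s) \<le> exp s - 1" using exp_ge_add_one_self[of s] exp_ge_add_one_self[of "-s"] s by linarith
      moreover have "exp s = norm (exp (\<i> * t))" using False t e by simp
      ultimately show ?thesis using norm_triangle_ineq2[of "exp (\<i> * t)" 1] by simp
    qed
    moreover have "1 - exp (-s) > 0" using s by simp
    ultimately have "exp (\<i> * t) \<noteq> 1" by auto
    moreover have "norm (\<phi> t - \<phi> 0) \<le> 2 * M"
      using norm_triangle_ineq4[of "\<phi> t" "\<phi> 0"] M[of t] M[OF 0] t s by (simp add: hstrip_def abs_if split: if_splits)
    ultimately show ?thesis unfolding q_def using lower \<open>1 - exp (-s) > 0\<close>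
      using order_trans[OF norm_ge_zero M[OF 0]] by (simp add: norm_divide) (intro frac_le, auto)
  qed
  have contq: "continuous_on A (\<lambda>t. q (of_real t))" for A
    using continuous_on_real_line[OF holomorphic_on_imp_continuous_on[OF q] 0] by simp
  have cont\<phi>: "continuous_on A (\<lambda>t. \<phi> (of_real t))" for A
    using continuous_on_real_line[OF holomorphic_on_imp_continuous_on[OF \<phi>] 0] by simp
  have tele: "fcoef m \<phi> = (if m = 0 then \<phi> 0 else 0) + (fcoef (m - 1) q - fcoef m q)" for m
  proof -
    let ?e = "\<lambda>m t. exp (- (\<i> * of_int m * complex_of_real t))"
    have integ: "(\<lambda>t. q (of_real t) * ?e m t) integrable_on {0..2*pi}" "(\<lambda>t. \<phi> 0 * ?e m t) integrable_on {0..2*pi}" for m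
      by (intro integrable_continuous_real continuous_intros contq)+
    have pt: "\<phi> (of_real t) * ?e m t = \<phi> 0 * ?e m t + (q (of_real t) * ?e (m - 1) t - q (of_real t) * ?e m t)" if "t \<in> {0..2*pi} - {0, 2*pi}" for t
    proof -
      have "exp (\<i> * of_real t) \<noteq> 1"
      proof
        assume "exp (\<i> * of_real t) = 1"
        then obtain k :: int where k: "t = of_int (2 * k) * pi" unfolding exp_eq_1 by auto
        have "0 < t" "t < 2 * pi" using that by auto
        then have "0 < of_int (2 * k) * pi" "of_int (2 * k) * pi < 2 * pi" unfolding k by auto
        then have "0 < k" "k < 1" by (auto simp: zero_less_mult_iff)
        then show False by simp
      qed
      then have 1: "\<phi> (of_real t) = \<phi> 0 + q (of_real t) * (exp (\<i> * of_real t) - 1)" by (simp add: q_def)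
      have 2: "?e (m - 1) t = exp (\<i> * of_real t) * ?e m t"
        by (simp add: exp_add[symmetric] algebra_simps)
      have "(b + u * (e - 1)) * x = b * x + (u * (e * x) - u * x)" for b u e x :: complex
        by (simp add: algebra_simps)
      then show ?thesis unfolding 1 2 .
    qed
    have "integral {0..2*pi} (\<lambda>t. \<phi> (of_real t) * ?e m t) = integral {0..2*pi} (\<lambda>t. \<phi> 0 * ?e m t + (q (of_real t) * ?e (m - 1) t - q (of_real t) * ?e m t))"
    proof (rule integral_spike)
      show "negligible {0, 2*pi}" by simp
      show "\<phi> 0 * ?e m t + (q (of_real t) * ?e (m - 1) t - q (of_real t) * ?e m t) = \<phi> (of_real t) * ?e m t"
        if "t \<in> {0..2*pi} - {0, 2*pi}" for t by (rule pt[OF that, symmetric])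
    qed
    also have "\<dots> = integral {0..2*pi} (\<lambda>t. \<phi> 0 * ?e m t) + (integral {0..2*pi} (\<lambda>t. q (of_real t) * ?e (m - 1) t) - integral {0..2*pi} (\<lambda>t. q (of_real t) * ?e m t))"
      by (subst Henstock_Kurzweil_Integration.integral_add[OF integ(2) integrable_diff[OF integ(1) integ(1)]],
          subst Henstock_Kurzweil_Integration.integral_diff[OF integ(1) integ(1)]) (rule refl)
    finally have "fcoef m \<phi> = fcoef m (\<lambda>_. \<phi> 0) + (fcoef (m - 1) q - fcoef m q)"
      unfolding fcoef_def by (simp add: add_divide_distrib diff_divide_distrib)
    then show ?thesis by (simp add: fcoef_const)
  qed
  have partial: "(\<Sum>m\<in>{- int N..int N}. fcoef m \<phi>) = \<phi> 0 + (fcoef (- int N - 1) q - fcoef (int N) q)" for N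
  proof (induction N)
    case 0
    then show ?case using tele[of 0] by simp
  next
    case (Suc N)
    have idx: "- int N - 1 = - int (Suc N)" "int (Suc N) - 1 = int N" by auto
    have "{- int (Suc N)..int (Suc N)} = insert (- int (Suc N)) (insert (int (Suc N)) {- int N..int N})" by auto
    moreover have "- int (Suc N) \<notin> insert (int (Suc N)) {- int N..int N}" "int (Suc N) \<notin> {- int N..int N}" by auto
    ultimately have "(\<Sum>m\<in>{- int (Suc N)..int (Suc N)}. fcoef m \<phi>)
        = fcoef (- int (Suc N)) \<phi> + (fcoef (int (Suc N)) \<phi> + (\<Sum>m\<in>{- int N..int N}. fcoef m \<phi>))"
      by (simp only: sum.insert finite_insert finite_atLeastAtMost_int not_False_eq_True)
    also have "\<dots> = (0 + (fcoef (- int (Suc N) - 1) q - fcoef (- int (Suc N)) q)) + ((0 + (fcoef (int N) q - fcoef (int (Suc N)) q))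
        + (\<phi> 0 + (fcoef (- int (Suc N)) q - fcoef (int N) q)))"
      using Suc tele[of "- int (Suc N)"] tele[of "int (Suc N)"] unfolding idx by simp
    finally show ?case by simp
  qed
  have lim0: "(\<lambda>N. fcoef (g N) q) \<longlonglongrightarrow> 0" if g: "\<And>N. \<bar>g N\<bar> \<ge> int N" for g
  proof (rule Lim_null_comparison)
    show "\<forall>\<^sub>F N in sequentially. norm (fcoef (g N) q) \<le> 2 * M / (1 - exp (-s)) * exp (-s) ^ N"
    proof (rule always_eventually, rule allI)
      fix N
      have "norm (fcoef (g N) q) \<le> 2 * M / (1 - exp (-s)) * exp (- s * real_of_int \<bar>g N\<bar>)"
        by (rule fcoef_decay[OF q q_per s(1,2) q_bound])
      also have "\<dots> \<le> 2 * M / (1 - exp (-s)) * exp (-s) ^ N"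
      proof (rule mult_left_mono)
        have "exp (- s * real_of_int \<bar>g N\<bar>) \<le> exp (- s * real N)"
        proof -
          have "real N \<le> \<bar>real_of_int (g N)\<bar>" using g[of N] by linarith
          then show ?thesis using s by (simp add: mult_left_mono)
        qed
        then show "exp (- s * real_of_int \<bar>g N\<bar>) \<le> exp (-s) ^ N" by (simp add: exp_of_nat_mult[symmetric] mult.commute)
        show "0 \<le> 2 * M / (1 - exp (-s))" using s order_trans[OF norm_ge_zero M[OF 0]] by simp
      qed
      finally show "norm (fcoef (g N) q) \<le> 2 * M / (1 - exp (-s)) * exp (-s) ^ N" .
    qed
    show "(\<lambda>N. 2 * M / (1 - exp (-s)) * exp (-s) ^ N) \<longlonglongrightarrow> 0"
      using s by (intro tendsto_mult_right_zero LIMSEQ_power_zero) auto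
  qed
  have "(\<lambda>N. \<phi> 0 + (fcoef (- int N - 1) q - fcoef (int N) q)) \<longlonglongrightarrow> \<phi> 0 + (0 - 0)"
    by (intro tendsto_intros lim0) auto
  then have "(\<lambda>N. \<Sum>m\<in>{- int N..int N}. fcoef m \<phi>) \<longlonglongrightarrow> \<phi> 0" unfolding partial by simp
  \<comment> \<open>Absolute summability has already produced some sum \<open>S\<close>. Restricting
    its net of finite sets to symmetric intervals identifies \<open>S\<close> with the telescoped
    limit.\<close>
  moreover have "filterlim (\<lambda>N. {- int N..int N}) (finite_subsets_at_top UNIV) sequentially"
    unfolding filterlim_finite_subsets_at_top
  proof (intro allI impI)
    fix X :: "int set" assume "finite X \<and> X \<subseteq> UNIV"
    then obtain B where B: "\<And>x. x \<in> X \<Longrightarrow> \<bar>x\<bar> \<le> B"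
      by (metis Max_ge finite_imageI imageI)
    have "X \<subseteq> {- int N..int N}" if "N \<ge> nat B" for N
      using B that by (force simp: abs_le_iff)
    then show "\<forall>\<^sub>F N in sequentially. finite {- int N..int N} \<and> X \<subseteq> {- int N..int N} \<and> {- int N..int N} \<subseteq> UNIV"
      by (auto simp: eventually_sequentially)
  qed
  then have "(\<lambda>N. \<Sum>m\<in>{- int N..int N}. fcoef m \<phi>) \<longlonglongrightarrow> S"
    using S unfolding has_sum_def by (rule filterlim_compose[rotated])
  ultimately have "S = \<phi> 0" using LIMSEQ_unique by blast
  then show ?thesis using S by simp
qed

section \<open>From one variable to several: the multiple Fourier series\<close>

lemma fcoef_cong: "(\<And>t::real. \<phi> (of_real t) = \<theta> (of_real t)) \<Longrightarrow> fcoef m \<phi> = fcoef m \<theta>"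
  by (simp add: fcoef_def)

lemma fcoef_cmult: "fcoef m (\<lambda>t. c * \<phi> t) = c * fcoef m \<phi>"
  by (simp add: fcoef_def mult.assoc)

lemma fcoef_add:
  assumes "continuous_on UNIV (\<lambda>t::real. \<phi> (of_real t))" "continuous_on UNIV (\<lambda>t::real. \<theta> (of_real t))"
  shows "fcoef m (\<lambda>t. \<phi> t + \<theta> t) = fcoef m \<phi> + fcoef m \<theta>"
proof -
  have "(\<lambda>t. \<psi> (of_real t) * exp (- (\<i> * of_int m * of_real t))) integrable_on {0..2 * pi}"
    if "continuous_on UNIV (\<lambda>t::real. \<psi> (of_real t))" for \<psi>
    by (intro integrable_continuous_real continuous_intros continuous_on_subset[OF that]) auto
  from Henstock_Kurzweil_Integration.integral_add[OF this[OF assms(1)] this[OF assms(2)]]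
  show ?thesis by (simp add: fcoef_def ring_distribs add_divide_distrib)
qed

lemma fcoef_diff:
  assumes "continuous_on UNIV (\<lambda>t::real. \<phi> (of_real t))" "continuous_on UNIV (\<lambda>t::real. \<theta> (of_real t))"
  shows "fcoef m (\<lambda>t. \<phi> t - \<theta> t) = fcoef m \<phi> - fcoef m \<theta>"
proof -
  have "continuous_on UNIV (\<lambda>t::real. - 1 * \<theta> (of_real t))" using assms(2) by (intro continuous_intros)
  from fcoef_add[OF assms(1), of "\<lambda>t. - 1 * \<theta> t" m, OF this] show ?thesis
    unfolding fcoef_cmult by simp
qed

lemma fcoef_cnj:
  assumes "\<And>t::real. cnj (\<phi> (of_real t)) = \<theta> (of_real t)"
  shows "cnj (fcoef m \<phi>) = fcoef (- m) \<theta>"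
  unfolding fcoef_def complex_cnj_divide integral_cnj complex_cnj_mult assms exp_cnj
  by simp

text \<open>The slice is based at \<open>z\<close> itself, so this is a whole term of the series in
  direction \<open>i\<close>, including its exponential factor in \<open>z $ i\<close>, rather than
  a bare coefficient.\<close>

definition fc :: "'n \<Rightarrow> int \<Rightarrow> (complex ^ 'n \<Rightarrow> complex) \<Rightarrow> complex ^ 'n \<Rightarrow> complex" where
  "fc i m f z = fcoef m (\<lambda>t. f (z + t *s axis i 1))"

primrec fcl :: "'n list \<Rightarrow> ('n \<Rightarrow> int) \<Rightarrow> (complex ^ 'n \<Rightarrow> complex) \<Rightarrow> complex ^ 'n \<Rightarrow> complex" where
  "fcl [] k f = f"
| "fcl (i # L) k f = fcl L k (fc i (k i) f)"

definition periodic_hol :: "real \<Rightarrow> real \<Rightarrow> (complex ^ 'n \<Rightarrow> complex) \<Rightarrow> bool" where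
  "periodic_hol r M f \<longleftrightarrow> hol f (strip r) \<and> (\<forall>z\<in>strip r. norm (f z) \<le> M) \<and>
     (\<forall>z\<in>strip r. \<forall>v\<in>periods. f (z + v) = f z)"

text \<open>
  A function that is covariant with weight \<open>k i\<close> in every direction \<open>i\<close> is a multiple of \<open>exp (\<i> \<langle>k, z\<rangle>)\<close>; the
  terms of the multiple Fourier series are handled through this property.
\<close>

definition covariant :: "real \<Rightarrow> 'n \<Rightarrow> int \<Rightarrow> (complex ^ 'n \<Rightarrow> complex) \<Rightarrow> bool" where
  "covariant r i m g \<longleftrightarrow> (\<forall>z a. z \<in> strip r \<longrightarrow> z + a *s axis i 1 \<in> strip r \<longrightarrow>
     g (z + a *s axis i 1) = exp (\<i> * of_int m * a) * g z)"

lemma strip_axis: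
  assumes "z \<in> strip r"
  shows "z + t *s axis i 1 \<in> strip r \<longleftrightarrow> t \<in> hstrip (- r - Im (z $ i)) (r - Im (z $ i))"
proof
  assume "z + t *s axis i 1 \<in> strip r"
  then have "\<bar>Im ((z + t *s axis i 1) $ i)\<bar> < r" unfolding strip_def by blast
  then show "t \<in> hstrip (- r - Im (z $ i)) (r - Im (z $ i))" by (auto simp: hstrip_def axis_def)
next
  assume t: "t \<in> hstrip (- r - Im (z $ i)) (r - Im (z $ i))"
  show "z + t *s axis i 1 \<in> strip r" unfolding strip_def mem_Collect_eq
  proof
    fix j show "\<bar>Im ((z + t *s axis i 1) $ j)\<bar> < r"
      using t assms by (cases "j = i") (auto simp: hstrip_def axis_def strip_def)
  qed
qed

lemma strip_axis_real: "z \<in> strip r \<Longrightarrow> z + of_real t *s axis i 1 \<in> strip r"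
proof -
  assume z: "z \<in> strip r"
  then have "\<bar>Im (z $ i)\<bar> < r" unfolding strip_def by blast
  then show ?thesis unfolding strip_axis[OF z] hstrip_real by linarith
qed

lemma periodic_holD:
  assumes "periodic_hol r M f"
  shows "hol f (strip r)" "z \<in> strip r \<Longrightarrow> norm (f z) \<le> M" "z \<in> strip r \<Longrightarrow> v \<in> periods \<Longrightarrow> f (z + v) = f z"
  using assms by (auto simp: periodic_hol_def)

lemma continuous_on_axis_line:
  fixes f :: "complex ^ 'n \<Rightarrow> complex"
  assumes "continuous_on (strip r) f" "z \<in> strip r"
  shows "continuous_on S (\<lambda>t::real. f (z + of_real t *s axis i 1))"
proof -
  have "continuous_on S (\<lambda>t::real. z + of_real t *s axis i 1)"
    by (intro continuous_intros bounded_linear.continuous_on[OF bounded_linear_smult_left])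
  from continuous_on_compose2[OF assms(1) this] show ?thesis
    using strip_axis_real[OF assms(2)] by blast
qed

lemma slice_facts:
  fixes f :: "complex ^ 'n \<Rightarrow> complex" and i :: 'n
  assumes f: "periodic_hol r M f" and z: "z \<in> strip r"
  defines "U \<equiv> hstrip (- r - Im (z $ i)) (r - Im (z $ i))"
  shows "(\<lambda>t. f (z + t *s axis i 1)) holomorphic_on U"
    "t \<in> U \<Longrightarrow> f (z + (t + of_real (2 * pi)) *s axis i 1) = f (z + t *s axis i 1)" "0 \<in> U"
    "t \<in> U \<Longrightarrow> norm (f (z + t *s axis i 1)) \<le> M"
proof -
  show "(\<lambda>t. f (z + t *s axis i 1)) holomorphic_on U"
    by (rule hol_line_holomorphic[OF periodic_holD(1)[OF f]]) (simp add: strip_axis[OF z] U_def)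
  show "norm (f (z + t *s axis i 1)) \<le> M" if "t \<in> U" for t
    using periodic_holD(2)[OF f] that by (simp add: strip_axis[OF z] U_def)
  have "z + 0 *s axis i 1 \<in> strip r" using z by simp
  then show "0 \<in> U" unfolding strip_axis[OF z] U_def .
  show "f (z + (t + of_real (2 * pi)) *s axis i 1) = f (z + t *s axis i 1)" if "t \<in> U"
  proof -
    have "z + (t + of_real (2 * pi)) *s axis i 1 = (z + t *s axis i 1) + axis i (2 * of_real pi)"
      by (simp add: vec_eq_iff axis_def)
    moreover have "z + t *s axis i 1 \<in> strip r" using that by (simp add: strip_axis[OF z] U_def)
    moreover have "axis i (2 * of_real pi) \<in> (periods :: (complex ^ 'n) set)" by (simp add: periods_def)
    ultimately show ?thesis using periodic_holD(3)[OF f] by (simp only:)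
  qed
qed

lemma strip_margin:
  assumes "z \<in> strip r"
  obtains d where "0 < d" "d \<le> 1" "z \<in> strip (r - d)"
proof -
  obtain e where e: "e > 0" "\<And>i. \<bar>Im (z $ i)\<bar> \<le> r - e"
  proof -
    define e where "e = Min (range (\<lambda>i. r - \<bar>Im (z $ i)\<bar>))"
    have "e > 0" unfolding e_def using assms by (subst Min_gr_iff) (auto simp: strip_def)
    moreover have "e \<le> r - \<bar>Im (z $ i)\<bar>" for i unfolding e_def by (rule Min_le) auto
    ultimately show ?thesis using that[of e] by (simp add: algebra_simps)
  qed
  show ?thesis
  proof (rule that[of "min (e/2) 1"])
    have "\<bar>Im (z $ i)\<bar> < r - min (e/2) 1" for i using e(2)[of i] e(1) by (auto simp: min_def)
    then show "z \<in> strip (r - min (e/2) 1)" by (simp add: strip_def)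
  qed (use e in auto)
qed

text \<open>Differentiation under the integral. Real shifts keep the distance to the boundary of the
  strip, so the Taylor remainder of \<open>f\<close> is bounded uniformly along the real slice, and
  \<open>fcoef\<close> does not enlarge bounds.\<close>

lemma periodic_hol_fc:
  fixes f :: "complex ^ 'n \<Rightarrow> complex"
  assumes f: "periodic_hol r M f"
  shows "periodic_hol r M (fc i m f)"
  unfolding periodic_hol_def
proof (intro conjI ballI)
  fix z :: "complex ^ 'n" assume z: "z \<in> strip r"
  have cont: "continuous_on (strip r) f" using periodic_holD(1)[OF f] by (rule hol_continuous_on)
  show "norm (fc i m f z) \<le> M" unfolding fc_def
    by (rule fcoef_bound[OF continuous_on_axis_line[OF cont z]]) (intro periodic_holD(2)[OF f] strip_axis_real[OF z])
  fix v :: "complex ^ 'n" assume v: "v \<in> periods"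
  show "fc i m f (z + v) = fc i m f z" unfolding fc_def
  proof (rule fcoef_cong)
    fix t :: real
    have "z + v + of_real t *s axis i 1 = (z + of_real t *s axis i 1) + v" by (simp add: algebra_simps)
    then show "f (z + v + of_real t *s axis i 1) = f (z + of_real t *s axis i 1)"
      using periodic_holD(3)[OF f strip_axis_real[OF z] v] by (simp only:)
  qed
next
  have cont: "continuous_on (strip r) f" using periodic_holD(1)[OF f] by (rule hol_continuous_on)
  have contd: "continuous_on (strip r) (dd f w)" for w
    using hol_dd[OF periodic_holD(1)[OF f] open_strip] by (rule hol_continuous_on)
  show "hol (fc i m f) (strip r)" unfolding hol_def
  proof
    fix z :: "complex ^ 'n" assume z: "z \<in> strip r"
    let ?L = "\<lambda>w. fcoef m (\<lambda>t. dd f w (z + t *s axis i 1))"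
    note zt = strip_axis_real[OF z]
    obtain d where d: "0 < d" "z \<in> strip (r - d)" using strip_margin[OF z] by blast
    have smult: "?L (c *s w) = c * ?L w" for c w
      unfolding fcoef_cmult[symmetric] by (rule fcoef_cong) (rule hol_dd_smult[OF periodic_holD(1)[OF f] zt])
    have add: "?L (a + b) = ?L a + ?L b" for a b
      unfolding fcoef_add[OF continuous_on_axis_line[OF contd z] continuous_on_axis_line[OF contd z], symmetric]
      by (rule fcoef_cong) (rule hol_dd_add[OF periodic_holD(1)[OF f] zt])
    have "(fc i m f has_derivative ?L) (at z)"
    proof (rule derivative_from_quadratic_remainder[where \<rho>="d/2" and C="8 * M / d\<^sup>2", OF add smult])
      fix w :: "complex ^ 'n" assume w: "norm w < d / 2"
      have zw: "z + w \<in> strip r" using strip_ball[OF d(2)] w d(1) by (auto simp: subset_iff dist_norm)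
      let ?R = "\<lambda>t. f (z + w + t *s axis i 1) - f (z + t *s axis i 1) - dd f w (z + t *s axis i 1)"
      note c1 = continuous_on_axis_line[OF cont zw] and c2 = continuous_on_axis_line[OF cont z]
        and c3 = continuous_on_axis_line[OF contd z]
      have "fc i m f (z + w) - fc i m f z - ?L w = fcoef m ?R"
        unfolding fc_def by (simp add: fcoef_diff c1 c2 c3 continuous_on_diff)
      moreover have "norm (fcoef m ?R) \<le> 8 * M * (norm w)\<^sup>2 / d\<^sup>2"
      proof (rule fcoef_bound)
        show "continuous_on UNIV (\<lambda>t::real. ?R (of_real t))" by (intro continuous_intros c1 c2 c3)
        fix t :: real
        have "z + of_real t *s axis i 1 \<in> strip (r - d)" using strip_axis_real[OF d(2)] .
        then have sub: "ball (z + of_real t *s axis i 1) d \<subseteq> strip r" by (rule strip_ball)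
        have "norm (f (z + of_real t *s axis i 1 + w) - f (z + of_real t *s axis i 1) - dd f w (z + of_real t *s axis i 1)) \<le> 8 * M * (norm w)\<^sup>2 / d\<^sup>2"
          by (rule hol_Taylor[OF hol_subset[OF periodic_holD(1)[OF f] sub] _ w]) (use sub periodic_holD(2)[OF f] in blast)
        moreover have "z + of_real t *s axis i 1 + w = z + w + of_real t *s axis i 1" by simp
        ultimately show "norm (?R (of_real t)) \<le> 8 * M * (norm w)\<^sup>2 / d\<^sup>2" by (simp only:)
      qed
      ultimately show "norm (fc i m f (z + w) - fc i m f z - ?L w) \<le> 8 * M / d\<^sup>2 * (norm w)\<^sup>2"
        by (simp add: mult.commute mult.left_commute)
    qed (use d in auto)
    then show "\<exists>D. (fc i m f has_derivative D) (at z) \<and> (\<forall>c h. D (c *s h) = c * D h)" using smult by blast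
  qed
qed

lemma covariant_fc:
  fixes f :: "complex ^ 'n \<Rightarrow> complex"
  assumes f: "periodic_hol r M f"
  shows "covariant r i m (fc i m f)"
  unfolding covariant_def
proof (intro allI impI)
  fix z :: "complex ^ 'n" and a assume z: "z \<in> strip r" and za: "z + a *s axis i 1 \<in> strip r"
  have "fc i m f (z + a *s axis i 1) = fcoef m (\<lambda>t. f (z + (t + a) *s axis i 1))"
    unfolding fc_def by (rule fcoef_cong) (simp add: vector_sadd_rdistrib algebra_simps)
  also have "\<dots> = exp (\<i> * of_int m * a) * fc i m f z" unfolding fc_def
    by (rule fcoef_shift[OF slice_facts(1,2)[OF f z]]) (use za slice_facts(3)[OF f z] in \<open>auto simp: strip_axis[OF z]\<close>)
  finally show "fc i m f (z + a *s axis i 1) = exp (\<i> * of_int m * a) * fc i m f z" .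
qed

lemma covariant_fc_other:
  fixes f :: "complex ^ 'n \<Rightarrow> complex"
  assumes "covariant r j m f"
  shows "covariant r j m (fc i k f)"
  unfolding covariant_def
proof (intro allI impI)
  fix z :: "complex ^ 'n" and a assume z: "z \<in> strip r" and za: "z + a *s axis j 1 \<in> strip r"
  have eq: "z + a *s axis j 1 + of_real t *s axis i 1 = z + of_real t *s axis i 1 + a *s axis j 1" for t :: real by simp
  have "fc i k f (z + a *s axis j 1) = fcoef k (\<lambda>t. exp (\<i> * of_int m * a) * f (z + t *s axis i 1))"
    unfolding fc_def
  proof (rule fcoef_cong)
    fix t :: real
    have "z + of_real t *s axis i 1 + a *s axis j 1 \<in> strip r" using strip_axis_real[OF za, of t i] unfolding eq .
    then show "f (z + a *s axis j 1 + of_real t *s axis i 1) = exp (\<i> * of_int m * a) * f (z + of_real t *s axis i 1)"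
      using assms strip_axis_real[OF z] unfolding eq covariant_def by blast
  qed
  then show "fc i k f (z + a *s axis j 1) = exp (\<i> * of_int m * a) * fc i k f z"
    unfolding fcoef_cmult fc_def .
qed

lemma periodic_hol_fcl: "periodic_hol r M f \<Longrightarrow> periodic_hol r M (fcl L k f)"
  by (induction L arbitrary: f) (auto intro: periodic_hol_fc)

lemma covariant_fcl_other: "covariant r j m f \<Longrightarrow> covariant r j m (fcl L k f)"
  by (induction L arbitrary: f) (auto intro: covariant_fc_other)

lemma covariant_fcl: "periodic_hol r M f \<Longrightarrow> i \<in> set L \<Longrightarrow> covariant r i (k i) (fcl L k f)"
proof (induction L arbitrary: f)
  case (Cons j L)
  then show ?case
    using covariant_fcl_other[OF covariant_fc[OF Cons.prems(1)]] Cons.IH[OF periodic_hol_fc[OF Cons.prems(1)]]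
    by (cases "i = j") auto
qed auto

lemma covariant_shift:
  fixes z a :: "complex ^ 'n"
  assumes cov: "\<And>i. i \<in> A \<Longrightarrow> covariant r i (k i) g" and z: "z \<in> strip r" "z + a \<in> strip r"
  shows "g (z + (\<Sum>i\<in>A. a $ i *s axis i 1)) = exp (\<i> * (\<Sum>i\<in>A. of_int (k i) * a $ i)) * g z"
proof -
  have "finite A" by simp
  then show ?thesis using cov
  proof (induction A)
    case (insert j A)
    \<comment> \<open>The strip is a product condition: moving some coordinates only leaves each one
      equal to that of \<open>z\<close> or of \<open>z + a\<close>, both admissible.\<close>
    have strip: "z + (\<Sum>i\<in>B. a $ i *s axis i 1) \<in> strip r" for B
    proof -
      have "(z + (\<Sum>i\<in>B. a $ i *s axis i 1)) $ l = (if l \<in> B then (z + a) $ l else z $ l)" for l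
        by (simp add: axis_def if_distrib cong: if_cong)
      then show ?thesis using z by (auto simp: strip_def)
    qed
    have eq: "z + (\<Sum>i\<in>insert j A. a $ i *s axis i 1) = (z + (\<Sum>i\<in>A. a $ i *s axis i 1)) + a $ j *s axis j 1"
      using insert.hyps by (simp add: algebra_simps)
    have "covariant r j (k j) g" using insert.prems by simp
    then have "g (z + (\<Sum>i\<in>insert j A. a $ i *s axis i 1)) = exp (\<i> * of_int (k j) * a $ j) * g (z + (\<Sum>i\<in>A. a $ i *s axis i 1))"
      using strip[of A] strip[of "insert j A"] unfolding covariant_def eq by blast
    also have "\<dots> = exp (\<i> * of_int (k j) * a $ j) * (exp (\<i> * (\<Sum>i\<in>A. of_int (k i) * a $ i)) * g z)"
      using insert.IH insert.prems by simp
    also have "\<dots> = exp (\<i> * (\<Sum>i\<in>insert j A. of_int (k i) * a $ i)) * g z"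
      using insert.hyps by (simp add: ring_distribs exp_add mult.assoc)
    finally show ?case .
  qed auto
qed

text \<open>Every coordinate in \<open>A\<close> is moved by the imaginary amount \<open>d\<close>
  against the sign of its weight. Covariance turns this into growth by the reciprocal of the claimed
  product, while \<open>M\<close> still bounds the value reached.\<close>

lemma covariant_decay:
  fixes g :: "complex ^ 'n \<Rightarrow> complex"
  assumes g: "periodic_hol r M g" and cov: "\<And>i. i \<in> A \<Longrightarrow> covariant r i (k i) g" and z: "z \<in> strip (r - d)" and d: "0 < d"
  shows "norm (g z) \<le> M * (\<Prod>i\<in>A. exp (- d * real_of_int \<bar>k i\<bar>))"
proof -
  define a :: "complex ^ 'n" where "a = (\<chi> i. if i \<in> A then - (\<i> * of_real (d * of_int (sgn (k i)))) else 0)"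
  have "norm (a $ i) \<le> d" for i
    using d by (auto simp: a_def norm_mult abs_mult sgn_if)
  then have za: "z + a \<in> strip r" by (intro strip_add[OF z])
  have zr: "z \<in> strip r" using strip_mono[of "r - d" r] z d by auto
  have a_eq: "(\<Sum>i\<in>A. a $ i *s axis i 1) = a"
    unfolding vec_eq_iff
  proof
    fix l show "(\<Sum>i\<in>A. a $ i *s axis i 1) $ l = a $ l"
      by (cases "l \<in> A") (simp_all add: axis_def if_distrib a_def cong: if_cong)
  qed
  have "g (z + a) = exp (\<i> * (\<Sum>i\<in>A. of_int (k i) * a $ i)) * g z"
    using covariant_shift[of A r k g, OF cov zr za] unfolding a_eq by blast
  moreover have "\<i> * (\<Sum>i\<in>A. of_int (k i) * a $ i) = of_real (\<Sum>i\<in>A. d * real_of_int \<bar>k i\<bar>)"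
  proof -
    have "\<i> * (of_int (k i) * a $ i) = of_real (d * real_of_int \<bar>k i\<bar>)" if "i \<in> A" for i
      using that by (simp add: a_def abs_if sgn_if algebra_simps)
    then show ?thesis by (simp add: sum_distrib_left)
  qed
  ultimately have "norm (g (z + a)) = exp (\<Sum>i\<in>A. d * real_of_int \<bar>k i\<bar>) * norm (g z)"
    by (simp only: norm_mult norm_exp_eq_Re Re_complex_of_real)
  with periodic_holD(2)[OF g za] have "exp (\<Sum>i\<in>A. d * real_of_int \<bar>k i\<bar>) * norm (g z) \<le> M" by simp
  then have "norm (g z) \<le> M * exp (- (\<Sum>i\<in>A. d * real_of_int \<bar>k i\<bar>))" by (simp add: exp_minus field_simps)
  then show ?thesis by (simp add: sum_negf[symmetric] exp_sum)
qed

text \<open>Frequencies of the coordinates expanded so far. Requiring zero elsewhere makes the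
  splitting into one new weight and the old ones bijective.\<close>

definition idx :: "'n list \<Rightarrow> ('n \<Rightarrow> int) set" where
  "idx L = {k. \<forall>i. i \<notin> set L \<longrightarrow> k i = 0}"

lemma bij_idx:
  assumes "i \<notin> set L"
  shows "bij_betw (\<lambda>(m, k). k(i := m)) (UNIV \<times> idx L) (idx (i # L))"
  by (rule bij_betwI[where g="\<lambda>k. (k i, k(i := 0))"]) (use assms in \<open>auto simp: idx_def fun_eq_iff\<close>)

text \<open>Fubini for nonnegative terms, one coordinate at a time; it supplies the majorant for all
  multiple series.\<close>

lemma has_sum_weights:
  assumes w: "(w has_sum W) UNIV" "\<And>m. w m \<ge> (0::real)" and L: "distinct L"
  shows "((\<lambda>k. \<Prod>i\<in>set L. w (k i)) has_sum W ^ length L) (idx L)"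
  using L
proof (induction L)
  case Nil
  have "idx [] = {\<lambda>_::'a. 0::int}" by (auto simp: idx_def)
  then show ?case by (simp add: has_sum_finite_iff)
next
  case (Cons i L)
  then have i: "i \<notin> set L" and IH: "((\<lambda>k. \<Prod>i\<in>set L. w (k i)) has_sum W ^ length L) (idx L)" by auto
  let ?f = "\<lambda>(m, k). w m * (\<Prod>j\<in>set L. w (k j))"
  have inner: "((\<lambda>k. ?f (m, k)) has_sum w m * W ^ length L) (idx L)" for m
    using has_sum_cmult_right[OF IH, of "w m"] by simp
  have outer: "((\<lambda>m. w m * W ^ length L) has_sum W * W ^ length L) UNIV"
    using has_sum_cmult_left[OF w(1)] by simp
  have "?f summable_on (UNIV \<times> idx L)"
    by (rule summable_on_SigmaI[OF inner]) (use outer w(2) in \<open>auto simp: summable_on_def intro!: mult_nonneg_nonneg prod_nonneg\<close>)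
  then have "(?f has_sum W * W ^ length L) (UNIV \<times> idx L)" by (rule has_sum_SigmaI[OF inner outer])
  also have "?this \<longleftrightarrow> ((\<lambda>x. (\<lambda>k. \<Prod>j\<in>set (i # L). w (k j)) ((\<lambda>(m, k). k(i := m)) x)) has_sum W * W ^ length L) (UNIV \<times> idx L)"
  proof (rule has_sum_cong)
    fix x :: "int \<times> ('a \<Rightarrow> int)"
    obtain m k where x: "x = (m, k)" by (cases x)
    have "(\<Prod>j\<in>set L. w (if j = i then m else k j)) = (\<Prod>j\<in>set L. w (k j))"
      using i by (intro prod.cong) auto
    then show "?f x = (\<lambda>k. \<Prod>j\<in>set (i # L). w (k j)) ((\<lambda>(m, k). k(i := m)) x)"
      using i by (simp add: x fun_upd_def)
  qed
  also have "\<dots> \<longleftrightarrow> ((\<lambda>k. \<Prod>j\<in>set (i # L). w (k j)) has_sum W * W ^ length L) (idx (i # L))"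
    by (rule has_sum_reindex_bij_betw[OF bij_idx[OF i]])
  finally show ?case by simp
qed

lemma fcl_upd: "i \<notin> set L \<Longrightarrow> fcl L (k(i := m)) f = fcl L k f"
  by (induction L arbitrary: f) auto

text \<open>The iterated expansion, one coordinate after another, yields the right value, but a sum
  over the product index set needs summability first; that is provided by the decay of covariant
  terms on a slightly narrower strip around \<open>z\<close>.\<close>

lemma fourier_series:
  fixes f :: "complex ^ 'n \<Rightarrow> complex"
  assumes "periodic_hol r M f" "distinct L" and z: "z \<in> strip r"
  shows "((\<lambda>k. fcl L k f z) has_sum f z) (idx L)"
  using assms(1,2)
proof (induction L arbitrary: f)
  case Nil
  have "idx [] = {\<lambda>_::'n. 0::int}" by (auto simp: idx_def)
  then show ?case by (simp add: has_sum_finite_iff)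
next
  case (Cons i L)
  then have i: "i \<notin> set L" by simp
  let ?f = "\<lambda>(m, k). fcl L k (fc i m f) z"
  have inner: "((\<lambda>k. ?f (m, k)) has_sum fc i m f z) (idx L)" for m
    using Cons.IH[OF periodic_hol_fc[OF Cons.prems(1)]] Cons.prems by simp
  obtain d where d: "0 < d" "d \<le> 1" "z \<in> strip (r - d)" using strip_margin[OF z] by blast
  have outer: "((\<lambda>m. fc i m f z) has_sum f z) UNIV"
  proof -
    have sub: "hstrip (- d) d \<subseteq> hstrip (- r - Im (z $ i)) (r - Im (z $ i))"
    proof -
      have "\<bar>Im (z $ i)\<bar> < r - d" using d(3) unfolding strip_def by blast
      then show ?thesis unfolding hstrip_def by auto
    qed
    note sf = slice_facts[OF Cons.prems(1) z, where i=i]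
    have "((\<lambda>m. fcoef m (\<lambda>t. f (z + t *s axis i 1))) has_sum f (z + 0 *s axis i 1)) UNIV"
      by (rule fourier_series_at_0[OF holomorphic_on_subset[OF sf(1) sub] sf(2) d(1) sf(4)]) (use sub in auto)
    then show ?thesis by (simp add: fc_def)
  qed
  obtain W where W: "((\<lambda>m::int. exp (- d * real_of_int \<bar>m\<bar>)) has_sum W) UNIV"
    using has_sum_exp_int[OF d(1,2)] by blast
  have reind: "(\<lambda>k. fcl (i # L) k f z) ((\<lambda>(m, k). k(i := m)) x) = ?f x" for x
    using fcl_upd[OF i] by (cases x) simp
  have "(\<lambda>k. norm (fcl (i # L) k f z)) summable_on (idx (i # L))"
  proof (rule Infinite_Sum.abs_summable_on_comparison_test')
    have "((\<lambda>k. M * (\<Prod>j\<in>set (i # L). exp (- d * real_of_int \<bar>k j\<bar>))) has_sum M * W ^ length (i # L)) (idx (i # L))"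
      by (rule has_sum_cmult_right[OF has_sum_weights[OF W]]) (use Cons.prems in auto)
    then show "(\<lambda>k. M * (\<Prod>j\<in>set (i # L). exp (- d * real_of_int \<bar>k j\<bar>))) summable_on (idx (i # L))"
      by (auto simp: summable_on_def)
    show "norm (fcl (i # L) k f z) \<le> M * (\<Prod>j\<in>set (i # L). exp (- d * real_of_int \<bar>k j\<bar>))" for k
      by (rule covariant_decay[OF periodic_hol_fcl[OF Cons.prems(1)] covariant_fcl[OF Cons.prems(1)] d(3,1)])
  qed
  then have "(\<lambda>k. fcl (i # L) k f z) summable_on (idx (i # L))" by (rule abs_summable_summable)
  then have "?f summable_on (UNIV \<times> idx L)"
    using summable_on_reindex_bij_betw[OF bij_idx[OF i], of "\<lambda>k. fcl (i # L) k f z"] unfolding reind by simp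
  then have "(?f has_sum f z) (UNIV \<times> idx L)" by (rule has_sum_SigmaI[OF inner outer])
  then show ?case
    using has_sum_reindex_bij_betw[OF bij_idx[OF i], of "\<lambda>k. fcl (i # L) k f z" "f z"] unfolding reind by simp
qed

lemma fcl_cnj:
  fixes f :: "complex ^ 'n \<Rightarrow> complex"
  assumes "\<And>x. cnj (f (complexify x)) = g (complexify x)"
  shows "cnj (fcl L k f (complexify x)) = fcl L (\<lambda>i. - k i) g (complexify x)"
  using assms
proof (induction L arbitrary: f g)
  case (Cons i L)
  have "cnj (fc i (k i) f (complexify x)) = fc i (- k i) g (complexify x)" for x
    unfolding fc_def
  proof (rule fcoef_cnj)
    fix t :: real
    have "complexify x + of_real t *s axis i 1 = complexify (x + t *\<^sub>R axis i 1)"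
      by (simp add: complexify_add complexify_scaleR)
    then show "cnj (f (complexify x + of_real t *s axis i 1)) = g (complexify x + of_real t *s axis i 1)"
      using Cons.prems by simp
  qed
  then show ?case using Cons.IH by simp
qed auto

lemma continuous_on_fcl:
  fixes f :: "'p::topological_space \<Rightarrow> complex ^ 'n \<Rightarrow> complex"
  assumes "continuous_on (\<Xi> \<times> strip r) (\<lambda>(\<xi>, z). f \<xi> z)"
  shows "continuous_on (\<Xi> \<times> strip r) (\<lambda>(\<xi>, z). fcl L k (f \<xi>) z)"
  using assms
proof (induction L arbitrary: f)
  case (Cons i L)
  have "continuous_on (\<Xi> \<times> strip r) (\<lambda>x. integral (cbox 0 (2 * pi))
      (\<lambda>t. f (fst x) (snd x + of_real t *s axis i 1) * exp (- (\<i> * of_int (k i) * of_real t))))"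
  proof (rule integral_continuous_on_param)
    have "continuous_on ((\<Xi> \<times> strip r) \<times> cbox 0 (2 * pi)) (\<lambda>x. (\<lambda>(\<xi>, z). f \<xi> z) (fst (fst x), snd (fst x) + of_real (snd x) *s axis i 1))"
      by (rule continuous_on_compose2[OF Cons.prems])
        (auto intro!: continuous_intros bounded_linear.continuous_on[OF bounded_linear_smult_left] strip_axis_real)
    then show "continuous_on ((\<Xi> \<times> strip r) \<times> cbox 0 (2 * pi))
      (\<lambda>(x, t). f (fst x) (snd x + of_real t *s axis i 1) * exp (- (\<i> * of_int (k i) * of_real t)))"
      unfolding case_prod_beta by (auto intro!: continuous_intros)
  qed
  then have "continuous_on (\<Xi> \<times> strip r) (\<lambda>(\<xi>, z). fc i (k i) (f \<xi>) z)"
    unfolding fc_def fcoef_def case_prod_beta by (intro continuous_intros) auto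
  from Cons.IH[OF this] show ?case by simp
qed auto

section \<open>The homological equation\<close>

lemma power_le_fact_exp:
  fixes x :: real
  assumes "0 \<le> x"
  shows "x ^ n \<le> fact n * exp x"
proof -
  have "(\<Sum>m\<in>{n}. inverse (fact m) * x ^ m) \<le> (\<Sum>m. inverse (fact m) * x ^ m)"
    by (rule sum_le_suminf[OF summable_exp]) (use assms in auto)
  also have "(\<Sum>m. inverse (fact m) * x ^ m) = exp x" by (simp add: exp_def scaleR_conv_of_real)
  finally show ?thesis by (simp add: field_simps)
qed

text \<open>The Diophantine loss is polynomial of degree at most \<open>N\<close> in the
  \<open>l1\<close> norm of \<open>k\<close>. It is absorbed into half of the exponential decay
  gained on a strip narrower by \<open>d\<close>, at the price
  \<open>fact N * (2 / d) ^ N\<close>.\<close>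

lemma small_divisor_bound:
  fixes p :: "real ^ 'n" and k :: "'n \<Rightarrow> int"
  assumes dioph: "diophantine \<gamma> \<tau> p" and "\<gamma> > 0" "\<tau> > 0" and k: "k \<noteq> (\<lambda>_. 0)" and N: "\<tau> \<le> real N" and d: "d > 0"
  defines "D \<equiv> \<Sum>i\<in>UNIV. of_int (k i) * p $ i" and "s \<equiv> \<Sum>i\<in>UNIV. real_of_int \<bar>k i\<bar>"
  shows "D \<noteq> 0" "1 / \<bar>D\<bar> \<le> fact N * (2 / d) ^ N / \<gamma> * exp (d / 2 * s)"
proof -
  define v :: "real ^ 'n" where "v = (\<chi> i. of_int (k i))"
  obtain i0 where i0: "k i0 \<noteq> 0" using k by auto
  have v: "v \<noteq> 0" "\<forall>i. v $ i \<in> \<int>" using i0 by (auto simp: v_def vec_eq_iff)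
  have vD: "v \<bullet> p = D" by (simp add: D_def v_def inner_vec_def)
  have "real_of_int \<bar>k i0\<bar> \<le> s" unfolding s_def by (rule member_le_sum) auto
  then have s1: "1 \<le> s" using i0 by linarith
  have "norm v \<le> s" unfolding s_def using norm_le_l1_cart[of v] by (simp add: v_def)
  moreover have "norm v > 0" using v by simp
  ultimately have "s powr (- \<tau>) \<le> norm v powr (- \<tau>)" using \<open>\<tau> > 0\<close> by (intro powr_mono2') auto
  then have "\<gamma> * s powr (- \<tau>) \<le> \<gamma> * norm v powr (- \<tau>)" using \<open>\<gamma> > 0\<close> by simp
  also have "\<dots> \<le> \<bar>D\<bar>" using dioph v unfolding diophantine_def vD[symmetric] by blast
  finally have low: "\<gamma> * s powr (- \<tau>) \<le> \<bar>D\<bar>" .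
  have pos: "\<gamma> * s powr (- \<tau>) > 0" using s1 \<open>\<gamma> > 0\<close> by simp
  then show "D \<noteq> 0" using low by auto
  have "1 / \<bar>D\<bar> \<le> 1 / (\<gamma> * s powr (- \<tau>))" using low pos by (intro divide_left_mono) auto
  also have "\<dots> = s powr \<tau> / \<gamma>" using s1 by (simp add: powr_minus field_simps)
  also have "\<dots> \<le> s ^ N / \<gamma>"
  proof (rule divide_right_mono)
    have "s powr \<tau> \<le> s powr real N" using s1 N by (rule powr_mono[rotated])
    then show "s powr \<tau> \<le> s ^ N" using s1 by (simp add: powr_realpow)
  qed (use \<open>\<gamma> > 0\<close> in simp)
  also have "s ^ N = (2 / d) ^ N * (d / 2 * s) ^ N" using d by (simp add: power_mult_distrib[symmetric])
  also have "\<dots> \<le> (2 / d) ^ N * (fact N * exp (d / 2 * s))"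
    using d s1 by (intro mult_left_mono power_le_fact_exp) auto
  finally show "1 / \<bar>D\<bar> \<le> fact N * (2 / d) ^ N / \<gamma> * exp (d / 2 * s)"
    using \<open>\<gamma> > 0\<close> by (simp add: divide_right_mono mult.commute mult.left_commute)
qed

lemma dd_covariant:
  fixes g :: "complex ^ 'n \<Rightarrow> complex"
  assumes cov: "\<And>i. covariant r i (k i) g" and z: "z \<in> strip r"
  shows "dd g h z = \<i> * (\<Sum>i\<in>UNIV. of_int (k i) * h $ i) * g z"
proof -
  let ?D = "\<Sum>i\<in>UNIV. of_int (k i) * h $ i"
  have "continuous_on UNIV (\<lambda>t. z + t *s h)"
    by (intro continuous_intros linear_continuous_on bounded_linear_smult_left)
  then have "open ((\<lambda>t. z + t *s h) -` strip r)" by (intro open_vimage open_strip)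
  then have ev: "\<forall>\<^sub>F t in nhds 0. t \<in> (\<lambda>t. z + t *s h) -` strip r"
    by (rule eventually_nhds_in_open) (use z in auto)
  have eq: "g (z + t *s h) = exp (\<i> * ?D * t) * g z" if t: "z + t *s h \<in> strip r" for t
  proof -
    have "g (z + (\<Sum>i\<in>UNIV. (t *s h) $ i *s axis i 1)) = exp (\<i> * (\<Sum>i\<in>UNIV. of_int (k i) * (t *s h) $ i)) * g z"
      using covariant_shift[of UNIV r k g, OF cov z t] .
    moreover have "(\<Sum>i\<in>UNIV. of_int (k i) * (t *s h) $ i) = ?D * t"
      unfolding sum_distrib_right by (rule sum.cong) (auto simp: mult_ac)
    ultimately show ?thesis by (simp only: vector_eq_sum_axis[symmetric] mult.assoc)
  qed
  have "dd g h z = deriv (\<lambda>t. exp (\<i> * ?D * t) * g z) 0" unfolding dd_def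
    by (rule deriv_cong_ev[OF eventually_mono[OF ev]]) (auto simp: eq)
  also have "\<dots> = \<i> * ?D * g z"
    by (rule DERIV_imp_deriv) (auto intro!: derivative_eq_intros)
  finally show ?thesis .
qed

text \<open>Each Fourier term is an eigenfunction of the derivative along \<open>p\<close>, so the
  equation is solved by dividing it by \<open>\<i> * D k\<close>; the zero frequency cannot be
  removed and becomes \<open>m\<close>. The constants depend on the Diophantine data and the
  dimension alone, not on the family.\<close>

theorem homological_equation:
  fixes p :: "real ^ 'n"
  assumes dioph: "diophantine \<gamma> \<tau> p" and \<gamma>: "\<gamma> > 0" and \<tau>: "\<tau> > 0"
  obtains C :: real and \<kappa> :: nat where "C \<ge> 1"
    "\<And>(\<Xi> :: 'p::topological_space set) r f M d. analytic_family \<Xi> (strip r) periods f \<Longrightarrow>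
      (\<And>\<xi> z. \<xi> \<in> \<Xi> \<Longrightarrow> z \<in> strip r \<Longrightarrow> norm (f \<xi> z) \<le> M) \<Longrightarrow> 0 \<le> M \<Longrightarrow> 0 < d \<Longrightarrow> d \<le> 1 \<Longrightarrow> d < r \<Longrightarrow>
      \<exists>F m. analytic_family \<Xi> (strip (r - d)) periods F \<and> continuous_on \<Xi> m \<and>
        (\<forall>\<xi>\<in>\<Xi>. \<bar>m \<xi>\<bar> \<le> M \<and> (\<forall>z\<in>strip (r - d). norm (F \<xi> z) \<le> C * M / d ^ \<kappa> \<and>
           dd (F \<xi>) (complexify p) z = f \<xi> z - of_real (m \<xi>)))"
proof -
  define N where "N = nat \<lceil>\<tau>\<rceil>"
  have N: "\<tau> \<le> real N" using \<tau> by (simp add: N_def)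
  define n where "n = CARD('n)"
  \<comment> \<open>The factor \<open>2 ^ N\<close> belongs to the small divisors and
    \<open>8 ^ n\<close> to the summation over frequencies, since the weights sum to at most
    \<open>8 / d\<close> per coordinate. The exponent \<open>N + n\<close> of \<open>d\<close> has
    the same two sources.\<close>
  define C where "C = max 1 (fact N * 2 ^ N * 8 ^ n / \<gamma>)"
  obtain L :: "'n list" where L: "set L = UNIV" "distinct L" using finite_distinct_list[of "UNIV :: 'n set"] by auto
  have lenL: "length L = n" using L distinct_card[of L] by (simp add: n_def)
  have idxL: "idx L = UNIV" using L by (simp add: idx_def)
  show ?thesis
  proof (rule that[of C "N + n"])
    show "C \<ge> 1" by (simp add: C_def)
  next
    fix \<Xi> :: "'p set" and r :: real and f :: "'p \<Rightarrow> complex ^ 'n \<Rightarrow> complex" and M d :: real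
    assume f: "analytic_family \<Xi> (strip r) periods f"
      and M: "\<And>\<xi> z. \<xi> \<in> \<Xi> \<Longrightarrow> z \<in> strip r \<Longrightarrow> norm (f \<xi> z) \<le> M" "0 \<le> M" and d: "0 < d" "d \<le> 1" "d < r"
    have periodic_hol: "periodic_hol r M (f \<xi>)" if "\<xi> \<in> \<Xi>" for \<xi>
      using analytic_familyD[OF f] M(1) that by (auto simp: periodic_hol_def)
    define g where "g = (\<lambda>k \<xi>. fcl L k (f \<xi>))"
    define D where "D = (\<lambda>k. \<Sum>i\<in>UNIV. of_int (k i) * p $ i)"
    define K :: "('n \<Rightarrow> int) set" where "K = - {\<lambda>_. 0}"
    define F where "F = (\<lambda>\<xi> z. \<Sum>\<^sub>\<infinity>k\<in>K. g k \<xi> z / (\<i> * of_real (D k)))"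
    define m where "m = (\<lambda>\<xi>. Re (g (\<lambda>_. 0) \<xi> 0))"
    have phg: "periodic_hol r M (g k \<xi>)" if "\<xi> \<in> \<Xi>" for k \<xi> unfolding g_def by (rule periodic_hol_fcl[OF periodic_hol[OF that]])
    have covg: "covariant r i (k i) (g k \<xi>)" if "\<xi> \<in> \<Xi>" for k \<xi> i
      unfolding g_def by (rule covariant_fcl[OF periodic_hol[OF that]]) (simp add: L)
    have Dnz: "D k \<noteq> 0" if "k \<in> K" for k
      using small_divisor_bound(1)[OF dioph \<gamma> \<tau> _ N d(1), of k] that by (simp add: D_def K_def)
    have sub: "strip (r - d) \<subseteq> strip r" using d by (intro strip_mono) auto
    \<comment> \<open>Half of the width \<open>d\<close> is left for summation; the other half is
      spent on the small divisors.\<close>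
    define w where "w = (\<lambda>m::int. exp (- (d / 2) * real_of_int \<bar>m\<bar>))"
    define A where "A = M * (fact N * (2 / d) ^ N / \<gamma>)"
    have A0: "0 \<le> A" using M \<gamma> d by (simp add: A_def)
    have term_bound: "norm (g k \<xi> z / (\<i> * of_real (D k))) \<le> A * (\<Prod>i\<in>set L. w (k i))"
      if "k \<in> K" "\<xi> \<in> \<Xi>" "z \<in> strip (r - d)" for k \<xi> z
    proof -
      let ?s = "\<Sum>i\<in>UNIV. real_of_int \<bar>k i\<bar>"
      have "norm (g k \<xi> z) \<le> M * (\<Prod>i\<in>UNIV. exp (- d * real_of_int \<bar>k i\<bar>))"
        by (rule covariant_decay[OF phg[OF that(2)] covg[OF that(2)] that(3) d(1)])
      also have "(\<Prod>i\<in>UNIV. exp (- d * real_of_int \<bar>k i\<bar>)) = exp (- d * ?s)"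
        by (simp add: exp_sum[symmetric] sum_distrib_left sum_negf)
      finally have 1: "norm (g k \<xi> z) \<le> M * exp (- d * ?s)" .
      have 2: "1 / \<bar>D k\<bar> \<le> fact N * (2 / d) ^ N / \<gamma> * exp (d / 2 * ?s)"
        using small_divisor_bound(2)[OF dioph \<gamma> \<tau> _ N d(1), of k] that by (simp add: D_def K_def)
      have "norm (g k \<xi> z / (\<i> * of_real (D k))) = norm (g k \<xi> z) * (1 / \<bar>D k\<bar>)"
        by (simp add: norm_divide norm_mult)
      also have "\<dots> \<le> (M * exp (- d * ?s)) * (fact N * (2 / d) ^ N / \<gamma> * exp (d / 2 * ?s))"
        using M by (intro mult_mono 1 2) auto
      also have "\<dots> = A * (exp (- d * ?s) * exp (d / 2 * ?s))" by (simp add: A_def)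
      also have "exp (- d * ?s) * exp (d / 2 * ?s) = exp (- (d / 2) * ?s)"
        by (simp add: exp_add[symmetric] algebra_simps)
      also have "exp (- (d / 2) * ?s) = (\<Prod>i\<in>set L. w (k i))"
        unfolding w_def L(1) by (simp add: exp_sum[symmetric] sum_distrib_left sum_negf)
      finally show ?thesis .
    qed
    obtain W where W: "(w has_sum W) UNIV" "1 \<le> W" "W \<le> 4 / (d / 2)"
      using has_sum_exp_int[of "d / 2"] d unfolding w_def by auto
    have hsw: "((\<lambda>k. A * (\<Prod>i\<in>set L. w (k i))) has_sum A * W ^ n) UNIV"
      using has_sum_cmult_right[OF has_sum_weights[OF W(1) _ L(2)], of A] unfolding idxL lenL by (simp add: w_def)
    then have sumw: "(\<lambda>k. A * (\<Prod>i\<in>set L. w (k i))) summable_on K"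
      by (meson summable_on_def summable_on_subset_banach subset_UNIV)
    have ulim: "uniform_limit (\<Xi> \<times> strip (r - d)) (\<lambda>X y. \<Sum>k\<in>X. (\<lambda>(\<xi>, z). g k \<xi> z / (\<i> * of_real (D k))) y)
        (\<lambda>y. \<Sum>\<^sub>\<infinity>k\<in>K. (\<lambda>(\<xi>, z). g k \<xi> z / (\<i> * of_real (D k))) y) (finite_subsets_at_top K)"
      by (rule Weierstrass_m_test_general[OF _ sumw]) (use term_bound in auto)
    have ulim1: "uniform_limit (strip (r - d)) (\<lambda>X z. \<Sum>k\<in>X. g k \<xi> z / (\<i> * of_real (D k))) (F \<xi>) (finite_subsets_at_top K)"
      if "\<xi> \<in> \<Xi>" for \<xi>
      unfolding F_def by (rule Weierstrass_m_test_general[OF _ sumw]) (use term_bound that in auto)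
    have contg: "continuous_on (\<Xi> \<times> strip r) (\<lambda>(\<xi>, z). g k \<xi> z)" for k
      unfolding g_def by (rule continuous_on_fcl[OF analytic_familyD(4)[OF f]])
    have contF: "continuous_on (\<Xi> \<times> strip (r - d)) (\<lambda>(\<xi>, z). F \<xi> z)"
    proof -
      have "continuous_on (\<Xi> \<times> strip (r - d)) (\<lambda>y. \<Sum>\<^sub>\<infinity>k\<in>K. (\<lambda>(\<xi>, z). g k \<xi> z / (\<i> * of_real (D k))) y)"
      proof (rule uniform_limit_theorem[OF _ ulim])
        have sub2: "\<Xi> \<times> strip (r - d) \<subseteq> \<Xi> \<times> strip r" using sub by auto
        show "\<forall>\<^sub>F X in finite_subsets_at_top K. continuous_on (\<Xi> \<times> strip (r - d)) (\<lambda>y. \<Sum>k\<in>X. (\<lambda>(\<xi>, z). g k \<xi> z / (\<i> * of_real (D k))) y)"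
        proof (rule eventually_finite_subsets_at_top_weakI)
          fix X assume X: "finite X" "X \<subseteq> K"
          show "continuous_on (\<Xi> \<times> strip (r - d)) (\<lambda>y. \<Sum>k\<in>X. (\<lambda>(\<xi>, z). g k \<xi> z / (\<i> * of_real (D k))) y)"
            using continuous_on_subset[OF contg sub2] Dnz X(2) unfolding case_prod_beta
            by (intro continuous_intros) auto
        qed
      qed simp
      then show ?thesis unfolding F_def case_prod_beta .
    qed
    have hol_term: "hol (\<lambda>z. g k \<xi> z / (\<i> * of_real (D k))) (strip (r - d))" if "\<xi> \<in> \<Xi>" for k \<xi>
      using hol_cmult(1)[OF hol_subset[OF periodic_holD(1)[OF phg[OF that]] sub], of "inverse (\<i> * of_real (D k))"]
      by (simp add: divide_inverse mult.commute)
    have hol_part: "\<forall>\<^sub>F X in finite_subsets_at_top K. hol (\<lambda>z. \<Sum>k\<in>X. g k \<xi> z / (\<i> * of_real (D k))) (strip (r - d))"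
      if "\<xi> \<in> \<Xi>" for \<xi>
      by (rule always_eventually) (intro allI hol_sum hol_term that)
    have F_hol: "hol (F \<xi>) (strip (r - d))" if "\<xi> \<in> \<Xi>" for \<xi>
      by (rule hol_uniform_limit(1)[OF hol_part[OF that] open_strip ulim1[OF that]]) simp
    have cnj_g: "cnj (g k \<xi> (complexify x)) = g (\<lambda>i. - k i) \<xi> (complexify x)" if "\<xi> \<in> \<Xi>" for k \<xi> x
    proof -
      have "r > 0" using d by simp
      then have "cnj (f \<xi> (complexify y)) = f \<xi> (complexify y)" for y
        using analytic_familyD(3)[OF f that, of y] by (simp add: Reals_cnj_iff)
      then show ?thesis unfolding g_def by (rule fcl_cnj)
    qed
    have F_real: "F \<xi> (complexify x) \<in> \<real>" if "\<xi> \<in> \<Xi>" for \<xi> x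
    proof -
      \<comment> \<open>Conjugation sends the term of frequency \<open>k\<close> to that of
        \<open>-k\<close>: the sign lost in conjugating \<open>\<i>\<close> is restored by the
        oddness of \<open>D\<close>. Reindexing then gives a real sum.\<close>
      have "cnj (F \<xi> (complexify x)) = (\<Sum>\<^sub>\<infinity>k\<in>K. g (\<lambda>i. - k i) \<xi> (complexify x) / (\<i> * of_real (D (\<lambda>i. - k i))))"
      proof -
        have "D (\<lambda>i. - k i) = - D k" for k by (simp add: D_def sum_negf)
        then show ?thesis unfolding F_def infsum_cnj[symmetric] by (simp add: cnj_g[OF that])
      qed
      also have "\<dots> = F \<xi> (complexify x)" unfolding F_def
        by (rule infsum_reindex_bij_betw, rule bij_betwI[where g="\<lambda>k i. - k i"]) (auto simp: K_def fun_eq_iff)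
      finally show ?thesis by (simp add: Reals_cnj_iff)
    qed
    \<comment> \<open>The zero mode is covariant with weight zero in all directions and hence
      constant.\<close>
    have zero_g: "g (\<lambda>_. 0) \<xi> z = of_real (m \<xi>)" if "\<xi> \<in> \<Xi>" "z \<in> strip r" for \<xi> z
    proof -
      have 0: "(0 :: complex ^ 'n) \<in> strip r" using d by (simp add: strip_def)
      have "g (\<lambda>_. 0) \<xi> (0 + (\<Sum>i\<in>UNIV. z $ i *s axis i 1)) = exp (\<i> * (\<Sum>i\<in>UNIV. of_int 0 * z $ i)) * g (\<lambda>_. 0) \<xi> 0"
        by (rule covariant_shift[of UNIV r "\<lambda>_. 0", OF _ 0]) (use covg[OF that(1), of _ "\<lambda>_. 0"] that in auto)
      then have "g (\<lambda>_. 0) \<xi> z = g (\<lambda>_. 0) \<xi> 0" by (simp flip: vector_eq_sum_axis)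
      moreover have "g (\<lambda>_. 0) \<xi> 0 \<in> \<real>"
      proof -
        have "complexify (0 :: real ^ 'n) = 0" by (simp add: vec_eq_iff)
        then show ?thesis using cnj_g[OF that(1), of "\<lambda>_. 0" 0] by (simp add: Reals_cnj_iff)
      qed
      ultimately show ?thesis by (simp add: m_def)
    qed
    have dF: "dd (F \<xi>) (complexify p) z = f \<xi> z - of_real (m \<xi>)" if "\<xi> \<in> \<Xi>" "z \<in> strip (r - d)" for \<xi> z
    proof -
      have zr: "z \<in> strip r" using sub that by auto
      have "((\<lambda>k. g k \<xi> z) has_sum f \<xi> z) UNIV"
        using fourier_series[OF periodic_hol[OF that(1)] L(2) zr] unfolding idxL g_def .
      moreover have "((\<lambda>k. g k \<xi> z) has_sum g (\<lambda>_. 0) \<xi> z) {\<lambda>_. 0}" by (simp add: has_sum_finite_iff)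
      ultimately have "((\<lambda>k. g k \<xi> z) has_sum f \<xi> z - g (\<lambda>_. 0) \<xi> z) (UNIV - {\<lambda>_. 0})"
        by (rule has_sum_Diff) simp
      then have lim1: "((\<lambda>X. \<Sum>k\<in>X. g k \<xi> z) \<longlongrightarrow> f \<xi> z - of_real (m \<xi>)) (finite_subsets_at_top K)"
        unfolding has_sum_def K_def zero_g[OF that(1) zr] Compl_eq_Diff_UNIV .
      have lim2: "((\<lambda>X. dd (\<lambda>z. \<Sum>k\<in>X. g k \<xi> z / (\<i> * of_real (D k))) (complexify p) z) \<longlongrightarrow> dd (F \<xi>) (complexify p) z) (finite_subsets_at_top K)"
        by (rule hol_uniform_limit(2)[OF hol_part[OF that(1)] open_strip ulim1[OF that(1)] _ that(2)]) simp
      have ev: "\<forall>\<^sub>F X in finite_subsets_at_top K. dd (\<lambda>z. \<Sum>k\<in>X. g k \<xi> z / (\<i> * of_real (D k))) (complexify p) z = (\<Sum>k\<in>X. g k \<xi> z)"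
      proof (rule eventually_finite_subsets_at_top_weakI)
        fix X assume X: "finite X" "X \<subseteq> K"
        have "dd (\<lambda>z. g k \<xi> z / (\<i> * of_real (D k))) (complexify p) z = g k \<xi> z" if "k \<in> X" for k
        proof -
          have "dd (\<lambda>z. g k \<xi> z / (\<i> * of_real (D k))) (complexify p) z = inverse (\<i> * of_real (D k)) * dd (g k \<xi>) (complexify p) z"
            using hol_cmult(2)[OF periodic_holD(1)[OF phg[OF \<open>\<xi> \<in> \<Xi>\<close>]] zr, of "inverse (\<i> * of_real (D k))" k "complexify p"]
            by (simp add: divide_inverse mult.commute)
          also have "dd (g k \<xi>) (complexify p) z = \<i> * of_real (D k) * g k \<xi> z"
            using dd_covariant[of r k "g k \<xi>" z "complexify p", OF covg[OF \<open>\<xi> \<in> \<Xi>\<close>] zr] by (simp add: D_def)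
          also have "inverse (\<i> * of_real (D k)) * (\<i> * of_real (D k) * g k \<xi> z) = g k \<xi> z"
          proof -
            have inv: "inverse c * (c * a) = a" if "c \<noteq> 0" for a c :: complex using that by (simp flip: mult.assoc)
            have "\<i> * of_real (D k) \<noteq> 0" using Dnz that X by auto
            then show ?thesis by (rule inv)
          qed
          finally show ?thesis .
        qed
        then show "dd (\<lambda>z. \<Sum>k\<in>X. g k \<xi> z / (\<i> * of_real (D k))) (complexify p) z = (\<Sum>k\<in>X. g k \<xi> z)"
          using hol_sum(2)[of X "\<lambda>k z. g k \<xi> z / (\<i> * of_real (D k))", OF hol_term[OF that(1)] that(2)] by simp
      qed
      show ?thesis
        by (rule tendsto_unique[OF finite_subsets_at_top_neq_bot Lim_transform_eventually[OF lim2 ev] lim1])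
    qed
    have F_bound: "norm (F \<xi> z) \<le> C * M / d ^ (N + n)" if "\<xi> \<in> \<Xi>" "z \<in> strip (r - d)" for \<xi> z
    proof -
      have as: "(\<lambda>k. norm (g k \<xi> z / (\<i> * of_real (D k)))) summable_on K"
        by (rule Infinite_Sum.abs_summable_on_comparison_test'[OF sumw]) (use term_bound that in auto)
      have "norm (F \<xi> z) \<le> (\<Sum>\<^sub>\<infinity>k\<in>K. norm (g k \<xi> z / (\<i> * of_real (D k))))"
        unfolding F_def by (rule norm_infsum_bound[OF as])
      also have "\<dots> \<le> (\<Sum>\<^sub>\<infinity>k\<in>K. A * (\<Prod>i\<in>set L. w (k i)))"
        by (rule infsum_mono[OF as sumw]) (use term_bound that in auto)
      also have "\<dots> \<le> A * W ^ n"
        by (rule has_sum_mono'[OF has_sum_infsum[OF sumw] hsw]) (use A0 in \<open>auto intro!: mult_nonneg_nonneg prod_nonneg simp: w_def\<close>)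
      also have "\<dots> \<le> A * (8 / d) ^ n"
        using W A0 by (intro mult_left_mono power_mono) auto
      also have "\<dots> = (fact N * 2 ^ N * 8 ^ n / \<gamma>) * M / d ^ (N + n)"
        by (simp add: A_def power_divide power_add mult_ac)
      also have "\<dots> \<le> C * M / d ^ (N + n)"
        using M d by (intro divide_right_mono mult_right_mono) (auto simp: C_def)
      finally show ?thesis .
    qed
    have F_per: "F \<xi> (z + v) = F \<xi> z" if "\<xi> \<in> \<Xi>" "z \<in> strip (r - d)" "v \<in> periods" for \<xi> z v
      unfolding F_def using periodic_holD(3)[OF phg[OF that(1)]] that sub by (auto intro!: infsum_cong)
    have "analytic_family \<Xi> (strip (r - d)) periods F"
      unfolding analytic_family_def using F_hol F_per F_real contF by blast
    moreover have "continuous_on \<Xi> m"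
    proof -
      have "continuous_on \<Xi> (\<lambda>\<xi>. (\<lambda>(\<xi>, z). g (\<lambda>_. 0) \<xi> z) (\<xi>, 0))"
        by (rule continuous_on_compose2[OF contg]) (use d in \<open>auto intro!: continuous_intros simp: strip_def\<close>)
      then show ?thesis unfolding m_def by (auto intro!: continuous_intros)
    qed
    moreover have "\<bar>m \<xi>\<bar> \<le> M" if "\<xi> \<in> \<Xi>" for \<xi>
    proof -
      have "(0 :: complex ^ 'n) \<in> strip r" using d by (simp add: strip_def)
      then have "norm (g (\<lambda>_. 0) \<xi> 0) \<le> M" using periodic_holD(2)[OF phg[OF that]] by blast
      then show ?thesis unfolding m_def using abs_Re_le_cmod order_trans by blast
    qed
    ultimately show "\<exists>F m. analytic_family \<Xi> (strip (r - d)) periods F \<and> continuous_on \<Xi> m \<and>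
        (\<forall>\<xi>\<in>\<Xi>. \<bar>m \<xi>\<bar> \<le> M \<and> (\<forall>z\<in>strip (r - d). norm (F \<xi> z) \<le> C * M / d ^ (N + n) \<and>
           dd (F \<xi>) (complexify p) z = f \<xi> z - of_real (m \<xi>)))"
      using F_bound dF by (intro exI[of _ F] exI[of _ m]) blast
  qed
qed

section \<open>Perturbations\<close>

definition cjoin :: "complex ^ 'n \<Rightarrow> complex ^ 'n \<Rightarrow> complex ^ ('n::finite + 'n)" where
  "cjoin y x = (\<chi> k. case k of Inl i \<Rightarrow> y $ i | Inr i \<Rightarrow> x $ i)"

lemma cjoin_Inl [simp]: "cjoin y x $ Inl i = y $ i"
  and cjoin_Inr [simp]: "cjoin y x $ Inr i = x $ i"
  by (auto simp: cjoin_def)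

lemma vec_sum_eq_iff: "(v :: 'a ^ ('n::finite + 'n)) = w \<longleftrightarrow> (\<forall>i. v $ Inl i = w $ Inl i) \<and> (\<forall>i. v $ Inr i = w $ Inr i)"
proof -
  have "(\<forall>k. v $ k = w $ k) \<longleftrightarrow> (\<forall>i. v $ Inl i = w $ Inl i) \<and> (\<forall>i. v $ Inr i = w $ Inr i)"
    by (metis sum.exhaust)
  then show ?thesis by (simp add: vec_eq_iff)
qed

lemma sum_UNIV_Plus: "(\<Sum>k\<in>(UNIV :: ('n::finite + 'n) set). f k) = (\<Sum>i\<in>UNIV. f (Inl i)) + (\<Sum>i\<in>UNIV. f (Inr i))"
  by (subst UNIV_Plus_UNIV[symmetric], subst sum.Plus) auto

lemma norm_cjoin_0 [simp]: "norm (cjoin y 0) = norm y"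
  by (simp add: norm_vec_def L2_set_def sum_UNIV_Plus)

text \<open>Left components are actions, right components angles. The actions are centred at
  \<open>0\<close>; the base point \<open>y0\<close> in \<open>G\<close> enters only when the
  perturbation is built.\<close>

definition pdom :: "real \<Rightarrow> (complex ^ ('n::finite + 'n)) set" where
  "pdom \<rho> = {w. \<forall>i. norm (w $ Inl i) < \<rho> \<and> \<bar>Im (w $ Inr i)\<bar> < \<rho>}"

definition xperiods :: "(complex ^ ('n::finite + 'n)) set" where
  "xperiods = range (\<lambda>i. axis (Inr i) (2 * of_real pi))"

lemma open_pdom: "open (pdom \<rho> :: (complex ^ ('n::finite + 'n)) set)"
proof -
  have "pdom \<rho> = (\<Inter>i::'n. {w. norm (w $ Inl i) < \<rho>} \<inter> {w. \<bar>Im (w $ Inr i)\<bar> < \<rho>})" by (auto simp: pdom_def)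
  moreover have "open ({w :: complex ^ ('n::finite + 'n). norm (w $ Inl i) < \<rho>} \<inter> {w. \<bar>Im (w $ Inr i)\<bar> < \<rho>})" for i
    by (intro open_Int open_Collect_less continuous_intros)
  ultimately show ?thesis by (simp add: open_INT)
qed

lemma convex_pdom: "convex (pdom \<rho> :: (complex ^ ('n::finite + 'n)) set)"
proof (rule convexI)
  fix x y :: "complex ^ ('n::finite + 'n)" and u v :: real
  assume a: "x \<in> pdom \<rho>" "y \<in> pdom \<rho>" "0 \<le> u" "0 \<le> v" "u + v = 1"
  have "norm ((u *\<^sub>R x + v *\<^sub>R y) $ Inl i) < \<rho>" for i
  proof -
    have "norm ((u *\<^sub>R x + v *\<^sub>R y) $ Inl i) \<le> u * norm (x $ Inl i) + v * norm (y $ Inl i)"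
      using a(3,4) by (simp add: order_trans[OF norm_triangle_ineq])
    also have "\<dots> < \<rho>" using a by (intro convex_bound_lt) (auto simp: pdom_def)
    finally show ?thesis .
  qed
  moreover have "\<bar>Im ((u *\<^sub>R x + v *\<^sub>R y) $ Inr i)\<bar> < \<rho>" for i
  proof -
    have "\<bar>Im ((u *\<^sub>R x + v *\<^sub>R y) $ Inr i)\<bar> \<le> u * \<bar>Im (x $ Inr i)\<bar> + v * \<bar>Im (y $ Inr i)\<bar>"
      using a(3,4) by (simp add: abs_mult order_trans[OF abs_triangle_ineq])
    also have "\<dots> < \<rho>" using a by (intro convex_bound_lt) (auto simp: pdom_def)
    finally show ?thesis .
  qed
  ultimately show "u *\<^sub>R x + v *\<^sub>R y \<in> pdom \<rho>" by (simp add: pdom_def)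
qed

lemma pdom_mono: "r \<le> s \<Longrightarrow> pdom r \<subseteq> pdom s"
  unfolding pdom_def by (auto intro: less_le_trans)

lemma pdom_ball: "w \<in> pdom (\<rho> - d) \<Longrightarrow> ball w d \<subseteq> pdom \<rho>"
proof
  fix x assume w: "w \<in> pdom (\<rho> - d)" and "x \<in> ball w d"
  then have "norm (x - w) < d" by (simp add: dist_norm norm_minus_commute)
  then have c: "norm (x $ k - w $ k) < d" for k
    using Finite_Cartesian_Product.norm_nth_le[of "x - w" k] by simp
  have "norm (x $ Inl i) < \<rho>" for i
    using c[of "Inl i"] w[unfolded pdom_def mem_Collect_eq, rule_format, of i] norm_triangle_sub[of "x $ Inl i" "w $ Inl i"] by linarith
  moreover have "\<bar>Im (x $ Inr i)\<bar> < \<rho>" for i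
    using c[of "Inr i"] w[unfolded pdom_def mem_Collect_eq, rule_format, of i] abs_Im_le_cmod[of "x $ Inr i - w $ Inr i"] by simp linarith
  ultimately show "x \<in> pdom \<rho>" by (simp add: pdom_def)
qed

lemma pdom_xperiods: "w \<in> pdom \<rho> \<Longrightarrow> v \<in> xperiods \<Longrightarrow> w + v \<in> pdom \<rho>"
  by (auto simp: pdom_def xperiods_def axis_def)

definition perturbation ::
  "'p::topological_space set \<Rightarrow> real \<Rightarrow> real \<Rightarrow> ('p \<Rightarrow> complex ^ ('n::finite + 'n) \<Rightarrow> complex) \<Rightarrow> bool" where
  "perturbation \<Xi> \<rho> \<mu> \<Phi> \<longleftrightarrow> analytic_family \<Xi> (pdom \<rho>) xperiods \<Phi> \<and>
     (\<forall>\<xi>\<in>\<Xi>. \<forall>w\<in>pdom \<rho>. norm (\<Phi> \<xi> w) \<le> \<mu>)"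

text \<open>Domains shrink in steps of \<open>\<rho> / 8\<close>: first derivatives are bounded on
  \<open>7 * \<rho> / 8\<close>, their Lipschitz constants on \<open>6 * \<rho> / 8\<close>. The
  tori of the iteration are kept in the smallest of these domains.\<close>

lemma perturbation_grad:
  fixes \<Phi> :: "'p::topological_space \<Rightarrow> complex ^ ('n::finite + 'n) \<Rightarrow> complex"
  assumes \<Phi>: "perturbation \<Xi> \<rho> \<mu> \<Phi>" and \<rho>: "\<rho> > 0"
  shows "analytic_family \<Xi> (pdom (7 * \<rho> / 8)) xperiods (\<lambda>\<xi>. dd (\<Phi> \<xi>) (axis k 1))"
    "\<xi> \<in> \<Xi> \<Longrightarrow> w \<in> pdom (7 * \<rho> / 8) \<Longrightarrow> norm (dd (\<Phi> \<xi>) h w) \<le> 16 * \<mu> / \<rho> * norm h"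
proof -
  have fam: "analytic_family \<Xi> (pdom \<rho>) xperiods \<Phi>" and bd: "\<And>\<xi> w. \<xi> \<in> \<Xi> \<Longrightarrow> w \<in> pdom \<rho> \<Longrightarrow> norm (\<Phi> \<xi> w) \<le> \<mu>"
    using \<Phi> by (auto simp: perturbation_def)
  have ball: "ball w (\<rho> / 8) \<subseteq> pdom \<rho>" if "w \<in> pdom (7 * \<rho> / 8)" for w :: "complex ^ ('n::finite + 'n)"
    by (rule pdom_ball) (use that in \<open>simp add: algebra_simps\<close>)
  show "analytic_family \<Xi> (pdom (7 * \<rho> / 8)) xperiods (\<lambda>\<xi>. dd (\<Phi> \<xi>) (axis k 1))"
    using analytic_family_dd[OF fam bd open_pdom _ ball pdom_xperiods, where h="axis k 1"] \<rho> by simp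
  show "norm (dd (\<Phi> \<xi>) h w) \<le> 16 * \<mu> / \<rho> * norm h" if "\<xi> \<in> \<Xi>" "w \<in> pdom (7 * \<rho> / 8)"
    using ball_Cauchy[OF analytic_familyD(1)[OF fam that(1)] bd[OF that(1)] ball[OF that(2)], of h] \<rho> by simp
qed

lemma perturbation_grad_Lipschitz:
  fixes \<Phi> :: "'p::topological_space \<Rightarrow> complex ^ ('n::finite + 'n) \<Rightarrow> complex"
  assumes \<Phi>: "perturbation \<Xi> \<rho> \<mu> \<Phi>" and \<rho>: "\<rho> > 0" and \<xi>: "\<xi> \<in> \<Xi>"
    and w: "w \<in> pdom (6 * \<rho> / 8)" "w' \<in> pdom (6 * \<rho> / 8)"
  shows "norm (dd (\<Phi> \<xi>) (axis k 1) w' - dd (\<Phi> \<xi>) (axis k 1) w) \<le> 256 * \<mu> / \<rho>\<^sup>2 * norm (w' - w)"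
proof (rule differentiable_bound[OF convex_pdom _ _ w(2,1)])
  fix x :: "complex ^ ('n::finite + 'n)" assume x: "x \<in> pdom (6 * \<rho> / 8)"
  have hol: "hol (dd (\<Phi> \<xi>) (axis k 1)) (pdom (7 * \<rho> / 8))"
    by (rule analytic_familyD(1)[OF perturbation_grad(1)[OF \<Phi> \<rho>] \<xi>])
  have ball: "ball x (\<rho> / 8) \<subseteq> pdom (7 * \<rho> / 8)"
    by (rule pdom_ball) (use x in \<open>simp add: algebra_simps\<close>)
  then have "x \<in> pdom (7 * \<rho> / 8)" using \<rho> by (meson centre_in_ball subsetD divide_pos_pos zero_less_numeral)
  then show "(dd (\<Phi> \<xi>) (axis k 1) has_derivative (\<lambda>h. dd (dd (\<Phi> \<xi>) (axis k 1)) h x)) (at x within pdom (6 * \<rho> / 8))"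
    using hol_has_derivative[OF hol] has_derivative_at_withinI by blast
  have bd: "norm (dd (\<Phi> \<xi>) (axis k 1) z) \<le> 16 * \<mu> / \<rho>" if "z \<in> pdom (7 * \<rho> / 8)" for z
    using perturbation_grad(2)[OF \<Phi> \<rho> \<xi> that, of "axis k 1"] by simp
  show "onorm (\<lambda>h. dd (dd (\<Phi> \<xi>) (axis k 1)) h x) \<le> 256 * \<mu> / \<rho>\<^sup>2"
  proof (rule onorm_le)
    fix h
    have "norm (dd (dd (\<Phi> \<xi>) (axis k 1)) h x) \<le> 2 * (16 * \<mu> / \<rho>) / (\<rho> / 8) * norm h"
      by (rule ball_Cauchy[OF hol bd ball]) (use \<rho> in auto)
    then show "norm (dd (dd (\<Phi> \<xi>) (axis k 1)) h x) \<le> 256 * \<mu> / \<rho>\<^sup>2 * norm h"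
      by (simp add: power2_eq_square)
  qed
qed

lemma perturbation_Taylor:
  fixes \<Phi> :: "'p::topological_space \<Rightarrow> complex ^ ('n::finite + 'n) \<Rightarrow> complex"
  assumes \<Phi>: "perturbation \<Xi> \<rho> \<mu> \<Phi>" and \<rho>: "\<rho> > 0" and \<xi>: "\<xi> \<in> \<Xi>"
    and w: "w \<in> pdom (6 * \<rho> / 8)" and \<eta>: "norm \<eta> < \<rho> / 8"
  shows "norm (\<Phi> \<xi> (w + cjoin \<eta> 0) - \<Phi> \<xi> w - (\<Sum>i\<in>UNIV. \<eta> $ i * dd (\<Phi> \<xi>) (axis (Inl i) 1) w)) \<le> 128 * \<mu> / \<rho>\<^sup>2 * (norm \<eta>)\<^sup>2"
proof -
  have fam: "analytic_family \<Xi> (pdom \<rho>) xperiods \<Phi>" and bd: "\<And>\<xi> w. \<xi> \<in> \<Xi> \<Longrightarrow> w \<in> pdom \<rho> \<Longrightarrow> norm (\<Phi> \<xi> w) \<le> \<mu>"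
    using \<Phi> by (auto simp: perturbation_def)
  have ball: "ball w (\<rho> / 4) \<subseteq> pdom \<rho>"
    by (rule pdom_ball) (use w in \<open>simp add: algebra_simps\<close>)
  then have w\<rho>: "w \<in> pdom \<rho>" using \<rho> by (meson centre_in_ball subsetD divide_pos_pos zero_less_numeral)
  have "dd (\<Phi> \<xi>) (cjoin \<eta> 0) w = (\<Sum>i\<in>UNIV. \<eta> $ i * dd (\<Phi> \<xi>) (axis (Inl i) 1) w)"
    using hol_dd_axis[OF analytic_familyD(1)[OF fam \<xi>] w\<rho>, of "cjoin \<eta> 0"] by (simp add: sum_UNIV_Plus)
  moreover have "norm (\<Phi> \<xi> (w + cjoin \<eta> 0) - \<Phi> \<xi> w - dd (\<Phi> \<xi>) (cjoin \<eta> 0) w) \<le> 8 * \<mu> * (norm (cjoin \<eta> 0))\<^sup>2 / (\<rho> / 4)\<^sup>2"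
    by (rule hol_Taylor[OF hol_subset[OF analytic_familyD(1)[OF fam \<xi>] ball]]) (use bd \<xi> ball \<eta> in auto)
  ultimately show ?thesis by (simp add: power_divide)
qed

lemma analytic_family_component: "analytic_family \<Xi> U {} (\<lambda>\<xi> z. z $ i)"
  unfolding analytic_family_def by (auto simp: case_prod_beta intro!: continuous_intros)

lemma analytic_family_no_periods: "analytic_family \<Xi> U \<Lambda> f \<Longrightarrow> analytic_family \<Xi> U {} f"
  by (auto simp: analytic_family_def)

lemma analytic_family_torus_compose:
  fixes u Y :: "'p::topological_space \<Rightarrow> complex ^ 'n \<Rightarrow> complex ^ 'n"
  assumes \<Psi>: "analytic_family \<Xi> V xperiods \<Psi>"
    and u: "\<And>i. analytic_family \<Xi> (strip r) periods (\<lambda>\<xi> z. u \<xi> z $ i)"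
    and Y: "\<And>i. analytic_family \<Xi> (strip r) periods (\<lambda>\<xi> z. Y \<xi> z $ i)"
    and V: "\<And>\<xi> z. \<xi> \<in> \<Xi> \<Longrightarrow> z \<in> strip r \<Longrightarrow> cjoin (Y \<xi> z) (z + u \<xi> z) \<in> V"
  shows "analytic_family \<Xi> (strip r) periods (\<lambda>\<xi> z. \<Psi> \<xi> (cjoin (Y \<xi> z) (z + u \<xi> z)))"
proof (rule analytic_family_compose[OF \<Psi> _ V])
  fix k :: "'n + 'n"
  show "analytic_family \<Xi> (strip r) {} (\<lambda>\<xi> z. cjoin (Y \<xi> z) (z + u \<xi> z) $ k)"
  proof (cases k)
    case (Inl i)
    then show ?thesis using analytic_family_no_periods[OF Y] by simp
  next
    case (Inr i)
    then show ?thesis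
      using analytic_family_add[OF analytic_family_component analytic_family_no_periods[OF u]] by simp
  qed
next
  fix \<xi> and z v :: "complex ^ 'n" assume \<xi>: "\<xi> \<in> \<Xi>" and z: "z \<in> strip r" and v: "v \<in> periods"
  obtain i where i: "v = axis i (2 * of_real pi)" using v by (auto simp: periods_def)
  have "cjoin (Y \<xi> (z + v)) (z + v + u \<xi> (z + v)) = cjoin (Y \<xi> z) (z + u \<xi> z) + axis (Inr i) (2 * of_real pi)"
    using analytic_familyD(2)[OF Y \<xi> z v] analytic_familyD(2)[OF u \<xi> z v]
    by (simp add: vec_sum_eq_iff) (simp add: i axis_def)
  then show "\<exists>v'\<in>insert 0 xperiods. cjoin (Y \<xi> (z + v)) (z + v + u \<xi> (z + v)) = cjoin (Y \<xi> z) (z + u \<xi> z) + v'"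
    by (auto simp: xperiods_def)
qed

lemma analytic_family_near_identity_compose:
  fixes z :: "'p::topological_space \<Rightarrow> complex ^ 'n \<Rightarrow> complex ^ 'n"
  assumes f: "analytic_family \<Xi> (strip r') periods f"
    and z: "\<And>i. analytic_family \<Xi> (strip r) periods (\<lambda>\<xi> \<theta>. z \<xi> \<theta> $ i)"
    and maps: "\<And>\<xi> \<theta>. \<xi> \<in> \<Xi> \<Longrightarrow> \<theta> \<in> strip r \<Longrightarrow> \<theta> + z \<xi> \<theta> \<in> strip r'"
  shows "analytic_family \<Xi> (strip r) periods (\<lambda>\<xi> \<theta>. f \<xi> (\<theta> + z \<xi> \<theta>))"
proof (rule analytic_family_compose[OF f _ maps])
  show "analytic_family \<Xi> (strip r) {} (\<lambda>\<xi> \<theta>. (\<theta> + z \<xi> \<theta>) $ i)" for i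
    using analytic_family_add[OF analytic_family_component analytic_family_no_periods[OF z]] by simp
next
  fix \<xi> and \<theta> v :: "complex ^ 'n" assume a: "\<xi> \<in> \<Xi>" "\<theta> \<in> strip r" "v \<in> periods"
  have "z \<xi> (\<theta> + v) = z \<xi> \<theta>" using analytic_familyD(2)[OF z a] by (simp add: vec_eq_iff)
  then show "\<exists>v'\<in>insert 0 periods. \<theta> + v + z \<xi> (\<theta> + v) = \<theta> + z \<xi> \<theta> + v'"
    using a by (auto intro!: bexI[of _ v])
qed

section \<open>The Newton step\<close>

text \<open>
  The torus is \<open>\<theta> \<mapsto> (Y \<theta>, \<theta> + u \<theta>)\<close>, approximately invariant with frequency \<open>p + b\<close> and energy \<open>c\<close> for
  \<open>H = \<langle>\<omega>, y\<rangle> + \<Phi>\<close>; \<open>e\<close> bounds both errors and the last conjunct is isotropy, which holds exactly.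
\<close>

definition kam_state ::
  "'p::topological_space set \<Rightarrow> ('p \<Rightarrow> real ^ 'n) \<Rightarrow> ('p \<Rightarrow> complex ^ ('n::finite + 'n) \<Rightarrow> complex) \<Rightarrow> real ^ 'n \<Rightarrow>
   real \<Rightarrow> real \<Rightarrow> real \<Rightarrow> ('p \<Rightarrow> complex ^ 'n \<Rightarrow> complex ^ 'n) \<Rightarrow> ('p \<Rightarrow> complex ^ 'n \<Rightarrow> complex ^ 'n) \<Rightarrow>
   ('p \<Rightarrow> real ^ 'n) \<Rightarrow> ('p \<Rightarrow> real) \<Rightarrow> bool" where
  "kam_state \<Xi> \<omega> \<Phi> p r q e u Y b c \<longleftrightarrow>
     (\<forall>i. analytic_family \<Xi> (strip r) periods (\<lambda>\<xi> z. u \<xi> z $ i)) \<and>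
     (\<forall>i. analytic_family \<Xi> (strip r) periods (\<lambda>\<xi> z. Y \<xi> z $ i)) \<and>
     continuous_on \<Xi> b \<and> continuous_on \<Xi> c \<and>
     (\<forall>\<xi>\<in>\<Xi>. \<forall>z\<in>strip r.
        norm (u \<xi> z) \<le> q \<and> norm (Y \<xi> z) \<le> q \<and> (\<forall>i j. norm (dd (\<lambda>z. u \<xi> z $ i) (axis j 1) z) \<le> q) \<and>
        norm ((\<Sum>i\<in>UNIV. of_real (\<omega> \<xi> $ i) * Y \<xi> z $ i) + \<Phi> \<xi> (cjoin (Y \<xi> z) (z + u \<xi> z)) - of_real (c \<xi>)) \<le> e \<and>
        (\<forall>i. norm (of_real (\<omega> \<xi> $ i) + dd (\<Phi> \<xi>) (axis (Inl i) 1) (cjoin (Y \<xi> z) (z + u \<xi> z))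
             - (of_real ((p + b \<xi>) $ i) + dd (\<lambda>z. u \<xi> z $ i) (complexify (p + b \<xi>)) z)) \<le> e) \<and>
        (\<forall>h k. (\<Sum>i\<in>UNIV. (h $ i + dd (\<lambda>z. u \<xi> z $ i) h z) * dd (\<lambda>z. Y \<xi> z $ i) k z) =
               (\<Sum>i\<in>UNIV. (k $ i + dd (\<lambda>z. u \<xi> z $ i) k z) * dd (\<lambda>z. Y \<xi> z $ i) h z)))"

lemma norm_sum_le_card:
  fixes f :: "'n::finite \<Rightarrow> complex"
  assumes "\<And>i. norm (f i) \<le> B"
  shows "norm (\<Sum>i\<in>UNIV. f i) \<le> real CARD('n) * B"
  using sum_norm_le[of UNIV f "\<lambda>_. B"] assms by simp

text \<open>\<open>D\<close> absorbs the constants together with one homological equation and one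
  Cauchy estimate, \<open>d ^ (\<kappa> + 1)\<close> in total. The action correction is then at most
  \<open>D * e\<close>, the field to be straightened \<open>D ^ 2 * e\<close>, and the derivative of
  the change of angles \<open>D ^ 3 * e\<close>; the powers \<open>4\<close> and \<open>8\<close>
  are round upper bounds. The width is reduced five times: for \<open>s\<close> and its gradient,
  for \<open>z\<close> and its derivative, and for the composition with
  \<open>\<psi>\<close>.\<close>

lemma kam_step:
  fixes \<Xi> :: "'p::topological_space set" and p :: "real ^ 'n" and \<omega> :: "'p \<Rightarrow> real ^ 'n"
    and u Y :: "'p \<Rightarrow> complex ^ 'n \<Rightarrow> complex ^ 'n"
  defines "n \<equiv> real CARD('n)"
  assumes hom: "\<And>r f M d. analytic_family \<Xi> (strip r) periods f \<Longrightarrow>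
      (\<And>\<xi> z. \<xi> \<in> \<Xi> \<Longrightarrow> z \<in> strip r \<Longrightarrow> norm (f \<xi> z) \<le> M) \<Longrightarrow> 0 \<le> M \<Longrightarrow> 0 < d \<Longrightarrow> d \<le> 1 \<Longrightarrow> d < r \<Longrightarrow>
      \<exists>F m. analytic_family \<Xi> (strip (r - d)) periods F \<and> continuous_on \<Xi> m \<and>
        (\<forall>\<xi>\<in>\<Xi>. \<bar>m \<xi>\<bar> \<le> M \<and> (\<forall>z\<in>strip (r - d). norm (F \<xi> z) \<le> C0 * M / d ^ \<kappa> \<and>
           dd (F \<xi>) (complexify p) z = f \<xi> z - of_real (m \<xi>)))"
    and C0: "C0 \<ge> 1" and \<rho>: "0 < \<rho>" "\<rho> \<le> 1" and \<Phi>: "perturbation \<Xi> \<rho> 1 \<Phi>" and \<omega>: "continuous_on \<Xi> \<omega>"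
    and st: "kam_state \<Xi> \<omega> \<Phi> p r q e u Y b c"
    and r: "r \<le> \<rho> / 2" and q: "0 \<le> q" "q \<le> \<rho> / 8" "n\<^sup>2 * q \<le> 1 / 2"
    and d: "0 < d" "d \<le> \<rho> / 8" "5 * d < r" and e: "0 \<le> e" and h: "\<And>\<xi>. \<xi> \<in> \<Xi> \<Longrightarrow> norm (b \<xi>) \<le> h" "0 \<le> h"
    and K: "4 * n * C0 \<le> K" "2 * n * (1 + 256 / \<rho>\<^sup>2) \<le> K" "128 / \<rho>\<^sup>2 \<le> K" "2 \<le> K"
  defines "D \<equiv> K / d ^ (\<kappa> + 1)"
  assumes small: "D ^ 4 * e \<le> d"
  shows "\<exists>u' Y' b' c'. kam_state \<Xi> \<omega> \<Phi> p (r - 5 * d) (q + D ^ 4 * e) (D ^ 8 * e * (e + h)) u' Y' b' c' \<and>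
    (\<forall>\<xi>\<in>\<Xi>. norm (b' \<xi> - b \<xi>) \<le> D ^ 4 * e \<and>
      (\<forall>z\<in>strip (r - 5 * d). norm (u' \<xi> z - u \<xi> z) \<le> D ^ 4 * e \<and> norm (Y' \<xi> z - Y \<xi> z) \<le> D ^ 4 * e))"
proof -
  have n1: "n \<ge> 1" by (simp add: n_def)
  have d1: "d \<le> 1" using d \<rho> by simp
  have dk: "0 < d ^ k" "d ^ k \<le> 1" for k using d d1 by (auto intro: power_le_one)
  have D_ge: "D \<ge> K" unfolding D_def using dk[of "\<kappa>+1"] K by (simp add: pos_le_divide_eq mult_left_le)
  have D2: "D \<ge> 2" "D \<ge> 1" "D \<ge> 0" using D_ge K by auto
  have DC: "4 * n * C0 / d ^ (\<kappa> + 1) \<le> D" unfolding D_def using K dk[of "\<kappa>+1"] by (intro divide_right_mono) auto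
  have n4: "4 * n \<le> D"
  proof -
    have "4 * n * 1 \<le> 4 * n * C0" using C0 n1 by (intro mult_left_mono) auto
    then show ?thesis using D_ge K(1) by linarith
  qed
  have Dpow: "D ^ i \<le> D ^ j" if "i \<le> j" for i j using D2 that by (intro power_increasing) auto

  have fu: "analytic_family \<Xi> (strip r) periods (\<lambda>\<xi> z. u \<xi> z $ i)"
    and fY: "analytic_family \<Xi> (strip r) periods (\<lambda>\<xi> z. Y \<xi> z $ i)" for i
    using st by (auto simp: kam_state_def)
  have cb: "continuous_on \<Xi> b" and cc: "continuous_on \<Xi> c" using st by (auto simp: kam_state_def)
  define ju where "ju = (\<lambda>\<xi> z. cjoin (Y \<xi> z) (z + u \<xi> z))"
  define du where "du = (\<lambda>i j \<xi> z. dd (\<lambda>z. u \<xi> z $ i) (axis j 1) z)"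
  have bu: "norm (u \<xi> z) \<le> q" and bY: "norm (Y \<xi> z) \<le> q" and bdu: "norm (du i j \<xi> z) \<le> q"
    and bE1: "norm ((\<Sum>i\<in>UNIV. of_real (\<omega> \<xi> $ i) * Y \<xi> z $ i) + \<Phi> \<xi> (ju \<xi> z) - of_real (c \<xi>)) \<le> e"
    and bE2: "norm (of_real (\<omega> \<xi> $ i) + dd (\<Phi> \<xi>) (axis (Inl i) 1) (ju \<xi> z)
             - (of_real ((p + b \<xi>) $ i) + dd (\<lambda>z. u \<xi> z $ i) (complexify (p + b \<xi>)) z)) \<le> e"
    and lagr: "(\<Sum>i\<in>UNIV. (h $ i + dd (\<lambda>z. u \<xi> z $ i) h z) * dd (\<lambda>z. Y \<xi> z $ i) k z) =
               (\<Sum>i\<in>UNIV. (k $ i + dd (\<lambda>z. u \<xi> z $ i) k z) * dd (\<lambda>z. Y \<xi> z $ i) h z)"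
    if "\<xi> \<in> \<Xi>" "z \<in> strip r" for \<xi> z i j h k
    using st that unfolding kam_state_def ju_def du_def by blast+
  have hu: "hol (\<lambda>z. u \<xi> z $ i) (strip r)" and hY: "hol (\<lambda>z. Y \<xi> z $ i) (strip r)" if "\<xi> \<in> \<Xi>" for \<xi> i
    using analytic_familyD(1)[OF fu that] analytic_familyD(1)[OF fY that] .
  have sub: "strip (r - k * d) \<subseteq> strip r" if "k \<ge> 0" for k using d that by (intro strip_mono) auto
  have lin: "dd (\<lambda>z. u \<xi> z $ i) v z = (\<Sum>j\<in>UNIV. v $ j * du i j \<xi> z)" if "\<xi> \<in> \<Xi>" "z \<in> strip r" for \<xi> z i v
    unfolding du_def by (rule hol_dd_axis[OF hu[OF that(1)] that(2)])
  have comp_le: "norm (v $ i) \<le> norm v" for v :: "complex ^ 'n" and i by (rule Finite_Cartesian_Product.norm_nth_le)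
  have nq: "n * q \<le> 1 / 2"
  proof -
    have "n * q \<le> n\<^sup>2 * q" using n1 q by (intro mult_right_mono) (auto simp: power2_eq_square)
    then show ?thesis using q by simp
  qed
  have T_bound: "norm (v $ i + dd (\<lambda>z. u \<xi> z $ i) v z) \<le> 2 * norm v" if "\<xi> \<in> \<Xi>" "z \<in> strip r" for \<xi> z i v
  proof -
    have "norm (dd (\<lambda>z. u \<xi> z $ i) v z) \<le> n * (norm v * q)"
      unfolding lin[OF that] n_def
      by (rule norm_sum_le_card) (auto simp: norm_mult intro!: mult_mono comp_le bdu[OF that])
    also have "\<dots> = (n * q) * norm v" by simp
    also have "\<dots> \<le> 1 / 2 * norm v" using nq by (rule mult_right_mono) simp
    finally show ?thesis using norm_triangle_ineq[of "v $ i" "dd (\<lambda>z. u \<xi> z $ i) v z"] comp_le[of v i] norm_ge_zero[of v] by linarith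
  qed
  \<comment> \<open>The budget is \<open>r + q\<close>, at most
    \<open>5 * \<rho> / 8\<close>.\<close>
  have imz: "\<bar>Im ((z + u \<xi> z) $ i)\<bar> < 6 * \<rho> / 8" if "\<xi> \<in> \<Xi>" "z \<in> strip r" for \<xi> z i
  proof -
    have "\<bar>Im (z $ i)\<bar> < r" using that(2) unfolding strip_def by blast
    moreover have "\<bar>Im (u \<xi> z $ i)\<bar> \<le> q" using abs_Im_le_cmod[of "u \<xi> z $ i"] comp_le[of "u \<xi> z" i] bu[OF that] by linarith
    ultimately have "\<bar>Im (z $ i) + Im (u \<xi> z $ i)\<bar> < r + q" by linarith
    then show ?thesis using r q \<rho> by simp
  qed
  have ju_dom: "ju \<xi> z \<in> pdom (6 * \<rho> / 8)" if "\<xi> \<in> \<Xi>" "z \<in> strip r" for \<xi> z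
  proof -
    have "norm (Y \<xi> z $ i) < 6 * \<rho> / 8" for i using comp_le[of "Y \<xi> z" i] bY[OF that] q \<rho> by simp
    then show ?thesis using imz[OF that] by (simp add: pdom_def ju_def)
  qed
  have p78: "pdom (6 * \<rho> / 8) \<subseteq> pdom (7 * \<rho> / 8)" "pdom (6 * \<rho> / 8) \<subseteq> pdom \<rho>" using \<rho> by (intro pdom_mono; simp)+
  have f\<Phi>: "analytic_family \<Xi> (pdom \<rho>) xperiods \<Phi>" using \<Phi> by (simp add: perturbation_def)
  have f\<Phi>y: "analytic_family \<Xi> (pdom (7 * \<rho> / 8)) xperiods (\<lambda>\<xi>. dd (\<Phi> \<xi>) (axis k 1))" for k
    by (rule perturbation_grad(1)[OF \<Phi> \<rho>(1)])
  have f\<omega>: "analytic_family \<Xi> U \<Lambda> (\<lambda>\<xi> z. of_real (\<omega> \<xi> $ i))" for U \<Lambda> i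
    by (rule analytic_family_const) (auto intro!: continuous_intros \<omega>)
  have fpb: "analytic_family \<Xi> U \<Lambda> (\<lambda>\<xi> z. of_real ((p + b \<xi>) $ i))" for U \<Lambda> i
    by (rule analytic_family_const) (auto intro!: continuous_intros cb)

  \<comment> \<open>The Hamilton--Jacobi equation, linearised along the torus.\<close>
  define E1 where "E1 = (\<lambda>\<xi> z. (\<Sum>i\<in>UNIV. of_real (\<omega> \<xi> $ i) * Y \<xi> z $ i) + \<Phi> \<xi> (ju \<xi> z) - of_real (c \<xi>))"
  have fE1: "analytic_family \<Xi> (strip r) periods E1" unfolding E1_def ju_def
  proof (intro analytic_family_diff analytic_family_add analytic_family_sum analytic_family_mult f\<omega> fY
      analytic_family_torus_compose[OF f\<Phi> fu fY])
    show "cjoin (Y \<xi> z) (z + u \<xi> z) \<in> pdom \<rho>" if "\<xi> \<in> \<Xi>" "z \<in> strip r" for \<xi> z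
      using ju_dom[OF that] p78 by (auto simp: ju_def)
    show "analytic_family \<Xi> (strip r) periods (\<lambda>\<xi> z. of_real (c \<xi>))"
      by (rule analytic_family_const) (auto intro!: continuous_intros cc)
  qed
  \<comment> \<open>\<open>s\<close> is the generating function of the action correction; the mean
    \<open>m\<close> of the energy error is added to the energy level.\<close>
  obtain s m where fs: "analytic_family \<Xi> (strip (r - d)) periods s" and cm: "continuous_on \<Xi> m"
    and bs: "\<And>\<xi> z. \<xi> \<in> \<Xi> \<Longrightarrow> z \<in> strip (r - d) \<Longrightarrow> norm (s \<xi> z) \<le> C0 * e / d ^ \<kappa>"
    and ds_p: "\<And>\<xi> z. \<xi> \<in> \<Xi> \<Longrightarrow> z \<in> strip (r - d) \<Longrightarrow> dd (s \<xi>) (complexify p) z = E1 \<xi> z - of_real (m \<xi>)"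
    using hom[OF fE1 _ e d(1) d1, unfolded E1_def, OF bE1] d(1,3) unfolding E1_def by fastforce
  define a1 where "a1 = 2 * (C0 * e / d ^ \<kappa>) / d"
  have a1: "0 \<le> a1" using C0 e d by (simp add: a1_def)
  have hs: "hol (s \<xi>) (strip (r - d))" if "\<xi> \<in> \<Xi>" for \<xi> using analytic_familyD(1)[OF fs that] .
  have r2: "r - 2 * d = (r - d) - d" by simp
  have bds: "norm (dd (s \<xi>) v z) \<le> a1 * norm v" if "\<xi> \<in> \<Xi>" "z \<in> strip (r - 2 * d)" for \<xi> z v
    unfolding a1_def by (rule strip_Cauchy[OF hs[OF that(1)] bs[OF that(1)] that(2)[unfolded r2] d(1)])
  have fds: "analytic_family \<Xi> (strip (r - 2 * d)) periods (\<lambda>\<xi>. dd (s \<xi>) (axis i 1))" for i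
  proof -
    have "ball z d \<subseteq> strip (r - d)" if "z \<in> strip (r - 2 * d)" for z :: "complex ^ 'n"
      by (rule strip_ball[OF that[unfolded r2]])
    from analytic_family_dd[OF fs bs open_strip d(1) this strip_periods, where h="axis i 1"]
    show ?thesis by simp
  qed
  have fdu: "analytic_family \<Xi> (strip (r - 2 * d)) periods (du i j)" for i j
  proof -
    have "analytic_family \<Xi> (strip (r - d)) periods (\<lambda>\<xi>. dd (\<lambda>z. u \<xi> z $ i) (axis j 1))"
      using analytic_family_dd[OF fu _ open_strip d(1) strip_ball strip_periods, where h="axis j 1" and B=q]
        bu comp_le order_trans by fastforce
    then have "analytic_family \<Xi> (strip (r - 2 * d)) periods (\<lambda>\<xi>. dd (\<lambda>z. u \<xi> z $ i) (axis j 1))"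
      by (rule analytic_family_subset) (use d in \<open>auto intro!: strip_mono\<close>)
    then show ?thesis by (simp add: du_def)
  qed
  have s2: "z \<in> strip r" "z \<in> strip (r - d)" if "z \<in> strip (r - 2 * d)" for z :: "complex ^ 'n"
    using that strip_mono[of "r - 2 * d" r] strip_mono[of "r - 2 * d" "r - d"] d by auto
  \<comment> \<open>The transposed matrix is intended: \<open>\<eta>\<close> is minus the inverse
    transpose of the angle Jacobian applied to the gradient of \<open>s\<close>. Equivalently,
    pairing \<open>\<eta>\<close> with the derivative of the angle map gives the exact form
    \<open>- ds\<close>.\<close>
  obtain \<eta> :: "'p \<Rightarrow> complex ^ 'n \<Rightarrow> complex ^ 'n"
    where f\<eta>: "\<And>i. analytic_family \<Xi> (strip (r - 2 * d)) periods (\<lambda>\<xi> z. \<eta> \<xi> z $ i)"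
    and eq\<eta>: "\<And>\<xi> z i. \<xi> \<in> \<Xi> \<Longrightarrow> z \<in> strip (r - 2 * d) \<Longrightarrow>
        \<eta> \<xi> z $ i + (\<Sum>j\<in>UNIV. du j i \<xi> z * \<eta> \<xi> z $ j) = 0 - dd (s \<xi>) (axis i 1) z"
    and b\<eta>0: "\<And>\<xi> z. \<xi> \<in> \<Xi> \<Longrightarrow> z \<in> strip (r - 2 * d) \<Longrightarrow>
        norm (\<eta> \<xi> z) \<le> 2 * norm (\<chi> i. 0 - dd (s \<xi>) (axis i 1) z)"
  proof (rule analytic_family_solve[where E="\<lambda>i j. du j i" and b="\<lambda>i \<xi> z. 0 - dd (s \<xi>) (axis i 1) z"
      and U="strip (r - 2 * d)" and \<Lambda>=periods and \<Xi>=\<Xi> and q=q])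
    show "analytic_family \<Xi> (strip (r - 2 * d)) periods (\<lambda>\<xi> z. 0 - dd (s \<xi>) (axis i 1) z)" for i
      by (intro analytic_family_diff fds analytic_family_const) auto
  qed (use open_strip strip_periods fdu bdu s2 q n_def in auto)
  define a2 where "a2 = 2 * (n * a1)"
  have a2: "0 \<le> a2" using a1 n1 by (simp add: a2_def)
  have b\<eta>: "norm (\<eta> \<xi> z) \<le> a2" if "\<xi> \<in> \<Xi>" "z \<in> strip (r - 2 * d)" for \<xi> z
  proof -
    have "norm (\<chi> i. 0 - dd (s \<xi>) (axis i 1) z) \<le> n * a1"
      unfolding n_def by (rule norm_vec_le_card) (use bds[OF that, of "axis _ 1"] in simp)
    then show ?thesis using b\<eta>0[OF that] by (simp add: a2_def)
  qed
  have a2D: "a2 \<le> D * e"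
  proof -
    have "a2 = 4 * n * C0 / d ^ (\<kappa> + 1) * e" by (simp add: a2_def a1_def mult_ac)
    also have "\<dots> \<le> D * e" using DC e by (rule mult_right_mono)
    finally show ?thesis .
  qed
  have De_small: "D * e \<le> \<rho> / 16"
  proof -
    have "D * e * 2 \<le> D * e * D ^ 3" using D2 e power_increasing[of 1 3 D] by (intro mult_left_mono) auto
    also have "\<dots> = D ^ 4 * e" by (simp add: eval_nat_numeral)
    finally show ?thesis using small d by simp
  qed
  have \<eta>L: "(\<Sum>j\<in>UNIV. (v $ j + dd (\<lambda>z. u \<xi> z $ j) v z) * \<eta> \<xi> z $ j) = - dd (s \<xi>) v z"
    if a: "\<xi> \<in> \<Xi>" "z \<in> strip (r - 2 * d)" for \<xi> z v
  proof -
    have "(\<Sum>j\<in>UNIV. (v $ j + dd (\<lambda>z. u \<xi> z $ j) v z) * \<eta> \<xi> z $ j)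
        = (\<Sum>j\<in>UNIV. v $ j * \<eta> \<xi> z $ j) + (\<Sum>j\<in>UNIV. \<Sum>i\<in>UNIV. v $ i * (du j i \<xi> z * \<eta> \<xi> z $ j))"
      unfolding lin[OF a(1) s2(1)[OF a(2)]]
      by (simp add: ring_distribs sum.distrib sum_distrib_right mult.assoc)
    also have "(\<Sum>j\<in>UNIV. \<Sum>i\<in>UNIV. v $ i * (du j i \<xi> z * \<eta> \<xi> z $ j)) = (\<Sum>i\<in>UNIV. v $ i * (\<Sum>j\<in>UNIV. du j i \<xi> z * \<eta> \<xi> z $ j))"
      by (subst sum.swap) (simp add: sum_distrib_left)
    also have "(\<Sum>j\<in>UNIV. v $ j * \<eta> \<xi> z $ j) + \<dots> = (\<Sum>i\<in>UNIV. v $ i * (\<eta> \<xi> z $ i + (\<Sum>j\<in>UNIV. du j i \<xi> z * \<eta> \<xi> z $ j)))"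
      by (simp add: ring_distribs sum.distrib)
    also have "\<dots> = - (\<Sum>i\<in>UNIV. v $ i * dd (s \<xi>) (axis i 1) z)"
      unfolding eq\<eta>[OF a] by (simp add: sum_negf)
    also have "\<dots> = - dd (s \<xi>) v z" using hol_dd_axis[OF hs[OF a(1)] s2(2)[OF a(2)], of v] by simp
    finally show ?thesis .
  qed
  define j\<eta> where "j\<eta> = (\<lambda>\<xi> z. cjoin (Y \<xi> z + \<eta> \<xi> z) (z + u \<xi> z))"
  have j\<eta>_eq: "j\<eta> \<xi> z = ju \<xi> z + cjoin (\<eta> \<xi> z) 0" for \<xi> z
    by (simp add: j\<eta>_def ju_def vec_sum_eq_iff)
  have j\<eta>_dom: "j\<eta> \<xi> z \<in> pdom (6 * \<rho> / 8)" if "\<xi> \<in> \<Xi>" "z \<in> strip (r - 2 * d)" for \<xi> z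
  proof -
    have "norm ((Y \<xi> z + \<eta> \<xi> z) $ i) < 6 * \<rho> / 8" for i
    proof -
      have "norm (Y \<xi> z $ i + \<eta> \<xi> z $ i) \<le> q + a2"
        using norm_triangle_ineq[of "Y \<xi> z $ i" "\<eta> \<xi> z $ i"] comp_le[of "Y \<xi> z" i] comp_le[of "\<eta> \<xi> z" i]
          bY[OF that(1) s2(1)[OF that(2)]] b\<eta>[OF that] by linarith
      then show ?thesis using q a2D De_small \<rho> by simp
    qed
    then show ?thesis using imz[OF that(1) s2(1)[OF that(2)]] by (simp add: pdom_def j\<eta>_def)
  qed

  \<comment> \<open>The conjugacy equation.\<close>
  define P where "P = (\<lambda>\<xi>. complexify (p + b \<xi>))"
  define E2 where "E2 = (\<lambda>i \<xi> z. of_real (\<omega> \<xi> $ i) + dd (\<Phi> \<xi>) (axis (Inl i) 1) (ju \<xi> z)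
      - (of_real ((p + b \<xi>) $ i) + (\<Sum>j\<in>UNIV. of_real ((p + b \<xi>) $ j) * du i j \<xi> z)))"
  have E2_eq: "E2 i \<xi> z = of_real (\<omega> \<xi> $ i) + dd (\<Phi> \<xi>) (axis (Inl i) 1) (ju \<xi> z)
      - (P \<xi> $ i + dd (\<lambda>z. u \<xi> z $ i) (P \<xi>) z)" if "\<xi> \<in> \<Xi>" "z \<in> strip r" for i \<xi> z
    unfolding E2_def lin[OF that] P_def by simp
  have bE2': "norm (E2 i \<xi> z) \<le> e" if "\<xi> \<in> \<Xi>" "z \<in> strip r" for i \<xi> z
    using bE2[OF that, of i] unfolding E2_eq[OF that] P_def by simp
  define E1' where "E1' = (\<lambda>\<xi> z. (\<Sum>i\<in>UNIV. of_real (\<omega> \<xi> $ i) * (Y \<xi> z + \<eta> \<xi> z) $ i) + \<Phi> \<xi> (j\<eta> \<xi> z) - of_real (c \<xi> + m \<xi>))"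
  \<comment> \<open>Newton cancellation: the linear term pairs \<open>\<eta>\<close> with the
    \<open>y\<close>-gradient of \<open>H\<close>, which up to \<open>E2\<close> is the image of
    \<open>p + b\<close> under the angle Jacobian, and so equals minus the derivative of
    \<open>s\<close> along \<open>p + b\<close>. Its part along \<open>p\<close> cancels
    \<open>E1 - m\<close>; there remain the derivative along \<open>b\<close>, the product of
    \<open>E2\<close> and \<open>\<eta>\<close>, and the Taylor remainder.\<close>
  have bE1': "norm (E1' \<xi> z) \<le> a1 * h + n * (e * a2) + K * a2\<^sup>2" if a: "\<xi> \<in> \<Xi>" "z \<in> strip (r - 2 * d)" for \<xi> z
  proof -
    note zr = s2[OF a(2)]
    define R where "R = \<Phi> \<xi> (j\<eta> \<xi> z) - \<Phi> \<xi> (ju \<xi> z) - (\<Sum>i\<in>UNIV. \<eta> \<xi> z $ i * dd (\<Phi> \<xi>) (axis (Inl i) 1) (ju \<xi> z))"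
    have "norm (\<eta> \<xi> z) < \<rho> / 8" using b\<eta>[OF a] a2D De_small \<rho> by simp
    then have "norm R \<le> 128 * 1 / \<rho>\<^sup>2 * (norm (\<eta> \<xi> z))\<^sup>2"
      unfolding R_def j\<eta>_eq by (rule perturbation_Taylor[OF \<Phi> \<rho>(1) a(1) ju_dom[OF a(1) zr(1)]])
    also have "\<dots> \<le> K * a2\<^sup>2" using K b\<eta>[OF a] by (intro mult_mono power_mono) auto
    finally have bR: "norm R \<le> K * a2\<^sup>2" .
    have dsP: "dd (s \<xi>) (P \<xi>) z = (E1 \<xi> z - of_real (m \<xi>)) + dd (s \<xi>) (complexify (b \<xi>)) z"
      unfolding P_def complexify_add hol_dd_add[OF hs[OF a(1)] zr(2)] ds_p[OF a(1) zr(2)] ..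
    have "E1' \<xi> z = E1 \<xi> z - of_real (m \<xi>) + (\<Sum>i\<in>UNIV. (of_real (\<omega> \<xi> $ i) + dd (\<Phi> \<xi>) (axis (Inl i) 1) (ju \<xi> z)) * \<eta> \<xi> z $ i) + R"
      by (simp add: E1'_def E1_def R_def ring_distribs sum.distrib mult.commute)
    also have "(\<Sum>i\<in>UNIV. (of_real (\<omega> \<xi> $ i) + dd (\<Phi> \<xi>) (axis (Inl i) 1) (ju \<xi> z)) * \<eta> \<xi> z $ i)
        = (\<Sum>i\<in>UNIV. (P \<xi> $ i + dd (\<lambda>z. u \<xi> z $ i) (P \<xi>) z) * \<eta> \<xi> z $ i) + (\<Sum>i\<in>UNIV. E2 i \<xi> z * \<eta> \<xi> z $ i)"
      unfolding E2_eq[OF a(1) zr(1)] by (simp add: sum.distrib[symmetric] ring_distribs)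
    also have "(\<Sum>i\<in>UNIV. (P \<xi> $ i + dd (\<lambda>z. u \<xi> z $ i) (P \<xi>) z) * \<eta> \<xi> z $ i) = - dd (s \<xi>) (P \<xi>) z"
      by (rule \<eta>L[OF a])
    finally have "E1' \<xi> z = - dd (s \<xi>) (complexify (b \<xi>)) z + (\<Sum>i\<in>UNIV. E2 i \<xi> z * \<eta> \<xi> z $ i) + R"
      unfolding dsP by simp
    moreover have "norm (dd (s \<xi>) (complexify (b \<xi>)) z) \<le> a1 * h"
      using bds[OF a, of "complexify (b \<xi>)"] mult_left_mono[OF h(1)[OF a(1)] a1] by simp
    moreover have "norm (\<Sum>i\<in>UNIV. E2 i \<xi> z * \<eta> \<xi> z $ i) \<le> n * (e * a2)" unfolding n_def
      by (rule norm_sum_le_card)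
        (use e bE2'[OF a(1) zr(1)] b\<eta>[OF a] comp_le[of "\<eta> \<xi> z"] in \<open>auto simp: norm_mult intro!: mult_mono intro: order_trans\<close>)
    ultimately show ?thesis using bR
      norm_triangle_ineq[of "- dd (s \<xi>) (complexify (b \<xi>)) z + (\<Sum>i\<in>UNIV. E2 i \<xi> z * \<eta> \<xi> z $ i)" R]
      norm_triangle_ineq[of "- dd (s \<xi>) (complexify (b \<xi>)) z" "\<Sum>i\<in>UNIV. E2 i \<xi> z * \<eta> \<xi> z $ i"] by simp
  qed
  \<comment> \<open>The conjugacy error once the actions have moved to
    \<open>Y + \<eta>\<close>.\<close>
  define rhs where "rhs = (\<lambda>i \<xi> z. E2 i \<xi> z + (dd (\<Phi> \<xi>) (axis (Inl i) 1) (j\<eta> \<xi> z) - dd (\<Phi> \<xi>) (axis (Inl i) 1) (ju \<xi> z)))"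
  have frhs: "analytic_family \<Xi> (strip (r - 2 * d)) periods (rhs i)" for i
  proof -
    have fu2: "analytic_family \<Xi> (strip (r - 2 * d)) periods (\<lambda>\<xi> z. u \<xi> z $ i)"
      and fY2: "analytic_family \<Xi> (strip (r - 2 * d)) periods (\<lambda>\<xi> z. Y \<xi> z $ i)" for i
      using analytic_family_subset[OF fu subset_refl sub[of 2]] analytic_family_subset[OF fY subset_refl sub[of 2]] by auto
    have fY\<eta>: "analytic_family \<Xi> (strip (r - 2 * d)) periods (\<lambda>\<xi> z. (Y \<xi> z + \<eta> \<xi> z) $ i)" for i
      using analytic_family_add[OF fY2 f\<eta>] by simp
    have 1: "analytic_family \<Xi> (strip (r - 2 * d)) periods (\<lambda>\<xi> z. dd (\<Phi> \<xi>) (axis (Inl i) 1) (ju \<xi> z))"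
      unfolding ju_def by (rule analytic_family_torus_compose[OF f\<Phi>y fu2 fY2])
        (use ju_dom s2 p78 in \<open>force simp: ju_def\<close>)
    have 2: "analytic_family \<Xi> (strip (r - 2 * d)) periods (\<lambda>\<xi> z. dd (\<Phi> \<xi>) (axis (Inl i) 1) (j\<eta> \<xi> z))"
      unfolding j\<eta>_def by (rule analytic_family_torus_compose[OF f\<Phi>y fu2 fY\<eta>])
        (use j\<eta>_dom s2 p78 in \<open>force simp: j\<eta>_def\<close>)
    show ?thesis unfolding rhs_def E2_def
      by (intro analytic_family_add analytic_family_diff analytic_family_sum analytic_family_mult 1 2 fpb f\<omega> fdu)
  qed
  have brhs: "norm (rhs i \<xi> z) \<le> e + 256 / \<rho>\<^sup>2 * a2" if a: "\<xi> \<in> \<Xi>" "z \<in> strip (r - 2 * d)" for i \<xi> z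
  proof -
    have "norm (dd (\<Phi> \<xi>) (axis (Inl i) 1) (j\<eta> \<xi> z) - dd (\<Phi> \<xi>) (axis (Inl i) 1) (ju \<xi> z)) \<le> 256 * 1 / \<rho>\<^sup>2 * norm (j\<eta> \<xi> z - ju \<xi> z)"
      by (rule perturbation_grad_Lipschitz[OF \<Phi> \<rho>(1) a(1) ju_dom[OF a(1) s2(1)[OF a(2)]] j\<eta>_dom[OF a]])
    also have "\<dots> \<le> 256 / \<rho>\<^sup>2 * a2" using b\<eta>[OF a] by (simp add: j\<eta>_eq divide_right_mono)
    finally show ?thesis
      unfolding rhs_def using bE2'[OF a(1) s2(1)[OF a(2)], of i] norm_triangle_ineq order_trans add_mono by meson
  qed
  \<comment> \<open>Pulling the error back by the angle Jacobian gives a vector field on the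
    parameter torus: at the moved actions the angular velocity is exactly the image of
    \<open>P + g\<close>.\<close>
  obtain g :: "'p \<Rightarrow> complex ^ 'n \<Rightarrow> complex ^ 'n"
    where fg: "\<And>i. analytic_family \<Xi> (strip (r - 2 * d)) periods (\<lambda>\<xi> z. g \<xi> z $ i)"
    and eqg: "\<And>\<xi> z i. \<xi> \<in> \<Xi> \<Longrightarrow> z \<in> strip (r - 2 * d) \<Longrightarrow>
        g \<xi> z $ i + (\<Sum>j\<in>UNIV. du i j \<xi> z * g \<xi> z $ j) = rhs i \<xi> z"
    and bg0: "\<And>\<xi> z. \<xi> \<in> \<Xi> \<Longrightarrow> z \<in> strip (r - 2 * d) \<Longrightarrow> norm (g \<xi> z) \<le> 2 * norm (\<chi> i. rhs i \<xi> z)"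
    by (rule analytic_family_solve[where E=du and b=rhs and U="strip (r - 2 * d)" and \<Lambda>=periods and \<Xi>=\<Xi> and q=q])
      (use open_strip strip_periods fdu bdu s2 q n_def frhs in auto)
  define a3 where "a3 = 2 * (n * (e + 256 / \<rho>\<^sup>2 * a2))"
  have a3: "0 \<le> a3" using a2 e n1 by (simp add: a3_def)
  have bg: "norm (g \<xi> z) \<le> a3" if a: "\<xi> \<in> \<Xi>" "z \<in> strip (r - 2 * d)" for \<xi> z
  proof -
    have "norm (\<chi> i. rhs i \<xi> z) \<le> n * (e + 256 / \<rho>\<^sup>2 * a2)"
      unfolding n_def by (rule norm_vec_le_card) (use brhs[OF a] in simp)
    then show ?thesis using bg0[OF a] by (simp add: a3_def)
  qed
  have a3D: "a3 \<le> D ^ 2 * e"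
  proof -
    have "e \<le> D * e" using D2 e by (simp add: mult_le_cancel_right1)
    then have "a3 \<le> 2 * (n * (D * e + 256 / \<rho>\<^sup>2 * (D * e)))"
      unfolding a3_def using a2D n1 by (intro mult_left_mono add_mono) auto
    also have "\<dots> = (2 * n * (1 + 256 / \<rho>\<^sup>2)) * (D * e)" by (simp add: algebra_simps)
    also have "\<dots> \<le> D * (D * e)" using K D_ge D2 e by (intro mult_right_mono) auto
    finally show ?thesis by (simp add: power2_eq_square)
  qed
  have geq: "g \<xi> z $ i + dd (\<lambda>z. u \<xi> z $ i) (g \<xi> z) z = rhs i \<xi> z" if a: "\<xi> \<in> \<Xi>" "z \<in> strip (r - 2 * d)" for \<xi> z i
    using eqg[OF a, of i] unfolding lin[OF a(1) s2(1)[OF a(2)]] by (simp add: mult.commute)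

  \<comment> \<open>Straightening the field \<open>P + g\<close> by a change of the torus
    parameter\<close>
  define a4' where "a4' = C0 * a3 / d ^ \<kappa>"
  define Q where "Q = (\<lambda>i F m. analytic_family \<Xi> (strip (r - 2 * d - d)) periods F \<and> continuous_on \<Xi> m \<and>
        (\<forall>\<xi>\<in>\<Xi>. \<bar>m \<xi>\<bar> \<le> a3 \<and> (\<forall>z\<in>strip (r - 2 * d - d). norm (F \<xi> z) \<le> a4' \<and>
           dd (F \<xi>) (complexify p) z = g \<xi> z $ i - of_real (m \<xi>))))"
  have "\<exists>F m. Q i F m" for i
    unfolding Q_def a4'_def
  proof (rule hom[OF fg _ a3 d(1) d1])
    show "norm (g \<xi> z $ i) \<le> a3" if "\<xi> \<in> \<Xi>" "z \<in> strip (r - 2 * d)" for \<xi> z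
      using comp_le[of "g \<xi> z" i] bg[OF that] by linarith
    show "d < r - 2 * d" using d by simp
  qed
  then obtain Fz mz where Q: "Q i (Fz i) (mz i)" for i by metis
  have Fz: "analytic_family \<Xi> (strip (r - 2 * d - d)) periods (Fz i)" "continuous_on \<Xi> (mz i)"
    "\<xi> \<in> \<Xi> \<Longrightarrow> \<bar>mz i \<xi>\<bar> \<le> a3"
    "\<xi> \<in> \<Xi> \<Longrightarrow> z \<in> strip (r - 2 * d - d) \<Longrightarrow> norm (Fz i \<xi> z) \<le> a4'"
    "\<xi> \<in> \<Xi> \<Longrightarrow> z \<in> strip (r - 2 * d - d) \<Longrightarrow> dd (Fz i \<xi>) (complexify p) z = g \<xi> z $ i - of_real (mz i \<xi>)" for i \<xi> z
    using Q[of i] unfolding Q_def by blast+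
  define z where "z = (\<lambda>\<xi> \<theta>. \<chi> i. Fz i \<xi> \<theta>)"
  define b1 :: "'p \<Rightarrow> real ^ 'n" where "b1 = (\<lambda>\<xi>. \<chi> i. mz i \<xi>)"
  define a5 where "a5 = 2 * a4' / d"
  have a4': "0 \<le> a4'" using C0 a3 d by (simp add: a4'_def)
  have a5: "0 \<le> a5" using a4' d by (simp add: a5_def)
  have na5: "2 * (n * a5) \<le> D ^ 3 * e"
  proof -
    have "2 * (n * a5) = 4 * n * C0 / d ^ (\<kappa> + 1) * a3" by (simp add: a5_def a4'_def mult_ac)
    also have "\<dots> \<le> D * (D ^ 2 * e)" using DC a3D a3 D2 by (intro mult_mono) auto
    finally show ?thesis by (simp add: eval_nat_numeral)
  qed
  have a5_le: "a5 \<le> n * a5" using mult_right_mono[OF n1 a5] by simp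
  have na4: "n * a4' = (n * a5) * (d / 2)" using d by (simp add: a5_def)
  have na4_le: "n * a4' \<le> n * a5 / 2"
    unfolding na4 using mult_left_mono[OF d1, of "n * a5"] a5 n1 by simp
  have a4_le: "a4' \<le> n * a4'" using mult_right_mono[OF n1 a4'] by simp
  have De34: "D ^ 3 * e \<le> D ^ 4 * e" "D ^ 2 * e \<le> D ^ 3 * e" "D * e \<le> D ^ 2 * e" "2 * (D ^ 3 * e) \<le> D ^ 4 * e"
    using Dpow[of 3 4] Dpow[of 2 3] Dpow[of 1 2] e mult_right_mono[OF D2(1), of "D ^ 3 * e"] D2
    by (auto intro!: mult_right_mono simp: eval_nat_numeral mult.assoc)
  have fz: "analytic_family \<Xi> (strip (r - 3 * d)) periods (\<lambda>\<xi> \<theta>. z \<xi> \<theta> $ i)" for i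
    using Fz(1)[of i] by (simp add: z_def)
  have hz: "hol (\<lambda>\<theta>. z \<xi> \<theta> $ i) (strip (r - 3 * d))" if "\<xi> \<in> \<Xi>" for \<xi> i using analytic_familyD(1)[OF fz that] .
  have bzi: "norm (z \<xi> \<theta> $ i) \<le> a4'" if "\<xi> \<in> \<Xi>" "\<theta> \<in> strip (r - 3 * d)" for \<xi> \<theta> i
    using Fz(4)[of \<xi> \<theta> i] that by (simp add: z_def)
  have bz: "norm (z \<xi> \<theta>) \<le> n * a4'" if "\<xi> \<in> \<Xi>" "\<theta> \<in> strip (r - 3 * d)" for \<xi> \<theta>
    unfolding n_def by (rule norm_vec_le_card) (rule bzi[OF that])
  have dzp: "dd (\<lambda>\<theta>. z \<xi> \<theta> $ i) (complexify p) \<theta> = g \<xi> \<theta> $ i - of_real (b1 \<xi> $ i)" if "\<xi> \<in> \<Xi>" "\<theta> \<in> strip (r - 3 * d)" for \<xi> \<theta> i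
    using Fz(5)[of \<xi> \<theta> i] that by (simp add: z_def b1_def)
  have bdz: "norm (dd (\<lambda>\<theta>. z \<xi> \<theta> $ i) v \<theta>) \<le> a5 * norm v" if "\<xi> \<in> \<Xi>" "\<theta> \<in> strip (r - 4 * d)" for \<xi> \<theta> i v
    unfolding a5_def by (rule strip_Cauchy[OF hz[OF that(1)] bzi[OF that(1)] _ d(1)]) (use that(2) in \<open>auto simp: algebra_simps\<close>)
  have bb1: "norm (b1 \<xi>) \<le> n * a3" if "\<xi> \<in> \<Xi>" for \<xi>
  proof -
    have "norm (complexify (b1 \<xi>)) \<le> n * a3" unfolding n_def
      by (rule norm_vec_le_card) (use Fz(3)[OF that] in \<open>simp add: b1_def\<close>)
    then show ?thesis by simp
  qed
  have cb1: "continuous_on \<Xi> b1" unfolding b1_def by (intro continuous_on_vec_lambda Fz(2))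
  have st: "strip (r - 5 * d) \<subseteq> strip (r - 4 * d)" "strip (r - 4 * d) \<subseteq> strip (r - 3 * d)"
    "strip (r - 3 * d) \<subseteq> strip (r - 2 * d)" "strip (r - 2 * d) \<subseteq> strip (r - d)" "strip (r - d) \<subseteq> strip r"
    using d by (auto intro!: strip_mono)
  \<comment> \<open>To first order this map carries the constant field \<open>P + b1\<close> to
    \<open>P + g\<close>. Being a reparametrisation it leaves the image torus, and so its energy,
    unchanged.\<close>
  define \<psi> where "\<psi> = (\<lambda>\<xi> \<theta>. \<theta> + z \<xi> \<theta>)"
  have \<psi>_strip: "\<psi> \<xi> \<theta> \<in> strip (r - 4 * d)" if "\<xi> \<in> \<Xi>" "\<theta> \<in> strip (r - 5 * d)" for \<xi> \<theta>
    unfolding \<psi>_def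
  proof (rule strip_add)
    show "\<theta> \<in> strip (r - 4 * d - d)" using that by (simp add: algebra_simps)
    have "\<theta> \<in> strip (r - 3 * d)" using that st by blast
    then show "norm (z \<xi> \<theta> $ i) \<le> d" for i
      using bzi[OF that(1), of \<theta> i] a4_le na4_le na5 De34 small a5 n1 mult_nonneg_nonneg[of n a5] by linarith
  qed
  define v\<psi> where "v\<psi> = (\<lambda>\<xi> \<theta> v. \<chi> l. v $ l + dd (\<lambda>\<theta>. z \<xi> \<theta> $ l) v \<theta>)"
  have hol\<psi>: "hol (\<lambda>\<theta>. \<psi> \<xi> \<theta> $ l) (strip (r - 5 * d))"
    and vdd\<psi>: "\<theta> \<in> strip (r - 5 * d) \<Longrightarrow> vdd (\<psi> \<xi>) v \<theta> = v\<psi> \<xi> \<theta> v" if \<xi>: "\<xi> \<in> \<Xi>" for \<xi> l \<theta> v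
  proof -
    have hz5: "hol (\<lambda>\<theta>. z \<xi> \<theta> $ l) (strip (r - 5 * d))" for l by (rule hol_subset[OF hz[OF \<xi>]]) (use st in blast)
    show "hol (\<lambda>\<theta>. \<psi> \<xi> \<theta> $ l) (strip (r - 5 * d))" unfolding \<psi>_def
      using hol_add(1)[OF hol_component hz5] by simp
    show "vdd (\<psi> \<xi>) v \<theta> = v\<psi> \<xi> \<theta> v" if "\<theta> \<in> strip (r - 5 * d)"
      unfolding vdd_def v\<psi>_def \<psi>_def using hol_add(2)[OF hol_component hz5 that] by (simp add: vec_eq_iff)
  qed
  have chain: "hol (\<lambda>\<theta>. f (\<psi> \<xi> \<theta>)) (strip (r - 5 * d))"
    "\<theta> \<in> strip (r - 5 * d) \<Longrightarrow> dd (\<lambda>\<theta>. f (\<psi> \<xi> \<theta>)) v \<theta> = dd f (v\<psi> \<xi> \<theta> v) (\<psi> \<xi> \<theta>)"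
    if "hol f (strip (r - 2 * d))" "\<xi> \<in> \<Xi>" for f \<xi> \<theta> v
  proof -
    have m: "\<psi> \<xi> \<theta> \<in> strip (r - 2 * d)" if "\<theta> \<in> strip (r - 5 * d)" for \<theta>
      using \<psi>_strip[OF \<open>\<xi> \<in> \<Xi>\<close> that] st by blast
    note hc = hol_compose[OF that(1) hol\<psi>[OF that(2)] m]
    show "hol (\<lambda>\<theta>. f (\<psi> \<xi> \<theta>)) (strip (r - 5 * d))" by (rule hc(1))
    show "\<theta> \<in> strip (r - 5 * d) \<Longrightarrow> dd (\<lambda>\<theta>. f (\<psi> \<xi> \<theta>)) v \<theta> = dd f (v\<psi> \<xi> \<theta> v) (\<psi> \<xi> \<theta>)"
      using hc(2) vdd\<psi>[OF that(2)] by simp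
  qed
  define u' where "u' = (\<lambda>\<xi> \<theta>. z \<xi> \<theta> + u \<xi> (\<psi> \<xi> \<theta>))"
  define Y' where "Y' = (\<lambda>\<xi> \<theta>. Y \<xi> (\<psi> \<xi> \<theta>) + \<eta> \<xi> (\<psi> \<xi> \<theta>))"
  have X': "\<theta> + u' \<xi> \<theta> = \<psi> \<xi> \<theta> + u \<xi> (\<psi> \<xi> \<theta>)" for \<xi> \<theta> by (simp add: u'_def \<psi>_def)
  have fu': "analytic_family \<Xi> (strip (r - 5 * d)) periods (\<lambda>\<xi> \<theta>. u' \<xi> \<theta> $ i)"
    and fY': "analytic_family \<Xi> (strip (r - 5 * d)) periods (\<lambda>\<xi> \<theta>. Y' \<xi> \<theta> $ i)" for i
  proof -
    have fz5: "analytic_family \<Xi> (strip (r - 5 * d)) periods (\<lambda>\<xi> \<theta>. z \<xi> \<theta> $ i)" for i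
      by (rule analytic_family_subset[OF fz]) (use st in auto)
    have cmp: "analytic_family \<Xi> (strip (r - 5 * d)) periods (\<lambda>\<xi> \<theta>. f \<xi> (\<psi> \<xi> \<theta>))"
      if "analytic_family \<Xi> (strip (r - 2 * d)) periods f" for f
      unfolding \<psi>_def
      by (rule analytic_family_near_identity_compose[OF that fz5]) (use \<psi>_strip[unfolded \<psi>_def] st in blast)
    have 1: "analytic_family \<Xi> (strip (r - 2 * d)) periods (\<lambda>\<xi> z. u \<xi> z $ i)"
      "analytic_family \<Xi> (strip (r - 2 * d)) periods (\<lambda>\<xi> z. Y \<xi> z $ i)"
      using analytic_family_subset[OF fu subset_refl sub[of 2]] analytic_family_subset[OF fY subset_refl sub[of 2]] by auto
    show "analytic_family \<Xi> (strip (r - 5 * d)) periods (\<lambda>\<xi> \<theta>. u' \<xi> \<theta> $ i)"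
      unfolding u'_def using analytic_family_add[OF fz5 cmp[OF 1(1)]] by simp
    show "analytic_family \<Xi> (strip (r - 5 * d)) periods (\<lambda>\<xi> \<theta>. Y' \<xi> \<theta> $ i)"
      unfolding Y'_def using analytic_family_add[OF cmp[OF 1(2)] cmp[OF f\<eta>]] by simp
  qed
  have h2: "hol (\<lambda>z. u \<xi> z $ i) (strip (r - 2 * d))" "hol (\<lambda>z. Y \<xi> z $ i) (strip (r - 2 * d))"
    "hol (\<lambda>z. \<eta> \<xi> z $ i) (strip (r - 2 * d))" if "\<xi> \<in> \<Xi>" for \<xi> i
    using hol_subset[OF hu[OF that]] hol_subset[OF hY[OF that]] sub[of 2] analytic_familyD(1)[OF f\<eta> that] by auto
  have ddu': "dd (\<lambda>\<theta>. u' \<xi> \<theta> $ i) v \<theta> = dd (\<lambda>\<theta>. z \<xi> \<theta> $ i) v \<theta> + dd (\<lambda>z. u \<xi> z $ i) (v\<psi> \<xi> \<theta> v) (\<psi> \<xi> \<theta>)"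
    and ddY': "dd (\<lambda>\<theta>. Y' \<xi> \<theta> $ i) v \<theta> = dd (\<lambda>z. Y \<xi> z $ i) (v\<psi> \<xi> \<theta> v) (\<psi> \<xi> \<theta>) + dd (\<lambda>z. \<eta> \<xi> z $ i) (v\<psi> \<xi> \<theta> v) (\<psi> \<xi> \<theta>)"
    if a: "\<xi> \<in> \<Xi>" "\<theta> \<in> strip (r - 5 * d)" for \<xi> \<theta> i v
  proof -
    have hz5: "hol (\<lambda>\<theta>. z \<xi> \<theta> $ i) (strip (r - 5 * d))" by (rule hol_subset[OF hz[OF a(1)]]) (use st in blast)
    show "dd (\<lambda>\<theta>. u' \<xi> \<theta> $ i) v \<theta> = dd (\<lambda>\<theta>. z \<xi> \<theta> $ i) v \<theta> + dd (\<lambda>z. u \<xi> z $ i) (v\<psi> \<xi> \<theta> v) (\<psi> \<xi> \<theta>)"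
      unfolding u'_def using hol_add(2)[OF hz5 chain(1)[OF h2(1)[OF a(1)] a(1)] a(2)] chain(2)[OF h2(1)[OF a(1)] a] by simp
    show "dd (\<lambda>\<theta>. Y' \<xi> \<theta> $ i) v \<theta> = dd (\<lambda>z. Y \<xi> z $ i) (v\<psi> \<xi> \<theta> v) (\<psi> \<xi> \<theta>) + dd (\<lambda>z. \<eta> \<xi> z $ i) (v\<psi> \<xi> \<theta> v) (\<psi> \<xi> \<theta>)"
      unfolding Y'_def using hol_add(2)[OF chain(1)[OF h2(2)[OF a(1)] a(1)] chain(1)[OF h2(3)[OF a(1)] a(1)] a(2)]
        chain(2)[OF h2(2)[OF a(1)] a] chain(2)[OF h2(3)[OF a(1)] a] by simp
  qed
  have T': "v $ i + dd (\<lambda>\<theta>. u' \<xi> \<theta> $ i) v \<theta> = v\<psi> \<xi> \<theta> v $ i + dd (\<lambda>z. u \<xi> z $ i) (v\<psi> \<xi> \<theta> v) (\<psi> \<xi> \<theta>)"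
    if a: "\<xi> \<in> \<Xi>" "\<theta> \<in> strip (r - 5 * d)" for \<xi> \<theta> i v
    unfolding ddu'[OF a] by (simp add: v\<psi>_def)
  \<comment> \<open>The identity \<open>\<eta>L\<close> for direction \<open>h\<close> is
    differentiated along \<open>k\<close>. Interchanging \<open>h\<close> and \<open>k\<close>
    changes only second derivatives of \<open>s\<close> and \<open>u\<close>, which are
    symmetric.\<close>
  have lagr\<eta>: "(\<Sum>i\<in>UNIV. (h $ i + dd (\<lambda>z. u \<xi> z $ i) h w) * dd (\<lambda>z. \<eta> \<xi> z $ i) k w) =
      (\<Sum>i\<in>UNIV. (k $ i + dd (\<lambda>z. u \<xi> z $ i) k w) * dd (\<lambda>z. \<eta> \<xi> z $ i) h w)"
    if a: "\<xi> \<in> \<Xi>" "w \<in> strip (r - 2 * d)" for \<xi> w h k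
  proof -
    have hdu: "hol (dd (\<lambda>z. u \<xi> z $ i) h) (strip (r - 2 * d))" for i h by (rule hol_dd[OF h2(1)[OF a(1)] open_strip])
    have hT: "hol (\<lambda>z. h $ i + dd (\<lambda>z. u \<xi> z $ i) h z) (strip (r - 2 * d))"
      and dT: "dd (\<lambda>z. h $ i + dd (\<lambda>z. u \<xi> z $ i) h z) k w = dd (dd (\<lambda>z. u \<xi> z $ i) h) k w" for i h k
      using hol_add[OF hol_const[of "h $ i"] hdu[of i h]] a(2) by auto
    have key: "(\<Sum>i\<in>UNIV. (h $ i + dd (\<lambda>z. u \<xi> z $ i) h w) * dd (\<lambda>z. \<eta> \<xi> z $ i) k w)
        = - dd (dd (s \<xi>) h) k w - (\<Sum>i\<in>UNIV. dd (dd (\<lambda>z. u \<xi> z $ i) h) k w * \<eta> \<xi> w $ i)" for h k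
    proof -
      have "dd (\<lambda>z. \<Sum>i\<in>UNIV. (h $ i + dd (\<lambda>z. u \<xi> z $ i) h z) * \<eta> \<xi> z $ i) k w
          = (\<Sum>i\<in>UNIV. (h $ i + dd (\<lambda>z. u \<xi> z $ i) h w) * dd (\<lambda>z. \<eta> \<xi> z $ i) k w + dd (dd (\<lambda>z. u \<xi> z $ i) h) k w * \<eta> \<xi> w $ i)"
        by (subst hol_sum(2)[OF hol_mult(1)[OF hT h2(3)[OF a(1)]] a(2)])
          (simp add: hol_mult(2)[OF hT h2(3)[OF a(1)] a(2)] dT)
      moreover have "dd (\<lambda>z. \<Sum>i\<in>UNIV. (h $ i + dd (\<lambda>z. u \<xi> z $ i) h z) * \<eta> \<xi> z $ i) k w = dd (\<lambda>z. - 1 * dd (s \<xi>) h z) k w"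
        by (rule dd_cong[OF open_strip a(2)]) (use \<eta>L[OF a(1)] in simp)
      moreover have "dd (\<lambda>z. - 1 * dd (s \<xi>) h z) k w = - 1 * dd (dd (s \<xi>) h) k w"
        by (rule hol_cmult(2)[OF hol_dd[OF hs[OF a(1)] open_strip] s2(2)[OF a(2)]])
      ultimately show ?thesis by (simp add: sum.distrib eq_diff_eq)
    qed
    show ?thesis unfolding key[of h k] key[of k h]
      using dd_commute[OF hs[OF a(1)] open_strip s2(2)[OF a(2)], of h k]
        dd_commute[OF h2(1)[OF a(1)] open_strip a(2), of _ h k] by simp
  qed
  \<comment> \<open>The displacement of \<open>\<psi>\<close> is at most \<open>n * a4'\<close>,
    that is \<open>n * a5 * d / 2\<close>, so the divisor \<open>d\<close> of the Cauchy estimate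
    cancels.\<close>
  have Lip: "norm (f (\<psi> \<xi> \<theta>) - f \<theta>) \<le> B * (n * a5)"
    if "hol f (strip (r - 2 * d))" "\<And>x. x \<in> strip (r - 2 * d) \<Longrightarrow> norm (f x) \<le> B" "0 \<le> B" and a: "\<xi> \<in> \<Xi>" "\<theta> \<in> strip (r - 5 * d)"
    for f B \<xi> \<theta>
  proof -
    have "norm (f (\<psi> \<xi> \<theta>) - f \<theta>) \<le> 2 * B / d * norm (\<psi> \<xi> \<theta> - \<theta>)"
      by (rule strip_Lipschitz[OF that(1,2) _ _ d(1)]) (use a(2) \<psi>_strip[OF a] st in \<open>auto simp: algebra_simps\<close>)
    also have "\<dots> \<le> 2 * B / d * (n * a4')"
    proof (rule mult_left_mono)
      show "norm (\<psi> \<xi> \<theta> - \<theta>) \<le> n * a4'" unfolding \<psi>_def using bz[OF a(1)] a(2) st by auto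
    qed (use that(3) d in auto)
    also have "\<dots> = B * (n * a5)" unfolding na4 using d by simp
    finally show ?thesis .
  qed

  \<comment> \<open>Estimates for the new state\<close>
  define b' where "b' = (\<lambda>\<xi>. b \<xi> + b1 \<xi>)"
  define c' where "c' = (\<lambda>\<xi>. c \<xi> + m \<xi>)"
  have bnd: "norm (u' \<xi> \<theta>) \<le> q + D ^ 4 * e \<and> norm (Y' \<xi> \<theta>) \<le> q + D ^ 4 * e \<and>
      (\<forall>i j. norm (dd (\<lambda>\<theta>. u' \<xi> \<theta> $ i) (axis j 1) \<theta>) \<le> q + D ^ 4 * e)" if a: "\<xi> \<in> \<Xi>" "\<theta> \<in> strip (r - 5 * d)" for \<xi> \<theta>
  proof (intro conjI allI)
    have w: "\<psi> \<xi> \<theta> \<in> strip (r - 2 * d)" "\<psi> \<xi> \<theta> \<in> strip r" "\<theta> \<in> strip (r - 3 * d)" "\<theta> \<in> strip (r - 4 * d)" using \<psi>_strip[OF a] st a by blast+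
    have "norm (u' \<xi> \<theta>) \<le> n * a4' + q" unfolding u'_def
      using norm_triangle_ineq[of "z \<xi> \<theta>" "u \<xi> (\<psi> \<xi> \<theta>)"] bz[OF a(1) w(3)] bu[OF a(1) w(2)] by linarith
    then show "norm (u' \<xi> \<theta>) \<le> q + D ^ 4 * e" using na4_le na5 De34 a5_le a5 by linarith
    have "norm (Y' \<xi> \<theta>) \<le> q + a2" unfolding Y'_def
      using norm_triangle_ineq[of "Y \<xi> (\<psi> \<xi> \<theta>)" "\<eta> \<xi> (\<psi> \<xi> \<theta>)"] b\<eta>[OF a(1) w(1)] bY[OF a(1) w(2)] by linarith
    then show "norm (Y' \<xi> \<theta>) \<le> q + D ^ 4 * e" using a2D De34 by linarith
    fix i j
    have "dd (\<lambda>\<theta>. u' \<xi> \<theta> $ i) (axis j 1) \<theta> = dd (\<lambda>\<theta>. z \<xi> \<theta> $ i) (axis j 1) \<theta> + du i j \<xi> (\<psi> \<xi> \<theta>)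
        + (\<Sum>l\<in>UNIV. dd (\<lambda>\<theta>. z \<xi> \<theta> $ l) (axis j 1) \<theta> * du i l \<xi> (\<psi> \<xi> \<theta>))"
    proof -
      have "(\<Sum>l\<in>UNIV. axis j 1 $ l * du i l \<xi> (\<psi> \<xi> \<theta>)) = du i j \<xi> (\<psi> \<xi> \<theta>)"
        unfolding lin[OF a(1) w(2), symmetric] by (simp add: du_def)
      then show ?thesis unfolding ddu'[OF a] lin[OF a(1) w(2)]
        by (simp add: v\<psi>_def ring_distribs sum.distrib)
    qed
    moreover have "norm (\<Sum>l\<in>UNIV. dd (\<lambda>\<theta>. z \<xi> \<theta> $ l) (axis j 1) \<theta> * du i l \<xi> (\<psi> \<xi> \<theta>)) \<le> n * (a5 * q)"
      unfolding n_def by (rule norm_sum_le_card)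
        (use bdz[OF a(1) w(4), of _ "axis j 1"] bdu[OF a(1) w(2)] a5 in \<open>auto simp: norm_mult intro!: mult_mono\<close>)
    moreover have "n * (a5 * q) \<le> a5" using mult_right_mono[OF nq a5] a5 by (simp add: mult_ac)
    ultimately have "norm (dd (\<lambda>\<theta>. u' \<xi> \<theta> $ i) (axis j 1) \<theta>) \<le> a5 + q + a5"
      using bdz[OF a(1) w(4), of i "axis j 1"] bdu[OF a(1) w(2), of i j]
      norm_triangle_ineq[of "dd (\<lambda>\<theta>. z \<xi> \<theta> $ i) (axis j 1) \<theta> + du i j \<xi> (\<psi> \<xi> \<theta>)" "\<Sum>l\<in>UNIV. dd (\<lambda>\<theta>. z \<xi> \<theta> $ l) (axis j 1) \<theta> * du i l \<xi> (\<psi> \<xi> \<theta>)"]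
      norm_triangle_ineq[of "dd (\<lambda>\<theta>. z \<xi> \<theta> $ i) (axis j 1) \<theta>" "du i j \<xi> (\<psi> \<xi> \<theta>)"] by simp
    then show "norm (dd (\<lambda>\<theta>. u' \<xi> \<theta> $ i) (axis j 1) \<theta>) \<le> q + D ^ 4 * e" using na5 De34 a5_le a5 by linarith
  qed
  have E1n: "norm ((\<Sum>i\<in>UNIV. of_real (\<omega> \<xi> $ i) * Y' \<xi> \<theta> $ i) + \<Phi> \<xi> (cjoin (Y' \<xi> \<theta>) (\<theta> + u' \<xi> \<theta>)) - of_real (c' \<xi>)) \<le> D ^ 8 * e * (e + h)"
    if a: "\<xi> \<in> \<Xi>" "\<theta> \<in> strip (r - 5 * d)" for \<xi> \<theta>
  proof -
    have w: "\<psi> \<xi> \<theta> \<in> strip (r - 2 * d)" using \<psi>_strip[OF a] st by blast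
    have "(\<Sum>i\<in>UNIV. of_real (\<omega> \<xi> $ i) * Y' \<xi> \<theta> $ i) + \<Phi> \<xi> (cjoin (Y' \<xi> \<theta>) (\<theta> + u' \<xi> \<theta>)) - of_real (c' \<xi>) = E1' \<xi> (\<psi> \<xi> \<theta>)"
      unfolding X' by (simp add: E1'_def Y'_def j\<eta>_def c'_def)
    moreover have "a1 * h + n * (e * a2) + K * a2\<^sup>2 \<le> D ^ 8 * e * (e + h)"
    proof -
      have "a1 \<le> a2" unfolding a2_def using mult_right_mono[OF n1 a1] a1 by simp
      then have "a1 * h \<le> (D * e) * h" using a2D h(2) by (intro mult_right_mono) auto
      moreover have "n * (e * a2) \<le> D * (e * (D * e))" using n4 n1 D2 e a2 a2D by (intro mult_mono) auto
      moreover have "K * a2\<^sup>2 \<le> D * (D * e)\<^sup>2" using D_ge a2D a2 D2 by (intro mult_mono power_mono) auto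
      moreover have "(D * e) * h + D * (e * (D * e)) + D * (D * e)\<^sup>2 = D * (e * h) + D ^ 2 * e\<^sup>2 + D ^ 3 * e\<^sup>2"
        by (simp add: eval_nat_numeral algebra_simps)
      moreover have "D * (e * h) \<le> D ^ 8 * (e * h)" using Dpow[of 1 8] e h(2) by (intro mult_right_mono) auto
      moreover have "D ^ 2 * e\<^sup>2 + D ^ 3 * e\<^sup>2 \<le> D ^ 8 * e\<^sup>2"
      proof -
        have "D ^ 2 + D ^ 3 \<le> 2 * D ^ 3" using Dpow[of 2 3] by simp
        also have "\<dots> \<le> D * D ^ 3" using D2 by (intro mult_right_mono) auto
        also have "\<dots> \<le> D ^ 8" using Dpow[of 4 8] by (simp add: eval_nat_numeral)
        finally show ?thesis using mult_right_mono[of "D ^ 2 + D ^ 3" "D ^ 8" "e\<^sup>2"] by (simp add: distrib_right)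
      qed
      moreover have "D ^ 8 * (e * h) + D ^ 8 * e\<^sup>2 = D ^ 8 * e * (e + h)" by (simp add: algebra_simps power2_eq_square)
      ultimately show ?thesis by linarith
    qed
    ultimately show ?thesis using bE1'[OF a(1) w] by simp
  qed
  have E2n: "norm (of_real (\<omega> \<xi> $ i) + dd (\<Phi> \<xi>) (axis (Inl i) 1) (cjoin (Y' \<xi> \<theta>) (\<theta> + u' \<xi> \<theta>))
             - (of_real ((p + b' \<xi>) $ i) + dd (\<lambda>\<theta>. u' \<xi> \<theta> $ i) (complexify (p + b' \<xi>)) \<theta>)) \<le> D ^ 8 * e * (e + h)"
    if a: "\<xi> \<in> \<Xi>" "\<theta> \<in> strip (r - 5 * d)" for \<xi> \<theta> i
  proof -
    have w: "\<psi> \<xi> \<theta> \<in> strip (r - 2 * d)" "\<psi> \<xi> \<theta> \<in> strip r" "\<theta> \<in> strip (r - 3 * d)" "\<theta> \<in> strip (r - 4 * d)" "\<theta> \<in> strip (r - 2 * d)"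
      using \<psi>_strip[OF a] st a by blast+
    define w0 where "w0 = \<psi> \<xi> \<theta>"
    define T where "T = (\<lambda>v. v $ i + dd (\<lambda>z. u \<xi> z $ i) v w0)"
    have w0: "w0 \<in> strip r" "w0 \<in> strip (r - 2 * d)" using w by (auto simp: w0_def)
    have Tadd: "T (x + y) = T x + T y" for x y unfolding T_def hol_dd_add[OF hu[OF a(1)] w0(1)] by simp
    have Tbd: "norm (T x) \<le> 2 * norm x" for x unfolding T_def by (rule T_bound[OF a(1) w0(1)])
    define P' where "P' = complexify (p + b' \<xi>)"
    \<comment> \<open>The second homological equation differentiates \<open>z\<close> along
      \<open>p\<close>, whereas the new conjugacy equation differentiates along
      \<open>p + b'\<close>; \<open>v'\<close> is the difference. The other part of the new error is
      the variation of \<open>g\<close> between \<open>\<theta>\<close> and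
      \<open>\<psi> \<xi> \<theta>\<close>.\<close>
    define v' where "v' = (\<chi> l. dd (\<lambda>\<theta>. z \<xi> \<theta> $ l) (complexify (b \<xi> + b1 \<xi>)) \<theta>)"
    have "of_real (\<omega> \<xi> $ i) + dd (\<Phi> \<xi>) (axis (Inl i) 1) (cjoin (Y' \<xi> \<theta>) (\<theta> + u' \<xi> \<theta>))
        = (P \<xi> $ i + dd (\<lambda>z. u \<xi> z $ i) (P \<xi>) w0) + rhs i \<xi> w0"
      unfolding rhs_def E2_eq[OF a(1) w0(1)] X' by (simp add: Y'_def j\<eta>_def w0_def)
    also have "\<dots> = T (P \<xi> + g \<xi> w0)" unfolding geq[OF a(1) w0(2), symmetric] Tadd by (simp add: T_def)
    finally have 1: "of_real (\<omega> \<xi> $ i) + dd (\<Phi> \<xi>) (axis (Inl i) 1) (cjoin (Y' \<xi> \<theta>) (\<theta> + u' \<xi> \<theta>)) = T (P \<xi> + g \<xi> w0)" .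
    have "v\<psi> \<xi> \<theta> P' = P \<xi> + g \<xi> \<theta> + v'"
    proof -
      have "P' = complexify p + complexify (b \<xi> + b1 \<xi>)" by (simp add: P'_def b'_def complexify_add)
      then have "dd (\<lambda>\<theta>. z \<xi> \<theta> $ l) P' \<theta> = g \<xi> \<theta> $ l - of_real (b1 \<xi> $ l) + v' $ l" for l
        using hol_dd_add[OF hz[OF a(1)] w(3), of l "complexify p"] dzp[OF a(1) w(3), of l] by (simp add: v'_def)
      then show ?thesis by (simp add: vec_eq_iff v\<psi>_def P'_def P_def b'_def)
    qed
    then have 2: "of_real ((p + b' \<xi>) $ i) + dd (\<lambda>\<theta>. u' \<xi> \<theta> $ i) (complexify (p + b' \<xi>)) \<theta> = T (P \<xi> + g \<xi> \<theta> + v')"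
      using T'[OF a, of P' i] by (simp add: P'_def T_def w0_def)
    have "P \<xi> + g \<xi> w0 = (P \<xi> + g \<xi> \<theta> + v') + (g \<xi> w0 - g \<xi> \<theta> - v')" by simp
    then have "T (P \<xi> + g \<xi> w0) - T (P \<xi> + g \<xi> \<theta> + v') = T (g \<xi> w0 - g \<xi> \<theta> - v')" using Tadd by (metis add_diff_cancel_left')
    then have "norm (of_real (\<omega> \<xi> $ i) + dd (\<Phi> \<xi>) (axis (Inl i) 1) (cjoin (Y' \<xi> \<theta>) (\<theta> + u' \<xi> \<theta>))
        - (of_real ((p + b' \<xi>) $ i) + dd (\<lambda>\<theta>. u' \<xi> \<theta> $ i) (complexify (p + b' \<xi>)) \<theta>)) \<le> 2 * norm (g \<xi> w0 - g \<xi> \<theta> - v')"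
      unfolding 1 2 using Tbd[of "g \<xi> w0 - g \<xi> \<theta> - v'"] by simp
    also have "\<dots> \<le> 2 * (n * (a3 * (n * a5) + a5 * (h + n * a3)))"
    proof -
      have "norm ((g \<xi> w0 - g \<xi> \<theta> - v') $ l) \<le> a3 * (n * a5) + a5 * (h + n * a3)" for l
      proof -
        have "norm (g \<xi> w0 $ l - g \<xi> \<theta> $ l) \<le> a3 * (n * a5)"
          unfolding w0_def by (rule Lip[OF analytic_familyD(1)[OF fg a(1)] _ a3 a]) (use bg[OF a(1)] comp_le order_trans in blast)
        moreover have "norm (v' $ l) \<le> a5 * (h + n * a3)"
        proof -
          have "norm (v' $ l) \<le> a5 * norm (b \<xi> + b1 \<xi>)" using bdz[OF a(1) w(4), of l "complexify (b \<xi> + b1 \<xi>)"] by (simp add: v'_def)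
          also have "\<dots> \<le> a5 * (h + n * a3)"
            using h(1)[OF a(1)] bb1[OF a(1)] norm_triangle_ineq[of "b \<xi>" "b1 \<xi>"] a5 by (intro mult_left_mono) auto
          finally show ?thesis .
        qed
        ultimately show ?thesis using norm_triangle_ineq4[of "g \<xi> w0 $ l - g \<xi> \<theta> $ l" "v' $ l"] by simp
      qed
      then show ?thesis unfolding n_def by (intro mult_left_mono norm_vec_le_card) auto
    qed
    also have "\<dots> = 4 * n * a3 * (n * a5) + 2 * (n * a5) * h" by (simp add: algebra_simps)
    also have "\<dots> \<le> D * (D ^ 2 * e) * (D ^ 3 * e) + (D ^ 3 * e) * h"
    proof (rule add_mono)
      have "4 * n * a3 \<le> D * (D ^ 2 * e)" using n4 n1 a3D a3 D2 by (intro mult_mono) auto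
      moreover have "n * a5 \<le> D ^ 3 * e" using na5 a5_le a5 by linarith
      ultimately show "4 * n * a3 * (n * a5) \<le> D * (D ^ 2 * e) * (D ^ 3 * e)"
        by (rule mult_mono) (use n1 a5 D2 e in auto)
      show "2 * (n * a5) * h \<le> (D ^ 3 * e) * h" using na5 h(2) by (rule mult_right_mono)
    qed
    also have "\<dots> = D ^ 6 * e\<^sup>2 + D ^ 3 * (e * h)" by (simp add: eval_nat_numeral algebra_simps)
    also have "\<dots> \<le> D ^ 8 * e\<^sup>2 + D ^ 8 * (e * h)"
      using Dpow[of 6 8] Dpow[of 3 8] e h(2) by (intro add_mono mult_right_mono) auto
    also have "\<dots> = D ^ 8 * e * (e + h)" by (simp add: algebra_simps power2_eq_square)
    finally show ?thesis .
  qed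
  \<comment> \<open>The symmetry is bilinear and survives pullback by \<open>\<psi>\<close>, where
    both directions become \<open>v\<psi>\<close>; the contributions of \<open>Y\<close> and
    \<open>\<eta>\<close> are symmetric separately.\<close>
  have lagr': "(\<Sum>i\<in>UNIV. (h $ i + dd (\<lambda>\<theta>. u' \<xi> \<theta> $ i) h \<theta>) * dd (\<lambda>\<theta>. Y' \<xi> \<theta> $ i) k \<theta>) =
               (\<Sum>i\<in>UNIV. (k $ i + dd (\<lambda>\<theta>. u' \<xi> \<theta> $ i) k \<theta>) * dd (\<lambda>\<theta>. Y' \<xi> \<theta> $ i) h \<theta>)"
    if a: "\<xi> \<in> \<Xi>" "\<theta> \<in> strip (r - 5 * d)" for \<xi> \<theta> h k
  proof -
    have w: "\<psi> \<xi> \<theta> \<in> strip (r - 2 * d)" "\<psi> \<xi> \<theta> \<in> strip r" using \<psi>_strip[OF a] st by blast+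
    show ?thesis unfolding T'[OF a] ddY'[OF a] distrib_left sum.distrib
      using lagr[OF a(1) w(2)] lagr\<eta>[OF a(1) w(1)] by simp
  qed
  have close: "norm (u' \<xi> \<theta> - u \<xi> \<theta>) \<le> D ^ 4 * e \<and> norm (Y' \<xi> \<theta> - Y \<xi> \<theta>) \<le> D ^ 4 * e"
    if a: "\<xi> \<in> \<Xi>" "\<theta> \<in> strip (r - 5 * d)" for \<xi> \<theta>
  proof -
    have w: "\<psi> \<xi> \<theta> \<in> strip (r - 2 * d)" "\<theta> \<in> strip (r - 3 * d)" using \<psi>_strip[OF a] st a by blast+
    have Lq: "norm (f \<xi> (\<psi> \<xi> \<theta>) - f \<xi> \<theta>) \<le> n * a5"
      if f: "\<And>i. hol (\<lambda>z. f \<xi> z $ i) (strip (r - 2 * d))" "\<And>x. x \<in> strip r \<Longrightarrow> norm (f \<xi> x) \<le> q" for f :: "'p \<Rightarrow> complex ^ 'n \<Rightarrow> complex ^ 'n"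
    proof -
      have "norm ((f \<xi> (\<psi> \<xi> \<theta>) - f \<xi> \<theta>) $ i) \<le> q * (n * a5)" for i
        using Lip[OF f(1)[of i] _ q(1) a] f(2) s2(1) comp_le order_trans by (metis vector_minus_component)
      then have "norm (f \<xi> (\<psi> \<xi> \<theta>) - f \<xi> \<theta>) \<le> n * (q * (n * a5))" unfolding n_def by (rule norm_vec_le_card)
      also have "\<dots> = (n * q) * (n * a5)" by simp
      also have "\<dots> \<le> 1 * (n * a5)" using nq n1 a5 by (intro mult_right_mono) auto
      finally show ?thesis by simp
    qed
    have eqU: "u' \<xi> \<theta> - u \<xi> \<theta> = z \<xi> \<theta> + (u \<xi> (\<psi> \<xi> \<theta>) - u \<xi> \<theta>)" by (simp add: u'_def)
    have "norm (u' \<xi> \<theta> - u \<xi> \<theta>) \<le> n * a4' + n * a5"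
      unfolding eqU using norm_triangle_ineq[of "z \<xi> \<theta>" "u \<xi> (\<psi> \<xi> \<theta>) - u \<xi> \<theta>"] bz[OF a(1) w(2)] Lq[of u, OF h2(1)[OF a(1)] bu[OF a(1)]] by linarith
    moreover have eqY: "Y' \<xi> \<theta> - Y \<xi> \<theta> = \<eta> \<xi> (\<psi> \<xi> \<theta>) + (Y \<xi> (\<psi> \<xi> \<theta>) - Y \<xi> \<theta>)" by (simp add: Y'_def)
    have "norm (Y' \<xi> \<theta> - Y \<xi> \<theta>) \<le> a2 + n * a5"
      unfolding eqY using norm_triangle_ineq[of "\<eta> \<xi> (\<psi> \<xi> \<theta>)" "Y \<xi> (\<psi> \<xi> \<theta>) - Y \<xi> \<theta>"] b\<eta>[OF a(1) w(1)] Lq[of Y, OF h2(2)[OF a(1)] bY[OF a(1)]] by linarith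
    ultimately show ?thesis using na4_le na5 a2D De34 a5_le a5 by linarith
  qed
  have "norm (b' \<xi> - b \<xi>) \<le> D ^ 4 * e" if "\<xi> \<in> \<Xi>" for \<xi>
  proof -
    have "n * a3 \<le> D * (D ^ 2 * e)" using n4 n1 a3D a3 D2 by (intro mult_mono) auto
    then show ?thesis using bb1[OF that] De34 by (simp add: b'_def eval_nat_numeral)
  qed
  moreover have "kam_state \<Xi> \<omega> \<Phi> p (r - 5 * d) (q + D ^ 4 * e) (D ^ 8 * e * (e + h)) u' Y' b' c'"
    unfolding kam_state_def
  proof (intro conjI allI ballI)
    show "continuous_on \<Xi> b'" "continuous_on \<Xi> c'" unfolding b'_def c'_def by (intro continuous_intros cb cb1 cc cm)+
  qed (use fu' fY' bnd E1n E2n lagr' in blast)+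
  ultimately show ?thesis using close by blast
qed

section \<open>Iteration and limit\<close>

lemma perturbation_subset:
  "perturbation \<Xi> \<rho> \<mu> \<Phi> \<Longrightarrow> \<Xi>' \<subseteq> \<Xi> \<Longrightarrow> \<mu> \<le> \<mu>' \<Longrightarrow> perturbation \<Xi>' \<rho> \<mu>' \<Phi>"
  unfolding perturbation_def by (meson analytic_family_subset order_refl order_trans subsetD)

lemma kam_state_weaken:
  fixes \<omega> :: "'p::topological_space \<Rightarrow> real ^ 'n"
  assumes st: "kam_state \<Xi> \<omega> \<Phi> p r q e u Y b c" and sub: "\<Xi>' \<subseteq> \<Xi>" and b: "\<And>\<xi>. \<xi> \<in> \<Xi>' \<Longrightarrow> b' \<xi> = b \<xi>"
    and r: "r' \<le> r" and q: "q \<le> q'" and e: "e \<le> e'"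
  shows "kam_state \<Xi>' \<omega> \<Phi> p r' q' e' u Y b' c"
proof -
  have sr: "strip r' \<subseteq> strip r" using r by (rule strip_mono)
  have "continuous_on \<Xi>' b" "continuous_on \<Xi>' c" using st sub unfolding kam_state_def by (meson continuous_on_subset)+
  moreover have "continuous_on \<Xi>' b' \<longleftrightarrow> continuous_on \<Xi>' b" by (rule continuous_on_cong) (use b in auto)
  moreover have "analytic_family \<Xi>' (strip r') periods (\<lambda>\<xi> z. u \<xi> z $ i)" "analytic_family \<Xi>' (strip r') periods (\<lambda>\<xi> z. Y \<xi> z $ i)" for i
    using st sub sr unfolding kam_state_def by (meson analytic_family_subset)+
  ultimately show ?thesis
    unfolding kam_state_def
  proof (intro conjI allI ballI)
    fix \<xi> and z :: "complex ^ 'n" and i j assume a: "\<xi> \<in> \<Xi>'" "z \<in> strip r'"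
    then have a': "\<xi> \<in> \<Xi>" "z \<in> strip r" using sub sr by auto
    note S = st[unfolded kam_state_def, THEN conjunct2, THEN conjunct2, THEN conjunct2, THEN conjunct2, rule_format, OF a']
    show "norm (u \<xi> z) \<le> q'" "norm (Y \<xi> z) \<le> q'" "norm (dd (\<lambda>z. u \<xi> z $ i) (axis j 1) z) \<le> q'"
      using S q by (auto intro: order_trans)
    show "norm ((\<Sum>i\<in>UNIV. of_real (\<omega> \<xi> $ i) * Y \<xi> z $ i) + \<Phi> \<xi> (cjoin (Y \<xi> z) (z + u \<xi> z)) - of_real (c \<xi>)) \<le> e'"
      using S e by (auto intro: order_trans)
    show "norm (of_real (\<omega> \<xi> $ i) + dd (\<Phi> \<xi>) (axis (Inl i) 1) (cjoin (Y \<xi> z) (z + u \<xi> z))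
             - (of_real ((p + b' \<xi>) $ i) + dd (\<lambda>z. u \<xi> z $ i) (complexify (p + b' \<xi>)) z)) \<le> e'"
      unfolding b[OF a(1)] using S e by (meson order_trans)
  next
    fix \<xi> and z h k :: "complex ^ 'n" assume a: "\<xi> \<in> \<Xi>'" "z \<in> strip r'"
    then have a': "\<xi> \<in> \<Xi>" "z \<in> strip r" using sub sr by auto
    show "(\<Sum>i\<in>UNIV. (h $ i + dd (\<lambda>z. u \<xi> z $ i) h z) * dd (\<lambda>z. Y \<xi> z $ i) k z) =
               (\<Sum>i\<in>UNIV. (k $ i + dd (\<lambda>z. u \<xi> z $ i) k z) * dd (\<lambda>z. Y \<xi> z $ i) h z)"
      using st a' unfolding kam_state_def by blast
  qed auto
qed

text \<open>For the flat torus with drift \<open>\<omega> - p\<close> the linear part of the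
  conjugacy equation holds exactly, so only \<open>\<Phi>\<close> and its \<open>y\<close>-gradient
  contribute to the errors; the factor \<open>16 / \<rho>\<close> is the Cauchy estimate for the
  latter.\<close>

lemma kam_state_initial:
  fixes \<omega> :: "'p::topological_space \<Rightarrow> real ^ 'n"
  assumes \<Phi>: "perturbation \<Xi> \<rho> \<mu> \<Phi>" and \<omega>: "continuous_on \<Xi> \<omega>" and \<rho>: "0 < \<rho>" "\<rho> \<le> 1" and \<mu>: "0 \<le> \<mu>"
  shows "kam_state \<Xi> \<omega> \<Phi> p (\<rho> / 2) 0 (16 * \<mu> / \<rho>) (\<lambda>_ _. 0) (\<lambda>_ _. 0) (\<lambda>\<xi>. \<omega> \<xi> - p) (\<lambda>_. 0)"
  unfolding kam_state_def
proof (intro conjI allI ballI)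
  show "continuous_on \<Xi> (\<lambda>\<xi>. \<omega> \<xi> - p)" by (intro continuous_intros \<omega>)
  fix \<xi> and z :: "complex ^ 'n" assume a: "\<xi> \<in> \<Xi>" "z \<in> strip (\<rho> / 2)"
  have dom: "cjoin 0 (z + 0) \<in> pdom (7 * \<rho> / 8)"
  proof -
    have "\<bar>Im (z $ i)\<bar> < 7 * \<rho> / 8" for i
    proof -
      have "\<bar>Im (z $ i)\<bar> < \<rho> / 2" using a(2) unfolding strip_def by blast
      then show ?thesis using \<rho> by simp
    qed
    then show ?thesis using \<rho> by (simp add: pdom_def)
  qed
  have "cjoin 0 (z + 0) \<in> pdom \<rho>" using dom pdom_mono[of "7 * \<rho> / 8" \<rho>] \<rho> by auto
  then have "norm (\<Phi> \<xi> (cjoin 0 (z + 0))) \<le> \<mu>" using \<Phi> a(1) unfolding perturbation_def by blast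
  moreover have "\<mu> \<le> 16 * \<mu> / \<rho>"
  proof -
    have "\<mu> * \<rho> \<le> \<mu> * 16" using \<rho> \<mu> by (intro mult_left_mono) auto
    then show ?thesis using \<rho> by (simp add: field_simps)
  qed
  ultimately show "norm ((\<Sum>i\<in>UNIV. of_real (\<omega> \<xi> $ i) * (0 :: complex ^ 'n) $ i) + \<Phi> \<xi> (cjoin 0 (z + 0)) - of_real 0) \<le> 16 * \<mu> / \<rho>"
    by simp
  fix i
  have "norm (dd (\<Phi> \<xi>) (axis (Inl i) 1) (cjoin 0 (z + 0))) \<le> 16 * \<mu> / \<rho>"
    using perturbation_grad(2)[OF \<Phi> \<rho>(1) a(1) dom, of "axis (Inl i) 1"] by simp
  then show "norm (of_real (\<omega> \<xi> $ i) + dd (\<Phi> \<xi>) (axis (Inl i) 1) (cjoin 0 (z + 0))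
     - (of_real ((p + (\<omega> \<xi> - p)) $ i) + dd (\<lambda>z. 0 $ i) (complexify (p + (\<omega> \<xi> - p))) z)) \<le> 16 * \<mu> / \<rho>"
    by simp
qed (auto intro: analytic_family_const)

lemma geometric_limit:
  fixes f :: "nat \<Rightarrow> 'x \<Rightarrow> 'b::banach"
  assumes step: "\<And>j x. x \<in> X \<Longrightarrow> norm (f (Suc j) x - f j x) \<le> a * s ^ j" and s: "0 \<le> s" "s \<le> 1 / 2" and a: "0 \<le> a"
  obtains g where "uniform_limit X f g sequentially" "\<And>j x. x \<in> X \<Longrightarrow> norm (g x - f j x) \<le> 2 * a * s ^ j"
proof -
  \<comment> \<open>The subtracted term makes the induction close: it is what remains of the
    geometric series and pays for the next step because \<open>s \<le> 1 / 2\<close>.\<close>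
  have tail: "norm (f (j + k) x - f j x) \<le> 2 * a * s ^ j - 2 * a * s ^ (j + k)" if "x \<in> X" for x j k
  proof (induction k)
    case (Suc k)
    have "norm (f (j + Suc k) x - f j x) \<le> norm (f (Suc (j + k)) x - f (j + k) x) + norm (f (j + k) x - f j x)"
      using norm_triangle_ineq[of "f (Suc (j + k)) x - f (j + k) x" "f (j + k) x - f j x"] by simp
    also have "\<dots> \<le> a * s ^ (j + k) + (2 * a * s ^ j - 2 * a * s ^ (j + k))" using step[OF that, of "j + k"] Suc by simp
    also have "\<dots> \<le> 2 * a * s ^ j - 2 * a * s ^ (j + Suc k)"
    proof -
      have "s * (2 * (a * s ^ (j + k))) \<le> 1 / 2 * (2 * (a * s ^ (j + k)))" using s a by (intro mult_right_mono) auto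
      then show ?thesis by (simp add: algebra_simps)
    qed
    finally show ?case .
  qed auto
  have tail': "norm (f (j + k) x - f j x) \<le> 2 * a * s ^ j" if "x \<in> X" for x j k
  proof -
    have "0 \<le> 2 * a * s ^ (j + k)" using a s by simp
    then show ?thesis using tail[OF that, of j k] by linarith
  qed
  have "(\<lambda>j. 2 * a * s ^ j) \<longlonglongrightarrow> 0" using s by (intro tendsto_mult_right_zero LIMSEQ_power_zero) auto
  then have small: "\<forall>\<^sub>F j in sequentially. 2 * a * s ^ j < e" if "e > 0" for e using that by (rule order_tendstoD)
  have "convergent (\<lambda>j. f j x)" if "x \<in> X" for x
  proof (rule Cauchy_convergent, rule metric_CauchyI)
    fix e :: real assume "e > 0"
    then obtain N where N: "2 * a * s ^ N < e / 2" using small[of "e / 2"] by (auto simp: eventually_sequentially)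
    have "dist (f m x) (f N x) < e / 2" if "m \<ge> N" for m
      using tail'[OF \<open>x \<in> X\<close>, of N "m - N"] N that by (simp add: dist_norm)
    then have "\<forall>m\<ge>N. \<forall>n\<ge>N. dist (f m x) (f n x) < e" using dist_triangle_half_l by blast
    then show "\<exists>M. \<forall>m\<ge>M. \<forall>n\<ge>M. dist (f m x) (f n x) < e" by blast
  qed
  then obtain g where g: "\<And>x. x \<in> X \<Longrightarrow> (\<lambda>j. f j x) \<longlonglongrightarrow> g x" unfolding convergent_def by metis
  have bd: "norm (g x - f j x) \<le> 2 * a * s ^ j" if "x \<in> X" for x j
  proof (rule tendsto_upperbound)
    show "(\<lambda>k. norm (f (j + k) x - f j x)) \<longlonglongrightarrow> norm (g x - f j x)"
      using LIMSEQ_ignore_initial_segment[OF g[OF that], of j] by (intro tendsto_intros) (simp add: add.commute)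
  qed (use tail'[OF that] in auto)
  have "uniform_limit X f g sequentially"
  proof (rule uniform_limitI)
    fix e :: real assume "e > 0"
    from small[OF this] show "\<forall>\<^sub>F j in sequentially. \<forall>x\<in>X. dist (f j x) (g x) < e"
    proof eventually_elim
      case (elim j)
      show ?case
      proof
        fix x assume "x \<in> X"
        from bd[OF this, of j] elim show "dist (f j x) (g x) < e" by (simp add: dist_norm norm_minus_commute)
      qed
    qed
  qed
  then show ?thesis using bd that by blast
qed

text \<open>Convergence of the energies \<open>c j\<close> need not be assumed. At every point the
  energy equation forces them towards the energy of the limit torus there, which is therefore real
  and independent of the point. Derivatives converge by Weierstrass.\<close>

lemma kam_state_limit:
  fixes \<omega> :: "'p::topological_space \<Rightarrow> real ^ 'n"
  assumes st: "\<And>j. kam_state {\<xi>} \<omega> \<Phi> p r q (e j) (u j) (Y j) (b j) (c j)"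
    and e: "e \<longlonglongrightarrow> 0" and b: "(\<lambda>j. b j \<xi>) \<longlonglongrightarrow> 0"
    and ulim: "uniform_limit (strip r) (\<lambda>j. u j \<xi>) U sequentially" and Ylim: "uniform_limit (strip r) (\<lambda>j. Y j \<xi>) V sequentially"
    and \<Phi>: "perturbation {\<xi>} \<rho> \<mu> \<Phi>" and \<rho>: "\<rho> > 0" and r: "0 < r" "r \<le> \<rho> / 2" and q: "q \<le> \<rho> / 8"
  shows "\<exists>c'. kam_state {\<xi>} \<omega> \<Phi> p r q 0 (\<lambda>_. U) (\<lambda>_. V) (\<lambda>_. 0) c'"
proof -
  have comp_le: "norm (v $ i) \<le> norm v" for v :: "complex ^ 'n" and i by (rule Finite_Cartesian_Product.norm_nth_le)
  have fam: "analytic_family {\<xi>} (strip r) periods (\<lambda>\<xi> z. u j \<xi> z $ i)" "analytic_family {\<xi>} (strip r) periods (\<lambda>\<xi> z. Y j \<xi> z $ i)" for i j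
    using st[of j] by (auto simp: kam_state_def)
  have S: "norm (u j \<xi> z) \<le> q" "norm (Y j \<xi> z) \<le> q" "norm (dd (\<lambda>z. u j \<xi> z $ i) (axis k 1) z) \<le> q"
    "norm ((\<Sum>i\<in>UNIV. of_real (\<omega> \<xi> $ i) * Y j \<xi> z $ i) + \<Phi> \<xi> (cjoin (Y j \<xi> z) (z + u j \<xi> z)) - of_real (c j \<xi>)) \<le> e j"
    "norm (of_real (\<omega> \<xi> $ i) + dd (\<Phi> \<xi>) (axis (Inl i) 1) (cjoin (Y j \<xi> z) (z + u j \<xi> z))
             - (of_real ((p + b j \<xi>) $ i) + dd (\<lambda>z. u j \<xi> z $ i) (complexify (p + b j \<xi>)) z)) \<le> e j"
    "(\<Sum>i\<in>UNIV. (h $ i + dd (\<lambda>z. u j \<xi> z $ i) h z) * dd (\<lambda>z. Y j \<xi> z $ i) h' z) =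
               (\<Sum>i\<in>UNIV. (h' $ i + dd (\<lambda>z. u j \<xi> z $ i) h' z) * dd (\<lambda>z. Y j \<xi> z $ i) h z)"
    if "z \<in> strip r" for z j i k h h'
    using st[of j] that unfolding kam_state_def by blast+
  have compU: "uniform_limit (strip r) (\<lambda>j z. f j z $ i) (\<lambda>z. F z $ i) sequentially"
    if "uniform_limit (strip r) f F sequentially" for f and F :: "complex ^ 'n \<Rightarrow> complex ^ 'n" and i
  proof (rule uniform_limitI)
    fix \<epsilon> :: real assume "\<epsilon> > 0"
    from uniform_limitD[OF that this] show "\<forall>\<^sub>F j in sequentially. \<forall>z\<in>strip r. dist (f j z $ i) (F z $ i) < \<epsilon>"
      by eventually_elim (metis dist_vec_nth_le order_le_less_trans)
  qed
  have famU: "analytic_family {\<xi>} (strip r) periods (\<lambda>_ z. F z $ i)"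
    if f: "\<And>j. analytic_family {\<xi>} (strip r) periods (\<lambda>\<xi> z. f j \<xi> z $ i)" and l: "uniform_limit (strip r) (\<lambda>j. f j \<xi>) F sequentially"
    for f :: "nat \<Rightarrow> 'p \<Rightarrow> complex ^ 'n \<Rightarrow> complex ^ 'n" and F i
  proof (rule analytic_family_uniform_limit[OF always_eventually open_strip sequentially_bot strip_periods])
    show "\<forall>j. analytic_family {\<xi>} (strip r) periods (\<lambda>\<xi> z. f j \<xi> z $ i)" using f by blast
    show "uniform_limit ({\<xi>} \<times> strip r) (\<lambda>j (\<xi>, z). f j \<xi> z $ i) (\<lambda>(\<xi>, z). F z $ i) sequentially"
    proof (rule uniform_limitI)
      fix \<epsilon> :: real assume "\<epsilon> > 0"
      from uniform_limitD[OF compU[OF l, of i] this]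
      show "\<forall>\<^sub>F j in sequentially. \<forall>x\<in>{\<xi>} \<times> strip r. dist (case x of (\<xi>, z) \<Rightarrow> f j \<xi> z $ i) (case x of (\<xi>, z) \<Rightarrow> F z $ i) < \<epsilon>"
        by eventually_elim auto
    qed
  qed auto
  have limu: "(\<lambda>j. u j \<xi> z) \<longlonglongrightarrow> U z" and limY: "(\<lambda>j. Y j \<xi> z) \<longlonglongrightarrow> V z" if "z \<in> strip r" for z
    using tendsto_uniform_limitI[OF ulim that] tendsto_uniform_limitI[OF Ylim that] .
  have hol_u: "hol (\<lambda>z. u j \<xi> z $ i) (strip r)" "hol (\<lambda>z. Y j \<xi> z $ i) (strip r)" for i j
    using analytic_familyD(1)[OF fam(1)] analytic_familyD(1)[OF fam(2)] by auto
  have limdu: "(\<lambda>j. dd (\<lambda>z. u j \<xi> z $ i) h z) \<longlonglongrightarrow> dd (\<lambda>z. U z $ i) h z"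
    and limdY: "(\<lambda>j. dd (\<lambda>z. Y j \<xi> z $ i) h z) \<longlonglongrightarrow> dd (\<lambda>z. V z $ i) h z" if "z \<in> strip r" for z i h
    using hol_uniform_limit(2)[OF always_eventually open_strip compU[OF ulim] sequentially_bot that]
      hol_uniform_limit(2)[OF always_eventually open_strip compU[OF Ylim] sequentially_bot that] hol_u by blast+
  have bU: "norm (U z) \<le> q" and bV: "norm (V z) \<le> q" if "z \<in> strip r" for z
    using tendsto_upperbound[OF tendsto_norm[OF limu[OF that]] always_eventually]
      tendsto_upperbound[OF tendsto_norm[OF limY[OF that]] always_eventually] S(1,2)[OF that] by auto
  have bdU: "norm (dd (\<lambda>z. U z $ i) (axis k 1) z) \<le> q" if "z \<in> strip r" for z i k
    using tendsto_upperbound[OF tendsto_norm[OF limdu[OF that]] always_eventually] S(3)[OF that] by auto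
  have dom: "cjoin (V z) (z + U z) \<in> pdom (7 * \<rho> / 8)" if "z \<in> strip r" for z
  proof -
    have "norm (V z $ i) < 7 * \<rho> / 8" for i using comp_le[of "V z" i] bV[OF that] q \<rho> by simp
    moreover have "\<bar>Im ((z + U z) $ i)\<bar> < 7 * \<rho> / 8" for i
    proof -
      have "\<bar>Im (z $ i)\<bar> < r" using that unfolding strip_def by blast
      moreover have "\<bar>Im (U z $ i)\<bar> \<le> q" using abs_Im_le_cmod[of "U z $ i"] comp_le[of "U z" i] bU[OF that] by linarith
      ultimately have "\<bar>Im (z $ i) + Im (U z $ i)\<bar> < r + q" by linarith
      then show ?thesis using r q \<rho> by simp
    qed
    ultimately show ?thesis by (simp add: pdom_def)
  qed
  have limj: "(\<lambda>j. cjoin (Y j \<xi> z) (z + u j \<xi> z)) \<longlonglongrightarrow> cjoin (V z) (z + U z)" if "z \<in> strip r" for z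
  proof (rule vec_tendstoI)
    fix k :: "'n + 'n"
    show "(\<lambda>j. cjoin (Y j \<xi> z) (z + u j \<xi> z) $ k) \<longlonglongrightarrow> cjoin (V z) (z + U z) $ k"
      by (cases k) (auto intro!: tendsto_intros limu[OF that] limY[OF that])
  qed
  have cont: "(\<lambda>j. f (cjoin (Y j \<xi> z) (z + u j \<xi> z))) \<longlonglongrightarrow> f (cjoin (V z) (z + U z))"
    if "hol f (pdom (7 * \<rho> / 8))" "z \<in> strip r" for f z
  proof -
    have "isCont f (cjoin (V z) (z + U z))"
      using has_derivative_continuous[OF hol_has_derivative[OF that(1) dom[OF that(2)]]] .
    then show ?thesis using limj[OF that(2)] isCont_tendsto_compose by blast
  qed
  have hol\<Phi>: "hol (\<Phi> \<xi>) (pdom (7 * \<rho> / 8))" "hol (dd (\<Phi> \<xi>) (axis k 1)) (pdom (7 * \<rho> / 8))" for k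
  proof -
    have "hol (\<Phi> \<xi>) (pdom \<rho>)" using \<Phi> by (auto simp: perturbation_def analytic_family_def)
    then show "hol (\<Phi> \<xi>) (pdom (7 * \<rho> / 8))" by (rule hol_subset) (use \<rho> in \<open>auto intro!: pdom_mono\<close>)
    show "hol (dd (\<Phi> \<xi>) (axis k 1)) (pdom (7 * \<rho> / 8))"
      using analytic_familyD(1)[OF perturbation_grad(1)[OF \<Phi> \<rho>]] by auto
  qed
  have E2: "of_real (\<omega> \<xi> $ i) + dd (\<Phi> \<xi>) (axis (Inl i) 1) (cjoin (V z) (z + U z)) = of_real (p $ i) + dd (\<lambda>z. U z $ i) (complexify p) z"
    if z: "z \<in> strip r" for z i
  proof -
    have split: "dd (\<lambda>z. u j \<xi> z $ i) (complexify (p + b j \<xi>)) z = dd (\<lambda>z. u j \<xi> z $ i) (complexify p) z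
        + (\<Sum>k\<in>UNIV. of_real (b j \<xi> $ k) * dd (\<lambda>z. u j \<xi> z $ i) (axis k 1) z)" for j
      unfolding complexify_add hol_dd_add[OF hol_u(1) z] hol_dd_axis[OF hol_u(1) z, of _ _ "complexify (b j \<xi>)"] by simp
    have lb: "(\<lambda>j. b j \<xi> $ k) \<longlonglongrightarrow> 0" for k using tendsto_vec_nth[OF b, of k] by simp
    have "(\<lambda>j. of_real (\<omega> \<xi> $ i) + dd (\<Phi> \<xi>) (axis (Inl i) 1) (cjoin (Y j \<xi> z) (z + u j \<xi> z))
             - (of_real ((p + b j \<xi>) $ i) + dd (\<lambda>z. u j \<xi> z $ i) (complexify (p + b j \<xi>)) z))
        \<longlonglongrightarrow> of_real (\<omega> \<xi> $ i) + dd (\<Phi> \<xi>) (axis (Inl i) 1) (cjoin (V z) (z + U z))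
             - (of_real (p $ i + 0) + (dd (\<lambda>z. U z $ i) (complexify p) z + (\<Sum>k\<in>UNIV. of_real 0 * dd (\<lambda>z. U z $ i) (axis k 1) z)))"
      unfolding split vector_add_component by (intro tendsto_intros cont[OF hol\<Phi>(2) z] limdu[OF z] lb)
    moreover have "(\<lambda>j. of_real (\<omega> \<xi> $ i) + dd (\<Phi> \<xi>) (axis (Inl i) 1) (cjoin (Y j \<xi> z) (z + u j \<xi> z))
             - (of_real ((p + b j \<xi>) $ i) + dd (\<lambda>z. u j \<xi> z $ i) (complexify (p + b j \<xi>)) z)) \<longlonglongrightarrow> 0"
      by (rule Lim_null_comparison[OF always_eventually e]) (use S(5)[OF z] in blast)
    ultimately show ?thesis using LIMSEQ_unique by fastforce
  qed
  define Hl where "Hl = (\<lambda>z. (\<Sum>i\<in>UNIV. of_real (\<omega> \<xi> $ i) * V z $ i) + \<Phi> \<xi> (cjoin (V z) (z + U z)))"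
  have limc: "(\<lambda>j. complex_of_real (c j \<xi>)) \<longlonglongrightarrow> Hl z" if z: "z \<in> strip r" for z
  proof -
    have 1: "(\<lambda>j. (\<Sum>i\<in>UNIV. of_real (\<omega> \<xi> $ i) * Y j \<xi> z $ i) + \<Phi> \<xi> (cjoin (Y j \<xi> z) (z + u j \<xi> z))) \<longlonglongrightarrow> Hl z"
      unfolding Hl_def by (intro tendsto_intros limY[OF z] cont[OF hol\<Phi>(1) z])
    have 2: "(\<lambda>j. (\<Sum>i\<in>UNIV. of_real (\<omega> \<xi> $ i) * Y j \<xi> z $ i) + \<Phi> \<xi> (cjoin (Y j \<xi> z) (z + u j \<xi> z)) - of_real (c j \<xi>)) \<longlonglongrightarrow> 0"
      by (rule Lim_null_comparison[OF always_eventually e]) (use S(4)[OF z] in blast)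
    from tendsto_diff[OF 1 2] show ?thesis by simp
  qed
  have 0: "(0 :: complex ^ 'n) \<in> strip r" using r by (simp add: strip_def)
  have "Hl 0 \<in> \<real>"
    by (rule Lim_in_closed_set[OF closed_complex_Reals _ sequentially_bot limc[OF 0]]) auto
  then have Hl: "Hl z = of_real (Re (Hl 0))" if "z \<in> strip r" for z
    using LIMSEQ_unique[OF limc[OF that] limc[OF 0]] by simp
  have lagr: "(\<Sum>i\<in>UNIV. (h $ i + dd (\<lambda>z. U z $ i) h z) * dd (\<lambda>z. V z $ i) h' z) =
      (\<Sum>i\<in>UNIV. (h' $ i + dd (\<lambda>z. U z $ i) h' z) * dd (\<lambda>z. V z $ i) h z)" if z: "z \<in> strip r" for z h h'
  proof (rule LIMSEQ_unique)
    show "(\<lambda>j. \<Sum>i\<in>UNIV. (h $ i + dd (\<lambda>z. u j \<xi> z $ i) h z) * dd (\<lambda>z. Y j \<xi> z $ i) h' z)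
      \<longlonglongrightarrow> (\<Sum>i\<in>UNIV. (h $ i + dd (\<lambda>z. U z $ i) h z) * dd (\<lambda>z. V z $ i) h' z)"
      by (intro tendsto_intros limdu[OF z] limdY[OF z])
    show "(\<lambda>j. \<Sum>i\<in>UNIV. (h $ i + dd (\<lambda>z. u j \<xi> z $ i) h z) * dd (\<lambda>z. Y j \<xi> z $ i) h' z)
      \<longlonglongrightarrow> (\<Sum>i\<in>UNIV. (h' $ i + dd (\<lambda>z. U z $ i) h' z) * dd (\<lambda>z. V z $ i) h z)"
      unfolding S(6)[OF z, of h _ h'] by (intro tendsto_intros limdu[OF z] limdY[OF z])
  qed
  have "kam_state {\<xi>} \<omega> \<Phi> p r q 0 (\<lambda>_. U) (\<lambda>_. V) (\<lambda>_. 0) (\<lambda>_. Re (Hl 0))"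
    unfolding kam_state_def
  proof (intro conjI allI ballI)
    show "analytic_family {\<xi>} (strip r) periods (\<lambda>\<xi> z. U z $ i)" for i by (rule famU[OF fam(1) ulim])
    show "analytic_family {\<xi>} (strip r) periods (\<lambda>\<xi> z. V z $ i)" for i by (rule famU[OF fam(2) Ylim])
    fix \<xi>' and z :: "complex ^ 'n" assume \<xi>': "\<xi>' \<in> {\<xi>}" and z: "z \<in> strip r"
    show "norm (U z) \<le> q" "norm (V z) \<le> q" by (rule bU[OF z] bV[OF z])+
    show "norm (dd (\<lambda>z. U z $ i) (axis j 1) z) \<le> q" for i j by (rule bdU[OF z])
    show "norm ((\<Sum>i\<in>UNIV. of_real (\<omega> \<xi>' $ i) * V z $ i) + \<Phi> \<xi>' (cjoin (V z) (z + U z)) - of_real (Re (Hl 0))) \<le> 0"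
      using \<xi>' Hl[OF z] unfolding Hl_def by simp
    show "norm (of_real (\<omega> \<xi>' $ i) + dd (\<Phi> \<xi>') (axis (Inl i) 1) (cjoin (V z) (z + U z))
        - (of_real ((p + 0) $ i) + dd (\<lambda>z. U z $ i) (complexify (p + 0)) z)) \<le> 0" for i
      using \<xi>' E2[OF z, of i] by simp
    show "(\<Sum>i\<in>UNIV. (h $ i + dd (\<lambda>z. U z $ i) h z) * dd (\<lambda>z. V z $ i) h' z) =
      (\<Sum>i\<in>UNIV. (h' $ i + dd (\<lambda>z. U z $ i) h' z) * dd (\<lambda>z. V z $ i) h z)" for h h' by (rule lagr[OF z])
  qed auto
  then show ?thesis by blast
qed

text \<open>The step controls the new drift on \<open>\<Xi>\<close> only. What is extended is its
  difference from the old drift: its values lie in a ball, and a Dugundji extension keeps them in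
  that convex set, so the bound persists on all of \<open>B\<close>.\<close>

lemma kam_step_extend:
  fixes B \<Xi> :: "(real ^ 'n) set" and b b'' :: "real ^ 'n \<Rightarrow> real ^ 'n"
  assumes "closedin (top_of_set B) \<Xi>" and b: "continuous_on B b" and st: "kam_state \<Xi> \<omega> \<Phi> p r q e u' Y' b'' c'"
    and close: "\<And>\<xi>. \<xi> \<in> \<Xi> \<Longrightarrow> norm (b'' \<xi> - b \<xi>) \<le> \<delta>" and \<delta>: "0 \<le> \<delta>"
  obtains b' where "kam_state \<Xi> \<omega> \<Phi> p r q e u' Y' b' c'" "continuous_on B b'"
    "\<And>\<xi>. \<xi> \<in> B \<Longrightarrow> norm (b' \<xi> - b \<xi>) \<le> \<delta>"
proof -
  have sub: "\<Xi> \<subseteq> B" using assms(1) closedin_imp_subset by blast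
  have "continuous_on \<Xi> b''" using st unfolding kam_state_def by blast
  then have cont: "continuous_on \<Xi> (\<lambda>\<xi>. b'' \<xi> - b \<xi>)"
    by (rule continuous_on_diff[OF _ continuous_on_subset[OF b sub]])
  have img: "(\<lambda>\<xi>. b'' \<xi> - b \<xi>) ` \<Xi> \<subseteq> cball 0 \<delta>" using close by auto
  have ne: "cball (0 :: real ^ 'n) \<delta> \<noteq> {}" using \<delta> by simp
  obtain g where g: "continuous_on B g" "g ` B \<subseteq> cball 0 \<delta>" "\<And>\<xi>. \<xi> \<in> \<Xi> \<Longrightarrow> g \<xi> = b'' \<xi> - b \<xi>"
    by (rule Dugundji[OF convex_cball ne assms(1) cont img]) blast
  show ?thesis
  proof (rule that[of "\<lambda>\<xi>. b \<xi> + g \<xi>"])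
    show "kam_state \<Xi> \<omega> \<Phi> p r q e u' Y' (\<lambda>\<xi>. b \<xi> + g \<xi>) c'"
      by (rule kam_state_weaken[OF st]) (use g(3) in auto)
    show "continuous_on B (\<lambda>\<xi>. b \<xi> + g \<xi>)" by (intro continuous_intros b g(1))
    show "norm (b \<xi> + g \<xi> - b \<xi>) \<le> \<delta>" if "\<xi> \<in> B" for \<xi> using g(2) that by auto
  qed
qed

text \<open>The threshold \<open>\<mu>0\<close> precedes \<open>B\<close>, \<open>\<omega>\<close>
  and \<open>\<Phi>\<close>, because \<open>\<Phi>\<close> will vary with the size of the
  perturbation. With losses of width that halve, the recursion \<open>D ^ 8 * e * (e + h)\<close>
  closes for geometric sequences as soon as the drift thresholds decay fast enough to offset the
  growth of \<open>D ^ 8\<close>.\<close>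

theorem kam_normal_form:
  fixes p :: "real ^ 'n"
  assumes dioph: "diophantine \<gamma> \<tau> p" "\<gamma> > 0" "\<tau> > 0" and \<rho>: "0 < \<rho>" "\<rho> \<le> 1" and \<eta>: "\<eta> > 0"
  obtains \<mu>0 q where "\<mu>0 > 0" "0 \<le> q" "q \<le> \<rho> / 8" "(real CARD('n))\<^sup>2 * q \<le> 1 / 2"
    "\<And>(B :: (real ^ 'n) set) \<omega> \<Phi>. continuous_on B \<omega> \<Longrightarrow> perturbation B \<rho> \<mu>0 \<Phi> \<Longrightarrow>
      \<exists>V. continuous_on B V \<and> (\<forall>\<xi>\<in>B. norm (V \<xi>) \<le> \<eta>) \<and>
        (\<forall>\<xi>\<in>B. \<omega> \<xi> + V \<xi> = p \<longrightarrow> (\<exists>u Y c. kam_state {\<xi>} \<omega> \<Phi> p (\<rho> / 4) q 0 u Y (\<lambda>_. 0) c))"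
proof -
  obtain C0 :: real and \<kappa> :: nat where C0: "C0 \<ge> 1" and hom:
    "\<And>(\<Xi> :: (real ^ 'n) set) r f M d. analytic_family \<Xi> (strip r) periods f \<Longrightarrow>
      (\<And>\<xi> z. \<xi> \<in> \<Xi> \<Longrightarrow> z \<in> strip r \<Longrightarrow> norm (f \<xi> z) \<le> M) \<Longrightarrow> 0 \<le> M \<Longrightarrow> 0 < d \<Longrightarrow> d \<le> 1 \<Longrightarrow> d < r \<Longrightarrow>
      \<exists>F m. analytic_family \<Xi> (strip (r - d)) periods F \<and> continuous_on \<Xi> m \<and>
        (\<forall>\<xi>\<in>\<Xi>. \<bar>m \<xi>\<bar> \<le> M \<and> (\<forall>z\<in>strip (r - d). norm (F \<xi> z) \<le> C0 * M / d ^ \<kappa> \<and>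
           dd (F \<xi>) (complexify p) z = f \<xi> z - of_real (m \<xi>)))"
    using homological_equation[OF dioph, where 'p="real ^ 'n"] by blast
  define n where "n = real CARD('n)"
  have n1: "n \<ge> 1" by (simp add: n_def)
  define K where "K = max (max (4 * n * C0) (2 * n * (1 + 256 / \<rho>\<^sup>2))) (max (128 / \<rho>\<^sup>2) 2)"
  have K: "4 * n * C0 \<le> K" "2 * n * (1 + 256 / \<rho>\<^sup>2) \<le> K" "128 / \<rho>\<^sup>2 \<le> K" "2 \<le> K" by (auto simp: K_def)
  \<comment> \<open>The factor by which \<open>D j\<close> grows when the loss of width is
    halved.\<close>
  define \<Lambda> :: real where "\<Lambda> = 2 ^ (\<kappa> + 1)"
  have \<Lambda>: "\<Lambda> \<ge> 2" using power_increasing[of 1 "\<kappa> + 1" "2 :: real"] by (simp add: \<Lambda>_def)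
  \<comment> \<open>The exponents give \<open>\<Lambda> ^ 4 * t = s\<close>, so that the corrections
    \<open>D j ^ 4 * e j\<close> decrease with ratio \<open>s\<close>, and
    \<open>\<Lambda> ^ 8 * s = 1\<close>, so that the factor \<open>D j ^ 8 * (e j + h j)\<close> of
    the error recursion stays below \<open>t\<close>.\<close>
  define t where "t = (1 / \<Lambda>) ^ 12"
  define s where "s = (1 / \<Lambda>) ^ 8"
  have L1: "0 < 1 / \<Lambda>" "1 / \<Lambda> \<le> 1 / 2" using \<Lambda> by auto
  have t0: "0 < t" "t \<le> s" "0 < s" using L1 by (auto simp: t_def s_def intro!: power_decreasing)
  have s_half: "s \<le> 1 / 2"
  proof -
    have "s \<le> (1 / \<Lambda>) ^ 1" unfolding s_def using L1 by (intro power_decreasing) auto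
    then show ?thesis using L1(2) unfolding power_one_right by linarith
  qed
  \<comment> \<open>Five losses per step, summed over halving widths, amount to
    \<open>10 * d0 = \<rho> / 4\<close>, taking the strip from \<open>\<rho> / 2\<close> down to
    \<open>\<rho> / 4\<close>.\<close>
  define d0 where "d0 = \<rho> / 40"
  define dj where "dj = (\<lambda>j::nat. d0 / 2 ^ j)"
  define D where "D = (\<lambda>j. K / dj j ^ (\<kappa> + 1))"
  have d0: "d0 > 0" using \<rho> by (simp add: d0_def)
  have D_eq: "D j = D 0 * \<Lambda> ^ j" for j
  proof -
    have "(2 ^ j :: real) ^ (\<kappa> + 1) = \<Lambda> ^ j" unfolding \<Lambda>_def by (simp only: power_mult[symmetric] mult.commute)
    then show ?thesis by (simp only: D_def dj_def power_divide) simp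
  qed
  have D0: "D 0 \<ge> 1"
  proof -
    have "d0 ^ (\<kappa> + 1) \<le> 1" using \<rho> by (intro power_le_one) (auto simp: d0_def)
    moreover have "0 < d0 ^ (\<kappa> + 1)" using d0 by simp
    ultimately show ?thesis using K(4) unfolding D_def dj_def by (simp add: pos_le_divide_eq)
  qed
  \<comment> \<open>The four bounds serve, in order, the error recursion, the condition
    \<open>D ^ 4 * e \<le> d\<close> together with \<open>q \<le> \<rho> / 8\<close>, the
    invertibility of the angle Jacobian, and the prescribed size \<open>\<eta>\<close> of
    \<open>V\<close>. Then \<open>e0\<close> is set so that the first correction is
    \<open>h0 / 2\<close>.\<close>
  define h0 where "h0 = min (min (t / (2 * D 0 ^ 8)) d0) (min (1 / (2 * n\<^sup>2)) \<eta>)"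
  define e0 where "e0 = h0 / (2 * D 0 ^ 4)"
  have h0: "0 < h0" "h0 \<le> t / (2 * D 0 ^ 8)" "h0 \<le> d0" "h0 \<le> 1 / (2 * n\<^sup>2)" "h0 \<le> \<eta>"
    using t0 D0 d0 n1 \<eta> by (auto simp: h0_def min_def)
  have e0: "0 < e0" "e0 \<le> h0"
  proof -
    show "0 < e0" using h0 D0 by (simp add: e0_def)
    have "1 \<le> D 0 ^ 4" using D0 by (rule one_le_power)
    then have "h0 * 1 \<le> h0 * (2 * D 0 ^ 4)" using h0 by (intro mult_left_mono) auto
    then show "e0 \<le> h0" using D0 by (simp add: e0_def pos_divide_le_eq)
  qed
  define e where "e = (\<lambda>j. e0 * t ^ j)"
  define h where "h = (\<lambda>j. h0 * s ^ j)"
  \<comment> \<open>Since \<open>s \<le> 1 / 2\<close>, each difference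
    \<open>h0 * (1 - s) * s ^ j\<close> covers the correction \<open>h0 / 2 * s ^ j\<close>, while
    all values stay below \<open>h0\<close>.\<close>
  define q where "q = (\<lambda>j. h0 * (1 - s ^ j))"
  define r where "r = (\<lambda>j::nat. \<rho> / 4 + \<rho> / 4 / 2 ^ j)"
  have spos: "0 < s ^ j" "s ^ j \<le> 1" for j using t0 s_half by (auto intro!: power_le_one)
  have inc: "D j ^ 4 * e j = h0 / 2 * s ^ j" for j
  proof -
    have "D j ^ 4 * e j = (D 0 ^ 4 * e0) * (\<Lambda> ^ 4 * t) ^ j"
      unfolding D_eq[of j] e_def by (simp add: power_mult_distrib power_mult[symmetric] mult.commute[of 4])
    also have "\<Lambda> ^ 4 * t = s" using \<Lambda> by (simp add: t_def s_def power_divide power_add[symmetric] field_simps)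
    also have "D 0 ^ 4 * e0 = h0 / 2" using D0 by (simp add: e0_def)
    finally show ?thesis .
  qed
  have enext: "D j ^ 8 * e j * (e j + h j) \<le> e (Suc j)" for j
  proof -
    have "t ^ j \<le> s ^ j" using t0 by (intro power_mono) auto
    then have "e j + h j \<le> 2 * h0 * s ^ j"
      using e0 h0 spos[of j] mult_mono[of e0 h0 "t ^ j" "s ^ j"] t0 unfolding e_def h_def by simp
    then have "D j ^ 8 * (e j + h j) \<le> D j ^ 8 * (2 * h0 * s ^ j)" by (intro mult_left_mono) (auto intro: zero_le_even_power)
    also have "\<dots> = D 0 ^ 8 * (2 * h0) * (\<Lambda> ^ 8 * s) ^ j"
      unfolding D_eq[of j] by (simp add: power_mult_distrib power_mult[symmetric] mult.commute[of 8])
    also have "\<Lambda> ^ 8 * s = 1" using \<Lambda> by (simp add: s_def power_divide)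
    also have "D 0 ^ 8 * (2 * h0) * 1 ^ j \<le> t"
      using h0(2) D0 by (simp add: pos_le_divide_eq mult_ac)
    finally have "D j ^ 8 * (e j + h j) \<le> t" .
    then have "e j * (D j ^ 8 * (e j + h j)) \<le> e j * t" using e0 t0 by (intro mult_left_mono) (auto simp: e_def)
    then show ?thesis by (simp add: e_def mult_ac)
  qed
  have e_pos: "0 \<le> e j" "0 \<le> h j" "0 \<le> q j" "q j \<le> h0" for j
    using e0 t0 h0 spos[of j] by (auto simp: e_def h_def q_def mult_left_le)
  have qnext: "q j + h0 / 2 * s ^ j \<le> q (Suc j)" for j
  proof -
    have "s * (h0 * s ^ j) \<le> 1 / 2 * (h0 * s ^ j)" using s_half h0 spos[of j] by (intro mult_right_mono) auto
    then show ?thesis by (simp add: q_def algebra_simps)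
  qed
  have rnext: "r (Suc j) = r j - 5 * dj j" for j by (simp add: r_def dj_def d0_def field_simps)
  have hq: "h0 \<le> \<rho> / 8" "n\<^sup>2 * h0 \<le> 1 / 2"
    using h0(3,4) \<rho> n1 by (auto simp: d0_def field_simps)
  \<comment> \<open>The bound \<open>1\<close> is the size of \<open>\<Phi>\<close> assumed by
    \<open>kam_step\<close>; the other bound turns the initial error
    \<open>16 * \<mu>0 / \<rho>\<close> into at most \<open>e0\<close>.\<close>
  define \<mu>0 where "\<mu>0 = min 1 (e0 * \<rho> / 16)"
  show ?thesis
  proof (rule that[of \<mu>0 h0])
    show "\<mu>0 > 0" using e0 \<rho> by (simp add: \<mu>0_def)
    show "0 \<le> h0" "h0 \<le> \<rho> / 8" "(real CARD('n))\<^sup>2 * h0 \<le> 1 / 2" using h0 hq by (auto simp: n_def)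
  next
    fix B :: "(real ^ 'n) set" and \<omega> :: "real ^ 'n \<Rightarrow> real ^ 'n"
      and \<Phi> :: "real ^ 'n \<Rightarrow> complex ^ ('n + 'n) \<Rightarrow> complex"
    assume \<omega>: "continuous_on B \<omega>" and \<Phi>: "perturbation B \<rho> \<mu>0 \<Phi>"
    have \<mu>0: "0 \<le> \<mu>0" "\<mu>0 \<le> 1" "16 * \<mu>0 / \<rho> \<le> e0" using e0 \<rho> by (auto simp: \<mu>0_def field_simps min_def)
    \<comment> \<open>The clause for \<open>j = 0\<close> records the starting set and drift, which
      dependent choice would otherwise leave unspecified.\<close>
    define Inv where "Inv = (\<lambda>j (\<Xi>, u, Y, b, c). closedin (top_of_set B) \<Xi> \<and> continuous_on B b \<and>
        kam_state \<Xi> \<omega> \<Phi> p (r j) (q j) (e j) u Y b c \<and> (\<forall>\<xi>\<in>\<Xi>. norm (b \<xi>) \<le> h j) \<and> (j = 0 \<longrightarrow> \<Xi> = {\<xi>\<in>B. norm (b \<xi>) \<le> h 0} \<and> b = (\<lambda>\<xi>. \<omega> \<xi> - p)))"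
    \<comment> \<open>Drifts are compared on all of \<open>B\<close>, where their limit must be
      continuous, but embeddings only on \<open>\<Xi>\<close>, where the state equations control
      them.\<close>
    define Step where "Step = (\<lambda>j (\<Xi> :: (real ^ 'n) set, u :: real ^ 'n \<Rightarrow> complex ^ 'n \<Rightarrow> complex ^ 'n, Y :: real ^ 'n \<Rightarrow> complex ^ 'n \<Rightarrow> complex ^ 'n,
          b :: real ^ 'n \<Rightarrow> real ^ 'n, c :: real ^ 'n \<Rightarrow> real) (\<Xi>', u', Y', b', c' :: real ^ 'n \<Rightarrow> real).
        \<Xi>' = {\<xi>\<in>\<Xi>. norm (b' \<xi>) \<le> h (Suc j)} \<and> (\<forall>\<xi>\<in>B. norm (b' \<xi> - b \<xi>) \<le> h0 / 2 * s ^ j) \<and>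
        (\<forall>\<xi>\<in>\<Xi>. \<forall>z\<in>strip (r (Suc j)). norm (u' \<xi> z - u \<xi> z) \<le> h0 / 2 * s ^ j \<and> norm (Y' \<xi> z - Y \<xi> z) \<le> h0 / 2 * s ^ j))"
    have closed_sub: "closedin (top_of_set B) {\<xi>\<in>\<Xi>. norm (b \<xi>) \<le> c}"
      if "closedin (top_of_set B) \<Xi>" "continuous_on B b" for \<Xi> b c
    proof -
      have "{\<xi>\<in>\<Xi>. norm (b \<xi>) \<le> c} = \<Xi> \<inter> (B \<inter> b -` cball 0 c)" using closedin_imp_subset[OF that(1)] by auto
      moreover have "closedin (top_of_set B) (B \<inter> b -` cball 0 c)"
        by (rule continuous_closedin_preimage[OF that(2)]) simp
      ultimately show ?thesis using that(1) by (simp add: closedin_Int)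
    qed
    have "\<exists>x. Inv 0 x"
    proof -
      let ?b = "\<lambda>\<xi>. \<omega> \<xi> - p"
      have cb: "continuous_on B ?b" by (intro continuous_intros \<omega>)
      let ?\<Xi> = "{\<xi>\<in>B. norm (?b \<xi>) \<le> h 0}"
      have sub: "?\<Xi> \<subseteq> B" by auto
      have "kam_state ?\<Xi> \<omega> \<Phi> p (\<rho> / 2) 0 (16 * \<mu>0 / \<rho>) (\<lambda>_ _. 0) (\<lambda>_ _. 0) ?b (\<lambda>_. 0)"
        by (rule kam_state_initial[OF perturbation_subset[OF \<Phi> sub order_refl] continuous_on_subset[OF \<omega> sub] \<rho> \<mu>0(1)])
      then have "kam_state ?\<Xi> \<omega> \<Phi> p (r 0) (q 0) (e 0) (\<lambda>_ _. 0) (\<lambda>_ _. 0) ?b (\<lambda>_. 0)"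
        by (rule kam_state_weaken) (use \<mu>0 e_pos in \<open>auto simp: r_def q_def e_def\<close>)
      then have "Inv 0 (?\<Xi>, \<lambda>_ _. 0, \<lambda>_ _. 0, ?b, \<lambda>_. 0)"
        using closed_sub[OF closedin_subtopology_refl[THEN iffD2] cb] cb by (simp add: Inv_def)
      then show ?thesis by blast
    qed
    moreover have "\<exists>x'. Inv (Suc j) x' \<and> Step j x x'" if inv: "Inv j x" for j x
    proof -
      obtain \<Xi> u Y b c where x: "x = (\<Xi>, u, Y, b, c)" by (cases x) auto
      have I: "closedin (top_of_set B) \<Xi>" "continuous_on B b" "kam_state \<Xi> \<omega> \<Phi> p (r j) (q j) (e j) u Y b c" "\<And>\<xi>. \<xi> \<in> \<Xi> \<Longrightarrow> norm (b \<xi>) \<le> h j"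
        using inv by (auto simp: Inv_def x)
      have sub: "\<Xi> \<subseteq> B" using I(1) closedin_imp_subset by blast
      have dj: "0 < dj j" "dj j \<le> \<rho> / 8" "5 * dj j < r j"
      proof -
        show "0 < dj j" using d0 by (simp add: dj_def)
        have "d0 / 2 ^ j \<le> d0 / 1" using d0 by (intro divide_left_mono) auto
        then show "dj j \<le> \<rho> / 8" using \<rho> by (simp add: dj_def d0_def)
        have "0 < r (Suc j)" using \<rho> by (simp add: r_def add_pos_pos)
        then show "5 * dj j < r j" using rnext[of j] by simp
      qed
      have rj: "r j \<le> \<rho> / 2"
      proof -
        have "\<rho> / 4 / 2 ^ j \<le> \<rho> / 4 / 1" using \<rho> by (intro divide_left_mono) auto
        then show ?thesis by (simp add: r_def)
      qed
      have small: "D j ^ 4 * e j \<le> dj j"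
      proof -
        have "s ^ j \<le> (1 / 2) ^ j" using s_half t0 by (intro power_mono) auto
        then have "h0 / 2 * s ^ j \<le> d0 * (1 / 2) ^ j" using h0 spos[of j] by (intro mult_mono) auto
        then show ?thesis unfolding inc by (simp add: dj_def power_one_over)
      qed
      have Dj: "K / dj j ^ (\<kappa> + 1) = D j" by (simp add: D_def)
      have nq: "n\<^sup>2 * q j \<le> 1 / 2" using mult_left_mono[OF e_pos(4)[of j], of "n\<^sup>2"] hq by simp
      have qj: "q j \<le> \<rho> / 8" using e_pos(4)[of j] hq by simp
      have "\<exists>u' Y' b' c'. kam_state \<Xi> \<omega> \<Phi> p (r j - 5 * dj j) (q j + (K / dj j ^ (\<kappa> + 1)) ^ 4 * e j) ((K / dj j ^ (\<kappa> + 1)) ^ 8 * e j * (e j + h j)) u' Y' b' c' \<and>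
        (\<forall>\<xi>\<in>\<Xi>. norm (b' \<xi> - b \<xi>) \<le> (K / dj j ^ (\<kappa> + 1)) ^ 4 * e j \<and>
          (\<forall>z\<in>strip (r j - 5 * dj j). norm (u' \<xi> z - u \<xi> z) \<le> (K / dj j ^ (\<kappa> + 1)) ^ 4 * e j \<and> norm (Y' \<xi> z - Y \<xi> z) \<le> (K / dj j ^ (\<kappa> + 1)) ^ 4 * e j))"
        by (rule kam_step[where ?C0.0=C0, OF hom C0 \<rho> perturbation_subset[OF \<Phi> sub \<mu>0(2)] continuous_on_subset[OF \<omega> sub] I(3) rj
              e_pos(3) qj nq[unfolded n_def] dj e_pos(1) I(4) e_pos(2) K[unfolded n_def] small[unfolded D_def]])
      then obtain u' Y' b'' c' where st: "kam_state \<Xi> \<omega> \<Phi> p (r (Suc j)) (q j + h0 / 2 * s ^ j) (D j ^ 8 * e j * (e j + h j)) u' Y' b'' c'"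
        and cl0: "\<forall>\<xi>\<in>\<Xi>. norm (b'' \<xi> - b \<xi>) \<le> h0 / 2 * s ^ j \<and>
          (\<forall>z\<in>strip (r (Suc j)). norm (u' \<xi> z - u \<xi> z) \<le> h0 / 2 * s ^ j \<and> norm (Y' \<xi> z - Y \<xi> z) \<le> h0 / 2 * s ^ j)"
        unfolding Dj rnext[symmetric] inc by (elim exE conjE)
      have cl: "\<And>\<xi>. \<xi> \<in> \<Xi> \<Longrightarrow> norm (b'' \<xi> - b \<xi>) \<le> h0 / 2 * s ^ j"
          "\<And>\<xi> z. \<xi> \<in> \<Xi> \<Longrightarrow> z \<in> strip (r (Suc j)) \<Longrightarrow> norm (u' \<xi> z - u \<xi> z) \<le> h0 / 2 * s ^ j \<and> norm (Y' \<xi> z - Y \<xi> z) \<le> h0 / 2 * s ^ j"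
        using cl0 by blast+
      obtain b' where b': "kam_state \<Xi> \<omega> \<Phi> p (r (Suc j)) (q j + h0 / 2 * s ^ j) (D j ^ 8 * e j * (e j + h j)) u' Y' b' c'"
        "continuous_on B b'" "\<And>\<xi>. \<xi> \<in> B \<Longrightarrow> norm (b' \<xi> - b \<xi>) \<le> h0 / 2 * s ^ j"
        using kam_step_extend[OF I(1,2) st cl(1)] h0 spos[of j] by auto
      define \<Xi>' where "\<Xi>' = {\<xi>\<in>\<Xi>. norm (b' \<xi>) \<le> h (Suc j)}"
      have "kam_state \<Xi>' \<omega> \<Phi> p (r (Suc j)) (q (Suc j)) (e (Suc j)) u' Y' b' c'"
        by (rule kam_state_weaken[OF b'(1)]) (use qnext enext in \<open>auto simp: \<Xi>'_def\<close>)
      then have "Inv (Suc j) (\<Xi>', u', Y', b', c')"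
        using closed_sub[OF I(1) b'(2)] b'(2) by (simp add: Inv_def \<Xi>'_def)
      moreover have "Step j x (\<Xi>', u', Y', b', c')" using cl(2) b'(3) by (simp add: Step_def x \<Xi>'_def)
      ultimately show ?thesis by blast
    qed
    ultimately obtain f where f: "\<And>j. Inv j (f j)" "\<And>j. Step j (f j) (f (Suc j))"
      using dependent_nat_choice[of Inv Step] by blast
    define \<Xi> where "\<Xi> = (\<lambda>j. fst (f j))"
    define u where "u = (\<lambda>j. fst (snd (f j)))"
    define Y where "Y = (\<lambda>j. fst (snd (snd (f j))))"
    define b where "b = (\<lambda>j. fst (snd (snd (snd (f j)))))"
    define c where "c = (\<lambda>j. snd (snd (snd (snd (f j)))))"
    have f_eq: "f j = (\<Xi> j, u j, Y j, b j, c j)" for j by (simp add: \<Xi>_def u_def Y_def b_def c_def)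
    have Inv': "continuous_on B (b j)" "kam_state (\<Xi> j) \<omega> \<Phi> p (r j) (q j) (e j) (u j) (Y j) (b j) (c j)"
      and Inv0: "\<Xi> 0 = {\<xi>\<in>B. norm (b 0 \<xi>) \<le> h 0}" "b 0 = (\<lambda>\<xi>. \<omega> \<xi> - p)" for j
      using f(1)[of j] f(1)[of 0] by (auto simp: Inv_def f_eq)
    have Step': "\<Xi> (Suc j) = {\<xi>\<in>\<Xi> j. norm (b (Suc j) \<xi>) \<le> h (Suc j)}"
      "\<xi> \<in> B \<Longrightarrow> norm (b (Suc j) \<xi> - b j \<xi>) \<le> h0 / 2 * s ^ j"
      "\<xi> \<in> \<Xi> j \<Longrightarrow> z \<in> strip (r (Suc j)) \<Longrightarrow> norm (u (Suc j) \<xi> z - u j \<xi> z) \<le> h0 / 2 * s ^ j"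
      "\<xi> \<in> \<Xi> j \<Longrightarrow> z \<in> strip (r (Suc j)) \<Longrightarrow> norm (Y (Suc j) \<xi> z - Y j \<xi> z) \<le> h0 / 2 * s ^ j" for j \<xi> z
      using f(2)[of j] by (auto simp: Step_def f_eq)
    have a0: "0 \<le> h0 / 2" and s01: "0 \<le> s" using h0 t0 by auto
    obtain binf where binf: "uniform_limit B b binf sequentially" "\<And>j \<xi>. \<xi> \<in> B \<Longrightarrow> norm (binf \<xi> - b j \<xi>) \<le> 2 * (h0 / 2) * s ^ j"
      using geometric_limit[of B b "h0 / 2" s, OF Step'(2) s01 s_half a0] by blast
    have cbinf: "continuous_on B binf"
      by (rule uniform_limit_theorem[OF _ binf(1)]) (use Inv'(1) in auto)
    define V where "V = (\<lambda>\<xi>. binf \<xi> - (\<omega> \<xi> - p))"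
    have "continuous_on B V" unfolding V_def by (intro continuous_intros cbinf \<omega>)
    moreover have "norm (V \<xi>) \<le> \<eta>" if "\<xi> \<in> B" for \<xi>
      using binf(2)[OF that, of 0] h0(5) by (simp add: V_def Inv0)
    moreover have "\<exists>u Y c. kam_state {\<xi>} \<omega> \<Phi> p (\<rho> / 4) h0 0 u Y (\<lambda>_. 0) c" if \<xi>: "\<xi> \<in> B" and eq: "\<omega> \<xi> + V \<xi> = p" for \<xi>
    proof -
      have "binf \<xi> = 0" using eq by (simp add: V_def algebra_simps)
      \<comment> \<open>The corrections after stage \<open>j\<close> add up to at most
        \<open>2 * (h0 / 2) * s ^ j\<close>, which is exactly the threshold \<open>h j\<close>; a
        zero of the limit drift therefore never leaves the nested sets.\<close>
      then have bj: "norm (b j \<xi>) \<le> h j" for j using binf(2)[OF \<xi>, of j] by (simp add: h_def)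
      have in\<Xi>: "\<xi> \<in> \<Xi> j" for j
        by (induction j) (use \<xi> bj[of 0] bj Inv0(1) Step'(1) in auto)
      have r4: "\<rho> / 4 \<le> r j" for j using \<rho> by (simp add: r_def)
      have st: "kam_state {\<xi>} \<omega> \<Phi> p (\<rho> / 4) h0 (e j) (u j) (Y j) (b j) (c j)" for j
        by (rule kam_state_weaken[OF Inv'(2)]) (use in\<Xi> r4 e_pos in auto)
      have sub: "z \<in> strip (r j)" if "z \<in> strip (\<rho> / 4)" for z :: "complex ^ 'n" and j using that strip_mono[OF r4] by blast
      have diff: "norm (u (Suc j) \<xi> z - u j \<xi> z) \<le> h0 / 2 * s ^ j" "norm (Y (Suc j) \<xi> z - Y j \<xi> z) \<le> h0 / 2 * s ^ j"
        if "z \<in> strip (\<rho> / 4)" for j z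
        by (rule Step'(3)[OF in\<Xi> sub[OF that]], rule Step'(4)[OF in\<Xi> sub[OF that]])
      obtain U where U: "uniform_limit (strip (\<rho> / 4)) (\<lambda>j. u j \<xi>) U sequentially"
      proof (rule geometric_limit[where f="\<lambda>j. u j \<xi>" and X="strip (\<rho> / 4)", OF diff(1) s01 s_half a0])
        fix g assume "uniform_limit (strip (\<rho> / 4)) (\<lambda>j. u j \<xi>) g sequentially"
        then show thesis by (rule that)
      qed
      obtain W where W: "uniform_limit (strip (\<rho> / 4)) (\<lambda>j. Y j \<xi>) W sequentially"
      proof (rule geometric_limit[where f="\<lambda>j. Y j \<xi>" and X="strip (\<rho> / 4)", OF diff(2) s01 s_half a0])
        fix g assume "uniform_limit (strip (\<rho> / 4)) (\<lambda>j. Y j \<xi>) g sequentially"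
        then show thesis by (rule that)
      qed
      have elim: "e \<longlonglongrightarrow> 0" unfolding e_def
        using t0 s_half by (intro tendsto_mult_right_zero LIMSEQ_power_zero) auto
      have blim: "(\<lambda>j. b j \<xi>) \<longlonglongrightarrow> 0" using tendsto_uniform_limitI[OF binf(1) \<xi>] \<open>binf \<xi> = 0\<close> by simp
      show ?thesis
        using kam_state_limit[OF st elim blim U W perturbation_subset[OF \<Phi> _ order_refl] \<rho>(1)] \<xi> \<rho> hq by auto
    qed
    ultimately show "\<exists>V. continuous_on B V \<and> (\<forall>\<xi>\<in>B. norm (V \<xi>) \<le> \<eta>) \<and>
        (\<forall>\<xi>\<in>B. \<omega> \<xi> + V \<xi> = p \<longrightarrow> (\<exists>u Y c. kam_state {\<xi>} \<omega> \<Phi> p (\<rho> / 4) h0 0 u Y (\<lambda>_. 0) c))"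
      by blast
  qed
qed

section \<open>From the functional equations to an invariant torus\<close>

lemma torus_periodicI:
  fixes f :: "real ^ 'n \<Rightarrow> 'b"
  assumes per: "\<And>x i. f (x + axis i (2 * pi)) = f x"
  shows "torus_periodic f"
proof -
  have nat: "f (x + axis i (2 * pi * real m)) = f x" for x i m
  proof (induction m)
    case (Suc m)
    have eq: "x + axis i (2 * pi * real (Suc m)) = (x + axis i (2 * pi * real m)) + axis i (2 * pi)"
      by (simp add: vec_eq_iff axis_def algebra_simps)
    show ?case unfolding eq per by (rule Suc)
  next
    case 0
    have "axis i (2 * pi * real 0) = 0" by (simp add: vec_eq_iff axis_def)
    then show ?case by (simp only: add_0_right)
  qed
  have int: "f (x + axis i (2 * pi * real_of_int m)) = f x" for x i m
  proof (cases m rule: int_cases2)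
    case (nonneg k)
    then show ?thesis using nat[of x i k] by simp
  next
    case (nonpos k)
    have eq: "(x + axis i (2 * pi * real_of_int m)) + axis i (2 * pi * real k) = x"
      using nonpos by (simp add: vec_eq_iff axis_def)
    show ?thesis using nat[of "x + axis i (2 * pi * real_of_int m)" i k] unfolding eq by (rule sym)
  qed
  show ?thesis unfolding torus_periodic_def
  proof (intro allI ballI)
    fix x v :: "real ^ 'n" assume "v \<in> torus_lattice"
    then obtain m :: "'n \<Rightarrow> int" where m: "\<And>i. v $ i = 2 * pi * of_int (m i)"
      unfolding torus_lattice_def mem_Collect_eq by metis
    have "f (x + (\<Sum>i\<in>A. axis i (2 * pi * real_of_int (m i)))) = f x" if "finite A" for A
      using that
    proof (induction A)
      case (insert i A)
      have eq: "x + (\<Sum>i\<in>insert i A. axis i (2 * pi * real_of_int (m i)))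
          = (x + (\<Sum>i\<in>A. axis i (2 * pi * real_of_int (m i)))) + axis i (2 * pi * real_of_int (m i))"
        using insert.hyps by (simp add: algebra_simps)
      show ?case unfolding eq int by (rule insert.IH)
    qed auto
    moreover have "(\<Sum>i\<in>UNIV. axis i (2 * pi * real_of_int (m i))) = v"
      by (simp add: vec_eq_iff axis_def m if_distrib cong: if_cong)
    ultimately show "f (x + v) = f x" by (metis finite)
  qed
qed

lemma bounded_linear_complexify: "bounded_linear (complexify :: real ^ 'n \<Rightarrow> complex ^ 'n)"
  by (rule bounded_linear_intro[where K=1])
    (auto simp: complexify_add complexify_scaleR scaleR_vector_smult)

lemma hol_real_derivative:
  assumes "hol f U" "complexify x \<in> U"
  shows "((\<lambda>x. f (complexify x)) has_derivative (\<lambda>h. dd f (complexify h) (complexify x))) (at x)"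
  by (rule has_derivative_compose[OF bounded_linear_imp_has_derivative[OF bounded_linear_complexify]
        hol_has_derivative[OF assms]])

lemma has_derivative_vec_components:
  fixes f :: "'a::real_normed_vector \<Rightarrow> real ^ 'n"
  assumes "\<And>i. ((\<lambda>x. f x $ i) has_derivative (\<lambda>h. D h $ i)) (at x)"
  shows "(f has_derivative D) (at x)"
proof -
  have eq: "v = (\<Sum>i\<in>UNIV. (v $ i) *\<^sub>R axis i 1)" for v :: "real ^ 'n"
    by (simp add: vec_eq_iff axis_def if_distrib cong: if_cong)
  have "((\<lambda>x. \<Sum>i\<in>UNIV. (f x $ i) *\<^sub>R (axis i 1 :: real ^ 'n)) has_derivative (\<lambda>h. \<Sum>i\<in>UNIV. (D h $ i) *\<^sub>R axis i 1)) (at x)"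
    by (intro has_derivative_sum bounded_linear.has_derivative[OF bounded_linear_scaleR_left] assms)
  then show ?thesis unfolding eq[symmetric] .
qed

text \<open>Differentiating the constant energy along \<open>h\<close>, replacing the
  \<open>y\<close>-gradient by the angle Jacobian applied to \<open>p\<close>, and exchanging
  \<open>p\<close> and \<open>h\<close> by isotropy shows that the defect of the action equation is
  orthogonal to the image of every \<open>h\<close>. The angle Jacobian is close to the identity, so
  the defect vanishes.\<close>

lemma kam_torus_equations:
  fixes \<omega> :: "'p::topological_space \<Rightarrow> real ^ 'n"
  assumes st: "kam_state {\<xi>} \<omega> \<Phi> p r q 0 u Y (\<lambda>_. 0) c" and \<Phi>: "perturbation {\<xi>} \<rho> \<mu> \<Phi>"
    and \<rho>: "0 < \<rho>" and r: "0 < r" "r \<le> \<rho> / 2" and q: "0 \<le> q" "q \<le> \<rho> / 8" "(real CARD('n))\<^sup>2 * q \<le> 1 / 2" and z: "z \<in> strip r"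
  defines "w \<equiv> cjoin (Y \<xi> z) (z + u \<xi> z)"
  shows "w \<in> pdom \<rho>"
    "of_real (\<omega> \<xi> $ i) + dd (\<Phi> \<xi>) (axis (Inl i) 1) w = of_real (p $ i) + dd (\<lambda>z. u \<xi> z $ i) (complexify p) z"
    "dd (\<lambda>z. Y \<xi> z $ i) (complexify p) z = - dd (\<Phi> \<xi>) (axis (Inr i) 1) w"
proof -
  have comp_le: "norm (v $ i) \<le> norm v" for v :: "complex ^ 'n" and i by (rule Finite_Cartesian_Product.norm_nth_le)
  have fu: "analytic_family {\<xi>} (strip r) periods (\<lambda>\<xi> z. u \<xi> z $ i)" and fY: "analytic_family {\<xi>} (strip r) periods (\<lambda>\<xi> z. Y \<xi> z $ i)" for i
    using st unfolding kam_state_def by blast+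
  have hu: "hol (\<lambda>z. u \<xi> z $ i) (strip r)" and hY: "hol (\<lambda>z. Y \<xi> z $ i) (strip r)" for i
    using analytic_familyD(1)[OF fu] analytic_familyD(1)[OF fY] by auto
  have S: "norm (u \<xi> z) \<le> q" "norm (Y \<xi> z) \<le> q" "norm (dd (\<lambda>z. u \<xi> z $ i) (axis k 1) z) \<le> q"
    "norm ((\<Sum>i\<in>UNIV. of_real (\<omega> \<xi> $ i) * Y \<xi> z $ i) + \<Phi> \<xi> (cjoin (Y \<xi> z) (z + u \<xi> z)) - of_real (c \<xi>)) \<le> 0"
    "norm (of_real (\<omega> \<xi> $ i) + dd (\<Phi> \<xi>) (axis (Inl i) 1) (cjoin (Y \<xi> z) (z + u \<xi> z))
             - (of_real ((p + 0) $ i) + dd (\<lambda>z. u \<xi> z $ i) (complexify (p + 0)) z)) \<le> 0"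
    "(\<Sum>i\<in>UNIV. (h $ i + dd (\<lambda>z. u \<xi> z $ i) h z) * dd (\<lambda>z. Y \<xi> z $ i) h' z) =
               (\<Sum>i\<in>UNIV. (h' $ i + dd (\<lambda>z. u \<xi> z $ i) h' z) * dd (\<lambda>z. Y \<xi> z $ i) h z)"
    if "z \<in> strip r" for z i k h h'
    using st that unfolding kam_state_def by blast+
  have dom: "cjoin (Y \<xi> z) (z + u \<xi> z) \<in> pdom \<rho>" if "z \<in> strip r" for z
  proof -
    have "norm (Y \<xi> z $ i) < \<rho>" for i using comp_le[of "Y \<xi> z" i] S(2)[OF that] q \<rho> by simp
    moreover have "\<bar>Im ((z + u \<xi> z) $ i)\<bar> < \<rho>" for i
    proof -
      have "\<bar>Im (z $ i)\<bar> < r" using that unfolding strip_def by blast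
      moreover have "\<bar>Im (u \<xi> z $ i)\<bar> \<le> q" using abs_Im_le_cmod[of "u \<xi> z $ i"] comp_le[of "u \<xi> z" i] S(1)[OF that] by linarith
      ultimately have "\<bar>Im (z $ i) + Im (u \<xi> z $ i)\<bar> < r + q" by linarith
      then show ?thesis using r q \<rho> by simp
    qed
    ultimately show ?thesis by (simp add: pdom_def)
  qed
  show w_dom: "w \<in> pdom \<rho>" unfolding w_def by (rule dom[OF z])
  show E2: "of_real (\<omega> \<xi> $ i) + dd (\<Phi> \<xi>) (axis (Inl i) 1) w = of_real (p $ i) + dd (\<lambda>z. u \<xi> z $ i) (complexify p) z" for i
    using S(5)[OF z, of i] by (simp add: w_def)
  have h\<Phi>: "hol (\<Phi> \<xi>) (pdom \<rho>)" using \<Phi> by (auto simp: perturbation_def analytic_family_def)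
  define j where "j = (\<lambda>z. cjoin (Y \<xi> z) (z + u \<xi> z))"
  have hj: "hol (\<lambda>z. j z $ k) (strip r)" for k
    by (cases k) (auto simp: j_def intro!: hY hol_add hu)
  have vj: "vdd j h z = cjoin (\<chi> i. dd (\<lambda>z. Y \<xi> z $ i) h z) (\<chi> i. h $ i + dd (\<lambda>z. u \<xi> z $ i) h z)" for h
    using hol_add(2)[OF hol_component hu z] by (simp add: vec_sum_eq_iff vdd_def j_def)
  have energy: "(\<Sum>i\<in>UNIV. of_real (\<omega> \<xi> $ i) * dd (\<lambda>z. Y \<xi> z $ i) h z) + dd (\<Phi> \<xi>) (vdd j h z) w = 0" for h
  proof -
    have "dd (\<lambda>z. (\<Sum>i\<in>UNIV. of_real (\<omega> \<xi> $ i) * Y \<xi> z $ i) + \<Phi> \<xi> (j z)) h z = dd (\<lambda>z. of_real (c \<xi>)) h z"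
      by (rule dd_cong[OF open_strip z]) (use S(4) in \<open>simp add: j_def\<close>)
    moreover have "dd (\<lambda>z. (\<Sum>i\<in>UNIV. of_real (\<omega> \<xi> $ i) * Y \<xi> z $ i) + \<Phi> \<xi> (j z)) h z
        = (\<Sum>i\<in>UNIV. of_real (\<omega> \<xi> $ i) * dd (\<lambda>z. Y \<xi> z $ i) h z) + dd (\<Phi> \<xi>) (vdd j h z) w"
    proof -
      have c1: "hol (\<lambda>z. \<Phi> \<xi> (j z)) (strip r)" by (rule hol_compose(1)[OF h\<Phi> hj]) (use dom in \<open>simp add: j_def\<close>)
      have c2: "dd (\<lambda>z. \<Phi> \<xi> (j z)) h z = dd (\<Phi> \<xi>) (vdd j h z) (j z)"
        by (rule hol_compose(2)[OF h\<Phi> hj _ z]) (use dom in \<open>simp add: j_def\<close>)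
      have s1: "hol (\<lambda>z. \<Sum>i\<in>UNIV. of_real (\<omega> \<xi> $ i) * Y \<xi> z $ i) (strip r)" by (intro hol_sum hol_cmult hY)
      have s2: "dd (\<lambda>z. \<Sum>i\<in>UNIV. of_real (\<omega> \<xi> $ i) * Y \<xi> z $ i) h z = (\<Sum>i\<in>UNIV. of_real (\<omega> \<xi> $ i) * dd (\<lambda>z. Y \<xi> z $ i) h z)"
        by (subst hol_sum(2)[OF hol_cmult(1)[OF hY] z]) (simp add: hol_cmult(2)[OF hY z])
      have jw: "j z = w" by (simp add: j_def w_def)
      show ?thesis unfolding hol_add(2)[OF s1 c1 z] s2 c2 jw ..
    qed
    ultimately show ?thesis by simp
  qed
  define a where "a = (\<lambda>i. dd (\<lambda>z. Y \<xi> z $ i) (complexify p) z + dd (\<Phi> \<xi>) (axis (Inr i) 1) w)"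
  have orth: "(\<Sum>i\<in>UNIV. (h $ i + dd (\<lambda>z. u \<xi> z $ i) h z) * a i) = 0" for h
  proof -
    have exp: "dd (\<Phi> \<xi>) (vdd j h z) w = (\<Sum>i\<in>UNIV. dd (\<lambda>z. Y \<xi> z $ i) h z * dd (\<Phi> \<xi>) (axis (Inl i) 1) w)
        + (\<Sum>i\<in>UNIV. (h $ i + dd (\<lambda>z. u \<xi> z $ i) h z) * dd (\<Phi> \<xi>) (axis (Inr i) 1) w)"
      using hol_dd_axis[OF h\<Phi> w_dom, of "vdd j h z"] by (simp add: vj sum_UNIV_Plus)
    have spl: "(\<Sum>i\<in>UNIV. (of_real (\<omega> \<xi> $ i) + dd (\<Phi> \<xi>) (axis (Inl i) 1) w) * dd (\<lambda>z. Y \<xi> z $ i) h z)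
        = (\<Sum>i\<in>UNIV. of_real (\<omega> \<xi> $ i) * dd (\<lambda>z. Y \<xi> z $ i) h z) + (\<Sum>i\<in>UNIV. dd (\<lambda>z. Y \<xi> z $ i) h z * dd (\<Phi> \<xi>) (axis (Inl i) 1) w)"
      by (simp add: sum.distrib[symmetric] algebra_simps)
    have "(\<Sum>i\<in>UNIV. (of_real (\<omega> \<xi> $ i) + dd (\<Phi> \<xi>) (axis (Inl i) 1) w) * dd (\<lambda>z. Y \<xi> z $ i) h z)
        + (\<Sum>i\<in>UNIV. (h $ i + dd (\<lambda>z. u \<xi> z $ i) h z) * dd (\<Phi> \<xi>) (axis (Inr i) 1) w) = 0"
      using energy[of h] unfolding exp spl by (simp only: add.assoc)
    moreover have "(\<Sum>i\<in>UNIV. (of_real (\<omega> \<xi> $ i) + dd (\<Phi> \<xi>) (axis (Inl i) 1) w) * dd (\<lambda>z. Y \<xi> z $ i) h z)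
        = (\<Sum>i\<in>UNIV. (h $ i + dd (\<lambda>z. u \<xi> z $ i) h z) * dd (\<lambda>z. Y \<xi> z $ i) (complexify p) z)"
      unfolding E2 using S(6)[OF z, of "complexify p" h] by simp
    ultimately show ?thesis by (simp add: a_def distrib_left sum.distrib)
  qed
  \<comment> \<open>Testing with coordinate vectors says that the transposed Jacobian annihilates
    \<open>a\<close>; the entry bound on the derivatives of \<open>u\<close> applies to the
    transpose as well.\<close>
  have "norm (\<chi> i. a i) \<le> 2 * norm (\<chi> k. (\<chi> i. a i) $ k + (\<Sum>i\<in>UNIV. dd (\<lambda>z. u \<xi> z $ i) (axis k 1) z * (\<chi> i. a i) $ i))"
    by (rule near_identity_bound[OF S(3)[OF z] q(3)])
  also have "(\<chi> k. (\<chi> i. a i) $ k + (\<Sum>i\<in>UNIV. dd (\<lambda>z. u \<xi> z $ i) (axis k 1) z * (\<chi> i. a i) $ i)) = 0"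
  proof -
    have "a k + (\<Sum>i\<in>UNIV. dd (\<lambda>z. u \<xi> z $ i) (axis k 1) z * a i) = 0" for k
    proof -
      have "(\<Sum>i\<in>UNIV. axis k 1 $ i * a i) = a k" by (simp add: axis_def if_distrib if_distribR cong: if_cong)
      then show ?thesis using orth[of "axis k 1"] by (simp add: distrib_right sum.distrib)
    qed
    then show ?thesis by (simp add: vec_eq_iff)
  qed
  finally have "(\<chi> i. a i) = 0" by simp
  then have "a i = 0" by (simp add: vec_eq_iff)
  then show "dd (\<lambda>z. Y \<xi> z $ i) (complexify p) z = - dd (\<Phi> \<xi>) (axis (Inr i) 1) w" by (simp add: a_def eq_neg_iff_add_eq_0)
qed

text \<open>At real angles \<open>u\<close> and \<open>Y\<close> are real, so the complex equations
  restrict to Hamilton's equations along straight lines of direction \<open>p\<close>.\<close>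

lemma kam_state_invariant_torus:
  fixes P :: "real ^ 'n \<Rightarrow> real ^ 'n \<Rightarrow> real ^ 'n \<Rightarrow> real \<Rightarrow> real"
  assumes st: "kam_state {\<xi>} \<omega> \<Phi> p r q 0 u Y (\<lambda>_. 0) c" and \<Phi>: "perturbation {\<xi>} \<rho> \<mu> \<Phi>"
    and \<rho>: "0 < \<rho>" and r: "0 < r" "r \<le> \<rho> / 2" and q: "0 \<le> q" "q \<le> \<rho> / 8" "(real CARD('n))\<^sup>2 * q \<le> 1 / 2"
    and G: "\<And>y. (\<And>i. \<bar>y $ i\<bar> < \<rho>) \<Longrightarrow> y0 + y \<in> interior G"
    and P: "\<And>y x. (\<And>i. \<bar>y $ i\<bar> < \<rho>) \<Longrightarrow> \<Phi> \<xi> (cjoin (complexify y) (complexify x)) = of_real (\<epsilon> * P (y0 + y) x \<xi> \<epsilon>)"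
  shows "admits_invariant_torus G (\<lambda>y x. hamiltonian \<omega> P y x \<xi> \<epsilon>) p"
proof -
  have comp_le: "norm (v $ i) \<le> norm v" for v :: "complex ^ 'n" and i by (rule Finite_Cartesian_Product.norm_nth_le)
  have fam: "analytic_family {\<xi>} (strip r) periods (\<lambda>\<xi> z. u \<xi> z $ i)" "analytic_family {\<xi>} (strip r) periods (\<lambda>\<xi> z. Y \<xi> z $ i)" for i
    using st unfolding kam_state_def by blast+
  have hu: "hol (\<lambda>z. u \<xi> z $ i) (strip r)" and hY: "hol (\<lambda>z. Y \<xi> z $ i) (strip r)" for i
    using analytic_familyD(1)[OF fam(1)] analytic_familyD(1)[OF fam(2)] by auto
  have S: "norm (Y \<xi> z) \<le> q" "norm (dd (\<lambda>z. u \<xi> z $ i) (axis k 1) z) \<le> q" if "z \<in> strip r" for z i k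
    using st that unfolding kam_state_def by blast+
  have cs: "complexify x \<in> strip r" for x :: "real ^ 'n" using r by simp
  define U where "U = (\<lambda>\<theta>. \<chi> i. Re (u \<xi> (complexify \<theta>) $ i))"
  define V where "V = (\<lambda>\<theta>. \<chi> i. Re (Y \<xi> (complexify \<theta>) $ i))"
  have cU: "complexify (U \<theta>) = u \<xi> (complexify \<theta>)" and cV: "complexify (V \<theta>) = Y \<xi> (complexify \<theta>)" for \<theta>
    using analytic_familyD(3)[OF fam(1) _ cs] analytic_familyD(3)[OF fam(2) _ cs] by (auto simp: vec_eq_iff U_def V_def)
  have dU: "(U has_derivative (\<lambda>h. \<chi> i. Re (dd (\<lambda>z. u \<xi> z $ i) (complexify h) (complexify \<theta>)))) (at \<theta>)"
    and dV: "(V has_derivative (\<lambda>h. \<chi> i. Re (dd (\<lambda>z. Y \<xi> z $ i) (complexify h) (complexify \<theta>)))) (at \<theta>)" for \<theta>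
    by (rule has_derivative_vec_components; simp add: U_def V_def;
        intro bounded_linear.has_derivative[OF bounded_linear_Re] hol_real_derivative[OF hu cs] hol_real_derivative[OF hY cs])+
  have V_small: "\<bar>V \<theta> $ i\<bar> < \<rho>" for \<theta> i
  proof -
    have "\<bar>V \<theta> $ i\<bar> \<le> norm (Y \<xi> (complexify \<theta>) $ i)" by (simp add: V_def abs_Re_le_cmod)
    also have "\<dots> \<le> q" using comp_le[of "Y \<xi> (complexify \<theta>)" i] S(1)[OF cs] by (rule order_trans)
    finally show ?thesis using q \<rho> by simp
  qed
  have per: "torus_periodic U" "torus_periodic V"
  proof -
    have cx: "complexify (x + axis i (2 * pi)) = complexify x + axis i (2 * of_real pi)" for x :: "real ^ 'n" and i
      by (simp add: vec_eq_iff axis_def)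
    have pi: "axis i (2 * of_real pi) \<in> (periods :: (complex ^ 'n) set)" for i by (simp add: periods_def)
    show "torus_periodic U" "torus_periodic V"
      by (rule torus_periodicI; simp only: U_def V_def cx analytic_familyD(2)[OF fam(1) singletonI cs pi] analytic_familyD(2)[OF fam(2) singletonI cs pi])+
  qed
  \<comment> \<open>The entries of the Jacobian of \<open>U\<close> are at most \<open>q\<close>, so
    \<open>n^2 * q\<close> bounds its norm; as a contraction, \<open>U\<close> cannot destroy the
    injectivity of the identity.\<close>
  have Lip: "norm (U \<theta> - U \<theta>') \<le> 1 / 2 * norm (\<theta> - \<theta>')" for \<theta> \<theta>'
  proof (rule differentiable_bound[OF convex_UNIV _ _ UNIV_I UNIV_I])
    fix x :: "real ^ 'n"
    show "(U has_derivative (\<lambda>h. \<chi> i. Re (dd (\<lambda>z. u \<xi> z $ i) (complexify h) (complexify x)))) (at x within UNIV)" using dU by simp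
    show "onorm (\<lambda>h. \<chi> i. Re (dd (\<lambda>z. u \<xi> z $ i) (complexify h) (complexify x))) \<le> 1 / 2"
    proof (rule onorm_le)
      fix h :: "real ^ 'n"
      have 1: "norm (dd (\<lambda>z. u \<xi> z $ i) (complexify h) (complexify x)) \<le> real CARD('n) * (norm h * q)" for i
        unfolding hol_dd_axis[OF hu cs, of _ "complexify h"]
        by (rule norm_sum_le_card) (use S(2)[OF cs] q comp_le[of "complexify h"] in \<open>auto simp: norm_mult intro!: mult_mono\<close>)
      have "norm (\<chi> i. Re (dd (\<lambda>z. u \<xi> z $ i) (complexify h) (complexify x))) = norm (complexify (\<chi> i. Re (dd (\<lambda>z. u \<xi> z $ i) (complexify h) (complexify x))))"
        by (simp only: norm_complexify)
      also have "\<dots> \<le> real CARD('n) * (real CARD('n) * (norm h * q))"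
        by (rule norm_vec_le_card) (use 1 abs_Re_le_cmod order_trans in fastforce)
      also have "\<dots> = ((real CARD('n))\<^sup>2 * q) * norm h" by (simp add: power2_eq_square)
      also have "\<dots> \<le> 1 / 2 * norm h" using q(3) by (rule mult_right_mono) simp
      finally show "norm (\<chi> i. Re (dd (\<lambda>z. u \<xi> z $ i) (complexify h) (complexify x))) \<le> 1 / 2 * norm h" .
    qed
  qed
  define X where "X = (\<lambda>\<theta>. \<theta> + U \<theta>)"
  define Z where "Z = (\<lambda>\<theta>. y0 + V \<theta>)"
  have contU: "continuous_on UNIV U" "continuous_on UNIV V"
    by (rule continuous_at_imp_continuous_on, rule ballI, rule has_derivative_continuous, rule dU)
      (rule continuous_at_imp_continuous_on, rule ballI, rule has_derivative_continuous, rule dV)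
  have emb: "torus_embedding Z X"
    unfolding torus_embedding_def
  proof (intro conjI allI impI)
    show "continuous_on UNIV Z" "continuous_on UNIV X" unfolding Z_def X_def by (intro continuous_intros contU)+
    show "torus_periodic Z" "torus_periodic (\<lambda>\<theta>. X \<theta> - \<theta>)" using per unfolding torus_periodic_def Z_def X_def by auto
    fix \<theta> \<theta>' assume "Z \<theta> = Z \<theta>' \<and> X \<theta> - X \<theta>' \<in> torus_lattice"
    then obtain v where v: "v \<in> torus_lattice" "X \<theta> - X \<theta>' = v" by blast
    \<comment> \<open>Absorbing the lattice vector, \<open>X\<close> takes equal values at
      \<open>\<theta>\<close> and \<open>\<theta>' + v\<close>, and the contraction property makes
      these two points coincide.\<close>
    have "U (\<theta>' + v) = U \<theta>'" using per(1) v(1) unfolding torus_periodic_def by blast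
    then have "\<theta> - (\<theta>' + v) = U (\<theta>' + v) - U \<theta>" using v(2) unfolding X_def by (simp add: algebra_simps)
    then have "norm (\<theta> - (\<theta>' + v)) \<le> 1 / 2 * norm (\<theta> - (\<theta>' + v))"
      using Lip[of "\<theta>' + v" \<theta>] by (simp add: norm_minus_commute)
    then have "\<theta> - \<theta>' = v" by (simp add: algebra_simps)
    then show "\<theta> - \<theta>' \<in> torus_lattice" using v by simp
  qed
  have h\<Phi>: "hol (\<Phi> \<xi>) (pdom \<rho>)" using \<Phi> by (auto simp: perturbation_def analytic_family_def)
  have sol: "hamilton_solution G (\<lambda>y x. hamiltonian \<omega> P y x \<xi> \<epsilon>) (\<lambda>t. Z (\<theta> + t *\<^sub>R p)) (\<lambda>t. X (\<theta> + t *\<^sub>R p))" for \<theta>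
    unfolding hamilton_solution_def
  proof (intro allI conjI exI)
    fix t
    define \<phi> where "\<phi> = \<theta> + t *\<^sub>R p"
    define w where "w = cjoin (complexify (V \<phi>)) (complexify (X \<phi>))"
    define Hy where "Hy = \<omega> \<xi> + (\<chi> i. Re (dd (\<Phi> \<xi>) (axis (Inl i) 1) w))"
    define Hx where "Hx = (\<chi> i. Re (dd (\<Phi> \<xi>) (axis (Inr i) 1) w))"
    have w_eq: "w = cjoin (Y \<xi> (complexify \<phi>)) (complexify \<phi> + u \<xi> (complexify \<phi>))"
      by (simp add: w_def X_def complexify_add cU cV)
    note eqs = kam_torus_equations[OF st \<Phi> \<rho> r q cs[of \<phi>], folded w_eq]
    show "Z (\<theta> + t *\<^sub>R p) \<in> interior G" unfolding Z_def by (rule G) (rule V_small)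
    have lin1: "bounded_linear (\<lambda>h. cjoin (complexify h) 0 :: complex ^ ('n + 'n))" and lin2: "bounded_linear (\<lambda>h. cjoin 0 (complexify h) :: complex ^ ('n + 'n))"
      by (auto intro!: linear_conv_bounded_linear[THEN iffD1] linearI simp: vec_sum_eq_iff scaleR_conv_of_real[where 'a=complex])
    have ddl: "dd (\<Phi> \<xi>) (cjoin (complexify h) 0) w = (\<Sum>i\<in>UNIV. of_real (h $ i) * dd (\<Phi> \<xi>) (axis (Inl i) 1) w)"
      and ddr: "dd (\<Phi> \<xi>) (cjoin 0 (complexify h)) w = (\<Sum>i\<in>UNIV. of_real (h $ i) * dd (\<Phi> \<xi>) (axis (Inr i) 1) w)" for h
      using hol_dd_axis[OF h\<Phi> eqs(1), of "cjoin (complexify h) 0"] hol_dd_axis[OF h\<Phi> eqs(1), of "cjoin 0 (complexify h)"]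
      by (auto simp: sum_UNIV_Plus)
    have sp: "cjoin (complexify (v - y0)) a = cjoin (complexify v) 0 + cjoin (- complexify y0) a"
      and sp2: "cjoin (complexify (V \<phi>)) (complexify v) = cjoin (complexify (V \<phi>)) 0 + cjoin 0 (complexify v)" for v a
      by (simp_all add: vec_sum_eq_iff)
    have "((\<lambda>v. \<omega> \<xi> \<bullet> v + Re (\<Phi> \<xi> (cjoin (complexify (v - y0)) (complexify (X \<phi>))))) has_derivative (\<lambda>h. h \<bullet> Hy)) (at (Z \<phi>))"
    proof -
      have "((\<lambda>v. cjoin (complexify (v - y0)) (complexify (X \<phi>))) has_derivative (\<lambda>h. cjoin (complexify h) 0)) (at (Z \<phi>))"
        unfolding sp
        by (rule has_derivative_eq_rhs[OF has_derivative_add[OF bounded_linear_imp_has_derivative[OF lin1] has_derivative_const]]) simp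
      moreover have "(\<Phi> \<xi> has_derivative (\<lambda>h. dd (\<Phi> \<xi>) h w)) (at (cjoin (complexify (Z \<phi> - y0)) (complexify (X \<phi>))))"
        using hol_has_derivative[OF h\<Phi> eqs(1)] by (simp add: w_def Z_def)
      ultimately have "((\<lambda>v. \<Phi> \<xi> (cjoin (complexify (v - y0)) (complexify (X \<phi>)))) has_derivative (\<lambda>h. dd (\<Phi> \<xi>) (cjoin (complexify h) 0) w)) (at (Z \<phi>))"
        by (rule has_derivative_compose)
      from bounded_linear.has_derivative[OF bounded_linear_Re this]
      have "((\<lambda>v. \<omega> \<xi> \<bullet> v + Re (\<Phi> \<xi> (cjoin (complexify (v - y0)) (complexify (X \<phi>))))) has_derivative (\<lambda>h. \<omega> \<xi> \<bullet> h + Re (dd (\<Phi> \<xi>) (cjoin (complexify h) 0) w))) (at (Z \<phi>))"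
        by (intro has_derivative_add has_derivative_inner_right has_derivative_ident)
      moreover have "(\<lambda>h. \<omega> \<xi> \<bullet> h + Re (dd (\<Phi> \<xi>) (cjoin (complexify h) 0) w)) = (\<lambda>h. h \<bullet> Hy)"
        unfolding ddl by (simp add: fun_eq_iff Hy_def inner_add_right inner_commute) (simp add: inner_vec_def)
      ultimately show ?thesis by simp
    qed
    then show "GDERIV (\<lambda>v. hamiltonian \<omega> P v (X (\<theta> + t *\<^sub>R p)) \<xi> \<epsilon>) (Z (\<theta> + t *\<^sub>R p)) :> Hy"
      unfolding gderiv_def \<phi>_def[symmetric]
    proof (rule has_derivative_transform_within_open)
      \<comment> \<open>\<open>\<Phi>\<close> represents \<open>P\<close> only for action
        displacements below \<open>\<rho>\<close>; agreement on this neighbourhood suffices for the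
        gradient.\<close>
      let ?N = "{v. \<forall>i. \<bar>(v - y0) $ i\<bar> < \<rho>}"
      have "?N = (\<Inter>i. {v. \<bar>(v - y0) $ i\<bar> < \<rho>})" by auto
      then show "open ?N" by (simp only:) (intro open_INT open_Collect_less continuous_intros finite ballI)
      show "Z \<phi> \<in> ?N" using V_small by (simp add: Z_def)
      show "\<omega> \<xi> \<bullet> v + Re (\<Phi> \<xi> (cjoin (complexify (v - y0)) (complexify (X \<phi>)))) = hamiltonian \<omega> P v (X \<phi>) \<xi> \<epsilon>" if "v \<in> ?N" for v
        using P[of "v - y0" "X \<phi>"] that by (simp add: hamiltonian_def)
    qed
    have "((\<lambda>v. \<omega> \<xi> \<bullet> Z \<phi> + Re (\<Phi> \<xi> (cjoin (complexify (V \<phi>)) (complexify v)))) has_derivative (\<lambda>h. h \<bullet> Hx)) (at (X \<phi>))"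
    proof -
      have "((\<lambda>v. cjoin (complexify (V \<phi>)) (complexify v)) has_derivative (\<lambda>h. cjoin 0 (complexify h))) (at (X \<phi>))"
        unfolding sp2
        by (rule has_derivative_eq_rhs[OF has_derivative_add[OF has_derivative_const bounded_linear_imp_has_derivative[OF lin2]]]) simp
      moreover have "(\<Phi> \<xi> has_derivative (\<lambda>h. dd (\<Phi> \<xi>) h w)) (at (cjoin (complexify (V \<phi>)) (complexify (X \<phi>))))"
        using hol_has_derivative[OF h\<Phi> eqs(1)] by (simp add: w_def)
      ultimately have "((\<lambda>v. \<Phi> \<xi> (cjoin (complexify (V \<phi>)) (complexify v))) has_derivative (\<lambda>h. dd (\<Phi> \<xi>) (cjoin 0 (complexify h)) w)) (at (X \<phi>))"
        by (rule has_derivative_compose)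
      from bounded_linear.has_derivative[OF bounded_linear_Re this]
      have "((\<lambda>v. \<omega> \<xi> \<bullet> Z \<phi> + Re (\<Phi> \<xi> (cjoin (complexify (V \<phi>)) (complexify v)))) has_derivative (\<lambda>h. 0 + Re (dd (\<Phi> \<xi>) (cjoin 0 (complexify h)) w))) (at (X \<phi>))"
        by (intro has_derivative_add has_derivative_const)
      moreover have "(\<lambda>h. 0 + Re (dd (\<Phi> \<xi>) (cjoin 0 (complexify h)) w)) = (\<lambda>h. h \<bullet> Hx)"
        unfolding ddr by (simp add: fun_eq_iff Hx_def inner_vec_def)
      ultimately show ?thesis by simp
    qed
    moreover have "(\<lambda>v. \<omega> \<xi> \<bullet> Z \<phi> + Re (\<Phi> \<xi> (cjoin (complexify (V \<phi>)) (complexify v)))) = (\<lambda>v. hamiltonian \<omega> P (Z \<phi>) v \<xi> \<epsilon>)"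
      using P[OF V_small] by (simp add: hamiltonian_def Z_def)
    ultimately show "GDERIV (\<lambda>v. hamiltonian \<omega> P (Z (\<theta> + t *\<^sub>R p)) v \<xi> \<epsilon>) (X (\<theta> + t *\<^sub>R p)) :> Hx"
      unfolding gderiv_def \<phi>_def[symmetric] by simp
    have line: "((\<lambda>t. \<theta> + t *\<^sub>R p) has_derivative (\<lambda>s. s *\<^sub>R p)) (at t)" by (auto intro!: derivative_eq_intros)
    have dV': "((\<lambda>t. Z (\<theta> + t *\<^sub>R p)) has_derivative (\<lambda>s. \<chi> i. Re (dd (\<lambda>z. Y \<xi> z $ i) (complexify (s *\<^sub>R p)) (complexify \<phi>)))) (at t)"
      unfolding Z_def using has_derivative_add[OF has_derivative_const[of y0] has_derivative_compose[OF line dV]] by (simp add: \<phi>_def)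
    have dX': "((\<lambda>t. X (\<theta> + t *\<^sub>R p)) has_derivative (\<lambda>s. s *\<^sub>R p + (\<chi> i. Re (dd (\<lambda>z. u \<xi> z $ i) (complexify (s *\<^sub>R p)) (complexify \<phi>))))) (at t)"
      unfolding X_def using has_derivative_add[OF line has_derivative_compose[OF line dU]] by (simp add: \<phi>_def)
    have scale: "dd (\<lambda>z. u \<xi> z $ i) (complexify (s *\<^sub>R p)) (complexify \<phi>) = of_real s * dd (\<lambda>z. u \<xi> z $ i) (complexify p) (complexify \<phi>)"
      "dd (\<lambda>z. Y \<xi> z $ i) (complexify (s *\<^sub>R p)) (complexify \<phi>) = of_real s * dd (\<lambda>z. Y \<xi> z $ i) (complexify p) (complexify \<phi>)" for s i
      unfolding complexify_scaleR by (rule hol_dd_smult[OF hu cs] hol_dd_smult[OF hY cs])+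
    show "((\<lambda>t. Z (\<theta> + t *\<^sub>R p)) has_vector_derivative - Hx) (at t)"
      unfolding has_vector_derivative_def using dV' unfolding scale eqs(3)
      by (rule has_derivative_eq_rhs) (simp add: fun_eq_iff vec_eq_iff Hx_def)
    show "((\<lambda>t. X (\<theta> + t *\<^sub>R p)) has_vector_derivative Hy) (at t)"
      unfolding has_vector_derivative_def using dX' unfolding scale
    proof (rule has_derivative_eq_rhs)
      have "Re (dd (\<lambda>z. u \<xi> z $ i) (complexify p) (complexify \<phi>)) = Hy $ i - p $ i" for i
        using arg_cong[OF eqs(2)[of i], of Re] by (simp add: Hy_def)
      then show "(\<lambda>s. s *\<^sub>R p + (\<chi> i. Re (of_real s * dd (\<lambda>z. u \<xi> z $ i) (complexify p) (complexify \<phi>)))) = (\<lambda>s. s *\<^sub>R Hy)"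
        by (simp add: fun_eq_iff vec_eq_iff right_diff_distrib)
    qed
  qed
  show ?thesis unfolding admits_invariant_torus_def using emb sol by blast
qed

section \<open>Complex extension of the perturbation\<close>

lemma holomorphic_zero_on_reals:
  assumes f: "f holomorphic_on T" and T: "open T" "connected T" and 0: "0 \<in> T" and w: "w \<in> T"
    and zero: "\<And>t::real. of_real t \<in> T \<Longrightarrow> f (of_real t) = 0"
  shows "f w = 0"
proof (rule analytic_continuation[OF f T _ 0 _ _ w])
  show "T \<inter> \<real> \<subseteq> T" by auto
  show "f z = 0" if "z \<in> T \<inter> \<real>" for z using that zero by (auto elim!: Reals_cases)
  show "0 islimpt T \<inter> \<real>"
    unfolding islimpt_approachable
  proof (intro allI impI)
    fix e :: real assume "e > 0"
    obtain d where d: "d > 0" "ball 0 d \<subseteq> T" using T(1) 0 open_contains_ball by blast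
    define x where "x = min d e / 2"
    have "x > 0" "x < d" "x < e" using d \<open>e > 0\<close> by (auto simp: x_def min_def)
    then have "of_real x \<in> T \<inter> \<real>" "of_real x \<noteq> (0::complex)" "dist (of_real x) (0::complex) < e"
      using d(2) by (auto simp: dist_norm)
    then show "\<exists>x'\<in>T \<inter> \<real>. x' \<noteq> 0 \<and> dist x' 0 < e" by blast
  qed
qed

text \<open>If convergence failed at \<open>w\<close>, a subsequence would stay away from
  \<open>g w\<close>. By Montel it has a further subsequence converging to a holomorphic function
  that agrees with \<open>g\<close> at real points, hence everywhere: a contradiction.\<close>

lemma pointwise_limit_from_reals:
  assumes f: "\<And>n. f n holomorphic_on T" "g holomorphic_on T" and T: "open T" "connected T" "0 \<in> T" and w: "w \<in> T"
    and B: "\<And>n z. z \<in> T \<Longrightarrow> norm (f n z) \<le> B"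
    and lim: "\<And>t::real. of_real t \<in> T \<Longrightarrow> (\<lambda>n. f n (of_real t)) \<longlonglongrightarrow> g (of_real t)"
  shows "(\<lambda>n. f n w) \<longlonglongrightarrow> g w"
proof (rule ccontr)
  assume "\<not> ?thesis"
  then obtain e where e: "e > 0" "\<not> (\<forall>\<^sub>F n in sequentially. dist (f n w) (g w) < e)"
    unfolding tendsto_iff by blast
  then have "\<exists>\<^sub>F n in sequentially. e \<le> dist (f n w) (g w)" by (simp add: frequently_def not_le)
  then have "infinite {n. e \<le> dist (f n w) (g w)}" by (simp add: cofinite_eq_sequentially[symmetric] frequently_cofinite)
  then obtain k :: "nat \<Rightarrow> nat" where k: "strict_mono k" "\<And>n. e \<le> dist (f (k n) w) (g w)"
    using infinite_enumerate by blast
  obtain g' r where g': "g' holomorphic_on T" "strict_mono (r :: nat \<Rightarrow> nat)"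
    "\<And>x. x \<in> T \<Longrightarrow> (\<lambda>n. f (k (r n)) x) \<longlonglongrightarrow> g' x"
  proof (rule Montel[where S=T and \<H>="range f" and \<F>="\<lambda>n. f (k n)"])
    show "\<exists>B. \<forall>h\<in>range f. \<forall>z\<in>K. norm (h z) \<le> B" if "K \<subseteq> T" for K using B that by (intro exI[of _ B]) auto
  qed (use f T that in auto)
  have sub: "strict_mono (\<lambda>n. k (r n))" using k(1) g'(2) by (simp add: strict_mono_def)
  have "(\<lambda>z. g' z - g z) w = 0"
  proof (rule holomorphic_zero_on_reals[OF _ T w])
    show "(\<lambda>z. g' z - g z) holomorphic_on T" by (intro holomorphic_intros g' f)
    fix t :: real assume t: "of_real t \<in> T"
    have "(\<lambda>n. f (k (r n)) (of_real t)) \<longlonglongrightarrow> g (of_real t)"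
      using LIMSEQ_subseq_LIMSEQ[OF lim[OF t] sub] by (simp add: o_def)
    then show "g' (of_real t) - g (of_real t) = 0" using LIMSEQ_unique g'(3)[OF t] by fastforce
  qed
  then have "(\<lambda>n. f (k (r n)) w) \<longlonglongrightarrow> g w" using g'(3)[OF w] by simp
  then have "\<forall>\<^sub>F n in sequentially. dist (f (k (r n)) w) (g w) < e" using e(1) unfolding tendsto_iff by blast
  then obtain n where "dist (f (k (r n)) w) (g w) < e" by (auto simp: eventually_sequentially)
  with k(2)[of "r n"] show False by simp
qed

text \<open>A complex point is the value at \<open>\<i>\<close> of a complexified real line, whose
  real times are real points. The times for which the line stays in the domain form a convex open
  set containing \<open>0\<close>, so one-variable identity theorems suffice.\<close>

lemma real_line_through:
  fixes w :: "complex ^ ('n::finite + 'n)"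
  assumes w: "w \<in> pdom \<rho>"
  obtains a b :: "real ^ ('n + 'n)" and T where "w = complexify a + \<i> *s complexify b"
    "T = {t. complexify a + t *s complexify b \<in> pdom \<rho>}" "open T" "connected T" "0 \<in> T" "\<i> \<in> T"
proof -
  define a where "a = (\<chi> k. Re (w $ k))"
  define b where "b = (\<chi> k. Im (w $ k))"
  define T where "T = {t. complexify a + t *s complexify b \<in> pdom \<rho>}"
  have eq: "w = complexify a + \<i> *s complexify b" by (simp add: vec_eq_iff a_def b_def complex_eq)
  have "continuous_on UNIV (\<lambda>t. complexify a + t *s complexify b)"
    by (intro continuous_intros linear_continuous_on bounded_linear_smult_left)
  then have "open ((\<lambda>t. complexify a + t *s complexify b) -` pdom \<rho>)" by (intro open_vimage open_pdom)
  then have "open T" by (simp add: T_def vimage_def)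
  moreover have "connected T"
  proof (rule convex_connected, rule convexI)
    fix x y :: complex and u v :: real
    assume a: "x \<in> T" "y \<in> T" "0 \<le> u" "0 \<le> v" "u + v = 1"
    have "u *\<^sub>R (complexify a + x *s complexify b) + v *\<^sub>R (complexify a + y *s complexify b) \<in> pdom \<rho>"
      using a by (intro convexD[OF convex_pdom]) (auto simp: T_def)
    moreover have "u *\<^sub>R (complexify a + x *s complexify b) + v *\<^sub>R (complexify a + y *s complexify b)
        = complexify a + (u *\<^sub>R x + v *\<^sub>R y) *s complexify b"
    proof -
      have "u *\<^sub>R (c + x * d) + v *\<^sub>R (c + y * d) = c + (u *\<^sub>R x + v *\<^sub>R y) * d" for c d :: complex
      proof -
        have "u *\<^sub>R (c + x * d) + v *\<^sub>R (c + y * d) = (u + v) *\<^sub>R c + (u *\<^sub>R x + v *\<^sub>R y) * d" by (simp add: algebra_simps)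
        then show ?thesis using a(5) by simp
      qed
      then show ?thesis
        unfolding vec_eq_iff vector_add_component vector_scaleR_component vector_smult_component by blast
    qed
    ultimately show "u *\<^sub>R x + v *\<^sub>R y \<in> T" by (simp add: T_def)
  qed
  moreover have "\<i> \<in> T" using w eq by (simp add: T_def)
  moreover have "0 \<in> T"
  proof -
    have "\<bar>Re (w $ Inl i)\<bar> < \<rho>" "0 < \<rho>" for i
      using w abs_Re_le_cmod[of "w $ Inl i"] abs_ge_zero[of "Im (w $ Inr i)"] unfolding pdom_def mem_Collect_eq
      by (meson order_le_less_trans)+
    then show ?thesis by (simp add: T_def pdom_def a_def)
  qed
  ultimately show ?thesis using that[of a b T] eq T_def by blast
qed

lemma real_points_on_line: "complexify a + of_real t *s complexify b = complexify (a + t *\<^sub>R b)"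
  by (simp add: complexify_add complexify_scaleR)

lemma pdom_hol_zero:
  fixes g :: "complex ^ ('n::finite + 'n) \<Rightarrow> complex"
  assumes g: "hol g (pdom \<rho>)" and zero: "\<And>v. complexify v \<in> pdom \<rho> \<Longrightarrow> g (complexify v) = 0" and w: "w \<in> pdom \<rho>"
  shows "g w = 0"
proof -
  obtain a b :: "real ^ ('n + 'n)" and T where T: "w = complexify a + \<i> *s complexify b"
    "T = {t. complexify a + t *s complexify b \<in> pdom \<rho>}" "open T" "connected T" "0 \<in> T" "\<i> \<in> T"
    by (rule real_line_through[OF w])
  have "(\<lambda>t. g (complexify a + t *s complexify b)) \<i> = 0"
    by (rule holomorphic_zero_on_reals[OF hol_line_holomorphic[OF g] T(3-6)])
      (use zero in \<open>auto simp: T(2) real_points_on_line\<close>)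
  then show ?thesis using T(1) by simp
qed

text \<open>
  Continuity in the parameter is known at real points only; by Montel's theorem and the identity theorem it
  propagates to complex points.
\<close>

lemma perturbation_continuous:
  fixes \<Phi> :: "real ^ 'n \<Rightarrow> complex ^ ('n + 'n) \<Rightarrow> complex"
  assumes hol: "\<And>\<xi>. \<xi> \<in> B \<Longrightarrow> hol (\<Phi> \<xi>) (pdom \<rho>)"
    and bd: "\<And>\<xi> w. \<xi> \<in> B \<Longrightarrow> w \<in> pdom \<rho> \<Longrightarrow> norm (\<Phi> \<xi> w) \<le> \<mu>"
    and cont: "\<And>v. complexify v \<in> pdom \<rho> \<Longrightarrow> continuous_on B (\<lambda>\<xi>. \<Phi> \<xi> (complexify v))"
  shows "continuous_on (B \<times> pdom \<rho>) (\<lambda>(\<xi>, w). \<Phi> \<xi> w)"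
  unfolding continuous_on_sequentially
proof (intro allI ballI impI)
  fix x :: "nat \<Rightarrow> (real ^ 'n) \<times> (complex ^ ('n + 'n))" and a
  assume a: "a \<in> B \<times> pdom \<rho>" and x: "(\<forall>n. x n \<in> B \<times> pdom \<rho>) \<and> x \<longlonglongrightarrow> a"
  define \<xi> where "\<xi> = fst a"
  define w where "w = snd a"
  have \<xi>: "\<xi> \<in> B" and w: "w \<in> pdom \<rho>" using a by (auto simp: \<xi>_def w_def)
  have xn: "fst (x n) \<in> B" "snd (x n) \<in> pdom \<rho>" for n using x by (auto simp: mem_Times_iff)
  have l\<xi>: "(\<lambda>n. fst (x n)) \<longlonglongrightarrow> \<xi>" and lw: "(\<lambda>n. snd (x n)) \<longlonglongrightarrow> w"
    using x tendsto_fst[of x a sequentially] tendsto_snd[of x a sequentially] by (auto simp: \<xi>_def w_def)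
  obtain c b :: "real ^ ('n + 'n)" and T where T: "w = complexify c + \<i> *s complexify b"
    "T = {t. complexify c + t *s complexify b \<in> pdom \<rho>}" "open T" "connected T" "0 \<in> T" "\<i> \<in> T"
    by (rule real_line_through[OF w])
  have 1: "(\<lambda>n. \<Phi> (fst (x n)) (complexify c + \<i> *s complexify b)) \<longlonglongrightarrow> \<Phi> \<xi> (complexify c + \<i> *s complexify b)"
  proof (rule pointwise_limit_from_reals[where f="\<lambda>n t. \<Phi> (fst (x n)) (complexify c + t *s complexify b)"
        and g="\<lambda>t. \<Phi> \<xi> (complexify c + t *s complexify b)", OF _ _ T(3-6)])
    show "(\<lambda>t. \<Phi> (fst (x n)) (complexify c + t *s complexify b)) holomorphic_on T" for n
      by (rule hol_line_holomorphic[OF hol[OF xn(1)]]) (simp add: T(2))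
    show "(\<lambda>t. \<Phi> \<xi> (complexify c + t *s complexify b)) holomorphic_on T"
      by (rule hol_line_holomorphic[OF hol[OF \<xi>]]) (simp add: T(2))
    show "norm (\<Phi> (fst (x n)) (complexify c + t *s complexify b)) \<le> \<mu>" if "t \<in> T" for n t
      using bd[OF xn(1)] that by (simp add: T(2))
    fix t :: real assume "of_real t \<in> T"
    then have "complexify (c + t *\<^sub>R b) \<in> pdom \<rho>" by (simp add: T(2) real_points_on_line)
    from continuous_on_tendsto_compose[OF cont[OF this] l\<xi> \<xi>] xn(1)
    show "(\<lambda>n. \<Phi> (fst (x n)) (complexify c + of_real t *s complexify b)) \<longlonglongrightarrow> \<Phi> \<xi> (complexify c + of_real t *s complexify b)"
      unfolding real_points_on_line by simp
  qed
  obtain d where d: "d > 0" "ball w d \<subseteq> pdom \<rho>" using open_pdom w open_contains_ball by blast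
  \<comment> \<open>A Lipschitz constant common to all parameters upgrades convergence at the fixed
    point \<open>w\<close> to convergence along the moving points \<open>snd (x n)\<close>.\<close>
  have Lip: "norm (\<Phi> \<zeta> w' - \<Phi> \<zeta> w) \<le> 4 * \<mu> / d * norm (w' - w)" if "\<zeta> \<in> B" "w' \<in> ball w (d / 2)" for \<zeta> w'
  proof (rule differentiable_bound[OF convex_ball[of w "d / 2"]])
    fix v assume v: "v \<in> ball w (d / 2)"
    have sub: "ball v (d / 2) \<subseteq> pdom \<rho>"
    proof
      fix z assume "z \<in> ball v (d / 2)"
      then have "z \<in> ball w d" using dist_triangle[of w z v] v by simp
      then show "z \<in> pdom \<rho>" using d(2) by blast
    qed
    then have "v \<in> pdom \<rho>" using d by (meson centre_in_ball half_gt_zero subsetD)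
    then show "(\<Phi> \<zeta> has_derivative (\<lambda>h. dd (\<Phi> \<zeta>) h v)) (at v within ball w (d / 2))"
      using hol_has_derivative[OF hol[OF that(1)]] has_derivative_at_withinI by blast
    show "onorm (\<lambda>h. dd (\<Phi> \<zeta>) h v) \<le> 4 * \<mu> / d"
    proof (rule onorm_le)
      fix h
      have "norm (dd (\<Phi> \<zeta>) h v) \<le> 2 * \<mu> / (d / 2) * norm h"
        by (rule ball_Cauchy[OF hol[OF that(1)] bd[OF that(1)] sub]) (use d in auto)
      then show "norm (dd (\<Phi> \<zeta>) h v) \<le> 4 * \<mu> / d * norm h" by simp
    qed
  qed (use that d in auto)
  have 2: "(\<lambda>n. \<Phi> (fst (x n)) (snd (x n)) - \<Phi> (fst (x n)) w) \<longlonglongrightarrow> 0"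
  proof (rule Lim_null_comparison)
    have "\<forall>\<^sub>F n in sequentially. snd (x n) \<in> ball w (d / 2)"
      using lw d by (intro topological_tendstoD) auto
    then show "\<forall>\<^sub>F n in sequentially. norm (\<Phi> (fst (x n)) (snd (x n)) - \<Phi> (fst (x n)) w) \<le> 4 * \<mu> / d * norm (snd (x n) - w)"
      by eventually_elim (rule Lip[OF xn(1)])
    have "(\<lambda>n. 4 * \<mu> / d * norm (snd (x n) - w)) \<longlonglongrightarrow> 4 * \<mu> / d * norm (w - w)" by (intro tendsto_intros lw)
    then show "(\<lambda>n. 4 * \<mu> / d * norm (snd (x n) - w)) \<longlonglongrightarrow> 0" by simp
  qed
  have "(\<lambda>n. \<Phi> (fst (x n)) (snd (x n))) \<longlonglongrightarrow> \<Phi> \<xi> w"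
    using tendsto_add[OF 2 1[folded T(1)]] by simp
  then show "((\<lambda>(\<xi>, w). \<Phi> \<xi> w) \<circ> x) \<longlonglongrightarrow> (\<lambda>(\<xi>, w). \<Phi> \<xi> w) a"
    by (simp add: o_def case_prod_beta \<xi>_def w_def)
qed

definition yproj :: "complex ^ ('n::finite + 'n) \<Rightarrow> complex ^ 'n" where "yproj w = (\<chi> i. w $ Inl i)"
definition xproj :: "complex ^ ('n::finite + 'n) \<Rightarrow> complex ^ 'n" where "xproj w = (\<chi> i. w $ Inr i)"

lemma bounded_linear_proj: "bounded_linear (\<lambda>w. (yproj w, xproj w))"
  by (auto intro!: linear_conv_bounded_linear[THEN iffD1] linearI simp: yproj_def xproj_def vec_eq_iff)

text \<open>For each parameter some complex extension is merely chosen, so periodicity and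
  continuity in the parameter are known at real points only and are carried over by the identity
  theorem. The condition on \<open>\<rho>\<close> fits the componentwise domain into a neighbourhood
  measured by the Euclidean norm.\<close>

lemma perturbation_exists:
  fixes P :: "real ^ 'n \<Rightarrow> real ^ 'n \<Rightarrow> real ^ 'n \<Rightarrow> real \<Rightarrow> real"
  assumes an: "\<And>\<xi>. \<xi> \<in> B \<Longrightarrow> real_analytic_with r M G (\<lambda>y x. P y x \<xi> \<epsilon>)"
    and per: "\<And>y \<xi>. y \<in> G \<Longrightarrow> \<xi> \<in> B \<Longrightarrow> torus_periodic (\<lambda>x. P y x \<xi> \<epsilon>)"
    and cont: "\<And>y x. y \<in> G \<Longrightarrow> continuous_on B (\<lambda>\<xi>. P y x \<xi> \<epsilon>)"
    and G: "\<And>y. (\<And>i. \<bar>y $ i\<bar> < \<rho>) \<Longrightarrow> y0 + y \<in> G"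
    and \<rho>: "0 < \<rho>" "real CARD('n) * \<rho> < r" and \<epsilon>: "0 < \<epsilon>" and \<mu>: "\<epsilon> * M \<le> \<mu>"
  obtains \<Phi> where "perturbation B \<rho> \<mu> \<Phi>"
    "\<And>\<xi> y x. \<xi> \<in> B \<Longrightarrow> (\<And>i. \<bar>y $ i\<bar> < \<rho>) \<Longrightarrow> \<Phi> \<xi> (cjoin (complexify y) (complexify x)) = of_real (\<epsilon> * P (y0 + y) x \<xi> \<epsilon>)"
proof -
  have "\<forall>\<xi>\<in>B. \<exists>F. holomorphic_several_on F (complex_neighbourhood G r) \<and>
      (\<forall>z \<in> complex_neighbourhood G r. norm (F z) \<le> M) \<and>
      (\<forall>y\<in>G. \<forall>x. F (complexify y, complexify x) = of_real (P y x \<xi> \<epsilon>))"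
    using an unfolding real_analytic_with_def by blast
  then obtain F where F: "\<And>\<xi>. \<xi> \<in> B \<Longrightarrow> holomorphic_several_on (F \<xi>) (complex_neighbourhood G r)"
    "\<And>\<xi> z. \<xi> \<in> B \<Longrightarrow> z \<in> complex_neighbourhood G r \<Longrightarrow> norm (F \<xi> z) \<le> M"
    "\<And>\<xi> y x. \<xi> \<in> B \<Longrightarrow> y \<in> G \<Longrightarrow> F \<xi> (complexify y, complexify x) = of_real (P y x \<xi> \<epsilon>)"
    by metis
  define \<Phi> where "\<Phi> = (\<lambda>\<xi> w. of_real \<epsilon> * F \<xi> ((complexify y0, 0) + (yproj w, xproj w)))"
  have y0: "y0 \<in> G" using G[of 0] \<rho> by simp
  have nb: "(complexify y0, 0) + (yproj w, xproj w) \<in> complex_neighbourhood G r" if w: "w \<in> pdom \<rho>" for w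
  proof -
    have "norm (yproj w) \<le> real CARD('n) * \<rho>"
      by (rule norm_vec_le_card) (use w in \<open>auto simp: yproj_def pdom_def intro: less_imp_le\<close>)
    then have 1: "dist (complexify y0 + yproj w) (complexify y0) < r" using \<rho> by (simp add: dist_norm)
    have "norm (xproj w - complexify (\<chi> i. Re (xproj w $ i))) \<le> real CARD('n) * \<rho>"
    proof (rule norm_vec_le_card)
      fix i
      have "(xproj w - complexify (\<chi> i. Re (xproj w $ i))) $ i = \<i> * of_real (Im (w $ Inr i))"
        by (simp add: xproj_def complex_eq_iff)
      then show "norm ((xproj w - complexify (\<chi> i. Re (xproj w $ i))) $ i) \<le> \<rho>"
        using w by (simp add: norm_mult pdom_def less_imp_le)
    qed
    then have 2: "dist (0 + xproj w) (complexify (\<chi> i. Re (xproj w $ i))) < r" using \<rho> by (simp add: dist_norm)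
    show ?thesis unfolding complex_neighbourhood_def using 1 2 y0 by auto
  qed
  have real: "\<Phi> \<xi> (complexify v) = of_real (\<epsilon> * P (y0 + (\<chi> i. v $ Inl i)) (\<chi> i. v $ Inr i) \<xi> \<epsilon>)"
    and realG: "y0 + (\<chi> i. v $ Inl i) \<in> G"
    if "\<xi> \<in> B" "complexify v \<in> pdom \<rho>" for \<xi> v
  proof -
    have "\<bar>(\<chi> i. v $ Inl i) $ i\<bar> < \<rho>" for i using that(2) by (simp add: pdom_def)
    then show g: "y0 + (\<chi> i. v $ Inl i) \<in> G" by (rule G)
    have "(complexify y0, 0) + (yproj (complexify v), xproj (complexify v)) = (complexify (y0 + (\<chi> i. v $ Inl i)), complexify (\<chi> i. v $ Inr i))"
      by (simp add: vec_eq_iff yproj_def xproj_def)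
    then show "\<Phi> \<xi> (complexify v) = of_real (\<epsilon> * P (y0 + (\<chi> i. v $ Inl i)) (\<chi> i. v $ Inr i) \<xi> \<epsilon>)"
      unfolding \<Phi>_def using F(3)[OF that(1) g] by simp
  qed
  have hol: "hol (\<Phi> \<xi>) (pdom \<rho>)" if \<xi>: "\<xi> \<in> B" for \<xi>
    unfolding hol_def
  proof
    fix w :: "complex ^ ('n + 'n)" assume w: "w \<in> pdom \<rho>"
    obtain D where D: "(F \<xi> has_derivative D) (at ((complexify y0, 0) + (yproj w, xproj w)))"
      "\<And>c h. D (c *s fst h, c *s snd h) = c * D h"
      using F(1)[OF \<xi>] nb[OF w] unfolding holomorphic_several_on_def by blast
    have "((\<lambda>w. (complexify y0, 0) + (yproj w, xproj w)) has_derivative (\<lambda>h. (yproj h, xproj h))) (at w)"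
      by (rule has_derivative_eq_rhs[OF has_derivative_add[OF has_derivative_const bounded_linear_imp_has_derivative[OF bounded_linear_proj]]]) simp
    from has_derivative_mult_right[OF has_derivative_compose[OF this D(1)], of "of_real \<epsilon>"]
    have "(\<Phi> \<xi> has_derivative (\<lambda>h. of_real \<epsilon> * D (yproj h, xproj h))) (at w)" by (simp add: \<Phi>_def)
    moreover have "of_real \<epsilon> * D (yproj (c *s h), xproj (c *s h)) = c * (of_real \<epsilon> * D (yproj h, xproj h))" for c h
    proof -
      have "(yproj (c *s h), xproj (c *s h)) = (c *s fst (yproj h, xproj h), c *s snd (yproj h, xproj h))"
        by (simp add: yproj_def xproj_def vec_eq_iff)
      then show ?thesis using D(2)[of c "(yproj h, xproj h)"] by (simp add: mult.left_commute)
    qed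
    ultimately show "\<exists>D. (\<Phi> \<xi> has_derivative D) (at w) \<and> (\<forall>c h. D (c *s h) = c * D h)" by blast
  qed
  have bd: "norm (\<Phi> \<xi> w) \<le> \<mu>" if "\<xi> \<in> B" "w \<in> pdom \<rho>" for \<xi> w
  proof -
    have "norm (\<Phi> \<xi> w) = \<epsilon> * norm (F \<xi> ((complexify y0, 0) + (yproj w, xproj w)))" using \<epsilon> by (simp add: \<Phi>_def norm_mult)
    also have "\<dots> \<le> \<epsilon> * M" using F(2)[OF that(1) nb[OF that(2)]] \<epsilon> by (intro mult_left_mono) auto
    finally show ?thesis using \<mu> by simp
  qed
  have periodic: "\<Phi> \<xi> (w + v) = \<Phi> \<xi> w" if \<xi>: "\<xi> \<in> B" and w: "w \<in> pdom \<rho>" and v: "v \<in> xperiods" for \<xi> w v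
  proof -
    obtain i where i: "v = axis (Inr i) (2 * of_real pi)" using v by (auto simp: xperiods_def)
    define v0 :: "real ^ ('n + 'n)" where "v0 = axis (Inr i) (2 * pi)"
    have v0: "complexify v0 = v" by (simp add: vec_eq_iff i v0_def axis_def)
    \<comment> \<open>The difference is holomorphic and vanishes at real points, where it is a
      difference of values of the periodic function \<open>P\<close>.\<close>
    have "(\<lambda>w. \<Phi> \<xi> (w + v) - \<Phi> \<xi> w) w = 0"
    proof (rule pdom_hol_zero[OF hol_diff(1)[OF hol_compose(1)[OF hol[OF \<xi>]] hol[OF \<xi>]] _ w])
      show "hol (\<lambda>w. (w + v) $ k) (pdom \<rho>)" for k using hol_add(1)[OF hol_component hol_const] by simp
      show "w + v \<in> pdom \<rho>" if "w \<in> pdom \<rho>" for w using pdom_xperiods[OF that v] .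
      fix a :: "real ^ ('n + 'n)" assume a: "complexify a \<in> pdom \<rho>"
      have a': "complexify (a + v0) \<in> pdom \<rho>" using pdom_xperiods[OF a v] by (simp add: complexify_add v0)
      have "(\<chi> j. (a + v0) $ Inl j) = (\<chi> j. a $ Inl j)" by (simp add: vec_eq_iff v0_def axis_def)
      moreover have "(\<chi> j. (a + v0) $ Inr j) = (\<chi> j. a $ Inr j) + axis i (2 * pi)" by (simp add: vec_eq_iff v0_def axis_def)
      moreover have "(axis i (2 * pi) :: real ^ 'n) \<in> torus_lattice" unfolding torus_lattice_def
        by (auto simp: axis_def intro: exI[of _ 1] exI[of _ 0])
      ultimately have "\<Phi> \<xi> (complexify (a + v0)) = \<Phi> \<xi> (complexify a)"
        using per[OF realG[OF \<xi> a] \<xi>] unfolding real[OF \<xi> a] real[OF \<xi> a'] torus_periodic_def by simp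
      then show "\<Phi> \<xi> (complexify a + v) - \<Phi> \<xi> (complexify a) = 0" by (simp add: complexify_add v0)
    qed
    then show ?thesis by simp
  qed
  have "continuous_on (B \<times> pdom \<rho>) (\<lambda>(\<xi>, w). \<Phi> \<xi> w)"
  proof (rule perturbation_continuous[OF hol bd])
    fix v :: "real ^ ('n + 'n)" assume v: "complexify v \<in> pdom \<rho>"
    show "continuous_on B (\<lambda>\<xi>. \<Phi> \<xi> (complexify v))"
    proof (cases "B = {}")
      case False
      then have "y0 + (\<chi> i. v $ Inl i) \<in> G" using realG v by blast
      then have "continuous_on B (\<lambda>\<xi>. complex_of_real (\<epsilon> * P (y0 + (\<chi> i. v $ Inl i)) (\<chi> i. v $ Inr i) \<xi> \<epsilon>))"
        by (intro continuous_intros cont)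
      then show ?thesis by (rule continuous_on_eq) (use real v in auto)
    qed simp
  qed
  then have "perturbation B \<rho> \<mu> \<Phi>"
    unfolding perturbation_def analytic_family_def using hol periodic bd real by (auto simp: Reals_of_real)
  moreover have "\<Phi> \<xi> (cjoin (complexify y) (complexify x)) = of_real (\<epsilon> * P (y0 + y) x \<xi> \<epsilon>)"
    if "\<xi> \<in> B" "\<And>i. \<bar>y $ i\<bar> < \<rho>" for \<xi> y x
  proof -
    define v :: "real ^ ('n + 'n)" where "v = (\<chi> k. case k of Inl i \<Rightarrow> y $ i | Inr i \<Rightarrow> x $ i)"
    have v: "complexify v = cjoin (complexify y) (complexify x)" by (simp add: vec_sum_eq_iff v_def)
    have "complexify v \<in> pdom \<rho>" unfolding v using that(2) \<rho> by (simp add: pdom_def)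
    from real[OF that(1) this] show ?thesis unfolding v by (simp add: v_def)
  qed
  ultimately show ?thesis using that by blast
qed

section \<open>Choice of the parameter\<close>

theorem theorem3p1:
  fixes G \<O> :: "(real ^ 'n) set"
    and \<omega> :: "real ^ 'n \<Rightarrow> real ^ 'n"
    and P :: "real ^ 'n \<Rightarrow> real ^ 'n \<Rightarrow> real ^ 'n \<Rightarrow> real \<Rightarrow> real"
    and \<phi>\<^sub>1 \<phi>\<^sub>2 :: "real \<Rightarrow> real"
    and p \<xi>\<^sub>0 :: "real ^ 'n"
    and \<epsilon>\<^sub>1 \<gamma> \<tau> \<delta> :: real
  assumes G: "bounded G" "connected G" "closed G" "interior G \<noteq> {}"
    and \<O>: "bounded \<O>" "connected \<O>" "closed \<O>" "interior \<O> \<noteq> {}"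
    and \<epsilon>\<^sub>1: "\<epsilon>\<^sub>1 > 0"
    and \<omega>_continuous: "continuous_on \<O> \<omega>"
    and P_torus: "\<And>y \<xi> \<epsilon>. y \<in> G \<Longrightarrow> \<xi> \<in> \<O> \<Longrightarrow> 0 < \<epsilon> \<Longrightarrow> \<epsilon> < \<epsilon>\<^sub>1 \<Longrightarrow>
          torus_periodic (\<lambda>x. P y x \<xi> \<epsilon>)"
    and P_analytic: "\<exists>r>0. \<exists>M. \<forall>\<xi>\<in>\<O>. \<forall>\<epsilon>. 0 < \<epsilon> \<and> \<epsilon> < \<epsilon>\<^sub>1 \<longrightarrow>
          real_analytic_with r M G (\<lambda>y x. P y x \<xi> \<epsilon>)"
    and P_continuous: "\<And>y x \<epsilon>. y \<in> G \<Longrightarrow> 0 < \<epsilon> \<Longrightarrow> \<epsilon> < \<epsilon>\<^sub>1 \<Longrightarrow>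
          continuous_on \<O> (\<lambda>\<xi>. P y x \<xi> \<epsilon>)"
    and \<phi>\<^sub>1: "modulus_of_continuity \<phi>\<^sub>1"
    and P_modulus: "\<And>y x \<epsilon>. y \<in> G \<Longrightarrow> 0 < \<epsilon> \<Longrightarrow> \<epsilon> < \<epsilon>\<^sub>1 \<Longrightarrow>
          modulus_continuous_on \<phi>\<^sub>1 \<O> (\<lambda>\<xi>. P y x \<xi> \<epsilon>)"
    and A1: "\<xi>\<^sub>0 \<in> interior \<O>" "\<omega> \<xi>\<^sub>0 = p" "\<tau> > 0" "\<gamma> > 0" "diophantine \<gamma> \<tau> (\<omega> \<xi>\<^sub>0)"
    and A2: "\<delta> > 0" "ball \<xi>\<^sub>0 \<delta> \<subseteq> interior \<O>" "modulus_of_continuity \<phi>\<^sub>2" "\<phi>\<^sub>1 \<lesssim> \<phi>\<^sub>2"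
      "\<And>\<xi> \<zeta>. \<xi> \<in> ball \<xi>\<^sub>0 \<delta> \<Longrightarrow> \<zeta> \<in> ball \<xi>\<^sub>0 \<delta> \<Longrightarrow> 0 < norm (\<xi> - \<zeta>) \<Longrightarrow> norm (\<xi> - \<zeta>) \<le> 1 \<Longrightarrow>
          norm (\<omega> \<xi> - \<omega> \<zeta>) \<ge> \<phi>\<^sub>2 (norm (\<xi> - \<zeta>))"
  shows "\<exists>\<epsilon>\<^sub>0>0. \<epsilon>\<^sub>0 \<le> \<epsilon>\<^sub>1 \<and> (\<forall>\<epsilon>. 0 < \<epsilon> \<and> \<epsilon> < \<epsilon>\<^sub>0 \<longrightarrow>
           (\<exists>\<xi>'\<in>ball \<xi>\<^sub>0 \<delta>. admits_invariant_torus G (\<lambda>y x. hamiltonian \<omega> P y x \<xi>' \<epsilon>) p))"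
proof -
  define n where "n = real CARD('n)"
  have n1: "n \<ge> 1" by (simp add: n_def)
  obtain r M where r: "r > 0" and an: "\<And>\<xi> \<epsilon>. \<xi> \<in> \<O> \<Longrightarrow> 0 < \<epsilon> \<Longrightarrow> \<epsilon> < \<epsilon>\<^sub>1 \<Longrightarrow> real_analytic_with r M G (\<lambda>y x. P y x \<xi> \<epsilon>)"
    using P_analytic by blast
  obtain y0 where y0: "y0 \<in> interior G" using G(4) by blast
  obtain R where R: "R > 0" "ball y0 R \<subseteq> interior G" using y0 open_interior open_contains_ball by blast
  \<comment> \<open>Components below \<open>\<rho>\<close> give a Euclidean norm of at most
    \<open>n * \<rho>\<close>, which has to stay below both the radius \<open>R\<close> inside
    \<open>G\<close> and the analyticity width \<open>r\<close>.\<close>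
  define \<rho> where "\<rho> = min 1 (min R r / (2 * n))"
  have \<rho>: "0 < \<rho>" "\<rho> \<le> 1" using R r n1 by (auto simp: \<rho>_def)
  have n\<rho>: "n * \<rho> < R" "n * \<rho> < r"
  proof -
    have "\<rho> \<le> min R r / (2 * n)" by (simp add: \<rho>_def)
    then have "n * \<rho> \<le> min R r / 2" using n1 by (simp add: field_simps)
    then show "n * \<rho> < R" "n * \<rho> < r" using R r by linarith+
  qed
  have yG: "y0 + y \<in> interior G" if "\<And>i. \<bar>y $ i\<bar> < \<rho>" for y
  proof -
    have "norm (complexify y) \<le> n * \<rho>" unfolding n_def
      by (rule norm_vec_le_card) (use that in \<open>simp add: less_imp_le\<close>)
    then show ?thesis using R n\<rho> by (auto simp: dist_norm subset_iff)
  qed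
  \<comment> \<open>The limit \<open>0\<close> at the origin and monotonicity make the value at
    \<open>d / 2\<close> nonnegative; strictness does the rest.\<close>
  have \<phi>2_pos: "\<phi>\<^sub>2 d > 0" if "d > 0" for d
  proof -
    have mono: "strict_mono_on {0<..} \<phi>\<^sub>2" and lim: "(\<phi>\<^sub>2 \<longlongrightarrow> 0) (at_right 0)"
      using A2(3) by (auto simp: modulus_of_continuity_def)
    have "\<forall>\<^sub>F x in at_right 0. \<phi>\<^sub>2 x \<le> \<phi>\<^sub>2 (d / 2)"
    proof -
      have "\<forall>\<^sub>F x in at_right (0::real). x \<in> {0<..<d / 2}" using that by (intro eventually_at_right_real) simp
      then show ?thesis
      proof eventually_elim
        case (elim x)
        then show ?case using strict_mono_onD[OF mono, of x "d / 2"] that by simp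
      qed
    qed
    then have "0 \<le> \<phi>\<^sub>2 (d / 2)" using lim by (intro tendsto_upperbound) auto
    also have "\<dots> < \<phi>\<^sub>2 d" using that by (intro strict_mono_onD[OF mono]) auto
    finally show ?thesis .
  qed
  \<comment> \<open>Two points of the closed ball of this radius are at distance at most
    \<open>1\<close>, as the lower bound on \<open>\<omega>\<close> requires. The ball is compact,
    which makes the inverse of \<open>\<omega>\<close> on it continuous, and lies within
    \<open>ball \<xi>\<^sub>0 \<delta>\<close>.\<close>
  define \<delta>1 where "\<delta>1 = min \<delta> 1 / 4"
  have \<delta>1: "\<delta>1 > 0" "\<delta>1 < \<delta>" "2 * \<delta>1 \<le> 1" using A2(1) by (auto simp: \<delta>1_def min_def)
  define B where "B = cball \<xi>\<^sub>0 \<delta>1"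
  have B_ball: "B \<subseteq> ball \<xi>\<^sub>0 \<delta>" using \<delta>1 by (auto simp: B_def)
  have B_\<O>: "B \<subseteq> \<O>" using B_ball A2(2) interior_subset by blast
  have inj: "inj_on \<omega> B"
  proof (rule inj_onI, rule ccontr)
    fix \<xi> \<zeta> assume a: "\<xi> \<in> B" "\<zeta> \<in> B" "\<omega> \<xi> = \<omega> \<zeta>" "\<xi> \<noteq> \<zeta>"
    have "dist \<xi> \<zeta> \<le> dist \<xi>\<^sub>0 \<xi> + dist \<xi>\<^sub>0 \<zeta>" by (metis dist_commute dist_triangle)
    then have "norm (\<xi> - \<zeta>) \<le> 1" using a \<delta>1 by (simp add: B_def dist_norm)
    then have "\<phi>\<^sub>2 (norm (\<xi> - \<zeta>)) \<le> norm (\<omega> \<xi> - \<omega> \<zeta>)" using a B_ball by (intro A2(5)) auto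
    moreover have "0 < \<phi>\<^sub>2 (norm (\<xi> - \<zeta>))" using a(4) by (intro \<phi>2_pos) simp
    ultimately show False using a(3) by simp
  qed
  have cont: "continuous_on B \<omega>" using \<omega>_continuous B_\<O> continuous_on_subset by blast
  have "open (\<omega> ` ball \<xi>\<^sub>0 \<delta>1)"
    by (rule invariance_of_domain) (auto intro: continuous_on_subset[OF cont] inj_on_subset[OF inj] simp: B_def)
  moreover have "p \<in> \<omega> ` ball \<xi>\<^sub>0 \<delta>1" using A1(2) \<delta>1 by (auto intro!: image_eqI[of _ _ \<xi>\<^sub>0])
  ultimately obtain \<kappa> where \<kappa>: "\<kappa> > 0" "cball p \<kappa> \<subseteq> \<omega> ` ball \<xi>\<^sub>0 \<delta>1" using open_contains_cball by blast
  define g where "g = inv_into B \<omega>"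
  have g: "continuous_on (\<omega> ` B) g"
    by (rule continuous_on_inv[OF cont]) (use inj in \<open>auto simp: g_def B_def\<close>)
  have \<kappa>B: "cball p \<kappa> \<subseteq> \<omega> ` B" using \<kappa>(2) by (auto simp: B_def)
  have gB: "g w \<in> B" "\<omega> (g w) = w" if "w \<in> cball p \<kappa>" for w
    using \<kappa>B that inv_into_into[of w \<omega> B] f_inv_into_f[of w \<omega> B] by (auto simp: g_def)
  have dioph: "diophantine \<gamma> \<tau> p" using A1(2,5) by simp
  obtain \<mu>0 q where \<mu>0: "\<mu>0 > 0" and q: "0 \<le> q" "q \<le> \<rho> / 8" "(real CARD('n))\<^sup>2 * q \<le> 1 / 2"
    and kam: "\<And>(B :: (real ^ 'n) set) \<omega> \<Phi>. continuous_on B \<omega> \<Longrightarrow> perturbation B \<rho> \<mu>0 \<Phi> \<Longrightarrow>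
      \<exists>V. continuous_on B V \<and> (\<forall>\<xi>\<in>B. norm (V \<xi>) \<le> \<kappa>) \<and>
        (\<forall>\<xi>\<in>B. \<omega> \<xi> + V \<xi> = p \<longrightarrow> (\<exists>u Y c. kam_state {\<xi>} \<omega> \<Phi> p (\<rho> / 4) q 0 u Y (\<lambda>_. 0) c))"
    by (rule kam_normal_form[OF dioph A1(4,3) \<rho> \<kappa>(1)]) blast
  \<comment> \<open>Chosen so that \<open>\<epsilon> * M\<close> stays below \<open>\<mu>0\<close>;
    the denominator dominates \<open>M\<close> and is positive whatever the sign of
    \<open>M\<close>.\<close>
  define \<epsilon>0 where "\<epsilon>0 = min \<epsilon>\<^sub>1 (\<mu>0 / (\<bar>M\<bar> + 1))"
  have M1: "\<bar>M\<bar> + 1 > 0" by simp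
  have "\<epsilon>0 > 0" "\<epsilon>0 \<le> \<epsilon>\<^sub>1" using \<epsilon>\<^sub>1 \<mu>0 M1 by (auto simp: \<epsilon>0_def)
  moreover have "\<exists>\<xi>'\<in>ball \<xi>\<^sub>0 \<delta>. admits_invariant_torus G (\<lambda>y x. hamiltonian \<omega> P y x \<xi>' \<epsilon>) p"
    if \<epsilon>: "0 < \<epsilon>" "\<epsilon> < \<epsilon>0" for \<epsilon>
  proof -
    have \<epsilon>1: "\<epsilon> < \<epsilon>\<^sub>1" using \<epsilon> by (simp add: \<epsilon>0_def)
    have \<epsilon>M: "\<epsilon> * M \<le> \<mu>0"
    proof -
      have "\<epsilon> * M \<le> \<epsilon> * (\<bar>M\<bar> + 1)" using \<epsilon> by (intro mult_left_mono) auto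
      also have "\<dots> \<le> \<mu>0 / (\<bar>M\<bar> + 1) * (\<bar>M\<bar> + 1)" using \<epsilon> by (intro mult_right_mono) (auto simp: \<epsilon>0_def)
      finally show ?thesis using M1 by simp
    qed
    obtain \<Phi> where \<Phi>: "perturbation B \<rho> \<mu>0 \<Phi>"
      "\<And>\<xi> y x. \<xi> \<in> B \<Longrightarrow> (\<And>i. \<bar>y $ i\<bar> < \<rho>) \<Longrightarrow> \<Phi> \<xi> (cjoin (complexify y) (complexify x)) = of_real (\<epsilon> * P (y0 + y) x \<xi> \<epsilon>)"
    proof (rule perturbation_exists[of B r M G P \<epsilon> \<rho> y0 \<mu>0])
      show "real_analytic_with r M G (\<lambda>y x. P y x \<xi> \<epsilon>)" if "\<xi> \<in> B" for \<xi> using an[of \<xi> \<epsilon>] that B_\<O> \<epsilon> \<epsilon>1 by blast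
      show "torus_periodic (\<lambda>x. P y x \<xi> \<epsilon>)" if "y \<in> G" "\<xi> \<in> B" for y \<xi> using P_torus[of y \<xi> \<epsilon>] that B_\<O> \<epsilon> \<epsilon>1 by blast
      show "continuous_on B (\<lambda>\<xi>. P y x \<xi> \<epsilon>)" if "y \<in> G" for y x
        using continuous_on_subset[OF P_continuous[OF that \<epsilon>(1) \<epsilon>1] B_\<O>] .
      show "y0 + y \<in> G" if "\<And>i. \<bar>y $ i\<bar> < \<rho>" for y using yG[OF that] interior_subset by blast
      show "real CARD('n) * \<rho> < r" using n\<rho> by (simp add: n_def)
    qed (use \<rho> \<epsilon> \<epsilon>M in auto)
    obtain V where V: "continuous_on B V" "\<And>\<xi>. \<xi> \<in> B \<Longrightarrow> norm (V \<xi>) \<le> \<kappa>"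
      and torus: "\<And>\<xi>. \<xi> \<in> B \<Longrightarrow> \<omega> \<xi> + V \<xi> = p \<Longrightarrow> \<exists>u Y c. kam_state {\<xi>} \<omega> \<Phi> p (\<rho> / 4) q 0 u Y (\<lambda>_. 0) c"
      using kam[OF cont \<Phi>(1)] by blast
    \<comment> \<open>The deviation bound requested from \<open>kam_normal_form\<close> was the
      radius \<open>\<kappa>\<close> of a ball covered by \<open>\<omega>\<close>, so this map
      preserves \<open>cball p \<kappa>\<close>. A fixed point satisfies
      \<open>\<omega> (g w) = w = p - V (g w)\<close>.\<close>
    obtain w where w: "w \<in> cball p \<kappa>" "p - V (g w) = w"
    proof (rule brouwer[of "cball p \<kappa>" "\<lambda>w. p - V (g w)"])
      show "continuous_on (cball p \<kappa>) (\<lambda>w. p - V (g w))"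
        using gB by (intro continuous_intros continuous_on_compose2[OF V(1) continuous_on_subset[OF g \<kappa>B]]) auto
      show "(\<lambda>w. p - V (g w)) \<in> cball p \<kappa> \<rightarrow> cball p \<kappa>" using V(2) gB by (auto simp: dist_norm)
    qed (use \<kappa> that in auto)
    define \<xi> where "\<xi> = g w"
    have \<xi>: "\<xi> \<in> B" "\<omega> \<xi> + V \<xi> = p" using gB[OF w(1)] w(2) by (auto simp: \<xi>_def algebra_simps)
    obtain u Y c where st: "kam_state {\<xi>} \<omega> \<Phi> p (\<rho> / 4) q 0 u Y (\<lambda>_. 0) c" using torus[OF \<xi>] by blast
    have "admits_invariant_torus G (\<lambda>y x. hamiltonian \<omega> P y x \<xi> \<epsilon>) p"
    proof (rule kam_state_invariant_torus[where ?y0.0 = y0, OF st])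
      show "perturbation {\<xi>} \<rho> \<mu>0 \<Phi>" by (rule perturbation_subset[OF \<Phi>(1)]) (use \<xi> in auto)
      show "y0 + y \<in> interior G" if "\<And>i. \<bar>y $ i\<bar> < \<rho>" for y using that by (rule yG)
      show "\<Phi> \<xi> (cjoin (complexify y) (complexify x)) = of_real (\<epsilon> * P (y0 + y) x \<xi> \<epsilon>)"
        if "\<And>i. \<bar>y $ i\<bar> < \<rho>" for y x
        using \<Phi>(2)[OF \<xi>(1) that] .
    qed (use \<rho> q in auto)
    then show ?thesis using \<xi>(1) B_ball by blast
  qed
  ultimately show ?thesis by blast
qed

end
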